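(* Assume that $\mathrm{R}(\lambda_0,\mathrm{A})$ is compact for some $\lambda_0\in\rho(\mathrm{A})$, and that $f:J\times\mathfrak{B}\to\mathbb{W}$ satisfies: $f(t,\cdot):\mathfrak{B}\to\mathbb{W}$ is continuous for a.e. $t\in J$; $t\mapsto f(t,\phi)$ is strongly measurable on $J$ for each $\phi\in\mathfrak{B}$; and there is $\gamma\in\mathrm{L}^1(J;\mathbb{R}^+)$ with $\|f(t,\phi)\|_{\mathbb{W}}\le\gamma(t)$ for a.e. $t\in J$ and all $\phi\in\mathfrak{B}$. Let $\psi\in\mathfrak{B}$ be such that $f_1\in\mathrm{W}^{1,1}(J;\mathbb{W})$ and $f_2\in\mathrm{L}^1(J;\mathbb{W})$, where $$f_1(t)=-\int_{-\infty}^0\mathrm{G}(t-s)\psi(s)\,\mathrm{d}s,\qquad f_2(t)=\int_{-\infty}^0\mathrm{N}(t-s)\psi(s)\,\mathrm{d}s .$$ Then for every $\lambda>0$ and every $\zeta_1\in\mathbb{W}$ there exists at least one mild solution $w$ of $$\frac{\mathrm{d}}{\mathrm{d}t}\Big[w(t)+\int_{-\infty}^t\mathrm{G}(t-s)w(s)\,\mathrm{d}s\Big]=\mathrm{A}w(t)+\int_{-\infty}^t\mathrm{N}(t-s)w(s)\,\mathrm{d}s+\mathrm{B}u(t)+f(t,w_t),\ t\in(0,T],\qquad w_0=\psi,$$ with the (feedback) control $u=u_\lambda(\cdot;w)$ given by $$u_\lambda(t;w)=\mathrm{B}^*\mathscr{R}(T-t)^*\mathscr{J}\big[\mathrm{R}(\lambda,\Psi_0^T)\,l(w(\cdot))\big],\quad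 t\in J,$$ $$l(w(\cdot))=\zeta_1-\mathscr{R}(T)\psi(0)-\int_0^T\mathscr{R}(T-s)[f_1'(s)+f_2(s)]\,\mathrm{d}s-\int_0^T\mathscr{R}(T-s)f(s,w_s)\,\mathrm{d}s .$$
   Context: Setting. $T>0$, $J=[0,T]$. $\mathbb{W}$ is a separable reflexive Banach space whose dual $\mathbb{W}^*$ is uniformly convex; $\mathbb{U}$ is a Hilbert space identified with its dual; $\mathrm{B}:\mathbb{U}\to\mathbb{W}$ is bounded linear; $\langle\cdot,\cdot\rangle$ is the duality pairing of $\mathbb{W}$ and $\mathbb{W}^*$; $^*$ on operators denotes the adjoint. $\mathcal{L}(X;Y)$ denotes bounded linear operators with the operator norm, $\mathcal{L}(X)=\mathcal{L}(X;X)$. $\mathrm{A}:D(\mathrm{A})\subseteq\mathbb{W}\to\mathbb{W}$ is a closed linear operator, $\mathrm{G}(t)$ ($t\ge0$) are bounded linear operators on $\mathbb{W}$, $\mathrm{N}(t)$ ($t\ge 0$) are closed linear operators in $\mathbb{W}$. $D_1(\mathrm{A})$ is $D(\mathrm{A})$ with the graph norm $\|z\|_1=\|z\|_{\mathbb{W}}+\|\mathrm{A}z\|_{\mathbb{W}}$. A hat denotes the Laplace transform, and $\Lambda_\nu=\{\lambda\in\mathbb{C}\setminus\{0\}:|\arg\lambda|<\nu\}$. Standing conditions. (Cd1) $\mathrm{A}$ generates an analytic semigroup on $\mathbb{W}$; there are $M_0>0$ and $\nu\in(\pi/2,\pi)$ with $\rho(\mathrm{A})\supseteq\Lambda_\nu$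 and $\|\mathrm{R}(\lambda,\mathrm{A})\|_{\mathcal{L}(\mathbb{W})}\le M_0/|\lambda|$ for $\lambda\in\Lambda_\nu$, where $\mathrm{R}(\lambda,\mathrm{A})$ is the resolvent of $\mathrm{A}$. (Cd2) $\mathrm{G}:[0,\infty)\to\mathcal{L}(\mathbb{W})$ is strongly continuous, $\widehat{\mathrm{G}}(\lambda)z$ is absolutely convergent for $z\in\mathbb{W}$, $\mathrm{Re}\,\lambda>0$; there are $\alpha>0$, $N_1,N_2>0$ and an analytic extension of $\widehat{\mathrm{G}}$ to $\Lambda_\nu$ (same notation) with $\|\widehat{\mathrm{G}}(\lambda)\|_{\mathcal{L}(\mathbb{W})}\le N_1|\lambda|^{-\alpha}$ for $\lambda\in\Lambda_\nu$ and $\|\widehat{\mathrm{G}}(\lambda)z\|_{\mathbb{W}}\le N_2|\lambda|^{-1}\|z\|_1$ for $\lambda\in\Lambda_\nu$, $z\in D(\mathrm{A})$. (Cd3) For each $t\ge0$, $\mathrm{N}(t)$ is closed linear with $D(\mathrm{A})\subseteq D(\mathrm{N}(t))$, and $\mathrm{N}(\cdot)z$ is strongly measurable on $(0,\infty)$ for $z\in D(\mathrm{A})$. There is $\varPi\in \mathrm{L}^1_{loc}(\mathbb{R}^+)$ such that $\widehat{\varPi}(\lambda)$ exists for $\mathrm{Re}\,\lambda>0$ and $\|\mathrm{N}(t)z\|_{\mathbb{W}}\le\varPi(t)\|z\|_1$ for $t>0$, $z\in D(\mathrm{A})$. The function $\widehat{\mathrm{N}}:\Lambda_{\pi/2}\to\mathcal{L}(D_1(\mathrm{A});\mathbb{W})$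 has an analytic extension (same notation) to $\Lambda_\nu$ with $\|\widehat{\mathrm{N}}(\lambda)z\|_{\mathbb{W}}\le\|\widehat{\mathrm{N}}(\lambda)\|_{\mathcal{L}(D_1(\mathrm{A});\mathbb{W})}\|z\|_1$ for $z\in D(\mathrm{A})$, and $\|\widehat{\mathrm{N}}(\lambda)\|_{\mathcal{L}(D_1(\mathrm{A});\mathbb{W})}\to0$ as $|\lambda|\to\infty$. (Cd4) There are a subspace $Y\subseteq D(\mathrm{A})$, dense in $D(\mathrm{A})$ for the graph norm, and $M_1,M_2>0$ with $\mathrm{A}(Y)\subseteq D(\mathrm{A})$, $\widehat{\mathrm{N}}(\lambda)(Y)\subseteq D(\mathrm{A})$, $\widehat{\mathrm{G}}(\lambda)(Y)\subseteq D(\mathrm{A})$, $\|\mathrm{A}\widehat{\mathrm{N}}(\lambda)z\|_{\mathbb{W}}\le M_1\|z\|_1$ and $\|\widehat{\mathrm{G}}(\lambda)z\|_1\le M_2|\lambda|^{-\alpha}\|z\|_1$ for all $\lambda\in\Lambda_\nu$, $z\in Y$. Resolvent operator. $(\mathscr{R}(t))_{t\ge0}\subset\mathcal{L}(\mathbb{W})$ denotes the resolvent operator of the homogeneous problem $\frac{\mathrm{d}}{\mathrm{d}t}[w(t)+\int_0^t\mathrm{G}(t-s)w(s)\mathrm{d}s]=\mathrm{A}w(t)+\int_0^t\mathrm{N}(t-s)w(s)\mathrm{d}s$, $w(0)=\zeta$: it is exponentially bounded, strongly continuous, $\mathscr{R}(0)=\mathrm{I}$, and for $z\in D(\mathrm{A})$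 one has $\mathscr{R}(\cdot)z\in C([0,\infty);D_1(\mathrm{A}))\cap C^1((0,\infty);\mathbb{W})$ with, for every $t\ge0$, $\frac{\mathrm{d}}{\mathrm{d}t}[\mathscr{R}(t)z+\int_0^t\mathrm{G}(t-s)\mathscr{R}(s)z\,\mathrm{d}s]=\mathrm{A}\mathscr{R}(t)z+\int_0^t\mathrm{N}(t-s)\mathscr{R}(s)z\,\mathrm{d}s$ and $\frac{\mathrm{d}}{\mathrm{d}t}[\mathscr{R}(t)z+\int_0^t\mathscr{R}(t-s)\mathrm{G}(s)z\,\mathrm{d}s]=\mathscr{R}(t)\mathrm{A}z+\int_0^t\mathscr{R}(t-s)\mathrm{N}(s)z\,\mathrm{d}s$. Under (Cd1)-(Cd4) it exists and is unique; explicitly (known result), for $\theta\in(\pi/2,\nu)$ and $r>0$ large enough, $\mathscr{R}(t)=\frac1{2\pi i}\int_{\Gamma_{r,\theta}}e^{\lambda t}\mathrm{F}(\lambda)\,\mathrm{d}\lambda$ for $t>0$, where $\mathrm{F}(\lambda)=(\lambda\mathrm{I}+\lambda\widehat{\mathrm{G}}(\lambda)-\mathrm{A}-\widehat{\mathrm{N}}(\lambda))^{-1}$ and $\Gamma_{r,\theta}$ is the counterclockwise oriented path $\{te^{i\theta}:t\ge r\}\cup\{re^{i\phi}:-\theta\le\phi\le\theta\}\cup\{te^{-i\theta}:t\ge r\}$. If $\mathrm{R}(\lambda_0,\mathrm{A})$ is compact for some $\lambda_0\in\rho(\mathrm{A})$, then $\mathscr{R}(t)$ is compact for all $t>0$ (known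 result). Phase space. $\mathfrak{B}$ is a linear space of functions $(-\infty,0]\to\mathbb{W}$ with a seminorm $\|\cdot\|_{\mathfrak{B}}$ such that: (A1) if $z:(-\infty,\sigma+\vartheta)\to\mathbb{W}$, $\vartheta>0$, is continuous on $[\sigma,\sigma+\vartheta)$ and $z_\sigma\in\mathfrak{B}$, then for every $t\in[\sigma,\sigma+\vartheta)$: (i) $z_t\in\mathfrak{B}$; (ii) $\|z(t)\|_{\mathbb{W}}\le K_1\|z_t\|_{\mathfrak{B}}$ with a constant $K_1$ independent of $z$; (iii) $\|z_t\|_{\mathfrak{B}}\le\varLambda(t-\sigma)\sup_{\sigma\le s\le t}\|z(s)\|_{\mathbb{W}}+\varUpsilon(t-\sigma)\|z_\sigma\|_{\mathfrak{B}}$, where $\varLambda:[0,\infty)\to[1,\infty)$ is continuous, $\varUpsilon:[0,\infty)\to[1,\infty)$ is locally bounded, both independent of $z$; (A2) for such $z$, $t\mapsto z_t$ is continuous from $[\sigma,\sigma+\vartheta)$ to $\mathfrak{B}$; (A3) $\mathfrak{B}$ is complete. Here $z_t(\theta)=z(t+\theta)$, $\theta\le0$. Mild solution. For $\psi\in\mathfrak{B}$ with $f_1,f_2$ as in the claim ($f_1'$ being the a.e. derivative), a mild solution of the neutral system with control $u\in\mathrm{L}^2(J;\mathbb{U})$ is a function $w:(-\infty,T]\to\mathbb{W}$ with $w_0=\psi$, $w|_J\in C(J;\mathbb{W})$ and, for $t\in J$, $w(t)=\mathscr{R}(t)\psi(0)+\int_0^t\mathscr{R}(t-s)[\mathrm{B}u(s)+f(s,w_s)]\mathrm{d}s+\int_0^t\mathscr{R}(t-s)[f_1'(s)+f_2(s)]\mathrm{d}s$.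 Control operators. $\mathscr{J}:\mathbb{W}\to\mathbb{W}^*$ is the duality mapping, $\mathscr{J}[z]=\{z^*:\langle z,z^*\rangle=\|z\|_{\mathbb{W}}^2=\|z^*\|_{\mathbb{W}^*}^2\}$ (single valued since $\mathbb{W}^*$ is strictly convex). $\Psi_0^T:=\int_0^T\mathscr{R}(T-t)\mathrm{B}\mathrm{B}^*\mathscr{R}(T-t)^*\mathrm{d}t:\mathbb{W}^*\to\mathbb{W}$, and $\mathrm{R}(\lambda,\Psi_0^T):=(\lambda\mathrm{I}+\Psi_0^T\mathscr{J})^{-1}:\mathbb{W}\to\mathbb{W}$ for $\lambda>0$ (a generally nonlinear map; $\lambda\mathrm{I}+\Psi_0^T\mathscr{J}$ is a bijection of $\mathbb{W}$). *)

theory Defs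
  imports "HOL-Analysis.Analysis"
begin

section \<open>Complex Banach and Hilbert spaces\<close>

class complex_normed_vector = real_normed_vector +
  fixes scaleC :: "complex \<Rightarrow> 'a \<Rightarrow> 'a"  (infixr "*C" 75)
  assumes scaleC_add_right: "c *C (x + y) = c *C x + c *C y"
    and scaleC_add_left: "(c + d) *C x = c *C x + d *C x"
    and scaleC_scaleC: "c *C d *C x = (c * d) *C x"
    and scaleR_scaleC: "r *\<^sub>R x = complex_of_real r *C x"
    and norm_scaleC: "norm (c *C x) = cmod c * norm x"

class complex_banach = complex_normed_vector + complete_space
begin
subclass banach ..
end

text \<open>The inner product is linear in the first and conjugate-linear in the second argument.\<close>

class complex_hilbert = complex_banach +
  fixes cinner :: "'a \<Rightarrow> 'a \<Rightarrow> complex"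
  assumes cinner_commute: "cinner x y = cnj (cinner y x)"
    and cinner_add_left: "cinner (x + y) z = cinner x z + cinner y z"
    and cinner_scaleC_left: "cinner (c *C x) y = c * cinner x y"
    and cinner_self: "cinner x x = complex_of_real ((norm x)\<^sup>2)"

instantiation complex :: complex_hilbert
begin
definition "scaleC_complex (c::complex) (x::complex) = c * x"
definition "cinner_complex (x::complex) (y::complex) = x * cnj y"
instance
  by intro_classes
    (auto simp: scaleC_complex_def cinner_complex_def algebra_simps norm_mult
      scaleR_conv_of_real complex_norm_square simp del: of_real_power)
end

text \<open>
  Operators are represented by the real-linear bounded maps \<open>'a \<Rightarrow>\<^sub>L 'b\<close> of the library, whose
  norm is the operator norm; complex homogeneity is imposed separately by \<open>clinear_blinfun\<close>.
\<close>

instantiation blinfun :: (real_normed_vector, complex_normed_vector) complex_normed_vector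
begin
lift_definition scaleC_blinfun :: "complex \<Rightarrow> ('a \<Rightarrow>\<^sub>L 'b) \<Rightarrow> ('a \<Rightarrow>\<^sub>L 'b)"
  is "\<lambda>c f x. c *C f x"
proof -
  fix c and f :: "'a \<Rightarrow> 'b"
  assume "bounded_linear f"
  then interpret f: bounded_linear f .
  show "bounded_linear (\<lambda>x. c *C f x)"
  proof (rule bounded_linear_intro)
    show "c *C f (x + y) = c *C f x + c *C f y" for x y
      by (simp add: f.add scaleC_add_right)
    show "c *C f (r *\<^sub>R x) = r *\<^sub>R (c *C f x)" for r x
      by (simp add: f.scaleR scaleR_scaleC scaleC_scaleC mult.commute)
    show "norm (c *C f x) \<le> norm x * (cmod c * onorm f)" for x
      using mult_left_mono[OF onorm[OF \<open>bounded_linear f\<close>, of x], of "cmod c"]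
      by (simp add: norm_scaleC mult_ac)
  qed
qed
instance
proof
  fix c d :: complex and r :: real and f g :: "'a \<Rightarrow>\<^sub>L 'b"
  show "c *C (f + g) = c *C f + c *C g"
    by transfer (simp add: scaleC_add_right)
  show "(c + d) *C f = c *C f + d *C f"
    by transfer (simp add: scaleC_add_left)
  show "c *C d *C f = (c * d) *C f"
    by transfer (simp add: scaleC_scaleC)
  show "r *\<^sub>R f = complex_of_real r *C f"
    by transfer (simp add: scaleR_scaleC)
  have le: "norm (c *C f) \<le> cmod c * norm f" for c and f :: "'a \<Rightarrow>\<^sub>L 'b"
  proof (rule norm_blinfun_bound)
    show "norm (blinfun_apply (c *C f) x) \<le> cmod c * norm f * norm x" for x
      using mult_left_mono[OF norm_blinfun[of f x], of "cmod c"]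
      by (simp add: scaleC_blinfun.rep_eq norm_scaleC mult_ac)
  qed simp
  show "norm (c *C f) = cmod c * norm f"
  proof (cases "c = 0")
    case True
    then show ?thesis using le[of 0 f] by simp
  next
    case False
    then have "f = inverse c *C c *C f"
    proof (transfer fixing: c)
      fix h :: "'a \<Rightarrow> 'b"
      assume "c \<noteq> 0"
      then show "h = (\<lambda>x. inverse c *C c *C h x)"
        by (simp add: scaleC_scaleC fun_eq_iff) (metis of_real_1 scaleR_one scaleR_scaleC)
    qed
    then have "norm f \<le> cmod (inverse c) * norm (c *C f)"
      by (metis le)
    then have "cmod c * norm f \<le> norm (c *C f)"
      using mult_left_mono[of "norm f" "cmod (inverse c) * norm (c *C f)" "cmod c"] False
      by (simp add: norm_inverse mult.assoc[symmetric])
    then show ?thesis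
      using le[of c f] by simp
  qed
qed
end

definition clinear_blinfun :: "('a::complex_normed_vector \<Rightarrow>\<^sub>L 'b::complex_normed_vector) \<Rightarrow> bool"
  where "clinear_blinfun F \<longleftrightarrow> (\<forall>c x. F (c *C x) = c *C F x)"


section \<open>Operators defined on subspaces\<close>

definition csubspace :: "'a::complex_normed_vector set \<Rightarrow> bool"
  where "csubspace V \<longleftrightarrow> 0 \<in> V \<and> (\<forall>x\<in>V. \<forall>y\<in>V. x + y \<in> V) \<and> (\<forall>c. \<forall>x\<in>V. c *C x \<in> V)"

definition linear_operator ::
    "'a::complex_normed_vector set \<Rightarrow> ('a \<Rightarrow> 'b::complex_normed_vector) \<Rightarrow> bool"
  where "linear_operator D A \<longleftrightarrow> csubspace D
    \<and> (\<forall>x\<in>D. \<forall>y\<in>D. A (x + y) = A x + A y) \<and> (\<forall>c. \<forall>x\<in>D. A (c *C x) = c *C A x)"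

definition closed_operator ::
    "'a::complex_normed_vector set \<Rightarrow> ('a \<Rightarrow> 'b::complex_normed_vector) \<Rightarrow> bool"
  where "closed_operator D A \<longleftrightarrow> linear_operator D A \<and> closed ((\<lambda>x. (x, A x)) ` D)"

definition graph_norm :: "('a::real_normed_vector \<Rightarrow> 'b::real_normed_vector) \<Rightarrow> 'a \<Rightarrow> real"
  where "graph_norm A z = norm z + norm (A z)"

text \<open>
  Membership in, and the norm of, the space of bounded operators from the normed space with
  carrier \<open>D\<close> and norm \<open>n\<close> into the codomain.  In \<open>onorm_on\<close>, as in the library's \<open>onorm\<close>,
  the quotient at \<open>0\<close> is \<open>0\<close>.
\<close>

definition bounded_operator_on ::
    "'a::complex_normed_vector set \<Rightarrow> ('a \<Rightarrow> real) \<Rightarrow> ('a \<Rightarrow> 'b::complex_normed_vector) \<Rightarrow> bool"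
  where "bounded_operator_on D n F \<longleftrightarrow>
    linear_operator D F \<and> (\<exists>c. \<forall>z\<in>D. norm (F z) \<le> c * n z)"

definition onorm_on :: "'a set \<Rightarrow> ('a \<Rightarrow> real) \<Rightarrow> ('a \<Rightarrow> 'b::real_normed_vector) \<Rightarrow> real"
  where "onorm_on D n F = (SUP z\<in>D. norm (F z) / n z)"

text \<open>Complex differentiability in operator norm at every point of the open set \<open>\<Omega>\<close>.\<close>

definition operator_analytic_on ::
    "'a::complex_normed_vector set \<Rightarrow> ('a \<Rightarrow> real) \<Rightarrow> complex set
      \<Rightarrow> (complex \<Rightarrow> 'a \<Rightarrow> 'b::complex_normed_vector) \<Rightarrow> bool"
  where "operator_analytic_on D n \<Omega> F \<longleftrightarrow>
    (\<forall>z\<in>\<Omega>. bounded_operator_on D n (F z)) \<and>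
    (\<forall>z\<in>\<Omega>. \<exists>L. bounded_operator_on D n L \<and>
      ((\<lambda>h. onorm_on D n (\<lambda>x. inverse h *C (F (z + h) x - F z x) - L x)) \<longlongrightarrow> 0) (at 0))"

definition resolvent_set :: "'a::complex_normed_vector set \<Rightarrow> ('a \<Rightarrow> 'a) \<Rightarrow> complex set"
  where "resolvent_set D A = {z. bij_betw (\<lambda>x. z *C x - A x) D UNIV
    \<and> bounded_linear (inv_into D (\<lambda>x. z *C x - A x))}"

definition resolvent :: "'a::complex_normed_vector set \<Rightarrow> ('a \<Rightarrow> 'a) \<Rightarrow> complex \<Rightarrow> 'a \<Rightarrow> 'a"
  where "resolvent D A z = inv_into D (\<lambda>x. z *C x - A x)"

definition compact_operator :: "('a::real_normed_vector \<Rightarrow> 'b::real_normed_vector) \<Rightarrow> bool"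
  where "compact_operator F \<longleftrightarrow>
    bounded_linear F \<and> (\<forall>S. bounded S \<longrightarrow> compact (closure (F ` S)))"


section \<open>Duality\<close>

definition cdual :: "('a::complex_normed_vector \<Rightarrow>\<^sub>L complex) set"
  where "cdual = {f. clinear_blinfun f}"

definition reflexive_space :: "'a::complex_normed_vector itself \<Rightarrow> bool"
  where "reflexive_space _ \<longleftrightarrow>
    (\<forall>\<Phi> :: ('a \<Rightarrow>\<^sub>L complex) \<Rightarrow> complex. bounded_operator_on cdual norm \<Phi>
      \<longrightarrow> (\<exists>x::'a. \<forall>f\<in>cdual. \<Phi> f = f x))"

definition uniformly_convex :: "'a::real_normed_vector set \<Rightarrow> bool"
  where "uniformly_convex V \<longleftrightarrow>
    (\<forall>\<epsilon>>0. \<exists>\<delta>>0. \<forall>x\<in>V. \<forall>y\<in>V. norm x = 1 \<and> norm y = 1 \<and> \<epsilon> \<le> norm (x - y)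
      \<longrightarrow> norm ((1/2) *\<^sub>R (x + y)) \<le> 1 - \<delta>)"

definition duality_set :: "'a::complex_normed_vector \<Rightarrow> ('a \<Rightarrow>\<^sub>L complex) set"
  where "duality_set z =
    {f \<in> cdual. f z = complex_of_real ((norm z)\<^sup>2) \<and> (norm z)\<^sup>2 = (norm f)\<^sup>2}"

definition duality_map :: "'a::complex_normed_vector \<Rightarrow> ('a \<Rightarrow>\<^sub>L complex)"
  where "duality_map z = the_elem (duality_set z)"

definition banach_adjoint ::
    "('a::real_normed_vector \<Rightarrow>\<^sub>L 'b::real_normed_vector) \<Rightarrow> ('b \<Rightarrow>\<^sub>L complex) \<Rightarrow> ('a \<Rightarrow>\<^sub>L complex)"
  where "banach_adjoint S f = f o\<^sub>L S"

text \<open>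
  Adjoint of an operator on a Hilbert space identified with its dual: \<open>hilbert_adjoint B f\<close> is the
  Riesz representative of \<open>f \<circ> B\<close>.  It is conjugate-linear in \<open>f\<close>, since \<open>cdual\<close> consists of the
  linear functionals; so is the duality map, and the composition of the two is independent of
  whether linear or conjugate-linear functionals are used.
\<close>

definition hilbert_adjoint ::
    "('u::complex_hilbert \<Rightarrow>\<^sub>L 'w::complex_normed_vector) \<Rightarrow> ('w \<Rightarrow>\<^sub>L complex) \<Rightarrow> 'u"
  where "hilbert_adjoint B f = (THE v. \<forall>u. f (B u) = cinner u v)"


section \<open>Function spaces and Laplace transform\<close>

text \<open>
  All integrals are Bochner integrals with respect to the (complete) Lebesgue measure.
  Strong measurability is stated without separability of the codomain.
\<close>

definition strongly_measurable :: "'s measure \<Rightarrow> ('s \<Rightarrow> 'a::topological_space) \<Rightarrow> bool"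
  where "strongly_measurable M g \<longleftrightarrow>
    (\<exists>s. (\<forall>n::nat. simple_function M (s n)) \<and> (AE x in M. (\<lambda>n. s n x) \<longlonglongrightarrow> g x))"

definition L2_function :: "real \<Rightarrow> (real \<Rightarrow> 'a::real_normed_vector) \<Rightarrow> bool"
  where "L2_function T u \<longleftrightarrow> strongly_measurable (lebesgue_on {0..T}) u
    \<and> integrable (lebesgue_on {0..T}) (\<lambda>t. (norm (u t))\<^sup>2)"

text \<open>
  \<open>h\<close> belongs to \<open>W\<^sup>1\<^sup>,\<^sup>1\<close> on \<open>[0,T]\<close> and \<open>h'\<close> is its a.e. derivative: \<open>h\<close> is integrable and has an
  absolutely continuous representative \<open>g\<close>, the primitive of its integrable a.e. derivative.
\<close>

definition has_W11_derivative ::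
    "real \<Rightarrow> (real \<Rightarrow> 'a::{banach, second_countable_topology}) \<Rightarrow> (real \<Rightarrow> 'a) \<Rightarrow> bool"
  where "has_W11_derivative T h h' \<longleftrightarrow>
    integrable (lebesgue_on {0..T}) h \<and> integrable (lebesgue_on {0..T}) h' \<and>
    (\<exists>g. (AE t in lebesgue_on {0..T}. h t = g t) \<and>
         (\<forall>t\<in>{0..T}. g t = g 0 + (LINT s|lebesgue_on {0..t}. h' s)) \<and>
         (AE t in lebesgue_on {0..T}. (g has_vector_derivative h' t) (at t within {0..T})))"

definition laplace_exists ::
    "(real \<Rightarrow> 'a::{complex_banach, second_countable_topology}) \<Rightarrow> complex \<Rightarrow> bool"
  where "laplace_exists h z \<longleftrightarrow>
    integrable (lebesgue_on {0..}) (\<lambda>t. exp (- z * complex_of_real t) *C h t)"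

definition laplace ::
    "(real \<Rightarrow> 'a::{complex_banach, second_countable_topology}) \<Rightarrow> complex \<Rightarrow> 'a"
  where "laplace h z = (LINT t|lebesgue_on {0..}. exp (- z * complex_of_real t) *C h t)"

definition sector :: "real \<Rightarrow> complex set"
  where "sector \<nu> = {z. z \<noteq> 0 \<and> \<bar>Arg z\<bar> < \<nu>}"


section \<open>Standing conditions\<close>

text \<open>
  \<open>A\<close>, with domain \<open>D\<close>, is the infinitesimal generator of a semigroup \<open>S\<close> that is analytic in a
  sector around the positive half-axis and strongly continuous at \<open>0\<close> within that sector.
\<close>

definition generates_analytic_semigroup :: "'w::complex_banach set \<Rightarrow> ('w \<Rightarrow> 'w) \<Rightarrow> bool"
  where "generates_analytic_semigroup D A \<longleftrightarrow>
    (\<exists>\<delta> (S :: complex \<Rightarrow> 'w \<Rightarrow>\<^sub>L 'w). 0 < \<delta> \<and> \<delta> \<le> pi / 2 \<and>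
      S 0 = id_blinfun \<and>
      (\<forall>z\<in>sector \<delta>. clinear_blinfun (S z)) \<and>
      (\<forall>z\<in>sector \<delta>. \<forall>z'\<in>sector \<delta>. S (z + z') = S z o\<^sub>L S z') \<and>
      operator_analytic_on UNIV norm (sector \<delta>) (\<lambda>z. blinfun_apply (S z)) \<and>
      (\<forall>x. ((\<lambda>z. S z x) \<longlongrightarrow> x) (at 0 within sector \<delta>)) \<and>
      D = {x. \<exists>y. ((\<lambda>t. (1 / t) *\<^sub>R (S (complex_of_real t) x - x)) \<longlongrightarrow> y) (at_right 0)} \<and>
      (\<forall>x\<in>D. ((\<lambda>t. (1 / t) *\<^sub>R (S (complex_of_real t) x - x)) \<longlongrightarrow> A x) (at_right 0)))"

definition Cd1 :: "real \<Rightarrow> 'w::complex_banach set \<Rightarrow> ('w \<Rightarrow> 'w) \<Rightarrow> bool"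
  where "Cd1 \<nu> D A \<longleftrightarrow>
    generates_analytic_semigroup D A \<and> pi / 2 < \<nu> \<and> \<nu> < pi \<and> sector \<nu> \<subseteq> resolvent_set D A \<and>
    (\<exists>M0>0. \<forall>z\<in>sector \<nu>. onorm (resolvent D A z) \<le> M0 / cmod z)"

text \<open>In the following conditions \<open>Gh\<close> and \<open>Nh\<close> are the extended Laplace transforms.\<close>

definition Cd2 ::
    "real \<Rightarrow> real \<Rightarrow> 'w::{complex_banach, second_countable_topology} set \<Rightarrow> ('w \<Rightarrow> 'w)
      \<Rightarrow> (real \<Rightarrow> 'w \<Rightarrow>\<^sub>L 'w) \<Rightarrow> (complex \<Rightarrow> 'w \<Rightarrow>\<^sub>L 'w) \<Rightarrow> bool"
  where "Cd2 \<nu> \<alpha> D A G Gh \<longleftrightarrow>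
    (\<forall>t\<ge>0. clinear_blinfun (G t)) \<and>
    (\<forall>z. continuous_on {0..} (\<lambda>t. G t z)) \<and>
    (\<forall>\<mu> z. 0 < Re \<mu> \<longrightarrow> laplace_exists (\<lambda>t. G t z) \<mu> \<and> Gh \<mu> z = laplace (\<lambda>t. G t z) \<mu>) \<and>
    operator_analytic_on UNIV norm (sector \<nu>) (\<lambda>\<mu>. blinfun_apply (Gh \<mu>)) \<and>
    0 < \<alpha> \<and>
    (\<exists>N1>0. \<forall>\<mu>\<in>sector \<nu>. norm (Gh \<mu>) \<le> N1 * cmod \<mu> powr (- \<alpha>)) \<and>
    (\<exists>N2>0. \<forall>\<mu>\<in>sector \<nu>. \<forall>z\<in>D. norm (Gh \<mu> z) \<le> N2 / cmod \<mu> * graph_norm A z)"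

definition Cd3 ::
    "real \<Rightarrow> 'w::{complex_banach, second_countable_topology} set \<Rightarrow> ('w \<Rightarrow> 'w)
      \<Rightarrow> (real \<Rightarrow> 'w set) \<Rightarrow> (real \<Rightarrow> 'w \<Rightarrow> 'w) \<Rightarrow> (complex \<Rightarrow> 'w \<Rightarrow> 'w) \<Rightarrow> bool"
  where "Cd3 \<nu> D A DN N Nh \<longleftrightarrow>
    (\<forall>t\<ge>0. closed_operator (DN t) (N t) \<and> D \<subseteq> DN t) \<and>
    (\<forall>z\<in>D. strongly_measurable (lebesgue_on {0<..}) (\<lambda>t. N t z)) \<and>
    (\<exists>\<pi> :: real \<Rightarrow> real.
      (\<forall>a>0. integrable (lebesgue_on {0..a}) \<pi>) \<and>
      (\<forall>\<mu>. 0 < Re \<mu> \<longrightarrow> laplace_exists (\<lambda>t. complex_of_real (\<pi> t)) \<mu>) \<and>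
      (\<forall>t>0. \<forall>z\<in>D. norm (N t z) \<le> \<pi> t * graph_norm A z)) \<and>
    (\<forall>\<mu>. \<forall>z\<in>D. 0 < Re \<mu> \<longrightarrow> Nh \<mu> z = laplace (\<lambda>t. N t z) \<mu>) \<and>
    operator_analytic_on D (graph_norm A) (sector \<nu>) Nh \<and>
    (\<forall>\<mu>\<in>sector \<nu>. \<forall>z\<in>D.
      norm (Nh \<mu> z) \<le> onorm_on D (graph_norm A) (Nh \<mu>) * graph_norm A z) \<and>
    ((\<lambda>\<mu>. onorm_on D (graph_norm A) (Nh \<mu>)) \<longlongrightarrow> 0) (inf at_infinity (principal (sector \<nu>)))"

definition Cd4 ::
    "real \<Rightarrow> real \<Rightarrow> 'w::{complex_banach, second_countable_topology} set \<Rightarrow> ('w \<Rightarrow> 'w)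
      \<Rightarrow> (complex \<Rightarrow> 'w \<Rightarrow>\<^sub>L 'w) \<Rightarrow> (complex \<Rightarrow> 'w \<Rightarrow> 'w) \<Rightarrow> bool"
  where "Cd4 \<nu> \<alpha> D A Gh Nh \<longleftrightarrow>
    (\<exists>Y M1 M2. csubspace Y \<and> Y \<subseteq> D \<and> 0 < M1 \<and> 0 < M2 \<and>
      (\<forall>x\<in>D. \<forall>\<epsilon>>0. \<exists>y\<in>Y. graph_norm A (x - y) < \<epsilon>) \<and>
      A ` Y \<subseteq> D \<and>
      (\<forall>\<mu>\<in>sector \<nu>. Nh \<mu> ` Y \<subseteq> D \<and> blinfun_apply (Gh \<mu>) ` Y \<subseteq> D) \<and>
      (\<forall>\<mu>\<in>sector \<nu>. \<forall>z\<in>Y. norm (A (Nh \<mu> z)) \<le> M1 * graph_norm A z) \<and>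
      (\<forall>\<mu>\<in>sector \<nu>. \<forall>z\<in>Y.
        graph_norm A (Gh \<mu> z) \<le> M2 * cmod \<mu> powr (- \<alpha>) * graph_norm A z))"


section \<open>Resolvent operator of the homogeneous problem\<close>

text \<open>At \<open>t = 0\<close> the derivatives in the two equations are one-sided.\<close>

definition resolvent_operator ::
    "'w::{complex_banach, second_countable_topology} set \<Rightarrow> ('w \<Rightarrow> 'w) \<Rightarrow> (real \<Rightarrow> 'w \<Rightarrow>\<^sub>L 'w)
      \<Rightarrow> (real \<Rightarrow> 'w \<Rightarrow> 'w) \<Rightarrow> (real \<Rightarrow> 'w \<Rightarrow>\<^sub>L 'w) \<Rightarrow> bool"
  where "resolvent_operator D A G N R \<longleftrightarrow>
    (\<forall>t\<ge>0. clinear_blinfun (R t)) \<and>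
    (\<exists>M \<omega>. \<forall>t\<ge>0. norm (R t) \<le> M * exp (\<omega> * t)) \<and>
    (\<forall>z. continuous_on {0..} (\<lambda>t. R t z)) \<and>
    R 0 = id_blinfun \<and>
    (\<forall>z\<in>D.
      (\<forall>t\<ge>0. R t z \<in> D) \<and>
      continuous_on {0..} (\<lambda>t. A (R t z)) \<and>
      (\<exists>R'. continuous_on {0<..} R' \<and>
        (\<forall>t>0. ((\<lambda>t. R t z) has_vector_derivative R' t) (at t))) \<and>
      (\<forall>t\<ge>0. ((\<lambda>t. R t z + (LINT s|lebesgue_on {0..t}. G (t - s) (R s z)))
        has_vector_derivative A (R t z) + (LINT s|lebesgue_on {0..t}. N (t - s) (R s z)))
        (at t within {0..})) \<and>
      (\<forall>t\<ge>0. ((\<lambda>t. R t z + (LINT s|lebesgue_on {0..t}. R (t - s) (G s z)))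
        has_vector_derivative R t (A z) + (LINT s|lebesgue_on {0..t}. R (t - s) (N s z)))
        (at t within {0..})))"


section \<open>Phase space\<close>

text \<open>Functions on \<open>(-\<infinity>,0]\<close> are represented by functions on the line that vanish on \<open>(0,\<infinity>)\<close>.\<close>

definition history :: "(real \<Rightarrow> 'w::zero) \<Rightarrow> real \<Rightarrow> real \<Rightarrow> 'w"
  where "history z t = (\<lambda>\<theta>. if \<theta> \<le> 0 then z (t + \<theta>) else 0)"

definition seminormed_function_space ::
    "(real \<Rightarrow> 'w::complex_normed_vector) set \<Rightarrow> ((real \<Rightarrow> 'w) \<Rightarrow> real) \<Rightarrow> bool"
  where "seminormed_function_space \<BB> p \<longleftrightarrow>
    (\<forall>\<phi>\<in>\<BB>. \<forall>\<theta>>0. \<phi> \<theta> = 0) \<and>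
    (\<lambda>\<theta>. 0) \<in> \<BB> \<and>
    (\<forall>\<phi>\<in>\<BB>. \<forall>\<xi>\<in>\<BB>. (\<lambda>\<theta>. \<phi> \<theta> + \<xi> \<theta>) \<in> \<BB>) \<and>
    (\<forall>c. \<forall>\<phi>\<in>\<BB>. (\<lambda>\<theta>. c *C \<phi> \<theta>) \<in> \<BB>) \<and>
    (\<forall>\<phi>\<in>\<BB>. 0 \<le> p \<phi>) \<and>
    (\<forall>\<phi>\<in>\<BB>. \<forall>\<xi>\<in>\<BB>. p (\<lambda>\<theta>. \<phi> \<theta> + \<xi> \<theta>) \<le> p \<phi> + p \<xi>) \<and>
    (\<forall>c. \<forall>\<phi>\<in>\<BB>. p (\<lambda>\<theta>. c *C \<phi> \<theta>) = cmod c * p \<phi>)"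

definition phase_space ::
    "(real \<Rightarrow> 'w::complex_normed_vector) set \<Rightarrow> ((real \<Rightarrow> 'w) \<Rightarrow> real) \<Rightarrow> bool"
  where "phase_space \<BB> p \<longleftrightarrow>
    seminormed_function_space \<BB> p \<and>
    (\<exists>K1 \<Lambda> \<Upsilon>.
      continuous_on {0..} \<Lambda> \<and> (\<forall>r\<ge>0. 1 \<le> \<Lambda> r) \<and>
      (\<forall>a\<ge>0. bounded (\<Upsilon> ` {0..a})) \<and> (\<forall>r\<ge>0. 1 \<le> \<Upsilon> r) \<and>
      (\<forall>\<sigma> \<tau> z. 0 < \<tau> \<and> continuous_on {\<sigma>..<\<sigma> + \<tau>} z \<and> history z \<sigma> \<in> \<BB> \<longrightarrow>
        (\<forall>t\<in>{\<sigma>..<\<sigma> + \<tau>}.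
          history z t \<in> \<BB> \<and>
          norm (z t) \<le> K1 * p (history z t) \<and>
          p (history z t) \<le> \<Lambda> (t - \<sigma>) * (SUP s\<in>{\<sigma>..t}. norm (z s))
            + \<Upsilon> (t - \<sigma>) * p (history z \<sigma>)))) \<and>
    (\<forall>\<sigma> \<tau> z. 0 < \<tau> \<and> continuous_on {\<sigma>..<\<sigma> + \<tau>} z \<and> history z \<sigma> \<in> \<BB> \<longrightarrow>
      (\<forall>t\<in>{\<sigma>..<\<sigma> + \<tau>}.
        ((\<lambda>s. p (\<lambda>\<theta>. history z s \<theta> - history z t \<theta>)) \<longlongrightarrow> 0)
          (at t within {\<sigma>..<\<sigma> + \<tau>}))) \<and>
    (\<forall>\<Phi> :: nat \<Rightarrow> real \<Rightarrow> 'w.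
      (\<forall>n. \<Phi> n \<in> \<BB>) \<and>
      (\<forall>\<epsilon>>0. \<exists>k. \<forall>m\<ge>k. \<forall>n\<ge>k. p (\<lambda>\<theta>. \<Phi> m \<theta> - \<Phi> n \<theta>) < \<epsilon>) \<longrightarrow>
      (\<exists>\<xi>\<in>\<BB>. (\<lambda>n. p (\<lambda>\<theta>. \<Phi> n \<theta> - \<xi> \<theta>)) \<longlonglongrightarrow> 0))"


section \<open>Mild solutions and feedback control\<close>

text \<open>
  \<open>w\<close> represents a function on \<open>(-\<infinity>,T]\<close>; its values beyond \<open>T\<close> are irrelevant.  The integrability
  clauses state that the integrals exist (a divergent Bochner integral is \<open>0\<close> in the library).
\<close>

definition mild_solution ::
    "real \<Rightarrow> (real \<Rightarrow> 'w::{complex_banach, second_countable_topology} \<Rightarrow>\<^sub>L 'w)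
      \<Rightarrow> ('u::complex_hilbert \<Rightarrow>\<^sub>L 'w) \<Rightarrow> (real \<Rightarrow> (real \<Rightarrow> 'w) \<Rightarrow> 'w)
      \<Rightarrow> (real \<Rightarrow> 'w) \<Rightarrow> (real \<Rightarrow> 'w) \<Rightarrow> (real \<Rightarrow> 'w) \<Rightarrow> (real \<Rightarrow> 'u) \<Rightarrow> (real \<Rightarrow> 'w) \<Rightarrow> bool"
  where "mild_solution T R B f \<psi> f1' f2 u w \<longleftrightarrow>
    L2_function T u \<and> history w 0 = \<psi> \<and> continuous_on {0..T} w \<and>
    (\<forall>t\<in>{0..T}.
      integrable (lebesgue_on {0..t}) (\<lambda>s. R (t - s) (B (u s) + f s (history w s))) \<and>
      integrable (lebesgue_on {0..t}) (\<lambda>s. R (t - s) (f1' s + f2 s)) \<and>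
      w t = R t (\<psi> 0)
        + (LINT s|lebesgue_on {0..t}. R (t - s) (B (u s) + f s (history w s)))
        + (LINT s|lebesgue_on {0..t}. R (t - s) (f1' s + f2 s)))"

definition control_gramian ::
    "real \<Rightarrow> (real \<Rightarrow> 'w::{complex_banach, second_countable_topology} \<Rightarrow>\<^sub>L 'w)
      \<Rightarrow> ('u::complex_hilbert \<Rightarrow>\<^sub>L 'w) \<Rightarrow> ('w \<Rightarrow>\<^sub>L complex) \<Rightarrow> 'w"
  where "control_gramian T R B f =
    (LINT t|lebesgue_on {0..T}. R (T - t) (B (hilbert_adjoint B (banach_adjoint (R (T - t)) f))))"

text \<open>
  For \<open>\<mu> > 0\<close> and \<open>\<Psi>\<close> the Gramian, the map inverted here is a (generally nonlinear) bijection.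
\<close>

definition gramian_resolvent ::
    "real \<Rightarrow> (('w::complex_normed_vector \<Rightarrow>\<^sub>L complex) \<Rightarrow> 'w) \<Rightarrow> 'w \<Rightarrow> 'w"
  where "gramian_resolvent \<mu> \<Psi> = inv (\<lambda>z. \<mu> *\<^sub>R z + \<Psi> (duality_map z))"

definition steering_defect ::
    "real \<Rightarrow> (real \<Rightarrow> 'w::{complex_banach, second_countable_topology} \<Rightarrow>\<^sub>L 'w)
      \<Rightarrow> (real \<Rightarrow> (real \<Rightarrow> 'w) \<Rightarrow> 'w) \<Rightarrow> (real \<Rightarrow> 'w) \<Rightarrow> (real \<Rightarrow> 'w) \<Rightarrow> (real \<Rightarrow> 'w) \<Rightarrow> 'w
      \<Rightarrow> (real \<Rightarrow> 'w) \<Rightarrow> 'w"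
  where "steering_defect T R f \<psi> f1' f2 \<zeta>1 w =
    \<zeta>1 - R T (\<psi> 0) - (LINT s|lebesgue_on {0..T}. R (T - s) (f1' s + f2 s))
      - (LINT s|lebesgue_on {0..T}. R (T - s) (f s (history w s)))"

definition feedback_control ::
    "real \<Rightarrow> (real \<Rightarrow> 'w::{complex_banach, second_countable_topology} \<Rightarrow>\<^sub>L 'w)
      \<Rightarrow> ('u::complex_hilbert \<Rightarrow>\<^sub>L 'w) \<Rightarrow> (real \<Rightarrow> (real \<Rightarrow> 'w) \<Rightarrow> 'w)
      \<Rightarrow> (real \<Rightarrow> 'w) \<Rightarrow> (real \<Rightarrow> 'w) \<Rightarrow> (real \<Rightarrow> 'w) \<Rightarrow> real \<Rightarrow> 'w \<Rightarrow> (real \<Rightarrow> 'w) \<Rightarrow> real \<Rightarrow> 'u"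
  where "feedback_control T R B f \<psi> f1' f2 \<mu> \<zeta>1 w t =
    hilbert_adjoint B (banach_adjoint (R (T - t))
      (duality_map (gramian_resolvent \<mu> (control_gramian T R B)
        (steering_defect T R f \<psi> f1' f2 \<zeta>1 w))))"

end

theory Submission
  imports Defs "HOL-Complex_Analysis.Complex_Analysis"
begin

text \<open>
  Under the feedback law the system becomes a fixed point problem \<open>w = \<Gamma> w\<close> on continuous functions,
  solved by Schauder's theorem.  Since \<open>f\<close> is dominated by the integrable \<open>\<gamma>\<close>, the defect \<open>l w\<close> and
  the control are bounded uniformly in \<open>w\<close>, so all right-hand sides share one integrable majorant.
  The range of \<open>\<Gamma>\<close> is then relatively compact by Arzela-Ascoli, provided \<open>R t\<close> is compact and
  norm-continuous for \<open>t > 0\<close>.  Both follow from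
  \<open>R t = 1/(2\<pi>i) \<integral> e\<^sup>\<lambda>\<^sup>t (\<lambda> + \<lambda> Gh \<lambda> - A - Nh \<lambda>)\<^sup>-\<^sup>1 d\<lambda>\<close>: the symbol factors through the resolvent
  of \<open>A\<close>, and the Laplace transform of the second resolvent equation identifies the transform of
  \<open>R\<close> with the inverse symbol.  The contour consists of two rays issuing from a point of the positive
  half-axis, so that neither arcs nor the resolvent bound near \<open>0\<close> enter.

  Continuity of \<open>\<Gamma>\<close> rests on continuity of \<open>z \<mapsto> J ((\<mu> + \<Psi> J)\<^sup>-\<^sup>1 z)\<close> in the norm of the dual.  This
  functional is the minimiser of \<open>\<mu>/2 |g|\<^sup>2 + 1/2 Re g (\<Psi> g) - Re g z\<close> over the dual; uniform convexity
  makes minimising sequences converge in norm, which replaces reflexivity and weak compactness.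
\<close>

section \<open>The Hahn-Banach theorem\<close>

text \<open>The difficulty sits at time 0: \<open>R t\<close> is there only strongly continuous and
  \<open>R 0\<close> is the identity, so neither norm continuity nor compactness reaches the
  diagonal of the Duhamel integral. A last piece of length \<epsilon> is therefore split off, where
  absolute continuity of the integral of the majorant alone makes the contribution small; on the
  rest the Lipschitz constants may blow up with \<epsilon>. For the same reason the control is shown
  to be continuous on the half-open interval only. Schauder's theorem is used on a whole Banach
  space: functions on \<open>[0, T]\<close> are extended constantly to the line and the range of the
  map is totally bounded, so no invariant convex set is constructed. Operators are real-linear maps
  by type, hence the convex analysis uses real parts and real scalars; complex linearity enters
  through holomorphy and the duality pairing. The real half-line beyond \<open>a\<close> lies to the
  right of the contour, and there the transforms of \<open>R\<close> and of the contour integral are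
  compared; this is done after applying functionals, which leaves only scalar function
  theory.\<close>

lemma scaleC_one [simp]: "1 *C x = (x::'a::complex_normed_vector)"
  by (metis of_real_1 scaleR_one scaleR_scaleC)

lemma scaleC_scaleR: "c *C r *\<^sub>R x = r *\<^sub>R c *C (x::'a::complex_normed_vector)"
  by (simp add: scaleR_scaleC scaleC_scaleC mult.commute)

lemma bounded_bilinear_scaleC:
  "bounded_bilinear (scaleC :: complex \<Rightarrow> 'a \<Rightarrow> 'a::complex_normed_vector)"
proof
  show "\<exists>K. \<forall>a (b::'a). norm (a *C b) \<le> norm a * norm b * K"
    by (rule exI[of _ 1]) (simp add: norm_scaleC)
qed (auto simp: scaleC_add_left scaleC_add_right scaleC_scaleR scaleR_conv_of_real scaleR_scaleC[where 'a='a] scaleC_scaleC mult.commute)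

interpretation scaleC: bounded_bilinear
  "scaleC :: complex \<Rightarrow> 'a \<Rightarrow> 'a::complex_normed_vector"
  by (rule bounded_bilinear_scaleC)

definition sublinear :: "('a::real_vector \<Rightarrow> real) \<Rightarrow> bool"
  where "sublinear q \<longleftrightarrow> (\<forall>x y. q (x + y) \<le> q x + q y) \<and> (\<forall>t\<ge>0. \<forall>x. q (t *\<^sub>R x) = t * q x)"

lemma sublinearD:
  assumes "sublinear q"
  shows "q (x + y) \<le> q x + q y" "t \<ge> 0 \<Longrightarrow> q (t *\<^sub>R x) = t * q x" "- q (- x) \<le> q x" "q 0 = 0"
proof -
  show "q (x + y) \<le> q x + q y" "t \<ge> 0 \<Longrightarrow> q (t *\<^sub>R x) = t * q x" for x y t
    using assms by (auto simp: sublinear_def)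
  note this(1)[of x "- x"] 
  moreover show "q 0 = 0"
    using assms unfolding sublinear_def by (metis mult_zero_left order_refl scaleR_zero_left)
  ultimately show "- q (- x) \<le> q x"
    by simp
qed

lemma sublinearI:
  assumes "\<And>x y. q (x + y) \<le> q x + q y" and "\<And>t x. t > 0 \<Longrightarrow> q (t *\<^sub>R x) \<le> t * q x" and "q 0 = 0"
  shows "sublinear q"
  unfolding sublinear_def
proof (intro conjI allI impI)
  show "q (t *\<^sub>R x) = t * q x" if "0 \<le> t" for t x
  proof (cases "t = 0")
    case False
    then have "0 < t"
      using that by simp
    then have "q (inverse t *\<^sub>R t *\<^sub>R x) \<le> inverse t * q (t *\<^sub>R x)"
      by (intro assms(2)) simp
    then have "t * q x \<le> q (t *\<^sub>R x)"
      using \<open>0 < t\<close> by (simp add: field_simps)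
    then show ?thesis
      using assms(2)[OF \<open>0 < t\<close>, of x] by simp
  qed (simp add: assms)
qed (rule assms)

text \<open>For \<open>t \<ge> 0\<close> sublinearity gives
  \<open>- q (- x) \<le> q (x + t *\<^sub>R y) - t * q y\<close>, so the infimum is finite. The
  choice \<open>t = 1\<close> has two uses: a functional that equals all its shifts is
  superadditive, and at \<open>x = - y\<close> the shift prescribes the value at a single
  vector.\<close>

lemma sublinear_shift:
  fixes q :: "'a::real_vector \<Rightarrow> real"
  assumes q: "sublinear q"
  defines "q' \<equiv> \<lambda>y x. INF t\<in>{0..}. q (x + t *\<^sub>R y) - t * q y"
  shows "sublinear (q' y)" "q' y x \<le> q x" "q' y x \<le> q (x + y) - q y"
proof -
  have "- q (- x) \<le> q (x + t *\<^sub>R y) - t * q y" if "0 \<le> t" for x t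
    using sublinearD(1)[OF q, of "x + t *\<^sub>R y" "- x"] sublinearD(2)[OF q that, of y] by simp
  then have bdd: "bdd_below ((\<lambda>t. q (x + t *\<^sub>R y) - t * q y) ` {0..})" for x
    by (intro bdd_belowI) auto
  have le: "q' y x \<le> q (x + t *\<^sub>R y) - t * q y" if "0 \<le> t" for t x
    unfolding q'_def by (rule cINF_lower[OF bdd]) (use that in simp)
  have ge: "c \<le> q' y x" if "\<And>t. 0 \<le> t \<Longrightarrow> c \<le> q (x + t *\<^sub>R y) - t * q y" for c x
    unfolding q'_def by (rule cINF_greatest) (use that in auto)
  show "q' y x \<le> q x" for x
    using le[of 0 x] by simp
  show "q' y x \<le> q (x + y) - q y"
    using le[of 1 x] by simp
  show "sublinear (q' y)"
  proof (rule sublinearI)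
    fix x z
    have "q' y (x + z) - (q (x + t *\<^sub>R y) - t * q y) \<le> q' y z" if "0 \<le> t" for t
    proof (rule ge)
      fix s :: real
      assume "0 \<le> s"
      then show "q' y (x + z) - (q (x + t *\<^sub>R y) - t * q y) \<le> q (z + s *\<^sub>R y) - s * q y"
        using le[of "t + s" "x + z"] that sublinearD(1)[OF q, of "x + t *\<^sub>R y" "z + s *\<^sub>R y"]
        by (simp add: algebra_simps)
    qed
    then have "q' y (x + z) - q' y z \<le> q' y x"
      by (intro ge) (simp add: algebra_simps)
    then show "q' y (x + z) \<le> q' y x + q' y z"
      by simp
  next
    fix s :: real and x
    assume s: "0 < s"
    have "inverse s * q' y (s *\<^sub>R x) \<le> q' y x"
    proof (rule ge)
      fix t :: real
      assume "0 \<le> t"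
      then show "inverse s * q' y (s *\<^sub>R x) \<le> q (x + t *\<^sub>R y) - t * q y"
        using le[of "s * t" "s *\<^sub>R x"] s sublinearD(2)[OF q, of s "x + t *\<^sub>R y"]
        by (simp add: field_simps)
    qed
    then show "q' y (s *\<^sub>R x) \<le> s * q' y x"
      using s by (simp add: field_simps)
  next
    show "q' y 0 = 0"
    proof (rule antisym)
      show "q' y 0 \<le> 0"
        using le[of 0 0] sublinearD(4)[OF q] by simp
      show "0 \<le> q' y 0"
        by (rule ge) (simp add: sublinearD(2)[OF q])
    qed
  qed
qed

text \<open>A minimal sublinear functional is additive, since it agrees with all its shifts.\<close>

lemma exists_linear_below_sublinear:
  fixes q0 :: "'a::real_vector \<Rightarrow> real"
  assumes q0: "sublinear q0"
  shows "\<exists>q. linear q \<and> (\<forall>x. q x \<le> q0 x)"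
proof -
  let ?S = "{q. sublinear q \<and> (\<forall>x. q x \<le> q0 x)}"
  \<comment> \<open>The order is reversed, so that a maximal element in Zorn's lemma is a minimal
    functional.\<close>
  let ?P = "\<lambda>q q' :: 'a \<Rightarrow> real. \<forall>x. q' x \<le> q x"
  have "\<exists>m\<in>?S. \<forall>a\<in>?S. ?P m a \<longrightarrow> a = m"
  proof (rule predicate_Zorn)
    show "partial_order_on ?S (relation_of ?P ?S)"
      unfolding partial_order_on_def preorder_on_def
      by (auto simp: refl_on_def trans_def antisym_def relation_of_def fun_eq_iff
          intro: order_trans order_antisym)
    fix C
    assume C: "C \<in> Chains (relation_of ?P ?S)"
    show "\<exists>u\<in>?S. \<forall>a\<in>C. ?P a u"
    proof (cases "C = {}")
      case True
      then show ?thesis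
        using q0 by auto
    next
      case False
      have CS: "C \<subseteq> ?S" and lin: "\<And>q q'. q \<in> C \<Longrightarrow> q' \<in> C \<Longrightarrow> ?P q q' \<or> ?P q' q"
        using C by (auto simp: Chains_def relation_of_def)
      have "- q0 (- x) \<le> q x" if "q \<in> C" for q x
        using CS that sublinearD(3)[of q x] by (smt (verit) mem_Collect_eq subset_iff)
      then have bdd: "bdd_below ((\<lambda>q. q x) ` C)" for x
        by (intro bdd_belowI) auto
      define u where "u x = (INF q\<in>C. q x)" for x
      have le: "u x \<le> q x" if "q \<in> C" for q x
        unfolding u_def by (rule cINF_lower[OF bdd that])
      have ge: "c \<le> u x" if "\<And>q. q \<in> C \<Longrightarrow> c \<le> q x" for c x
        unfolding u_def by (rule cINF_greatest[OF False]) (use that in auto)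
      have "sublinear u"
      proof (rule sublinearI)
        fix x y
        have "u (x + y) - q x \<le> u y" if q: "q \<in> C" for q
        proof (rule ge)
          fix q'
          assume q': "q' \<in> C"
          \<comment> \<open>Of two comparable functionals the smaller one works at both arguments;
            this is where the chain property enters.\<close>
          obtain r where "r \<in> C" "r x \<le> q x" "r y \<le> q' y"
            using lin[OF q q'] q q' by (metis order_refl)
          then show "u (x + y) - q x \<le> q' y"
            using le[of r "x + y"] sublinearD(1)[of r x y] CS by auto
        qed
        then have "u (x + y) - u y \<le> u x"
          by (intro ge) (simp add: algebra_simps)
        then show "u (x + y) \<le> u x + u y"
          by simp
      next
        fix t :: real and x
        assume t: "0 < t"
        have "inverse t * u (t *\<^sub>R x) \<le> u x"
        proof (rule ge)
          fix q
          assume "q \<in> C"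
          then show "inverse t * u (t *\<^sub>R x) \<le> q x"
            using le[of q "t *\<^sub>R x"] sublinearD(2)[of q t x] CS t
            by (auto simp: field_simps)
        qed
        then show "u (t *\<^sub>R x) \<le> t * u x"
          using t by (simp add: field_simps)
      next
        have "q 0 = 0" if "q \<in> C" for q
          using sublinearD(4)[of q] that CS by blast
        then have "(\<lambda>q. q 0) ` C = {0}"
          using False by (auto simp: image_def)
        then show "u 0 = 0"
          by (simp add: u_def)
      qed
      moreover have "\<forall>x. u x \<le> q0 x"
      proof
        fix x
        obtain q where "q \<in> C"
          using False by blast
        then show "u x \<le> q0 x"
          using le[of q x] CS by (metis (no_types, lifting) mem_Collect_eq order_trans subsetD)
      qed
      ultimately show ?thesis
        using le by auto
    qed
  qed
  then obtain q where q: "sublinear q" "\<And>x. q x \<le> q0 x"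
    and min: "\<And>q'. sublinear q' \<Longrightarrow> \<forall>x. q' x \<le> q0 x \<Longrightarrow> \<forall>x. q' x \<le> q x \<Longrightarrow> q' = q"
    by blast
  have "q x + q y \<le> q (x + y)" for x y
  proof -
    let ?q' = "\<lambda>x. INF t\<in>{0..}. q (x + t *\<^sub>R y) - t * q y"
    have "?q' x \<le> q x" for x
      by (rule sublinear_shift(2)[OF q(1)])
    then have "?q' = q"
      using q(2) by (intro min sublinear_shift(1)[OF q(1)]) (auto intro: order_trans)
    then have "?q' x = q x"
      by (rule fun_cong)
    moreover have "?q' x \<le> q (x + y) - q y"
      by (rule sublinear_shift(3)[OF q(1)])
    ultimately show ?thesis
      by linarith
  qed
  then have add: "q (x + y) = q x + q y" for x y
    using sublinearD(1)[OF q(1), of x y] by (simp add: antisym)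
  then have neg: "q (- x) = - q x" for x
    using sublinearD(4)[OF q(1)] by (metis add.right_inverse add_eq_0_iff)
  have "q (t *\<^sub>R x) = t * q x" for t x
  proof (cases "0 \<le> t")
    case False
    then show ?thesis
      using sublinearD(2)[OF q(1), of "- t" x] neg[of "t *\<^sub>R x"] by simp
  qed (rule sublinearD(2)[OF q(1)])
  then have "linear q"
    using add by (intro linearI) auto
  then show ?thesis
    using q(2) by blast
qed

lemma cdual_functional:
  "f \<in> cdual \<Longrightarrow> f (c *C x) = c * f x"
  by (simp add: cdual_def clinear_blinfun_def scaleC_complex_def)

text \<open>Minimising below the shift of the norm at \<open>x0\<close>, rather than below the norm,
  already forces \<open>q x0 = norm x0\<close>, so nothing has to be extended from a subspace. The
  scaling by \<open>norm x0\<close> puts the functional into \<open>duality_set x0\<close>.\<close>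

theorem Hahn_Banach_norming:
  fixes x0 :: "'a::complex_normed_vector"
  obtains f :: "'a \<Rightarrow>\<^sub>L complex" where "f \<in> cdual" "f x0 = complex_of_real ((norm x0)\<^sup>2)" "norm f = norm x0"
proof -
  have sub: "sublinear (norm :: 'a \<Rightarrow> real)"
    by (simp add: sublinear_def norm_triangle_ineq)
  let ?q = "\<lambda>x. INF t\<in>{0..}. norm (x + t *\<^sub>R x0) - t * norm x0"
  obtain q where q: "linear q" "\<And>x. q x \<le> ?q x"
    using exists_linear_below_sublinear[OF sublinear_shift(1)[OF sub, of x0]] by blast
  interpret q: linear q
    by fact
  have qn: "q x \<le> norm x" for x
    using q(2)[of x] sublinear_shift(2)[OF sub, where y = x0 and x = x] by simp
  have "q (- x0) \<le> - norm x0"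
    using q(2)[of "- x0"] sublinear_shift(3)[OF sub, where y = x0 and x = "- x0"] by simp
  then have qx0: "q x0 = norm x0"
    using qn[of x0] by (simp add: q.neg)
  \<comment> \<open>The complex functional with real part \<open>q\<close>: its imaginary part is
    determined by the value at \<open>\<i> *C x\<close>.\<close>
  define h where "h x = Complex (q x) (- q (\<i> *C x))" for x
  have h_i: "h (\<i> *C x) = \<i> * h x" for x
    by (simp add: h_def scaleC_scaleC complex_eq_iff q.neg scaleC.minus_left)
  have h_add: "h (x + y) = h x + h y" for x y
    by (simp add: h_def complex_eq_iff q.add scaleC_add_right)
  have h_scaleR: "h (r *\<^sub>R x) = of_real r * h x" for r x
    by (simp add: h_def complex_eq_iff q.scaleR scaleC_scaleR)
  have h_scaleC: "h (c *C x) = c * h x" for c x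
  proof -
    have "c = of_real (Re c) + of_real (Im c) * \<i>"
      by (simp add: complex_eq_iff)
    then have "c *C x = Re c *\<^sub>R x + Im c *\<^sub>R \<i> *C x"
      unfolding scaleR_scaleC scaleC_scaleC by (metis scaleC_add_left)
    then have "h (c *C x) = (of_real (Re c) + \<i> * of_real (Im c)) * h x"
      by (simp only: h_add h_scaleR h_i) (simp add: algebra_simps)
    then show ?thesis
      by (simp flip: complex_eq)
  qed
  have h_norm: "norm (h x) \<le> norm x" for x
  proof (cases "h x = 0")
    case False
    \<comment> \<open>A rotation by the phase of \<open>h x\<close> makes the value real and
      positive, so the bound for the real part bounds the modulus.\<close>
    define c where "c = cnj (h x) / of_real (cmod (h x))"
    have c: "cmod c = 1" "c * h x = of_real (cmod (h x))"
      using False complex_norm_square[of "h x"]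
      by (auto simp: c_def norm_divide power2_eq_square field_simps)
    then have "cmod (h x) = Re (h (c *C x))"
      by (simp add: h_scaleC)
    also have "\<dots> \<le> norm (c *C x)"
      by (simp add: h_def qn)
    finally show ?thesis
      by (simp add: norm_scaleC c)
  qed simp
  have bl: "bounded_linear h"
    by (rule bounded_linear_intro[of _ 1]) (simp_all add: h_add h_scaleR h_norm scaleR_conv_of_real)
  \<comment> \<open>The real part already exhausts the norm, which leaves no room for an imaginary
    part.\<close>
  have hx0: "h x0 = of_real (norm x0)"
  proof -
    have "(norm x0)\<^sup>2 + (q (\<i> *C x0))\<^sup>2 \<le> (norm x0)\<^sup>2"
      using power_mono[OF h_norm[of x0], of 2] by (simp add: h_def qx0 cmod_power2)
    then show ?thesis
      by (simp add: h_def qx0 complex_eq_iff)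
  qed
  define f where "f = norm x0 *\<^sub>R Blinfun h"
  have f: "f x = norm x0 *\<^sub>R h x" for x
    by (simp add: f_def blinfun.scaleR_left bounded_linear_Blinfun_apply[OF bl])
  have fx0: "f x0 = complex_of_real ((norm x0)\<^sup>2)"
    by (simp add: f hx0 scaleR_conv_of_real power2_eq_square)
  have "norm (f x) \<le> norm x0 * norm x" for x
    by (simp add: f h_norm mult_left_mono)
  then have "norm f \<le> norm x0"
    by (intro norm_blinfun_bound) auto
  moreover have "norm x0 \<le> norm f"
  proof (cases "x0 = 0")
    case False
    have "norm x0 * norm x0 \<le> norm f * norm x0"
      using norm_blinfun[of f x0] by (simp add: fx0 power2_eq_square norm_mult)
    then show ?thesis
      using False by simp
  qed simp
  moreover have "f \<in> cdual"
    by (simp add: cdual_def clinear_blinfun_def f h_scaleC scaleC_complex_def)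
  ultimately show ?thesis
    using fx0 that by (metis order_antisym)
qed

text \<open>Identities between vectors and between vector-valued integrals are tested with
  functionals; calculus and Laplace uniqueness are then needed for complex-valued functions
  only.\<close>

lemma cdual_separates:
  fixes x y :: "'a::complex_normed_vector"
  assumes "\<And>f :: 'a \<Rightarrow>\<^sub>L complex. f \<in> cdual \<Longrightarrow> f x = f y"
  shows "x = y"
proof -
  obtain f :: "'a \<Rightarrow>\<^sub>L complex" where "f \<in> cdual" "f (x - y) = complex_of_real ((norm (x - y))\<^sup>2)"
    by (rule Hahn_Banach_norming)
  then show ?thesis
    using assms[of f] by (simp add: blinfun.diff_right)
qed

section \<open>The duality map and the regularised Gramian\<close>

text \<open>Divide by \<open>s\<close> and let \<open>s\<close> tend to 0. This turns a comparison
  with points on a segment into a first-order condition.\<close>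

lemma nonneg_if_quadratic_nonneg:
  fixes A e :: real
  assumes "\<And>s. 0 < s \<Longrightarrow> s \<le> 1 \<Longrightarrow> 0 \<le> s * A + s\<^sup>2 * e"
  shows "0 \<le> A"
proof (rule ccontr)
  assume "\<not> 0 \<le> A"
  \<comment> \<open>With this \<open>s\<close> the term \<open>s * \<bar>e\<bar>\<close> stays below
    half of \<open>- A\<close>.\<close>
  define s where "s = min 1 (- A / (2 * (\<bar>e\<bar> + 1)))"
  have s: "0 < s" "s \<le> 1" "s * (2 * (\<bar>e\<bar> + 1)) \<le> - A"
  proof -
    have "s \<le> - A / (2 * (\<bar>e\<bar> + 1))"
      by (simp add: s_def)
    then show "s * (2 * (\<bar>e\<bar> + 1)) \<le> - A"
      by (subst (asm) pos_le_divide_eq) auto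
    have "0 < - A / (2 * (\<bar>e\<bar> + 1))"
      using \<open>\<not> 0 \<le> A\<close> by (intro divide_pos_pos) auto
    then show "0 < s"
      by (simp add: s_def)
  qed (simp add: s_def)
  have "0 \<le> s * (A + s * e)"
    using assms[OF s(1,2)] by (simp add: power2_eq_square algebra_simps)
  then have "0 \<le> A + s * e"
    using s(1) by (simp add: zero_le_mult_iff)
  moreover have "s * e \<le> s * \<bar>e\<bar>"
    using s by (simp add: mult_left_mono)
  moreover have "0 \<le> s * \<bar>e\<bar>"
    using s by simp
  moreover have "s * (2 * (\<bar>e\<bar> + 1)) = 2 * (s * \<bar>e\<bar>) + 2 * s"
    by (simp add: algebra_simps)
  ultimately show False
    using s by linarith
qed

text \<open>Transfers uniform convexity from the unit sphere to a ball and to the squared norm. A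
  small gap forces nearly equal norms; if the points were still \<epsilon> apart, both norms would
  be at least \<open>\<epsilon> / 4\<close>, so the points could be normalised, and the midpoint
  would lie too far inside.\<close>

lemma uniformly_convex_gap:
  fixes V :: "'a::real_normed_vector set"
  assumes uc: "uniformly_convex V" and scale: "\<And>r x. x \<in> V \<Longrightarrow> r *\<^sub>R x \<in> V" and "0 < \<epsilon>"
  shows "\<exists>\<delta>>0. \<forall>x\<in>V. \<forall>y\<in>V. norm x \<le> C \<longrightarrow> norm y \<le> C \<longrightarrow>
    ((norm x)\<^sup>2 + (norm y)\<^sup>2) / 2 - (norm ((1/2) *\<^sub>R (x + y)))\<^sup>2 \<le> \<delta> \<longrightarrow> norm (x - y) < \<epsilon>"
proof -
  define K where "K = max 1 C"
  have K: "0 < K" "C \<le> K"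
    by (auto simp: K_def)
  have "0 < \<epsilon> / (2 * K)"
    using K \<open>0 < \<epsilon>\<close> by simp
  then obtain d where d: "0 < d" and uc': "\<And>x y. x \<in> V \<Longrightarrow> y \<in> V \<Longrightarrow> norm x = 1 \<Longrightarrow> norm y = 1 \<Longrightarrow>
      \<epsilon> / (2 * K) \<le> norm (x - y) \<Longrightarrow> norm ((1/2) *\<^sub>R (x + y)) \<le> 1 - d"
    using uc unfolding uniformly_convex_def by metis
  \<comment> \<open>The first bound keeps both norms above \<open>\<epsilon> / 4\<close> and the
    normalised vectors apart; the second keeps the difference of the norms from outweighing the gain
    \<open>\<epsilon> * d / 4\<close> from convexity.\<close>
  define \<eta> where "\<eta> = min (\<epsilon> / 2) (\<epsilon> * d / 8)"
  have \<eta>: "0 < \<eta>" "\<eta> \<le> \<epsilon> / 2" "\<eta> \<le> \<epsilon> * d / 8"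
    using \<open>0 < \<epsilon>\<close> d by (auto simp: \<eta>_def)
  \<comment> \<open>Below \<open>\<eta>\<^sup>2 / 4\<close> the gap bounds the difference of the
    norms by \<eta>; below \<open>\<epsilon>\<^sup>2 * d / 32\<close> it contradicts the final
    product estimate. Halving makes both strict.\<close>
  define \<delta> where "\<delta> = min (\<eta>\<^sup>2 / 4) (\<epsilon>\<^sup>2 * d / 32) / 2"
  have "0 < min (\<eta>\<^sup>2 / 4) (\<epsilon>\<^sup>2 * d / 32)"
    using \<eta> \<open>0 < \<epsilon>\<close> d by simp
  then have \<delta>: "0 < \<delta>" "\<delta> < \<eta>\<^sup>2 / 4" "\<delta> < \<epsilon>\<^sup>2 * d / 32"
    unfolding \<delta>_def by linarith+
  have "norm (x - y) < \<epsilon>"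
    if V: "x \<in> V" "y \<in> V" and C: "norm x \<le> C" "norm y \<le> C"
      and gap: "((norm x)\<^sup>2 + (norm y)\<^sup>2) / 2 - (norm ((1/2) *\<^sub>R (x + y)))\<^sup>2 \<le> \<delta>" for x y
  proof (rule ccontr)
    assume "\<not> norm (x - y) < \<epsilon>"
    then have ge: "\<epsilon> \<le> norm (x - y)"
      by simp
    define a b m where "a = norm x" and "b = norm y" and "m = norm ((1/2) *\<^sub>R (x + y))"
    have nn: "0 \<le> a" "0 \<le> b" "0 \<le> m"
      by (auto simp: a_def b_def m_def)
    have m: "m \<le> (a + b) / 2"
      unfolding a_def b_def m_def using norm_triangle_ineq[of x y] by simp
    then have "m\<^sup>2 \<le> ((a + b) / 2)\<^sup>2"
      using nn by (intro power_mono)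
    moreover have "(a\<^sup>2 + b\<^sup>2) / 2 - ((a + b) / 2)\<^sup>2 = (\<bar>a - b\<bar>)\<^sup>2 / 4"
      by (simp add: power2_eq_square field_simps)
    ultimately have "\<bar>a - b\<bar>\<^sup>2 < \<eta>\<^sup>2" and gap': "((a + b) / 2)\<^sup>2 - m\<^sup>2 \<le> \<delta>"
      using gap \<delta> zero_le_power2[of "\<bar>a - b\<bar>"] unfolding a_def[symmetric] b_def[symmetric] m_def[symmetric]
      by linarith+
    then have ab: "\<bar>a - b\<bar> < \<eta>"
      using \<eta> by (intro power2_less_imp_less[of _ \<eta>]) auto
    have "\<epsilon> \<le> a + b"
      using ge norm_triangle_ineq4[of x y] by (simp add: a_def b_def)
    then have pos: "\<epsilon> / 4 \<le> a" "\<epsilon> / 4 \<le> b" "0 < a" "0 < b"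
      using ab \<eta> \<open>0 < \<epsilon>\<close> by linarith+
    define x' y' where "x' = (1/a) *\<^sub>R x" and "y' = (1/b) *\<^sub>R y"
    have xy': "x' \<in> V" "y' \<in> V" "norm x' = 1" "norm y' = 1"
      using V pos scale by (auto simp: x'_def y'_def a_def b_def)
    have xe: "x = a *\<^sub>R x'" and ye: "y = b *\<^sub>R y'"
      using pos by (auto simp: x'_def y'_def)
    have "x - y = a *\<^sub>R (x' - y') + (a - b) *\<^sub>R y'"
      by (simp add: xe ye algebra_simps)
    then have "norm (x - y) \<le> a * norm (x' - y') + \<bar>a - b\<bar>"
      using norm_triangle_ineq[of "a *\<^sub>R (x' - y')" "(a - b) *\<^sub>R y'"] xy' pos by simp
    then have "\<epsilon> / 2 \<le> a * norm (x' - y')"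
      using ge ab \<eta> by linarith
    also have "\<dots> \<le> K * norm (x' - y')"
      using C K by (intro mult_right_mono) (auto simp: a_def)
    finally have "\<epsilon> / (2 * K) \<le> norm (x' - y')"
      using K by (simp add: field_simps)
    then have mid: "norm ((1/2) *\<^sub>R (x' + y')) \<le> 1 - d"
      using uc' xy' by blast
    have "(1/2) *\<^sub>R (x + y) = a *\<^sub>R (1/2) *\<^sub>R (x' + y') + ((b - a) / 2) *\<^sub>R y'"
      by (simp add: xe ye algebra_simps diff_divide_distrib)
    then have "m \<le> norm (a *\<^sub>R (1/2) *\<^sub>R (x' + y')) + norm (((b - a) / 2) *\<^sub>R y')"
      unfolding m_def by (metis norm_triangle_ineq)
    also have "\<dots> = a * norm ((1/2) *\<^sub>R (x' + y')) + \<bar>b - a\<bar> / 2"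
      using pos xy' by simp
    also have "\<dots> \<le> a * (1 - d) + \<bar>b - a\<bar> / 2"
      using mid pos by (intro add_right_mono mult_left_mono) auto
    finally have "m \<le> a - a * d + \<bar>b - a\<bar> / 2"
      by (simp add: algebra_simps)
    moreover have "\<epsilon> * d / 4 \<le> a * d"
      using pos d by (simp add: mult_right_mono)
    moreover have "\<bar>b - a\<bar> < \<epsilon> * d / 8"
      using ab \<eta> abs_minus_commute[of a b] by simp
    moreover have "\<bar>b - a\<bar> \<ge> a - b"
      by simp
    moreover have "E / 8 \<le> (a + b) / 2 - m"
      if "m \<le> a - P + t / 2" "E / 4 \<le> P" "t < E / 8" "a - b \<le> t" for E P t :: real
      using that by argo
    ultimately have "\<epsilon> * d / 8 \<le> (a + b) / 2 - m"
      by blast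
    then have "\<epsilon> * d / 8 * (\<epsilon> / 4) \<le> ((a + b) / 2 - m) * ((a + b) / 2 + m)"
      using pos nn d m \<open>0 < \<epsilon>\<close> by (intro mult_mono) argo+
    also have "\<dots> = ((a + b) / 2)\<^sup>2 - m\<^sup>2"
      by (simp add: power2_eq_square algebra_simps)
    also have "\<epsilon> * d / 8 * (\<epsilon> / 4) = \<epsilon>\<^sup>2 * d / 32"
      by (simp add: power2_eq_square)
    finally show False
      using gap' \<delta> by argo
  qed
  then show ?thesis
    using \<delta>(1) by blast
qed

text \<open>Uniform convexity makes minimising sequences Cauchy, so no weak compactness is needed.\<close>

lemma uniformly_convex_minimizer:
  fixes V :: "'a::banach set" and q :: "'a \<Rightarrow> real"
  assumes uc: "uniformly_convex V" and V: "subspace V" "closed V"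
    and conv: "\<And>x y. x \<in> V \<Longrightarrow> y \<in> V \<Longrightarrow> q ((1/2) *\<^sub>R (x + y)) \<le> (q x + q y) / 2"
    and cont: "continuous_on V q" and lower: "\<And>x. x \<in> V \<Longrightarrow> - c * norm x \<le> q x" and \<mu>: "0 < \<mu>"
  shows "\<exists>x\<in>V. \<forall>y\<in>V. \<mu> / 2 * (norm x)\<^sup>2 + q x \<le> \<mu> / 2 * (norm y)\<^sup>2 + q y"
proof -
  define \<Phi> where "\<Phi> x = \<mu> / 2 * (norm x)\<^sup>2 + q x" for x
  \<comment> \<open>Completing the square: half of the quadratic term absorbs the linear lower bound
    of \<open>q\<close>. Hence the infimum is finite and near-minimisers are bounded.\<close>
  have \<Phi>_lower: "\<mu> / 4 * (norm x)\<^sup>2 - c\<^sup>2 / \<mu> \<le> \<Phi> x" if "x \<in> V" for x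
  proof -
    have "0 \<le> (\<mu> / 2 * norm x - c)\<^sup>2 / \<mu>"
      using \<mu> by simp
    also have "\<dots> = \<mu> / 4 * (norm x)\<^sup>2 - c * norm x + c\<^sup>2 / \<mu>"
      using \<mu> by (simp add: power2_eq_square field_simps)
    finally show ?thesis
      using lower[OF that] by (simp add: \<Phi>_def)
  qed
  define I where "I = (INF x\<in>V. \<Phi> x)"
  have "- c\<^sup>2 / \<mu> \<le> \<Phi> x" if "x \<in> V" for x
    using \<Phi>_lower[OF that] \<mu> by (smt (verit) divide_minus_left zero_le_power2 mult_nonneg_nonneg divide_nonneg_nonneg)
  then have bdd: "bdd_below (\<Phi> ` V)"
    by (intro bdd_belowI) auto
  have ne: "V \<noteq> {}"
    using subspace_0[OF V(1)] by auto
  have I_le: "I \<le> \<Phi> x" if "x \<in> V" for x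
    unfolding I_def by (rule cINF_lower[OF bdd that])
  have "\<exists>x\<in>V. \<Phi> x < I + 1 / Suc n" for n
    using cInf_lessD[of "\<Phi> ` V" "I + 1 / Suc n"] ne unfolding I_def by auto
  then obtain x where x: "\<And>n. x n \<in> V" "\<And>n. \<Phi> (x n) < I + 1 / Suc n"
    by metis
  define K where "K = 4 * (I + 1 + c\<^sup>2 / \<mu>) / \<mu> + 1"
  have xK: "norm (x n) \<le> K" for n
  proof -
    have "1 / real (Suc n) \<le> 1"
      by simp
    then have "\<mu> / 4 * (norm (x n))\<^sup>2 \<le> I + 1 + c\<^sup>2 / \<mu>"
      using \<Phi>_lower[OF x(1), of n] x(2)[of n] by linarith
    then have "(norm (x n))\<^sup>2 \<le> 4 * (I + 1 + c\<^sup>2 / \<mu>) / \<mu>"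
      using \<mu> by (simp add: field_simps)
    moreover have "norm (x n) \<le> (norm (x n))\<^sup>2 + 1"
      using zero_le_power2[of "norm (x n) - 1/2"] by (simp add: power2_eq_square algebra_simps)
    ultimately show ?thesis
      by (simp add: K_def)
  qed
  have mid: "(1/2) *\<^sub>R (y + z) \<in> V" if "y \<in> V" "z \<in> V" for y z
    using that V(1) by (simp add: subspace_add subspace_scale)
  \<comment> \<open>At the midpoint the functional is still at least \<open>I\<close>, and
    \<open>q\<close> is midpoint convex, so the gap must be paid by the squared norm alone.\<close>
  have gap: "((norm y)\<^sup>2 + (norm z)\<^sup>2) / 2 - (norm ((1/2) *\<^sub>R (y + z)))\<^sup>2 \<le> e / \<mu> * 2"
    if "y \<in> V" "z \<in> V" "\<Phi> y \<le> I + e" "\<Phi> z \<le> I + e" for y z e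
  proof -
    have "I \<le> \<mu> / 2 * (norm ((1/2) *\<^sub>R (y + z)))\<^sup>2 + (q y + q z) / 2"
      using I_le[OF mid[OF that(1,2)]] conv[OF that(1,2)] unfolding \<Phi>_def by linarith
    then have "\<mu> / 2 * (((norm y)\<^sup>2 + (norm z)\<^sup>2) / 2 - (norm ((1/2) *\<^sub>R (y + z)))\<^sup>2) \<le> e"
      using that(3,4) unfolding \<Phi>_def by (simp only: right_diff_distrib distrib_left times_divide_eq_right add_divide_distrib)
    then show ?thesis
      using \<mu> by (simp only: pos_le_divide_eq times_divide_eq_left) (simp add: mult.commute field_simps)
  qed
  have "Cauchy x"
    unfolding Cauchy_def
  proof (intro allI impI)
    fix \<epsilon> :: real
    assume "0 < \<epsilon>"
    then obtain \<delta> where \<delta>: "0 < \<delta>" "\<And>y z. y \<in> V \<Longrightarrow> z \<in> V \<Longrightarrow> norm y \<le> K \<Longrightarrow> norm z \<le> K \<Longrightarrow>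
        ((norm y)\<^sup>2 + (norm z)\<^sup>2) / 2 - (norm ((1/2) *\<^sub>R (y + z)))\<^sup>2 \<le> \<delta> \<Longrightarrow> norm (y - z) < \<epsilon>"
      using uniformly_convex_gap[OF uc subspace_scale[OF V(1)], of \<epsilon> K] by blast
    obtain N where N: "inverse (real (Suc N)) < \<delta> * \<mu> / 2"
      using reals_Archimedean[of "\<delta> * \<mu> / 2"] \<delta>(1) \<mu> by auto
    have \<Phi>N: "\<Phi> (x n) \<le> I + \<delta> * \<mu> / 2" if "N \<le> n" for n
    proof -
      have "1 / real (Suc n) \<le> 1 / real (Suc N)"
        using that by (simp add: frac_le)
      then show ?thesis
        using x(2)[of n] N by (simp add: inverse_eq_divide)
    qed
    have "dist (x m) (x n) < \<epsilon>" if "N \<le> m" "N \<le> n" for m n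
      unfolding dist_norm
    proof (rule \<delta>(2))
      show "((norm (x m))\<^sup>2 + (norm (x n))\<^sup>2) / 2 - (norm ((1/2) *\<^sub>R (x m + x n)))\<^sup>2 \<le> \<delta>"
        using gap[OF x(1) x(1) \<Phi>N[OF that(1)] \<Phi>N[OF that(2)]] \<mu> by simp
    qed (use x xK in auto)
    then show "\<exists>M. \<forall>m\<ge>M. \<forall>n\<ge>M. dist (x m) (x n) < \<epsilon>"
      by blast
  qed
  then obtain l where l: "x \<longlonglongrightarrow> l"
    using Cauchy_convergent convergent_def by blast
  then have lV: "l \<in> V"
    using V(2) x(1) closed_sequentially by metis
  have "continuous_on V \<Phi>"
    unfolding \<Phi>_def by (intro continuous_intros cont)
  then have "(\<lambda>n. \<Phi> (x n)) \<longlonglongrightarrow> \<Phi> l"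
    using l lV x(1) by (intro continuous_on_tendsto_compose[of V \<Phi>]) auto
  moreover have "(\<lambda>n. I + 1 / Suc n) \<longlonglongrightarrow> I + 0"
    by (intro tendsto_intros LIMSEQ_Suc[OF lim_1_over_n])
  ultimately have "\<Phi> l \<le> I"
    using x(2) by (intro LIMSEQ_le[of "\<lambda>n. \<Phi> (x n)" _ "\<lambda>n. I + 1 / Suc n"]) (auto intro: less_imp_le)
  then show ?thesis
    using lV I_le unfolding \<Phi>_def by (intro bexI[of _ l]) (auto intro: order_trans)
qed

section \<open>Hilbert spaces: Riesz representation and adjoints\<close>

lemma cinner_add_right: "cinner z (x + y) = cinner z x + cinner z (y::'a::complex_hilbert)"
  by (subst (1 2 3) cinner_commute) (simp add: cinner_add_left)

lemma cinner_scaleC_right: "cinner z (c *C x) = cnj c * cinner z (x::'a::complex_hilbert)"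
  by (subst (1 2) cinner_commute) (simp add: cinner_scaleC_left)

lemma cinner_scaleR: "cinner (r *\<^sub>R x) z = of_real r * cinner x (z::'a::complex_hilbert)"
  "cinner z (r *\<^sub>R x) = of_real r * cinner z x"
  by (simp_all add: scaleR_scaleC cinner_scaleC_left cinner_scaleC_right)

lemma cinner_diff: "cinner (x - y) z = cinner x z - cinner y (z::'a::complex_hilbert)"
  "cinner z (x - y) = cinner z x - cinner z y"
  using cinner_add_left[of "x - y" y z] cinner_add_right[of z "x - y" y] by simp_all

lemma Re_cinner_commute: "Re (cinner x y) = Re (cinner y (x::'a::complex_hilbert))"
  by (subst cinner_commute) simp

lemma norm_add_cinner: "(norm (x + y))\<^sup>2 = (norm x)\<^sup>2 + 2 * Re (cinner y x) + (norm (y::'a::complex_hilbert))\<^sup>2"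
proof -
  have "complex_of_real ((norm (x + y))\<^sup>2) = cinner x x + cinner x y + cinner y x + cinner y y"
    by (simp only: cinner_self[symmetric] cinner_add_left cinner_add_right add_ac)
  then have "(norm (x + y))\<^sup>2 = Re (cinner x x + cinner x y + cinner y x + cinner y y)"
    by (metis Re_complex_of_real)
  then show ?thesis
    by (simp add: cinner_self Re_cinner_commute[of x y] del: of_real_power)
qed

text \<open>The parallelogram law gives \<open>1 - \<epsilon>\<^sup>2 / 4\<close> for the squared
  norm of the midpoint, and this is at most \<open>(1 - \<epsilon>\<^sup>2 / 8)\<^sup>2\<close>.
  Hilbert spaces thus fall under the same minimisation lemma as the dual space.\<close>

lemma uniformly_convex_hilbert: "uniformly_convex (UNIV :: 'a::complex_hilbert set)"
  unfolding uniformly_convex_def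
proof (intro allI impI)
  fix \<epsilon> :: real
  assume "0 < \<epsilon>"
  have "norm ((1/2) *\<^sub>R (x + y)) \<le> 1 - \<epsilon>\<^sup>2 / 8" if "norm x = 1" "norm y = 1" "\<epsilon> \<le> norm (x - y)" for x y :: 'a
  proof -
    have par: "(norm (x + y))\<^sup>2 + (norm (x - y))\<^sup>2 = 4"
      using norm_add_cinner[of x y] norm_add_cinner[of x "- y"] cinner_diff(1)[of 0 y x] that
        cinner_diff(1)[of 0 0 x] by simp
    have e2: "\<epsilon>\<^sup>2 \<le> (norm (x - y))\<^sup>2"
      using that \<open>0 < \<epsilon>\<close> by (intro power_mono) auto
    then have "\<epsilon>\<^sup>2 \<le> 4"
      using par zero_le_power2[of "norm (x + y)"] by linarith
    have "(norm ((1/2) *\<^sub>R (x + y)))\<^sup>2 = (norm (x + y))\<^sup>2 / 4"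
      by (simp add: power2_eq_square)
    also have "\<dots> \<le> 1 - \<epsilon>\<^sup>2 / 4"
      using par e2 by simp
    also have "\<dots> \<le> 1 - 2 * (\<epsilon>\<^sup>2 / 8) + (\<epsilon>\<^sup>2 / 8)\<^sup>2"
      by simp
    also have "\<dots> = (1 - \<epsilon>\<^sup>2 / 8)\<^sup>2"
      by (simp only: power2_diff power_one mult_1_right)
    finally show ?thesis
    proof (rule power2_le_imp_le)
      show "0 \<le> 1 - \<epsilon>\<^sup>2 / 8"
        using \<open>\<epsilon>\<^sup>2 \<le> 4\<close> by argo
    qed
  qed
  then show "\<exists>\<delta>>0. \<forall>x\<in>(UNIV::'a set). \<forall>y\<in>UNIV. norm x = 1 \<and> norm y = 1 \<and> \<epsilon> \<le> norm (x - y)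
      \<longrightarrow> norm ((1/2) *\<^sub>R (x + y)) \<le> 1 - \<delta>"
    using \<open>0 < \<epsilon>\<close> by (intro exI[of _ "\<epsilon>\<^sup>2 / 8"]) auto
qed

text \<open>The representing vector minimises \<open>norm x ^ 2 / 2 - Re (g x)\<close>. Its first
  variation identifies the real parts; inserting \<open>\<i> *C u\<close> gives the imaginary
  parts.\<close>

theorem Riesz_representation:
  fixes g :: "'a::complex_hilbert \<Rightarrow>\<^sub>L complex"
  assumes "g \<in> cdual"
  shows "\<exists>v. \<forall>u. g u = cinner u v"
proof -
  have "\<exists>x\<in>UNIV. \<forall>y\<in>UNIV. 1 / 2 * (norm x)\<^sup>2 + - Re (g x) \<le> 1 / 2 * (norm y)\<^sup>2 + - Re (g y)"
  proof (rule uniformly_convex_minimizer[OF uniformly_convex_hilbert])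
    show "- norm g * norm x \<le> - Re (g x)" for x
      using norm_blinfun[of g x] complex_Re_le_cmod[of "g x"] by simp
  qed (auto simp: blinfun.add_right blinfun.scaleR_right field_simps intro!: continuous_intros)
  then obtain v where v: "\<And>y. 1 / 2 * (norm v)\<^sup>2 + - Re (g v) \<le> 1 / 2 * (norm y)\<^sup>2 + - Re (g y)"
    by auto
  have ge: "0 \<le> Re (cinner u v) - Re (g u)" for u
  proof (rule nonneg_if_quadratic_nonneg[of _ "(norm u)\<^sup>2 / 2"])
    fix s :: real
    show "0 \<le> s * (Re (cinner u v) - Re (g u)) + s\<^sup>2 * ((norm u)\<^sup>2 / 2)"
      using v[of "v + s *\<^sub>R u"]
      by (simp add: norm_add_cinner blinfun.add_right blinfun.scaleR_right cinner_scaleR power_mult_distrib algebra_simps)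
  qed
  have Re_eq: "Re (g u) = Re (cinner u v)" for u
    using ge[of u] ge[of "- u"] cinner_diff(1)[of 0 u v] cinner_diff(1)[of 0 0 v]
    by (simp add: blinfun.minus_right)
  have "Im (g u) = Im (cinner u v)" for u
    using Re_eq[of "\<i> *C u"] cdual_functional[OF assms] by (simp add: cinner_scaleC_left)
  then show ?thesis
    using Re_eq by (intro exI[of _ v]) (simp add: complex_eq_iff)
qed

lemma cdual_banach_adjoint: "clinear_blinfun S \<Longrightarrow> f \<in> cdual \<Longrightarrow> banach_adjoint S f \<in> cdual"
  by (simp add: cdual_def clinear_blinfun_def banach_adjoint_def)

lemma banach_adjoint_apply: "banach_adjoint S f x = f (S x)"
  by (simp add: banach_adjoint_def)

lemma hilbert_adjoint_eqI:
  fixes B :: "'u::complex_hilbert \<Rightarrow>\<^sub>L 'w::complex_normed_vector" and f :: "'w \<Rightarrow>\<^sub>L complex"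
  assumes "\<And>u. f (B u) = cinner u v"
  shows "hilbert_adjoint B f = v"
  unfolding hilbert_adjoint_def
proof (rule the_equality)
  fix v'
  assume "\<forall>u. f (B u) = cinner u v'"
  then have "cinner (v' - v) (v' - v) = 0"
    using assms by (simp add: cinner_diff(2))
  then show "v' = v"
    by (simp add: cinner_self)
qed (use assms in blast)

lemma hilbert_adjoint:
  assumes "clinear_blinfun B" "f \<in> cdual"
  shows "f (B u) = cinner u (hilbert_adjoint B f)"
proof -
  obtain v where "\<And>u. banach_adjoint B f u = cinner u v"
    using Riesz_representation[OF cdual_banach_adjoint[OF assms]] by blast
  then show ?thesis
    using hilbert_adjoint_eqI[of f B v] by (simp add: banach_adjoint_apply)
qed

lemma closed_cdual: "closed (cdual :: ('a::complex_normed_vector \<Rightarrow>\<^sub>L complex) set)"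
proof -
  have "cdual = (\<Inter>c x. {f :: 'a \<Rightarrow>\<^sub>L complex. f (c *C x) = c * f x})"
    by (auto simp: cdual_def clinear_blinfun_def scaleC_complex_def)
  also have "closed \<dots>"
    by (intro closed_INT ballI closed_Collect_eq continuous_intros)
  finally show ?thesis .
qed

lemma subspace_cdual: "subspace (cdual :: ('a::complex_normed_vector \<Rightarrow>\<^sub>L complex) set)"
  by (auto simp: subspace_def cdual_def clinear_blinfun_def blinfun.add_left blinfun.scaleR_left
      scaleC_add_right scaleC_scaleR blinfun.zero_left scaleC.zero_right)

lemmas cdual_closed_ops = subspace_0[OF subspace_cdual] subspace_add[OF subspace_cdual]
  subspace_diff[OF subspace_cdual] subspace_scale[OF subspace_cdual]

text \<open>Real scalars only: the adjoint is conjugate-linear, and the convex analysis below works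
  over the reals.\<close>

lemma hilbert_adjoint_linear:
  assumes "clinear_blinfun B" "f \<in> cdual" "g \<in> cdual"
  shows "hilbert_adjoint B (f + g) = hilbert_adjoint B f + hilbert_adjoint B g"
    and "hilbert_adjoint B (f - g) = hilbert_adjoint B f - hilbert_adjoint B g"
    and "hilbert_adjoint B (r *\<^sub>R f) = r *\<^sub>R hilbert_adjoint B f"
  using hilbert_adjoint[OF assms(1,2)] hilbert_adjoint[OF assms(1,3)]
  by (auto intro!: hilbert_adjoint_eqI simp: blinfun.add_left blinfun.diff_left blinfun.scaleR_left
      cinner_add_right cinner_diff cinner_scaleR scaleR_conv_of_real)

lemma norm_hilbert_adjoint_le:
  assumes "clinear_blinfun B" "f \<in> cdual"
  shows "norm (hilbert_adjoint B f) \<le> norm f * norm B"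
proof -
  let ?v = "hilbert_adjoint B f"
  have "norm ?v * norm ?v = norm (f (B ?v))"
    by (simp add: hilbert_adjoint[OF assms] cinner_self norm_mult power2_eq_square)
  also have "\<dots> \<le> norm f * (norm B * norm ?v)"
    by (meson mult_left_mono norm_blinfun norm_ge_zero order_trans)
  finally show ?thesis
    by (cases "?v = 0") (auto simp: mult.assoc[symmetric])
qed

section \<open>The duality map when the dual is uniformly convex\<close>

context
  fixes dummy :: "'w::complex_banach itself"
  assumes uc: "uniformly_convex (cdual :: ('w \<Rightarrow>\<^sub>L complex) set)"
begin

text \<open>The average of two elements still takes the value \<open>(norm x)\<^sup>2\<close> at
  \<open>x\<close>, so its norm is not smaller than theirs; the convexity gap vanishes and uniform
  convexity identifies them.\<close>

lemma duality_set_unique: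
  fixes x :: 'w
  assumes "f \<in> duality_set x" "g \<in> duality_set x"
  shows "f = g"
proof (rule ccontr)
  assume "f \<noteq> g"
  then have "0 < norm (f - g)"
    by simp
  then obtain \<delta> where \<delta>: "0 < \<delta>" "\<And>f' g' :: 'w \<Rightarrow>\<^sub>L complex. f' \<in> cdual \<Longrightarrow> g' \<in> cdual \<Longrightarrow> norm f' \<le> norm x \<Longrightarrow> norm g' \<le> norm x \<Longrightarrow>
      ((norm f')\<^sup>2 + (norm g')\<^sup>2) / 2 - (norm ((1/2) *\<^sub>R (f' + g')))\<^sup>2 \<le> \<delta> \<Longrightarrow> norm (f' - g') < norm (f - g)"
    using uniformly_convex_gap[OF uc subspace_scale[OF subspace_cdual], of "norm (f - g)" "norm x"] by blast
  have n: "norm f = norm x" "norm g = norm x"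
    using assms by (auto simp: duality_set_def)
  have "norm x \<le> norm ((1/2) *\<^sub>R (f + g))"
  proof (cases "x = 0")
    case False
    have "((1/2) *\<^sub>R (f + g)) x = of_real ((norm x)\<^sup>2)"
      using assms by (simp add: duality_set_def blinfun.scaleR_left blinfun.add_left scaleR_conv_of_real)
    then have "norm x * norm x \<le> norm ((1/2) *\<^sub>R (f + g)) * norm x"
      using norm_blinfun[of "(1/2) *\<^sub>R (f + g)" x] by (simp add: power2_eq_square norm_mult)
    then show ?thesis
      using False by simp
  qed simp
  from power_mono[OF this norm_ge_zero, of 2]
  have "((norm f)\<^sup>2 + (norm g)\<^sup>2) / 2 - (norm ((1/2) *\<^sub>R (f + g)))\<^sup>2 \<le> \<delta>"
    using \<delta>(1) unfolding n by argo
  then show False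
    using \<delta>(2)[of f g] assms n by (auto simp: duality_set_def)
qed

lemma duality_map_eqI: "f \<in> duality_set x \<Longrightarrow> duality_map x = f" for x :: 'w
proof -
  assume "f \<in> duality_set x"
  then have "duality_set x = {f}"
    using duality_set_unique by blast
  then show ?thesis
    by (simp add: duality_map_def)
qed

lemma duality_map: "duality_map x \<in> duality_set x" for x :: 'w
proof -
  obtain f :: "'w \<Rightarrow>\<^sub>L complex" where "f \<in> cdual" "f x = complex_of_real ((norm x)\<^sup>2)" "norm f = norm x"
    by (rule Hahn_Banach_norming)
  then have "f \<in> duality_set x"
    by (simp add: duality_set_def)
  then show ?thesis
    using duality_map_eqI by metis
qed

lemma duality_map_cdual: "duality_map x \<in> cdual"
  and duality_map_self: "duality_map x x = of_real ((norm x)\<^sup>2)"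
  and norm_duality_map: "norm (duality_map x) = norm x" for x :: 'w
  using duality_map[of x] by (auto simp: duality_set_def)

section \<open>The equation \<open>\<mu> *\<^sub>R x + \<Psi> (duality_map x) = z\<close> for a
  positive symmetric \<Psi>\<close>

context
  fixes \<Psi> :: "('w \<Rightarrow>\<^sub>L complex) \<Rightarrow> 'w" and \<mu> c :: real
  assumes \<Psi>_add: "\<And>f g. f \<in> cdual \<Longrightarrow> g \<in> cdual \<Longrightarrow> \<Psi> (f + g) = \<Psi> f + \<Psi> g"
    and \<Psi>_scaleR: "\<And>f r. f \<in> cdual \<Longrightarrow> \<Psi> (r *\<^sub>R f) = r *\<^sub>R \<Psi> f"
    and \<Psi>_bounded: "\<And>f. f \<in> cdual \<Longrightarrow> norm (\<Psi> f) \<le> c * norm f"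
    and \<Psi>_sym: "\<And>f g. f \<in> cdual \<Longrightarrow> g \<in> cdual \<Longrightarrow> Re (f (\<Psi> g)) = Re (g (\<Psi> f))"
    and \<Psi>_pos: "\<And>f. f \<in> cdual \<Longrightarrow> 0 \<le> Re (f (\<Psi> f))"
    and \<mu>: "0 < \<mu>"
begin

lemma \<Psi>_diff: "f \<in> cdual \<Longrightarrow> g \<in> cdual \<Longrightarrow> \<Psi> (f - g) = \<Psi> f - \<Psi> g"
  using \<Psi>_add[of f "(-1) *\<^sub>R g"] \<Psi>_scaleR[of g "-1"] cdual_closed_ops(4)[of g "-1"] by simp

lemma \<Psi>_quadratic:
  assumes "f \<in> cdual" "g \<in> cdual"
  shows "Re ((f + s *\<^sub>R g) (\<Psi> (f + s *\<^sub>R g))) = Re (f (\<Psi> f)) + 2 * s * Re (g (\<Psi> f)) + s\<^sup>2 * Re (g (\<Psi> g))"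
  using assms \<Psi>_sym[OF assms]
  by (simp add: \<Psi>_add \<Psi>_scaleR cdual_closed_ops blinfun.add_left blinfun.add_right blinfun.scaleR_left
      blinfun.scaleR_right power2_eq_square algebra_simps)

text \<open>The Euler-Lagrange inequality of the minimisation problem over the dual says that
  \<open>(z - \<Psi> f) / \<mu>\<close> is a subgradient of \<open>norm\<^sup>2 / 2\<close> at the minimiser \<open>f\<close>, i.e. that \<open>f\<close> is its
  image under the duality map.\<close>

lemma exists_regularized_solution: "\<exists>x. \<mu> *\<^sub>R x + \<Psi> (duality_map x) = z"
proof -
  let ?q = "\<lambda>f. Re (f (\<Psi> f)) / 2 - Re (f z)"
  have "\<exists>f\<in>cdual. \<forall>g\<in>cdual. \<mu> / 2 * (norm f)\<^sup>2 + ?q f \<le> \<mu> / 2 * (norm g)\<^sup>2 + ?q g"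
  proof (rule uniformly_convex_minimizer[OF uc subspace_cdual closed_cdual])
    show "- norm z * norm f \<le> ?q f" if "f \<in> cdual" for f
      using norm_blinfun[of f z] complex_Re_le_cmod[of "f z"] \<Psi>_pos[OF that] by (simp add: mult.commute)
    show "?q ((1/2) *\<^sub>R (f + g)) \<le> (?q f + ?q g) / 2" if "f \<in> cdual" "g \<in> cdual" for f g
    proof -
      have fg: "(1/2) *\<^sub>R (f + g) = f + (1/2) *\<^sub>R (g - f)"
        by (simp add: algebra_simps scaleR_left_diff_distrib[symmetric] flip: scaleR_left_distrib)
      \<comment> \<open>Midpoint convexity of a quadratic form amounts to its positivity at the
        difference of the two points.\<close>
      have "0 \<le> Re ((g - f) (\<Psi> (g - f)))"
        using that by (intro \<Psi>_pos cdual_closed_ops)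
      moreover have "Re ((g - f) (\<Psi> (g - f))) = Re (g (\<Psi> g)) - 2 * Re (f (\<Psi> g)) + Re (f (\<Psi> f))"
        using \<Psi>_quadratic[OF that(2,1), of "-1"] by simp
      moreover have "Re (((1/2) *\<^sub>R (f + g)) z) = (Re (f z) + Re (g z)) / 2"
        by (simp add: blinfun.add_left blinfun.scaleR_left)
      moreover have "Re (((1/2) *\<^sub>R (f + g)) (\<Psi> ((1/2) *\<^sub>R (f + g)))) = (Re (f (\<Psi> f)) + 2 * Re (f (\<Psi> g)) + Re (g (\<Psi> g))) / 4"
        using that \<Psi>_sym[OF that]
        by (simp add: \<Psi>_add \<Psi>_scaleR cdual_closed_ops blinfun.add_left blinfun.add_right blinfun.scaleR_left
            blinfun.scaleR_right field_simps)
      ultimately show ?thesis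
        by argo
    qed
    have "continuous_on cdual \<Psi>"
    proof (rule continuous_onI)
      fix f :: "'w \<Rightarrow>\<^sub>L complex" and e :: real
      assume f: "f \<in> cdual" and "0 < e"
      show "\<exists>d>0. \<forall>g\<in>cdual. dist g f < d \<longrightarrow> dist (\<Psi> g) (\<Psi> f) \<le> e"
      proof (intro exI[of _ "e / (\<bar>c\<bar> + 1)"] conjI ballI impI)
        show "0 < e / (\<bar>c\<bar> + 1)"
          using \<open>0 < e\<close> by simp
        fix g
        assume g: "g \<in> cdual" "dist g f < e / (\<bar>c\<bar> + 1)"
        have "dist (\<Psi> g) (\<Psi> f) \<le> c * norm (g - f)"
          using \<Psi>_bounded[OF cdual_closed_ops(3)[OF g(1) f]] f g by (simp add: \<Psi>_diff dist_norm)
        also have "\<dots> \<le> (\<bar>c\<bar> + 1) * norm (g - f)"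
          by (intro mult_right_mono) auto
        also have "\<dots> \<le> e"
          using g(2) by (simp add: dist_norm field_simps)
        finally show "dist (\<Psi> g) (\<Psi> f) \<le> e" .
      qed
    qed
    then show "continuous_on cdual ?q"
      by (intro continuous_intros) auto
  qed fact
  then obtain f where f: "f \<in> cdual"
    and min: "\<And>g. g \<in> cdual \<Longrightarrow> \<mu> / 2 * (norm f)\<^sup>2 + ?q f \<le> \<mu> / 2 * (norm g)\<^sup>2 + ?q g"
    by blast
  define x where "x = (1 / \<mu>) *\<^sub>R (z - \<Psi> f)"
  have xz: "\<mu> *\<^sub>R x + \<Psi> f = z"
    using \<mu> by (simp add: x_def)
  have subgrad: "0 \<le> ((norm g)\<^sup>2 - (norm f)\<^sup>2) / 2 - Re ((g - f) x)" if g: "g \<in> cdual" for g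
  proof -
    have "0 \<le> \<mu> / 2 * ((norm g)\<^sup>2 - (norm f)\<^sup>2) + Re ((g - f) (\<Psi> f)) - Re ((g - f) z)"
    proof (rule nonneg_if_quadratic_nonneg)
      fix s :: real
      assume s: "0 < s" "s \<le> 1"
      have "norm (f + s *\<^sub>R (g - f)) \<le> (1 - s) * norm f + s * norm g"
      proof -
        have "f + s *\<^sub>R (g - f) = (1 - s) *\<^sub>R f + s *\<^sub>R g"
          by (simp add: algebra_simps)
        then show ?thesis
          using norm_triangle_ineq[of "(1 - s) *\<^sub>R f" "s *\<^sub>R g"] s by simp
      qed
      then have "(norm (f + s *\<^sub>R (g - f)))\<^sup>2 \<le> ((1 - s) * norm f + s * norm g)\<^sup>2"
        by (intro power_mono) auto
      also have "\<dots> = (1 - s) * (norm f)\<^sup>2 + s * (norm g)\<^sup>2 - s * (1 - s) * (norm f - norm g)\<^sup>2"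
        by (simp add: power2_eq_square algebra_simps)
      also have "\<dots> \<le> (1 - s) * (norm f)\<^sup>2 + s * (norm g)\<^sup>2"
        using s by simp
      finally have "\<mu> / 2 * (norm (f + s *\<^sub>R (g - f)))\<^sup>2 \<le> \<mu> / 2 * ((1 - s) * (norm f)\<^sup>2 + s * (norm g)\<^sup>2)"
        using \<mu> by (intro mult_left_mono) auto
      moreover have "f + s *\<^sub>R (g - f) \<in> cdual"
        using f g by (intro cdual_closed_ops)
      note min[OF this]
      moreover have "Re ((f + s *\<^sub>R (g - f)) z) = Re (f z) + s * Re ((g - f) z)"
        by (simp add: blinfun.add_left blinfun.scaleR_left)
      moreover note \<Psi>_quadratic[OF f cdual_closed_ops(3)[OF g f], of s]
      moreover have "0 \<le> s * (\<mu> / 2 * (b - a) + H - W) + s\<^sup>2 * (K / 2)"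
        if "\<mu> / 2 * m \<le> \<mu> / 2 * ((1 - s) * a + s * b)" "\<mu> / 2 * a + (F / 2 - Z) \<le> \<mu> / 2 * m + (X / 2 - Y)"
          "Y = Z + s * W" "X = F + 2 * s * H + s\<^sup>2 * K" for a b m F H K W X Y Z :: real
      proof -
        have "s * (\<mu> / 2 * (b - a) + H - W) + s\<^sup>2 * (K / 2)
          = (\<mu> / 2 * ((1 - s) * a + s * b) + (X / 2 - Y)) - (\<mu> / 2 * a + (F / 2 - Z))"
          by (simp add: that field_simps)
        then show ?thesis
          using that(1,2) by argo
      qed
      ultimately show "0 \<le> s * (\<mu> / 2 * ((norm g)\<^sup>2 - (norm f)\<^sup>2) + Re ((g - f) (\<Psi> f)) - Re ((g - f) z)) + s\<^sup>2 * (Re ((g - f) (\<Psi> (g - f))) / 2)"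
        by blast
    qed
    moreover have "Re ((g - f) z) = \<mu> * Re ((g - f) x) + Re ((g - f) (\<Psi> f))"
      by (subst xz[symmetric]) (simp add: blinfun.add_right blinfun.scaleR_right)
    ultimately have "0 \<le> \<mu> * (((norm g)\<^sup>2 - (norm f)\<^sup>2) / 2 - Re ((g - f) x))"
      by (simp add: algebra_simps)
    then show ?thesis
      using \<mu> by (simp add: zero_le_mult_iff)
  qed
  \<comment> \<open>Multiples of \<open>f\<close> are admissible competitors. Varying the factor
    upwards and downwards from 1 gives Euler's relation for the 2-homogeneous function
    \<open>norm ^ 2 / 2\<close>.\<close>
  have fx: "Re (f x) = (norm f)\<^sup>2"
  proof -
    have scaled: "0 \<le> (r\<^sup>2 * (norm f)\<^sup>2 - (norm f)\<^sup>2) / 2 - (r * Re (f x) - Re (f x))" if "0 \<le> r" for r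
      using subgrad[OF cdual_closed_ops(4)[OF f, of r]]
      by (simp add: blinfun.scaleR_left blinfun.diff_left power_mult_distrib)
    have expand: "((1 + s)\<^sup>2 * a - a) / 2 - ((1 + s) * r - r) = s * (a - r) + s\<^sup>2 * (a / 2)" for s a r :: real
      by (simp add: power2_eq_square field_simps)
    have "0 \<le> (norm f)\<^sup>2 - Re (f x)"
    proof (rule nonneg_if_quadratic_nonneg[of _ "(norm f)\<^sup>2 / 2"])
      fix s :: real assume s: "0 < s" "s \<le> 1"
      show "0 \<le> s * ((norm f)\<^sup>2 - Re (f x)) + s\<^sup>2 * ((norm f)\<^sup>2 / 2)"
        using scaled[of "1 + s"] s unfolding expand by argo
    qed
    moreover have "0 \<le> Re (f x) - (norm f)\<^sup>2"
    proof (rule nonneg_if_quadratic_nonneg[of _ "(norm f)\<^sup>2 / 2"])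
      fix s :: real assume s: "0 < s" "s \<le> 1"
      show "0 \<le> s * (Re (f x) - (norm f)\<^sup>2) + s\<^sup>2 * ((norm f)\<^sup>2 / 2)"
        using scaled[of "1 + - s"] s unfolding expand by (simp add: right_diff_distrib)
    qed
    ultimately show ?thesis
      by simp
  qed
  \<comment> \<open>A norming functional of \<open>x\<close> as competitor bounds
    \<open>norm x\<close> by \<open>norm f\<close>.\<close>
  obtain g :: "'w \<Rightarrow>\<^sub>L complex" where g: "g \<in> cdual" "g x = complex_of_real ((norm x)\<^sup>2)" "norm g = norm x"
    by (rule Hahn_Banach_norming)
  have "(norm x)\<^sup>2 \<le> (norm f)\<^sup>2"
    using subgrad[OF g(1)] by (simp add: blinfun.diff_left g fx del: of_real_power)
  then have "norm x \<le> norm f"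
    by (rule power2_le_imp_le) simp
  moreover have fle: "norm (f x) \<le> norm f * norm x"
    by (rule norm_blinfun)
  then have "norm f * norm f \<le> norm f * norm x"
    using fx complex_Re_le_cmod[of "f x"] by (simp add: power2_eq_square)
  then have "norm f \<le> norm x"
    by (cases "f = 0") auto
  ultimately have n: "norm f = norm x"
    by simp
  \<comment> \<open>\<open>Re (f x)\<close> equals the largest modulus possible, so the imaginary
    part is 0.\<close>
  have "(Re (f x))\<^sup>2 + (Im (f x))\<^sup>2 \<le> (norm f * norm x)\<^sup>2"
    using power_mono[OF fle, of 2] by (simp add: cmod_power2)
  then have "(Im (f x))\<^sup>2 \<le> 0"
    by (simp add: fx n power2_eq_square)
  then have "Im (f x) = 0"
    by simp
  then have "f \<in> duality_set x"
    using f fx n by (simp add: duality_set_def complex_eq_iff)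
  then show ?thesis
    using duality_map_eqI xz by metis
qed

text \<open>A quantitative form of the monotonicity of the duality map. The sum of the two
  functionals has norm \<open>2 * m\<close>, which bounds its values at \<open>x\<close> and
  \<open>y\<close>; what these values lack to reach
  \<open>2 * ((norm x)\<^sup>2 + (norm y)\<^sup>2)\<close> is the pairing of the differences.
  Uniform convexity later turns a small pairing into a small distance in the dual.\<close>

lemma duality_map_gap:
  fixes x y :: 'w
  shows "((norm x)\<^sup>2 + (norm y)\<^sup>2) / 2 - (norm ((1/2) *\<^sub>R (duality_map x + duality_map y)))\<^sup>2
    \<le> Re ((duality_map x - duality_map y) (x - y)) / 2"
proof -
  let ?f = "duality_map x" and ?g = "duality_map y"
  define m where "m = norm ((1/2) *\<^sub>R (?f + ?g))"
  have "Re ((?f + ?g) w) \<le> 2 * m * norm w" for w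
    using norm_blinfun[of "?f + ?g" w] complex_Re_le_cmod[of "(?f + ?g) w"] by (simp add: m_def)
  from this[of x] this[of y]
  have "Re ((?f + ?g) x) + Re ((?f + ?g) y) \<le> 2 * m * (norm x + norm y)"
    by (simp add: algebra_simps)
  moreover have "Re ((?f + ?g) x) + Re ((?f + ?g) y) + Re ((?f - ?g) (x - y)) = 2 * ((norm x)\<^sup>2 + (norm y)\<^sup>2)"
    by (simp add: blinfun.add_left blinfun.diff_left blinfun.diff_right duality_map_self del: of_real_power)
  moreover have "m * (norm x + norm y) \<le> m\<^sup>2 + ((norm x)\<^sup>2 + (norm y)\<^sup>2) / 2"
    using zero_le_power2[of "m - (norm x + norm y) / 2"] zero_le_power2[of "norm x - norm y"]
    by (simp add: power2_eq_square field_simps)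
  ultimately show ?thesis
    unfolding m_def[symmetric] by linarith
qed

text \<open>Subtracting the two equations leaves a \<Psi>-term that is nonnegative when tested with
  the difference of the functionals.\<close>

lemma regularized_monotone:
  fixes x y :: 'w
  shows "\<mu> * Re ((duality_map x - duality_map y) (x - y))
    \<le> Re ((duality_map x - duality_map y) ((\<mu> *\<^sub>R x + \<Psi> (duality_map x)) - (\<mu> *\<^sub>R y + \<Psi> (duality_map y))))"
proof -
  have "0 \<le> Re ((duality_map x - duality_map y) (\<Psi> (duality_map x - duality_map y)))"
    by (intro \<Psi>_pos cdual_closed_ops duality_map_cdual)
  moreover have "(\<mu> *\<^sub>R x + \<Psi> (duality_map x)) - (\<mu> *\<^sub>R y + \<Psi> (duality_map y))
    = \<mu> *\<^sub>R (x - y) + \<Psi> (duality_map x - duality_map y)"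
    by (simp add: \<Psi>_diff duality_map_cdual algebra_simps)
  ultimately show ?thesis
    by (simp add: blinfun.add_right blinfun.scaleR_right)
qed

lemma gramian_resolvent_eq:
  fixes z :: 'w
  defines "x \<equiv> gramian_resolvent \<mu> \<Psi> z"
  shows "\<mu> *\<^sub>R x + \<Psi> (duality_map x) = z"
proof -
  have "surj (\<lambda>x. \<mu> *\<^sub>R x + \<Psi> (duality_map x))"
    unfolding surj_def using exists_regularized_solution by metis
  then show ?thesis
    unfolding x_def gramian_resolvent_def by (rule surj_f_inv_f)
qed

text \<open>Pairing the equation with \<open>duality_map x\<close> and dropping the \<Psi>-term.
  Through this bound the control is estimated uniformly in the state.\<close>

lemma norm_duality_map_gramian_resolvent:
  "norm (duality_map (gramian_resolvent \<mu> \<Psi> z)) \<le> norm z / \<mu>"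
proof -
  let ?x = "gramian_resolvent \<mu> \<Psi> z"
  let ?f = "duality_map ?x"
  have "Re (?f z) = \<mu> * (norm ?x)\<^sup>2 + Re (?f (\<Psi> ?f))"
    by (subst gramian_resolvent_eq[of z, symmetric])
      (simp add: blinfun.add_right blinfun.scaleR_right duality_map_self del: of_real_power)
  then have "\<mu> * (norm ?x)\<^sup>2 \<le> norm ?f * norm z"
    using \<Psi>_pos[OF duality_map_cdual, of ?x] norm_blinfun[of ?f z] complex_Re_le_cmod[of "?f z"] by linarith
  then have "norm ?x * (\<mu> * norm ?x) \<le> norm ?x * norm z"
    by (simp add: norm_duality_map power2_eq_square algebra_simps)
  then show ?thesis
    using \<mu> by (cases "norm ?x = 0") (auto simp: norm_duality_map field_simps)
qed

text \<open>The monotonicity bound at two right-hand sides is at most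
  \<open>2 * C * norm (z' - z)\<close>, where \<open>C\<close> bounds both functionals as soon as
  \<open>norm (z' - z) < 1\<close>. Hence the radius \<open>\<delta> * \<mu> / C\<close>: it makes
  the convexity gap at most \<delta>.\<close>

lemma continuous_duality_map_gramian_resolvent:
  "continuous_on UNIV (\<lambda>z. duality_map (gramian_resolvent \<mu> \<Psi> z))"
  unfolding continuous_on_iff
proof (intro ballI allI impI)
  fix z :: 'w and e :: real
  assume "0 < e"
  let ?x = "gramian_resolvent \<mu> \<Psi>"
  define C where "C = (norm z + 1) / \<mu>"
  have C: "0 < C"
    using \<mu> by (simp add: C_def add_nonneg_pos)
  obtain \<delta> where \<delta>: "0 < \<delta>" "\<And>f g :: 'w \<Rightarrow>\<^sub>L complex. f \<in> cdual \<Longrightarrow> g \<in> cdual \<Longrightarrow> norm f \<le> C \<Longrightarrow> norm g \<le> C \<Longrightarrow>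
      ((norm f)\<^sup>2 + (norm g)\<^sup>2) / 2 - (norm ((1/2) *\<^sub>R (f + g)))\<^sup>2 \<le> \<delta> \<Longrightarrow> norm (f - g) < e"
    using uniformly_convex_gap[OF uc subspace_scale[OF subspace_cdual] \<open>0 < e\<close>, of C] by blast
  show "\<exists>d>0. \<forall>z'\<in>UNIV. dist z' z < d \<longrightarrow> dist (duality_map (?x z')) (duality_map (?x z)) < e"
  proof (intro exI[of _ "min 1 (\<delta> * \<mu> / C)"] conjI ballI impI)
    show "0 < min 1 (\<delta> * \<mu> / C)"
      using \<delta> \<mu> C by simp
    fix z'
    assume "dist z' z < min 1 (\<delta> * \<mu> / C)"
    then have d: "norm (z' - z) < 1" "norm (z' - z) < \<delta> * \<mu> / C"
      by (auto simp: dist_norm)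
    let ?f = "duality_map (?x z')" and ?g = "duality_map (?x z)"
    have bd: "norm ?f \<le> C" "norm ?g \<le> C"
    proof -
      have "norm z' \<le> norm z + 1"
        using d norm_triangle_sub[of z' z] by linarith
      then have "norm z' / \<mu> \<le> C" "norm z / \<mu> \<le> C"
        using \<mu> by (auto simp: C_def divide_right_mono)
      then show "norm ?f \<le> C" "norm ?g \<le> C"
        using norm_duality_map_gramian_resolvent order_trans by blast+
    qed
    have "\<mu> * Re ((?f - ?g) (?x z' - ?x z)) \<le> Re ((?f - ?g) (z' - z))"
      using regularized_monotone[of "?x z'" "?x z"] by (simp only: gramian_resolvent_eq)
    also have "\<dots> \<le> norm (?f - ?g) * norm (z' - z)"
      using norm_blinfun[of "?f - ?g" "z' - z"] complex_Re_le_cmod[of "(?f - ?g) (z' - z)"] by linarith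
    also have "\<dots> \<le> (2 * C) * (\<delta> * \<mu> / C)"
      using bd d C norm_triangle_ineq4[of ?f ?g] by (intro mult_mono) auto
    also have "\<dots> = \<mu> * (2 * \<delta>)"
      using C by simp
    finally have "Re ((?f - ?g) (?x z' - ?x z)) / 2 \<le> \<delta>"
      using \<mu> by simp
    then have "((norm ?f)\<^sup>2 + (norm ?g)\<^sup>2) / 2 - (norm ((1/2) *\<^sub>R (?f + ?g)))\<^sup>2 \<le> \<delta>"
      using duality_map_gap[of "?x z'" "?x z"] unfolding norm_duality_map by linarith
    then show "dist ?f ?g < e"
      unfolding dist_norm using bd by (intro \<delta>(2) duality_map_cdual)
  qed
qed

end

end

section \<open>The fixed point theorem of Schauder\<close>

text \<open>The index set of the cube is \<open>{..<n}\<close> with \<open>n\<close> a variable, unlike in the library's Brouwer theorem,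
  where the dimension is fixed by a type.\<close>

lemma Brouwer_cube_approx:
  fixes g :: "(nat \<Rightarrow> real) \<Rightarrow> nat \<Rightarrow> real"
  assumes maps: "\<And>a i. \<forall>i<n. 0 \<le> a i \<and> a i \<le> 1 \<Longrightarrow> i < n \<Longrightarrow> 0 \<le> g a i \<and> g a i \<le> 1"
    and cont: "\<And>e. 0 < e \<Longrightarrow> \<exists>d>0. \<forall>a b. (\<forall>i<n. 0 \<le> a i \<and> a i \<le> 1) \<longrightarrow> (\<forall>i<n. 0 \<le> b i \<and> b i \<le> 1) \<longrightarrow>
      (\<forall>i<n. \<bar>a i - b i\<bar> \<le> d) \<longrightarrow> (\<forall>i<n. \<bar>g a i - g b i\<bar> \<le> e)"
    and e: "0 < e"
  shows "\<exists>a. (\<forall>i<n. 0 \<le> a i \<and> a i \<le> 1) \<and> (\<forall>i<n. \<bar>g a i - a i\<bar> \<le> e)"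
proof -
  obtain d where d: "0 < d"
    and gd: "\<And>a b i. \<forall>i<n. 0 \<le> a i \<and> a i \<le> 1 \<Longrightarrow> \<forall>i<n. 0 \<le> b i \<and> b i \<le> 1 \<Longrightarrow>
      \<forall>i<n. \<bar>a i - b i\<bar> \<le> d \<Longrightarrow> i < n \<Longrightarrow> \<bar>g a i - g b i\<bar> \<le> e / 4"
    using cont[of "e / 4"] e by (metis zero_less_divide_iff zero_less_numeral)
  obtain k :: nat where k: "inverse (real (Suc k)) < min d (e / 4)"
    using reals_Archimedean[of "min d (e / 4)"] d e by auto
  define p where "p = Suc k"
  have p: "0 < p" "1 / real p < d" "1 / real p < e / 4"
    using k by (auto simp: p_def inverse_eq_divide)
  define pt :: "(nat \<Rightarrow> nat) \<Rightarrow> nat \<Rightarrow> real" where "pt x i = real (x i) / real p" for x i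
  \<comment> \<open>Kuhn's labelling by the sign of \<open>g a i - a i\<close>. On two opposite
    faces the label is prescribed, which is consistent with the sign because \<open>g\<close> maps
    the cube into itself.\<close>
  define lab :: "(nat \<Rightarrow> nat) \<Rightarrow> nat \<Rightarrow> nat" where
    "lab x i = (if x i = 0 then 0 else if x i = p then 1 else if pt x i \<le> g (pt x) i then 0 else 1)" for x i
  have pt: "\<forall>i<n. 0 \<le> pt x i \<and> pt x i \<le> 1" if "\<forall>i<n. x i \<le> p" for x
    using that p by (auto simp: pt_def)
  have lab01: "lab x i = 0 \<or> lab x i = 1" for x i
    by (simp add: lab_def)
  have lab0: "pt x i \<le> g (pt x) i" if "\<forall>i<n. x i \<le> p" "i < n" "lab x i = 0" for x i
    using that maps[OF pt[OF that(1)] that(2)] p(1) by (cases "x i = 0") (auto simp: lab_def pt_def[of x i] split: if_splits)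
  have lab1: "g (pt x) i \<le> pt x i" if "\<forall>i<n. x i \<le> p" "i < n" "lab x i \<noteq> 0" for x i
    using that maps[OF pt[OF that(1)] that(2)] p(1) by (cases "x i = p") (auto simp: lab_def pt_def[of x i] split: if_splits)
  \<comment> \<open>In the small cube at \<open>q\<close> each coordinate carries both labels, so
    \<open>g a i - a i\<close> changes sign there; the mesh and the modulus of continuity then make
    it small at \<open>q\<close>.\<close>
  obtain q where q: "\<forall>i<n. q i < p"
    and qq: "\<forall>i<n. \<exists>r s. (\<forall>j<n. q j \<le> r j \<and> r j \<le> q j + 1) \<and> (\<forall>j<n. q j \<le> s j \<and> s j \<le> q j + 1) \<and> lab r i \<noteq> lab s i"
    by (rule kuhn_lemma[OF p(1), of n lab]) (use p in \<open>auto simp: lab_def\<close>)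
  have q': "\<forall>i<n. q i \<le> p"
    using q by auto
  have near: "\<bar>g (pt r) i - g (pt q) i\<bar> \<le> e / 4 \<and> \<bar>pt r i - pt q i\<bar> \<le> e / 4 \<and> (\<forall>i<n. r i \<le> p)"
    if r: "\<forall>j<n. q j \<le> r j \<and> r j \<le> q j + 1" and i: "i < n" for r i
  proof -
    have rp: "\<forall>i<n. r i \<le> p"
    proof (intro allI impI)
      fix i
      assume "i < n"
      then have "r i \<le> q i + 1" "q i < p"
        using r q by auto
      then show "r i \<le> p"
        by linarith
    qed
    have le: "\<bar>pt r j - pt q j\<bar> \<le> 1 / real p" if "j < n" for j
    proof -
      have "pt r j - pt q j = (real (r j) - real (q j)) / real p"
        by (simp add: pt_def diff_divide_distrib)
      moreover have "0 \<le> real (r j) - real (q j)" "real (r j) - real (q j) \<le> 1"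
        using spec[OF r, of j] that by linarith+
      ultimately show ?thesis
        using p by (auto simp: divide_right_mono)
    qed
    then have "\<forall>j<n. \<bar>pt r j - pt q j\<bar> \<le> d"
      using p by fastforce
    then show ?thesis
      using gd[OF pt[OF rp] pt[OF q'] _ i] le[OF i] p rp by (smt (verit))
  qed
  have "\<bar>g (pt q) i - pt q i\<bar> \<le> e" if i: "i < n" for i
  proof -
    obtain r s where r: "\<forall>j<n. q j \<le> r j \<and> r j \<le> q j + 1" and s: "\<forall>j<n. q j \<le> s j \<and> s j \<le> q j + 1"
      and ne: "lab r i \<noteq> lab s i"
      using qq i by blast
    have "(pt r i \<le> g (pt r) i \<and> g (pt s) i \<le> pt s i) \<or> (pt s i \<le> g (pt s) i \<and> g (pt r) i \<le> pt r i)"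
      using lab0[of r i] lab0[of s i] lab1[of r i] lab1[of s i] near[OF r i] near[OF s i] i ne lab01
      by metis
    then show ?thesis
      using near[OF r i] near[OF s i] by linarith
  qed
  then show ?thesis
    using pt[OF q'] by blast
qed

text \<open>Schauder's projection in coordinates: \<open>g a i\<close> are the weights of a
  partition of unity subordinate to a finite net, evaluated at the combination \<open>L a\<close>.
  The cube of coefficients is used instead of the convex hull of the net; the weights sum to 1
  although the coefficients \<open>a\<close> need not.\<close>

lemma totally_bounded_range_imp_approx_fixpoint:
  fixes f :: "'a::real_normed_vector \<Rightarrow> 'a"
  assumes cont: "continuous_on UNIV f"
    and tb: "\<And>e. 0 < e \<Longrightarrow> \<exists>k. finite k \<and> range f \<subseteq> (\<Union>x\<in>k. ball x e)"
    and e: "0 < e"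
  shows "\<exists>x. dist (f x) x \<le> e"
proof -
  obtain Y where Y: "finite Y" "range f \<subseteq> (\<Union>x\<in>Y. ball x (e / 2))"
    using tb[of "e / 2"] e by auto
  obtain y n where y: "Y = y ` {..<n::nat}"
    using finite_imp_nat_seg_image_inj_on[OF Y(1)] by (metis lessThan_def)
  define m where "m i x = max 0 (e / 2 - dist (f x) (y i))" for i x
  define S where "S x = (\<Sum>i<n. m i x)" for x
  have m0: "0 \<le> m i x" for i x
    by (simp add: m_def)
  have Spos: "0 < S x" for x
  proof -
    obtain i where "i < n" "dist (y i) (f x) < e / 2"
      using Y(2) y by (auto simp: ball_def image_subset_iff)
    then show ?thesis
      unfolding S_def by (intro sum_pos2[of _ i]) (auto simp: m_def dist_commute)
  qed
  have contm: "continuous_on UNIV (m i)" for i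
    unfolding m_def by (intro continuous_intros cont)
  define L where "L a = (\<Sum>i<n. a i *\<^sub>R y i)" for a :: "nat \<Rightarrow> real"
  define g where "g a i = m i (L a) / S (L a)" for a i
  define N where "N = (\<Sum>i<n. norm (y i)) + 1"
  have N: "0 < N"
    unfolding N_def by (intro add_nonneg_pos sum_nonneg) auto
  define K where "K = L ` {a. \<forall>i<n. 0 \<le> a i \<and> a i \<le> 1}"
  have "compact K"
  proof -
    \<comment> \<open>Coefficients with index at least \<open>n\<close> are set to 0, which makes
      the parameter set a compact product.\<close>
    have "compact (L ` (\<Pi>\<^sub>E i\<in>UNIV. if i < n then {0..1} else {0}))"
    proof (rule compact_continuous_image)
      show "continuous_on (\<Pi>\<^sub>E i\<in>UNIV. if i < n then {0..1} else {0}) L"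
        unfolding L_def by (intro continuous_intros continuous_on_subset[OF continuous_on_product_coordinates] subset_UNIV)
      have "compactin (product_topology (\<lambda>i. euclidean :: real topology) UNIV) (\<Pi>\<^sub>E i\<in>UNIV. if i < n then {0..1} else {0})"
        by (subst compactin_PiE) auto
      then show "compact (\<Pi>\<^sub>E i\<in>UNIV. if i < n then {0..1::real} else {0})"
        by (simp add: euclidean_product_topology)
    qed
    moreover have "L ` (\<Pi>\<^sub>E i\<in>UNIV. if i < n then {0..1} else {0}) = K"
    proof (rule set_eqI, rule iffI)
      fix x
      assume "x \<in> K"
      then obtain a where a: "\<forall>i<n. 0 \<le> a i \<and> a i \<le> 1" "x = L a"
        by (auto simp: K_def)
      then have "x = L (\<lambda>i. if i < n then a i else 0)"
        by (simp add: L_def)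
      then show "x \<in> L ` (\<Pi>\<^sub>E i\<in>UNIV. if i < n then {0..1} else {0})"
        using a by (intro image_eqI[of _ _ "\<lambda>i. if i < n then a i else 0"]) auto
    qed (auto simp: K_def PiE_iff split: if_splits)
    ultimately show ?thesis
      by simp
  qed
  have "\<exists>a. (\<forall>i<n. 0 \<le> a i \<and> a i \<le> 1) \<and> (\<forall>i<n. \<bar>g a i - a i\<bar> \<le> e / (2 * N))"
  proof (rule Brouwer_cube_approx)
    show "0 \<le> g a i \<and> g a i \<le> 1" if "i < n" for a i
      using Spos[of "L a"] m0 that by (auto simp: g_def S_def intro!: member_le_sum)
    show "0 < e / (2 * N)"
      using e N by simp
    fix \<epsilon> :: real
    assume \<epsilon>: "0 < \<epsilon>"
    have "\<exists>d>0. \<forall>x\<in>K. \<forall>x'\<in>K. dist x' x < d \<longrightarrow> (\<bar>m i x' / S x' - m i x / S x\<bar> \<le> \<epsilon>)" for i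
    proof -
      have "uniformly_continuous_on K (\<lambda>x. m i x / S x)"
        using Spos unfolding S_def
        by (intro compact_uniformly_continuous[OF _ \<open>compact K\<close>] continuous_intros
            continuous_on_subset[OF contm]) (auto simp: less_imp_neq[symmetric])
      then show ?thesis
        using \<epsilon> unfolding uniformly_continuous_on_def dist_real_def by (metis less_imp_le)
    qed
    then obtain d where d: "\<And>i. 0 < d i"
      "\<And>i x x'. x \<in> K \<Longrightarrow> x' \<in> K \<Longrightarrow> dist x' x < d i \<Longrightarrow> \<bar>m i x' / S x' - m i x / S x\<bar> \<le> \<epsilon>"
      by metis
    define D where "D = Min (insert 1 (d ` {..<n}))"
    have D: "0 < D" "\<And>i. i < n \<Longrightarrow> D \<le> d i"
      using d(1) by (auto simp: D_def)
    show "\<exists>d>0. \<forall>a b. (\<forall>i<n. 0 \<le> a i \<and> a i \<le> 1) \<longrightarrow> (\<forall>i<n. 0 \<le> b i \<and> b i \<le> 1) \<longrightarrow>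
      (\<forall>i<n. \<bar>a i - b i\<bar> \<le> d) \<longrightarrow> (\<forall>i<n. \<bar>g a i - g b i\<bar> \<le> \<epsilon>)"
    proof (intro exI[of _ "D / (2 * N)"] conjI allI impI)
      show "0 < D / (2 * N)"
        using D N by simp
      fix a b :: "nat \<Rightarrow> real" and i
      assume ab: "\<forall>i<n. 0 \<le> a i \<and> a i \<le> 1" "\<forall>i<n. 0 \<le> b i \<and> b i \<le> 1"
        and le: "\<forall>i<n. \<bar>a i - b i\<bar> \<le> D / (2 * N)" and i: "i < n"
      have "dist (L a) (L b) = norm (\<Sum>i<n. (a i - b i) *\<^sub>R y i)"
        by (simp add: L_def dist_norm sum_subtractf scaleR_diff_left)
      also have "\<dots> \<le> (\<Sum>i<n. D / (2 * N) * norm (y i))"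
        by (rule sum_norm_le) (unfold norm_scaleR, rule mult_right_mono, use le in auto)
      also have "\<dots> = D / (2 * N) * (N - 1)"
        by (simp add: N_def sum_distrib_left)
      also have "\<dots> < D"
        using D N by (simp add: field_simps) (smt (verit) mult_pos_pos)
      finally have "dist (L a) (L b) < d i"
        using D(2)[OF i] by simp
      then show "\<bar>g a i - g b i\<bar> \<le> \<epsilon>"
        unfolding g_def using ab by (intro d(2)) (auto simp: K_def)
    qed
  qed
  then obtain a where a: "\<forall>i<n. \<bar>g a i - a i\<bar> \<le> e / (2 * N)"
    by blast
  let ?x = "L a"
  have sumg: "(\<Sum>i<n. g a i) = 1"
    using Spos[of ?x] by (simp add: g_def S_def flip: sum_divide_distrib)
  have g0: "0 \<le> g a i" for i
    using Spos[of ?x] m0 by (simp add: g_def)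
  have "f ?x - (\<Sum>i<n. g a i *\<^sub>R y i) = (\<Sum>i<n. g a i *\<^sub>R (f ?x - y i))"
    by (simp add: scaleR_diff_right sum_subtractf sumg flip: scaleR_sum_left)
  also have "norm \<dots> \<le> (\<Sum>i<n. g a i * (e / 2))"
  proof (rule sum_norm_le)
    fix i
    assume "i \<in> {..<n}"
    show "norm (g a i *\<^sub>R (f ?x - y i)) \<le> g a i * (e / 2)"
    proof (cases "g a i = 0")
      case False
      then have "m i ?x \<noteq> 0"
        by (auto simp: g_def)
      then have "norm (f ?x - y i) \<le> e / 2"
        by (auto simp: m_def dist_norm max_def split: if_splits)
      then show ?thesis
        using g0[of i] unfolding norm_scaleR by (simp only: abs_of_nonneg mult_left_mono)
    qed simp
  qed
  also have "\<dots> = (\<Sum>i<n. g a i) * (e / 2)"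
    by (rule sum_distrib_right[symmetric])
  also have "\<dots> = e / 2"
    by (simp add: sumg)
  finally have 1: "norm (f ?x - (\<Sum>i<n. g a i *\<^sub>R y i)) \<le> e / 2" .
  have "(\<Sum>i<n. g a i *\<^sub>R y i) - ?x = (\<Sum>i<n. (g a i - a i) *\<^sub>R y i)"
    by (simp add: L_def sum_subtractf scaleR_diff_left)
  also have "norm \<dots> \<le> (\<Sum>i<n. e / (2 * N) * norm (y i))"
    by (rule sum_norm_le) (unfold norm_scaleR, rule mult_right_mono, use a in auto)
  also have "\<dots> = e / (2 * N) * (N - 1)"
    by (simp add: N_def sum_distrib_left)
  also have "\<dots> \<le> e / 2"
    using e N by (simp add: field_simps)
  finally have "norm (f ?x - ?x) \<le> e / 2 + e / 2"
    using 1 by norm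
  then show ?thesis
    by (auto simp: dist_norm)
qed

text \<open>Total boundedness of the range takes the place of an invariant compact convex set. A
  cluster point of the images of \<open>1 / Suc n\<close>-fixed points is fixed by
  continuity.\<close>

theorem Schauder_fixpoint:
  fixes f :: "'a::banach \<Rightarrow> 'a"
  assumes cont: "continuous_on UNIV f"
    and tb: "\<And>e. 0 < e \<Longrightarrow> \<exists>k. finite k \<and> range f \<subseteq> (\<Union>x\<in>k. ball x e)"
  shows "\<exists>x. f x = x"
proof -
  have "compact (closure (range f))"
    unfolding compact_eq_totally_bounded
  proof (intro conjI allI impI)
    show "complete (closure (range f))"
      by (simp add: complete_eq_closed)
    fix e :: real
    assume "0 < e"
    then obtain k where k: "finite k" "range f \<subseteq> (\<Union>x\<in>k. ball x (e / 2))"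
      using tb[of "e / 2"] by auto
    have "closure (range f) \<subseteq> (\<Union>x\<in>k. cball x (e / 2))"
    proof (rule closure_minimal)
      show "range f \<subseteq> (\<Union>x\<in>k. cball x (e / 2))"
        using k(2) by (auto simp: subset_iff intro: less_imp_le)
      show "closed (\<Union>x\<in>k. cball x (e / 2))"
        using k(1) by (intro closed_UN) auto
    qed
    also have "\<dots> \<subseteq> (\<Union>x\<in>k. ball x e)"
      using \<open>0 < e\<close> by auto
    finally show "\<exists>k. finite k \<and> closure (range f) \<subseteq> (\<Union>x\<in>k. ball x e)"
      using k(1) by blast
  qed
  have "\<exists>x. dist (f x) x \<le> 1 / Suc n" for n
    by (rule totally_bounded_range_imp_approx_fixpoint[OF cont tb]) auto
  then obtain x where x: "\<And>n. dist (f (x n)) (x n) \<le> 1 / Suc n"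
    by metis
  obtain l r where l: "strict_mono r" "((\<lambda>n. f (x n)) \<circ> r) \<longlonglongrightarrow> l"
    using \<open>compact (closure (range f))\<close> closure_subset[of "range f"]
    unfolding compact_def by (metis (no_types, lifting) rangeI subset_iff)
  have "(\<lambda>n. 1 / real (Suc (r n))) \<longlonglongrightarrow> 0"
    using LIMSEQ_subseq_LIMSEQ[OF lim_1_over_n l(1)] LIMSEQ_subseq_LIMSEQ[OF LIMSEQ_Suc[OF lim_1_over_n] l(1)]
    by (simp add: o_def)
  then have "(\<lambda>n. dist (f (x (r n))) (x (r n))) \<longlonglongrightarrow> 0"
    by (rule Lim_null_comparison[rotated]) (use x in auto)
  then have "(\<lambda>n. f (x (r n)) - x (r n)) \<longlonglongrightarrow> 0"
    unfolding dist_norm by (rule tendsto_norm_zero_cancel)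
  moreover have "(\<lambda>n. f (x (r n))) \<longlonglongrightarrow> l"
    using l(2) by (simp add: o_def)
  ultimately have "(\<lambda>n. x (r n)) \<longlonglongrightarrow> l"
    using tendsto_diff[of "\<lambda>n. f (x (r n))" l sequentially "\<lambda>n. f (x (r n)) - x (r n)" 0] by simp
  then have "(\<lambda>n. f (x (r n))) \<longlonglongrightarrow> f l"
    using cont by (auto simp: continuous_on_eq_continuous_at intro: isCont_tendsto_compose)
  then show ?thesis
    using l(2) LIMSEQ_unique by (auto simp: o_def)
qed

section \<open>Scalar Laplace inversion along two rays\<close>

lemma set_integrable_inverse_square_bound:
  fixes f :: "real \<Rightarrow> 'a::{banach, second_countable_topology}"
  assumes cont: "continuous_on {0..} f" and le: "\<And>x. 0 \<le> x \<Longrightarrow> norm (f x) \<le> K / (1 + x)\<^sup>2"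
  shows "set_integrable lborel {0..} f"
proof -
  have "(\<integral>\<^sup>+x. ennreal (1 / (1 + x)\<^sup>2) * indicator {0 ..} x \<partial>lborel) = ennreal (0 - (- (1 / (1 + 0))))"
  proof (rule nn_integral_FTC_atLeast[where F = "\<lambda>x. - (1 / (1 + x))"])
    fix x :: real
    assume "0 \<le> x"
    then show "((\<lambda>x. - (1 / (1 + x))) has_field_derivative 1 / (1 + x)\<^sup>2) (at x)"
      by (auto intro!: derivative_eq_intros simp: power2_eq_square)
  next
    show "((\<lambda>x::real. - (1 / (1 + x))) \<longlongrightarrow> 0) at_top"
      by real_asymp
  qed auto
  also have "(\<integral>\<^sup>+x. ennreal (1 / (1 + x)\<^sup>2) * indicator {0 ..} x \<partial>lborel)
    = (\<integral>\<^sup>+x. ennreal (indicator {0..} x *\<^sub>R (1 / (1 + x)\<^sup>2)) \<partial>lborel)"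
    by (intro nn_integral_cong) (auto simp: indicator_def)
  finally have "integrable lborel (\<lambda>x::real. indicator {0..} x *\<^sub>R (1 / (1 + x)\<^sup>2))"
    by (intro integrableI_nn_integral_finite) auto
  then have "set_integrable lborel {0..} (\<lambda>x::real. \<bar>K\<bar> * (1 / (1 + x)\<^sup>2))"
    by (intro set_integrable_mult_right) (simp add: set_integrable_def)
  then show ?thesis
  proof (rule set_integrable_bound)
    show "set_borel_measurable lborel {0..} f"
      unfolding set_borel_measurable_def using borel_measurable_continuous_on_indicator[OF _ cont] by simp
    show "AE x in lborel. x \<in> {0..} \<longrightarrow> norm (f x) \<le> norm (\<bar>K\<bar> * (1 / (1 + x)\<^sup>2))"
    proof (intro AE_I2 impI)
      fix x :: real
      assume "x \<in> {0..}"
      then have "norm (f x) \<le> K / (1 + x)\<^sup>2"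
        using le by simp
      also have "\<dots> \<le> \<bar>K\<bar> * (1 / (1 + x)\<^sup>2)"
        by (simp add: divide_right_mono)
      finally show "norm (f x) \<le> norm (\<bar>K\<bar> * (1 / (1 + x)\<^sup>2))"
        by simp
    qed
  qed
qed

lemma tendsto_set_integral_Icc_at_top:
  fixes f :: "real \<Rightarrow> 'a::{banach, second_countable_topology}"
  assumes "set_integrable lborel {0..} f"
  shows "((\<lambda>y. LINT x:{0..y}|lborel. f x) \<longlongrightarrow> (LINT x:{0..}|lborel. f x)) at_top"
proof -
  have eq: "indicator {..y} x *\<^sub>R indicator {0..} x *\<^sub>R f x = indicator {0..y} x *\<^sub>R f x" for x y
    by (auto simp: indicator_def)
  show ?thesis
    using tendsto_integral_at_top[of lborel "\<lambda>x. indicator {0..} x *\<^sub>R f x"] assms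
    by (simp only: eq set_integrable_def set_lebesgue_integral_def sets_lborel)
qed

lemma set_integral_FTC_atLeast:
  fixes f :: "real \<Rightarrow> 'a::euclidean_space"
  assumes F: "\<And>x. 0 \<le> x \<Longrightarrow> (F has_vector_derivative f x) (at x within {0..})"
    and cont: "continuous_on {0..} f" and int: "set_integrable lborel {0..} f"
    and lim: "(F \<longlongrightarrow> L) at_top"
  shows "(LINT x:{0..}|lborel. f x) = L - F 0"
proof -
  have "(LINT x:{0..y}|lborel. f x) = F y - F 0" if "0 \<le> y" for y
    unfolding set_lebesgue_integral_def
    by (rule integral_FTC_Icc[OF that])
      (auto intro: has_vector_derivative_within_subset[OF F] continuous_on_subset[OF cont])
  then have "((\<lambda>y. LINT x:{0..y}|lborel. f x) \<longlongrightarrow> L - F 0) at_top"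
    by (intro Lim_transform_eventually[OF tendsto_diff[OF lim tendsto_const]])
      (auto intro: eventually_mono[OF eventually_ge_at_top[of 0]])
  then show ?thesis
    using tendsto_set_integral_Icc_at_top[OF int] tendsto_unique trivial_limit_at_top_linorder by blast
qed

section \<open>Rays, wedge and Cauchy's theorem on triangles\<close>

definition ray :: "real \<Rightarrow> complex \<Rightarrow> real \<Rightarrow> complex"
  where "ray a d \<rho> = of_real a + of_real \<rho> * d"

text \<open>The closed region to the right of the two rays from \<open>a\<close> with directions
  \<open>- c + \<i>\<close> and \<open>- c - \<i>\<close>. These directions are not normalised: the
  parameter of a ray is the absolute imaginary part, and the exponential decays along it at rate
  \<open>c * t\<close>.\<close>

definition wedge :: "real \<Rightarrow> real \<Rightarrow> complex set"
  where "wedge a c = {z. a - c * \<bar>Im z\<bar> \<le> Re z}"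

lemma continuous_on_ray [continuous_intros]: "continuous_on S (ray a d)"
  unfolding ray_def by (intro continuous_intros)

lemma convex_halfplane: "convex {z. r \<le> Re z + s * Im z}"
proof -
  have "linear (\<lambda>z. Re z + s * Im z)"
    by (rule linearI) (auto simp: algebra_simps)
  then have "convex ((\<lambda>z. Re z + s * Im z) -` {r..})"
    by (rule convex_linear_vimage) simp
  then show ?thesis
    by (simp add: vimage_def)
qed

context
  fixes a c :: real
  assumes a: "0 < a" and c: "0 < c" "c \<le> 1"
begin

lemma wedge_norm_ge: "z \<in> wedge a c \<Longrightarrow> a / 2 \<le> cmod z"
proof -
  assume "z \<in> wedge a c"
  then have "a \<le> Re z + c * \<bar>Im z\<bar>"
    by (simp add: wedge_def)
  also have "\<dots> \<le> cmod z + 1 * cmod z"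
    using c abs_Im_le_cmod[of z] complex_Re_le_cmod[of z] by (intro add_mono mult_mono) auto
  finally show ?thesis
    by simp
qed

lemma zero_notin_wedge: "0 \<notin> wedge a c"
  using a by (simp add: wedge_def)

lemma closed_wedge: "closed (wedge a c)"
  unfolding wedge_def by (intro closed_Collect_le continuous_intros)

context
  fixes d :: complex
  assumes d: "Re d = - c" "\<bar>Im d\<bar> = 1"
begin

lemma ray_in_wedge: "0 \<le> \<rho> \<Longrightarrow> ray a d \<rho> \<in> wedge a c"
  using d by (simp add: ray_def wedge_def abs_mult)

lemma Re_ray: "Re (ray a d \<rho>) = a - c * \<rho>"
  using d by (simp add: ray_def)

lemma norm_ray_ge: "0 \<le> \<rho> \<Longrightarrow> min a 2 / 4 * (1 + \<rho>) \<le> cmod (ray a d \<rho>)"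
proof -
  assume \<rho>: "0 \<le> \<rho>"
  have "\<rho> = \<bar>Im (ray a d \<rho>)\<bar>"
    using d \<rho> by (simp add: ray_def abs_mult)
  then have "\<rho> \<le> cmod (ray a d \<rho>)"
    using abs_Im_le_cmod by metis
  moreover have "a / 2 \<le> cmod (ray a d \<rho>)"
    by (rule wedge_norm_ge[OF ray_in_wedge[OF \<rho>]])
  moreover have "min a 2 / 4 * (1 + \<rho>) \<le> a / 4 + \<rho> / 2"
  proof -
    have "min a 2 / 4 * \<rho> \<le> 2 / 4 * \<rho>"
      using \<rho> by (intro mult_right_mono) auto
    moreover have "min a 2 / 4 \<le> a / 4"
      by simp
    ultimately show ?thesis
      unfolding distrib_left by argo
  qed
  ultimately show ?thesis
    by argo
qed

lemma norm_ray_diff_ge: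
  assumes "a < l" "0 \<le> \<rho>"
  shows "min (l - a) c * (1 + \<rho>) \<le> cmod (of_real l - ray a d \<rho>)"
proof -
  have "min (l - a) c * \<rho> \<le> c * \<rho>"
    using assms by (intro mult_right_mono) auto
  then have "min (l - a) c * (1 + \<rho>) \<le> l - Re (ray a d \<rho>)"
    by (simp add: distrib_left Re_ray)
  also have "\<dots> = Re (of_real l - ray a d \<rho>)"
    by simp
  also have "\<dots> \<le> cmod (of_real l - ray a d \<rho>)"
    by (rule complex_Re_le_cmod)
  finally show ?thesis .
qed

text \<open>The wedge is not convex, but it contains the half plane bounded by the line of the ray,
  and all three vertices lie in this half plane.\<close>

lemma triangle_subset_wedge:
  assumes "0 \<le> R"
  shows "convex hull {of_real a, of_real (a + R), ray a d R} \<subseteq> wedge a c"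
proof -
  let ?H = "{z. 0 \<le> Re z + (c + 1) * (Im d * Im z) - (Re z + c * (Im d * Im z))}"
  have "convex hull {of_real a, of_real (a + R), ray a d R} \<subseteq> {z. a \<le> Re z + (c * Im d) * Im z}"
    using d assms c a by (intro hull_minimal convex_halfplane) (auto simp: ray_def abs_if split: if_splits)
  also have "\<dots> \<subseteq> wedge a c"
  proof
    fix z
    assume "z \<in> {z. a \<le> Re z + (c * Im d) * Im z}"
    moreover have "c * (Im d * Im z) \<le> c * \<bar>Im z\<bar>"
      using d c by (intro mult_left_mono) (auto simp: abs_if split: if_splits)
    ultimately show "z \<in> wedge a c"
      by (simp add: wedge_def mult.assoc)
  qed
  finally show ?thesis .
qed

text \<open>On the first third of the side the real part is large, on the rest the imaginary part;
  both give the distance \<open>R / 3\<close> from \<open>a\<close>, and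
  \<open>6 * a \<le> R\<close> pays for the return to the origin.\<close>

lemma far_side_norm_ge:
  assumes R: "6 * a \<le> R" and x: "x \<in> closed_segment (of_real (a + R)) (ray a d R)"
  shows "R / 6 \<le> cmod x"
proof -
  obtain u where u: "0 \<le> u" "u \<le> 1" and "x = (1 - u) *\<^sub>R of_real (a + R) + u *\<^sub>R ray a d R"
    using x by (auto simp: closed_segment_def)
  then have xe: "x = (1 - u) *\<^sub>R of_real (a + R) + u *\<^sub>R ray a d R"
    by simp
  have Re: "Re x - a = R * (1 - u - c * u)" and Im: "Im x = R * (u * Im d)"
    unfolding xe using d by (simp_all add: ray_def algebra_simps)
  have "R / 3 \<le> cmod (x - of_real a)"
  proof (cases "u \<ge> 1 / 3")
    case True
    then have "R * (1 / 3) \<le> R * u"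
      using R a by (intro mult_left_mono) auto
    also have "\<dots> = \<bar>Im (x - of_real a)\<bar>"
      using d u R a by (simp add: Im abs_mult)
    also have "\<dots> \<le> cmod (x - of_real a)"
      by (rule abs_Im_le_cmod)
    finally show ?thesis by simp
  next
    case False
    have "c * u \<le> 1 * u"
      using c u by (intro mult_right_mono) auto
    then have "R * (1 / 3) \<le> R * (1 - u - c * u)"
      using R a False by (intro mult_left_mono) auto
    also have "\<dots> = Re (x - of_real a)"
      using Re by simp
    also have "\<dots> \<le> cmod (x - of_real a)"
      by (rule complex_Re_le_cmod)
    finally show ?thesis by simp
  qed
  also have "\<dots> \<le> cmod x + a"
    using norm_triangle_ineq4[of x "of_real a"] a by simp
  finally show ?thesis
    using R by linarith
qed

lemma contour_integral_ray_segment: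
  assumes q: "continuous_on (wedge a c) q" and R: "0 < R"
  shows "contour_integral (linepath (of_real a) (ray a d R)) q = (LINT \<rho>:{0..R}|lborel. q (ray a d \<rho>) * d)"
proof -
  let ?G = "\<lambda>\<rho>. q (ray a d \<rho>) * d"
  have "continuous_on {0..R} ?G"
    using ray_in_wedge by (intro continuous_intros continuous_on_compose2[OF q]) auto
  then have "set_integrable lborel {0..R} ?G"
    unfolding set_integrable_def by (intro borel_integrable_compact) auto
  then have "(?G has_integral (LINT \<rho>:{0..R}|lborel. ?G \<rho>)) {0..R}"
    using set_borel_integral_eq_integral[of "{0..R}" ?G] has_integral_integral by metis
  then have "((\<lambda>x. ?G (R * x)) has_integral (1 / \<bar>R\<bar>) *\<^sub>R (LINT \<rho>:{0..R}|lborel. ?G \<rho>)) ((\<lambda>x. x / R) ` {0..R})"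
    using R by (intro has_integral_stretch_real) auto
  moreover have "(\<lambda>x. x / R) ` {0..R} = {0..1}"
    using R by (auto simp: image_iff field_simps intro!: bexI[of _ "R * _"])
  ultimately have "((\<lambda>x. R *\<^sub>R ?G (R * x)) has_integral R *\<^sub>R ((1 / \<bar>R\<bar>) *\<^sub>R (LINT \<rho>:{0..R}|lborel. ?G \<rho>))) {0..1}"
    by (intro has_integral_cmul) simp
  moreover have "R *\<^sub>R ((1 / \<bar>R\<bar>) *\<^sub>R (LINT \<rho>:{0..R}|lborel. ?G \<rho>)) = (LINT \<rho>:{0..R}|lborel. ?G \<rho>)"
    using R by simp
  moreover have "R *\<^sub>R ?G (R * x) = q (linepath (of_real a) (ray a d R) x) * (ray a d R - of_real a)" for x
  proof -
    have "linepath (of_real a) (ray a d R) x = ray a d (R * x)"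
      by (simp add: linepath_def ray_def scaleR_conv_of_real algebra_simps)
    then show ?thesis
      by (simp add: ray_def scaleR_conv_of_real)
  qed
  ultimately have "(q has_contour_integral (LINT \<rho>:{0..R}|lborel. ?G \<rho>)) (linepath (of_real a) (ray a d R))"
    by (simp add: has_contour_integral_linepath)
  then show ?thesis
    by (rule contour_integral_unique)
qed

text \<open>Cauchy's theorem on the triangle with vertices \<open>a\<close>, \<open>a + R\<close>
  and the end of the ray. The far side has length at most \<open>3 * R\<close> and the integrand
  there is at most \<open>C / (R / 6)\<^sup>2\<close>, whence 108.\<close>

lemma ray_integral_eq_real_segment:
  assumes hol: "q holomorphic_on U" and U: "wedge a c \<subseteq> U" and C: "0 \<le> C"
    and le: "\<And>z. z \<in> wedge a c \<Longrightarrow> cmod (q z) \<le> C / (cmod z)\<^sup>2" and R: "6 * a \<le> R"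
  shows "cmod ((LINT \<rho>:{0..R}|lborel. q (ray a d \<rho>) * d)
    - contour_integral (linepath (of_real a) (of_real (a + R))) q) \<le> 108 * C / R"
proof -
  have R0: "0 < R"
    using R a by simp
  let ?A = "of_real a" and ?B = "of_real (a + R)" and ?D = "ray a d R"
  have sub: "convex hull {?A, ?B, ?D} \<subseteq> wedge a c"
    using triangle_subset_wedge R0 by simp
  have contq: "continuous_on (wedge a c) q"
    using holomorphic_on_imp_continuous_on[OF holomorphic_on_subset[OF hol U]] .
  have zero: "contour_integral (linepath ?A ?B) q + contour_integral (linepath ?B ?D) q + contour_integral (linepath ?D ?A) q = 0"
    by (rule has_chain_integral_chain_integral3[OF Cauchy_theorem_triangle])
      (rule holomorphic_on_subset[OF hol], use sub U in auto)
  have "convex hull {?B, ?D} \<subseteq> convex hull {?A, ?B, ?D}" "convex hull {?A, ?D} \<subseteq> convex hull {?A, ?B, ?D}"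
    by (rule hull_mono, blast)+
  then have seg: "closed_segment ?B ?D \<subseteq> wedge a c" "closed_segment ?A ?D \<subseteq> wedge a c"
    unfolding segment_convex_hull using sub by (meson order_trans)+
  have "contour_integral (linepath ?D ?A) q = - contour_integral (linepath ?A ?D) q"
    using contour_integral_reverse_linepath[of ?A ?D q] continuous_on_subset[OF contq seg(2)] by simp
  then have eq: "(LINT \<rho>:{0..R}|lborel. q (ray a d \<rho>) * d) - contour_integral (linepath ?A ?B) q
    = contour_integral (linepath ?B ?D) q"
    using zero contour_integral_ray_segment[OF contq R0] by (simp add: algebra_simps)
  have "cmod (contour_integral (linepath ?B ?D) q) \<le> (C / (R / 6)\<^sup>2) * cmod (?D - ?B)"
  proof (rule contour_integral_bound_linepath)
    show "q contour_integrable_on linepath ?B ?D"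
      by (rule contour_integrable_continuous_linepath[OF continuous_on_subset[OF contq seg(1)]])
    fix x
    assume x: "x \<in> closed_segment ?B ?D"
    have "cmod (q x) \<le> C / (cmod x)\<^sup>2"
      using le x seg by blast
    also have "\<dots> \<le> C / (R / 6)\<^sup>2"
      using far_side_norm_ge[OF R x] C R0 by (intro divide_left_mono power_mono mult_pos_pos) (auto simp: zero_less_power2)
    finally show "cmod (q x) \<le> C / (R / 6)\<^sup>2" .
  qed (use C in simp)
  also have "\<dots> \<le> C / (R / 6)\<^sup>2 * (3 * R)"
  proof (rule mult_left_mono)
    have "?D - ?B = of_real R * (d - 1)"
      by (simp add: ray_def algebra_simps)
    moreover have "cmod (d - 1) \<le> 3"
      using cmod_le[of "d - 1"] d c by (simp add: abs_if split: if_splits)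
    ultimately show "cmod (?D - ?B) \<le> 3 * R"
      using R0 by (simp add: norm_mult)
  qed (use C in simp)
  also have "\<dots> = 108 * C / R"
    using R0 by (simp add: power2_eq_square)
  finally show ?thesis
    unfolding eq .
qed

lemma set_integrable_ray:
  fixes g :: "real \<Rightarrow> 'a::{banach, second_countable_topology}"
  assumes cont: "continuous_on {0..} g" and C: "0 \<le> C"
    and le: "\<And>\<rho>. 0 \<le> \<rho> \<Longrightarrow> norm (g \<rho>) \<le> C / (cmod (ray a d \<rho>))\<^sup>2"
  shows "set_integrable lborel {0..} g"
proof (rule set_integrable_inverse_square_bound[OF cont])
  fix \<rho> :: real
  assume \<rho>: "0 \<le> \<rho>"
  have pos: "0 < min a 2 / 4"
    using a by simp
  have "norm (g \<rho>) \<le> C / (cmod (ray a d \<rho>))\<^sup>2"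
    by (rule le[OF \<rho>])
  also have "\<dots> \<le> C / (min a 2 / 4 * (1 + \<rho>))\<^sup>2"
  proof (intro divide_left_mono power_mono mult_pos_pos zero_less_power C norm_ray_ge \<rho> pos)
    show "0 < cmod (ray a d \<rho>)"
    proof -
      have "0 < min a 2 / 4 * (1 + \<rho>)"
        using pos \<rho> by (intro mult_pos_pos) auto
      then show ?thesis
        using norm_ray_ge[OF \<rho>] by linarith
    qed
  qed (use pos \<rho> in auto)
  also have "\<dots> = C / (min a 2 / 4)\<^sup>2 / (1 + \<rho>)\<^sup>2"
    by (simp add: power_mult_distrib power_divide)
  finally show "norm (g \<rho>) \<le> C / (min a 2 / 4)\<^sup>2 / (1 + \<rho>)\<^sup>2" .
qed

end

text \<open>Both rays are compared with the same real segment from \<open>a\<close> to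
  \<open>a + R\<close>, so their truncated integrals differ by a term of order
  \<open>1 / R\<close>.\<close>

lemma contour_integral_two_rays:
  assumes hol: "q holomorphic_on U" and U: "wedge a c \<subseteq> U" and C: "0 \<le> C"
    and le: "\<And>z. z \<in> wedge a c \<Longrightarrow> cmod (q z) \<le> C / (cmod z)\<^sup>2"
    and d: "d = Complex (- c) 1" "d' = Complex (- c) (- 1)"
  shows "(LINT \<rho>:{0..}|lborel. q (ray a d \<rho>) * d) = (LINT \<rho>:{0..}|lborel. q (ray a d' \<rho>) * d')"
proof -
  have contq: "continuous_on (wedge a c) q"
    using holomorphic_on_imp_continuous_on[OF holomorphic_on_subset[OF hol U]] .
  have lim: "((\<lambda>R. LINT \<rho>:{0..R}|lborel. q (ray a e \<rho>) * e) \<longlongrightarrow> (LINT \<rho>:{0..}|lborel. q (ray a e \<rho>) * e)) at_top"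
    if e: "Re e = - c" "\<bar>Im e\<bar> = 1" for e
  proof (rule tendsto_set_integral_Icc_at_top, rule set_integrable_ray[OF e])
    show "continuous_on {0..} (\<lambda>\<rho>. q (ray a e \<rho>) * e)"
      using ray_in_wedge[OF e] by (intro continuous_intros continuous_on_compose2[OF contq]) auto
    show "0 \<le> C * cmod e"
      using C by simp
    show "cmod (q (ray a e \<rho>) * e) \<le> C * cmod e / (cmod (ray a e \<rho>))\<^sup>2" if "0 \<le> \<rho>" for \<rho>
      using mult_right_mono[OF le[OF ray_in_wedge[OF e that]], of "cmod e"] by (simp add: norm_mult)
  qed
  have dd: "Re d = - c" "\<bar>Im d\<bar> = 1" "Re d' = - c" "\<bar>Im d'\<bar> = 1"
    using d by auto
  have "((\<lambda>R. (LINT \<rho>:{0..R}|lborel. q (ray a d \<rho>) * d) - (LINT \<rho>:{0..R}|lborel. q (ray a d' \<rho>) * d')) \<longlongrightarrow> 0) at_top"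
  proof (rule Lim_null_comparison)
    show "((\<lambda>R. 216 * C / R) \<longlongrightarrow> 0) at_top"
      by real_asymp
    show "\<forall>\<^sub>F R in at_top. norm ((LINT \<rho>:{0..R}|lborel. q (ray a d \<rho>) * d) - (LINT \<rho>:{0..R}|lborel. q (ray a d' \<rho>) * d')) \<le> 216 * C / R"
      using eventually_ge_at_top[of "6 * a"]
    proof eventually_elim
      case (elim R)
      let ?I = "contour_integral (linepath (of_real a) (of_real (a + R))) q"
      have "cmod ((LINT \<rho>:{0..R}|lborel. q (ray a d \<rho>) * d) - ?I) \<le> 108 * C / R"
        "cmod ((LINT \<rho>:{0..R}|lborel. q (ray a d' \<rho>) * d') - ?I) \<le> 108 * C / R"
        using ray_integral_eq_real_segment[OF dd(1,2) hol U C le elim] ray_integral_eq_real_segment[OF dd(3,4) hol U C le elim]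
        by auto
      then show ?case
        using norm_triangle_ineq4[of "(LINT \<rho>:{0..R}|lborel. q (ray a d \<rho>) * d) - ?I" "(LINT \<rho>:{0..R}|lborel. q (ray a d' \<rho>) * d') - ?I"]
        by simp
    qed
  qed
  moreover have "((\<lambda>R. (LINT \<rho>:{0..R}|lborel. q (ray a d \<rho>) * d) - (LINT \<rho>:{0..R}|lborel. q (ray a d' \<rho>) * d'))
    \<longlongrightarrow> (LINT \<rho>:{0..}|lborel. q (ray a d \<rho>) * d) - (LINT \<rho>:{0..}|lborel. q (ray a d' \<rho>) * d')) at_top"
    by (intro tendsto_diff lim dd)
  ultimately show ?thesis
    using tendsto_unique[OF trivial_limit_at_top_linorder] by fastforce
qed

section \<open>The Cauchy kernel along the two rays\<close>

lemma ray_ne_real: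
  assumes "Re d = - c" "\<bar>Im d\<bar> = 1" "a < l" "0 \<le> \<rho>"
  shows "ray a d \<rho> \<noteq> of_real l"
proof
  assume "ray a d \<rho> = of_real l"
  then have "a - c * \<rho> = l"
    using Re_ray[OF assms(1,2)] by (metis Re_complex_of_real)
  then show False
    using assms c by (smt (verit) mult_nonneg_nonneg)
qed

lemma ray_ne_zero:
  assumes "Re d = - c" "\<bar>Im d\<bar> = 1" "0 \<le> \<rho>"
  shows "ray a d \<rho> \<noteq> 0"
  using ray_in_wedge[OF assms] zero_notin_wedge by metis

lemma continuous_on_ray_kernel:
  assumes "Re d = - c" "\<bar>Im d\<bar> = 1" "a < l" and h: "continuous_on (wedge a c) h"
  shows "continuous_on {0..} (\<lambda>\<rho>. h (ray a d \<rho>) * d / (of_real l - ray a d \<rho>))"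
  using ray_in_wedge[OF assms(1,2)] ray_ne_real[OF assms(1-3)]
  by (intro continuous_intros continuous_on_compose2[OF h]) (auto simp: eq_commute[of "of_real l"])

lemma set_integrable_ray_kernel:
  assumes d: "Re d = - c" "\<bar>Im d\<bar> = 1" and l: "a < l" and h: "continuous_on (wedge a c) h" and C: "0 \<le> C"
    and le: "\<And>z. z \<in> wedge a c \<Longrightarrow> cmod (h z) \<le> C / cmod z"
  shows "set_integrable lborel {0..} (\<lambda>\<rho>. h (ray a d \<rho>) * d / (of_real l - ray a d \<rho>))"
proof (rule set_integrable_inverse_square_bound[OF continuous_on_ray_kernel[OF d l h]])
  fix \<rho> :: real
  assume \<rho>: "0 \<le> \<rho>"
  define m where "m = min a 2 / 4"
  define m' where "m' = min (l - a) c"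
  have m: "0 < m" "0 < m'"
    using a c l by (auto simp: m_def m'_def)
  have n: "m * (1 + \<rho>) \<le> cmod (ray a d \<rho>)" "m' * (1 + \<rho>) \<le> cmod (of_real l - ray a d \<rho>)"
    using norm_ray_ge[OF d \<rho>] norm_ray_diff_ge[OF d l \<rho>] by (auto simp: m_def m'_def)
  have pos: "0 < m * (1 + \<rho>)" "0 < m' * (1 + \<rho>)"
    using m \<rho> by auto
  have "cmod (h (ray a d \<rho>)) \<le> C / (m * (1 + \<rho>))"
    using le[OF ray_in_wedge[OF d \<rho>]] n(1) pos(1) C
    by (meson divide_left_mono mult_pos_pos order_less_le_trans order_trans)
  then have "cmod (h (ray a d \<rho>)) * cmod d / cmod (of_real l - ray a d \<rho>) \<le> C / (m * (1 + \<rho>)) * cmod d / (m' * (1 + \<rho>))"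
    using n(2) pos C by (intro frac_le mult_right_mono) auto
  also have "\<dots> = C * cmod d / (m * m') / (1 + \<rho>)\<^sup>2"
    by (simp add: power2_eq_square)
  finally show "cmod (h (ray a d \<rho>) * d / (of_real l - ray a d \<rho>)) \<le> C * cmod d / (m * m') / (1 + \<rho>)\<^sup>2"
    by (simp add: norm_mult norm_divide)
qed


text \<open>An explicit primitive, \<open>- Ln (- \<i> * (1 - l / z))\<close>. The factor
  \<open>- \<i>\<close> keeps the argument off the cut: at the start of the upper ray it is on the
  positive imaginary axis, afterwards its real part is positive. The limit \<open>- \<i>\<close> and
  the starting point contribute \<open>pi / 2\<close> each to the imaginary part.\<close>

lemma ray_kernel_inverse:
  assumes l: "a < l" and d: "d = Complex (- c) 1"
  shows "(LINT \<rho>:{0..}|lborel. of_real l / ray a d \<rho> * d / (of_real l - ray a d \<rho>)) = of_real (ln ((l - a) / a)) + \<i> * of_real pi"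
proof -
  have dd: "Re d = - c" "\<bar>Im d\<bar> = 1"
    using d by auto
  let ?z = "ray a d"
  define w where "w \<rho> = - \<i> * (1 - of_real l / ?z \<rho>)" for \<rho>
  have l0: "0 < l"
    using l a by simp
  have wn: "w \<rho> \<notin> \<real>\<^sub>\<le>\<^sub>0" if \<rho>: "0 \<le> \<rho>" for \<rho>
  proof (cases "\<rho> = 0")
    case True
    then have "w \<rho> = \<i> * of_real ((l - a) / a)"
      using a by (simp add: w_def ray_def field_simps)
    then have "Im (w \<rho>) = (l - a) / a"
      by simp
    moreover have "0 < (l - a) / a"
      using l a by simp
    ultimately show ?thesis
      by (metis complex_nonpos_Reals_iff less_irrefl)
  next
    case False
    have "Re (w \<rho>) = l * Im (?z \<rho>) / (cmod (?z \<rho>))\<^sup>2"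
      by (simp add: w_def Im_divide cmod_def)
    moreover have "Im (?z \<rho>) = \<rho>"
      using d by (simp add: ray_def)
    moreover have "0 < (cmod (?z \<rho>))\<^sup>2"
      using ray_ne_zero[OF dd \<rho>] by simp
    ultimately have "0 < Re (w \<rho>)"
      using False \<rho> l0 by simp
    then show ?thesis
      by (simp add: complex_nonpos_Reals_iff)
  qed
  have hwedge: "continuous_on (wedge a c) (\<lambda>z. of_real l / z)"
    using zero_notin_wedge by (intro continuous_intros) auto
  have "(LINT \<rho>:{0..}|lborel. of_real l / ?z \<rho> * d / (of_real l - ?z \<rho>)) = - Ln (- \<i>) - - Ln (w 0)"
  proof (rule set_integral_FTC_atLeast)
    fix \<rho> :: real
    assume \<rho>: "0 \<le> \<rho>"
    have nz: "?z \<rho> \<noteq> 0" "of_real l - ?z \<rho> \<noteq> 0"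
      using ray_ne_zero[OF dd \<rho>] ray_ne_real[OF dd l \<rho>] by auto
    let ?D = "- (inverse (- \<i> * (1 - of_real l / ?z \<rho>)) * (- \<i> * (of_real l / (?z \<rho> * ?z \<rho>))))"
    have "(?z has_vector_derivative d) (at \<rho> within {0..})"
      unfolding ray_def by (auto intro!: derivative_eq_intros)
    moreover have "((\<lambda>z. - Ln (- \<i> * (1 - of_real l / z))) has_field_derivative ?D) (at (?z \<rho>) within ?z ` {0..})"
      using nz wn[OF \<rho>] unfolding w_def
      by (auto intro!: derivative_eq_intros simp: field_simps power2_eq_square)
    ultimately have "((\<lambda>\<rho>. - Ln (w \<rho>)) has_vector_derivative d * ?D) (at \<rho> within {0..})"
      using field_vector_diff_chain_within[of ?z d \<rho> "{0..}" "\<lambda>z. - Ln (- \<i> * (1 - of_real l / z))" ?D]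
      unfolding o_def w_def by blast
    moreover have "d * ?D = of_real l / ?z \<rho> * d / (of_real l - ?z \<rho>)"
      using nz by (simp add: w_def field_simps)
    ultimately show "((\<lambda>\<rho>. - Ln (w \<rho>)) has_vector_derivative of_real l / ?z \<rho> * d / (of_real l - ?z \<rho>)) (at \<rho> within {0..})"
      by simp
  next
    show "continuous_on {0..} (\<lambda>\<rho>. of_real l / ?z \<rho> * d / (of_real l - ?z \<rho>))"
      by (rule continuous_on_ray_kernel[OF dd l hwedge])
    show "set_integrable lborel {0..} (\<lambda>\<rho>. of_real l / ?z \<rho> * d / (of_real l - ?z \<rho>))"
      by (rule set_integrable_ray_kernel[OF dd l hwedge, of l]) (use l0 in \<open>auto simp: norm_divide\<close>)
    have "((\<lambda>\<rho>. of_real l / ?z \<rho>) \<longlongrightarrow> 0) at_top"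
    proof (rule Lim_null_comparison)
      show "\<forall>\<^sub>F \<rho> in at_top. norm (of_real l / ?z \<rho>) \<le> l / (min a 2 / 4 * (1 + \<rho>))"
        using eventually_ge_at_top[of 0]
      proof eventually_elim
        case (elim \<rho>)
        have "0 < min a 2 / 4 * (1 + \<rho>)"
          using elim a by (intro mult_pos_pos) auto
        then show ?case
          unfolding norm_divide norm_of_real using norm_ray_ge[OF dd elim] l0 by (intro frac_le) auto
      qed
      have "0 < min a 2 / 4"
        using a by simp
      then show "((\<lambda>\<rho>. l / (min a 2 / 4 * (1 + \<rho>))) \<longlongrightarrow> 0) at_top"
        by real_asymp
    qed
    then have "(w \<longlongrightarrow> - \<i> * (1 - 0)) at_top"
      unfolding w_def by (intro tendsto_intros)
    then show "((\<lambda>\<rho>. - Ln (w \<rho>)) \<longlongrightarrow> - Ln (- \<i>)) at_top"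
      by (intro tendsto_intros) (auto simp: complex_nonpos_Reals_iff)
  qed
  moreover define k where "k = (l - a) / a"
  have k: "0 < k" "w 0 = of_real k * \<i>"
    using l a by (auto simp: k_def w_def ray_def field_simps)
  then have "Ln (w 0) = of_real (ln ((l - a) / a)) + \<i> * of_real pi / 2"
    using Ln_times_of_real[of k \<i>] Ln_of_real[of k] by (simp add: k_def[symmetric])
  moreover have "Ln (- \<i>) = - (\<i> * of_real pi / 2)"
    by simp
  ultimately show ?thesis
    by simp
qed

lemma ray_cnj: "ray a (cnj d) \<rho> = cnj (ray a d \<rho>)"
  by (simp add: ray_def)

text \<open>The lower integral is the conjugate of the upper one; the logarithms cancel and the
  imaginary parts add up.\<close>

lemma ray_kernel_inverse_two_rays:
  assumes l: "a < l" and d: "d = Complex (- c) 1" "d' = Complex (- c) (- 1)"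
  shows "(LINT \<rho>:{0..}|lborel. of_real l / ray a d \<rho> * d / (of_real l - ray a d \<rho>))
    - (LINT \<rho>:{0..}|lborel. of_real l / ray a d' \<rho> * d' / (of_real l - ray a d' \<rho>)) = 2 * of_real pi * \<i>"
proof -
  have d': "d' = cnj d"
    by (simp add: d complex_eq_iff)
  have "(LINT \<rho>:{0..}|lborel. of_real l / ray a d' \<rho> * d' / (of_real l - ray a d' \<rho>))
    = cnj (LINT \<rho>:{0..}|lborel. of_real l / ray a d \<rho> * d / (of_real l - ray a d \<rho>))"
    unfolding d' ray_cnj set_lebesgue_integral_def Bochner_Integration.integral_cnj[symmetric]
    by (rule Bochner_Integration.integral_cong) auto
  then show ?thesis
    unfolding ray_kernel_inverse[OF l d(1)] by (simp add: complex_eq_iff)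
qed

text \<open>Cauchy's formula on the unbounded contour. After subtraction of the pole at
  \<open>l\<close> the rest decays quadratically and has equal integrals over the two rays; the
  subtracted part is the kernel computed explicitly before.\<close>

lemma ray_inversion_kernel:
  assumes hol: "h holomorphic_on U" "open U" and U: "wedge a c \<subseteq> U" and C: "0 \<le> C"
    and le: "\<And>z. z \<in> wedge a c \<Longrightarrow> cmod (h z) \<le> C / cmod z" and l: "a < l"
    and d: "d = Complex (- c) 1" "d' = Complex (- c) (- 1)"
  shows "(LINT \<rho>:{0..}|lborel. h (ray a d \<rho>) * d / (of_real l - ray a d \<rho>))
    - (LINT \<rho>:{0..}|lborel. h (ray a d' \<rho>) * d' / (of_real l - ray a d' \<rho>)) = 2 * of_real pi * \<i> * h (of_real l)"
proof -
  have l0: "0 < l"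
    using a l by simp
  have dd: "Re d = - c" "\<bar>Im d\<bar> = 1" "Re d' = - c" "\<bar>Im d'\<bar> = 1"
    using d by auto
  \<comment> \<open>Subtracting the constant \<open>h l\<close> would leave a quotient of order
    \<open>1 / z\<close> only. The difference quotient of the bounded function
    \<open>z * h z\<close>, divided by \<open>z\<close>, decays quadratically.\<close>
  define k where "k z = z * h z" for z
  define Q where "Q z = (if z = of_real l then deriv k (of_real l) else (k z - k (of_real l)) / (z - of_real l))" for z
  have "k holomorphic_on U"
    unfolding k_def by (intro holomorphic_intros hol)
  then have "Q holomorphic_on U"
    unfolding Q_def by (rule pole_lemma_open[OF _ hol(2)])
  then have q: "(\<lambda>z. Q z / z) holomorphic_on (U - {0})"
    by (intro holomorphic_intros) (auto intro: holomorphic_on_subset)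
  have sub: "wedge a c \<subseteq> U - {0}"
    using U zero_notin_wedge by auto
  have contq: "continuous_on (wedge a c) (\<lambda>z. Q z / z)"
    by (rule holomorphic_on_imp_continuous_on[OF holomorphic_on_subset[OF q sub]])
  have conth: "continuous_on (wedge a c) h"
    by (rule holomorphic_on_imp_continuous_on[OF holomorphic_on_subset[OF hol(1) U]])
  have "compact (wedge a c \<inter> cball 0 (2 * l))"
    using closed_wedge by (simp add: closed_Int_compact)
  then have "bounded ((\<lambda>z. Q z / z) ` (wedge a c \<inter> cball 0 (2 * l)))"
    by (intro compact_imp_bounded compact_continuous_image continuous_on_subset[OF contq]) auto
  then obtain M where "\<forall>x\<in>(\<lambda>z. Q z / z) ` (wedge a c \<inter> cball 0 (2 * l)). cmod x \<le> M" and M0: "0 < M"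
    unfolding bounded_pos by blast
  then have M: "cmod (Q z / z) \<le> M" if "z \<in> wedge a c" "cmod z \<le> 2 * l" for z
    using that by simp
  have kle: "cmod (k z) \<le> C" if "z \<in> wedge a c" for z
  proof -
    have "0 < cmod z"
      using that zero_notin_wedge by auto
    then show ?thesis
      using le[OF that] by (simp add: k_def norm_mult field_simps)
  qed
  have lw: "of_real l \<in> wedge a c"
    using l by (simp add: wedge_def)
  \<comment> \<open>The first summand serves \<open>cmod z > 2 * l\<close>, where
    \<open>cmod z / 2 \<le> cmod (z - l)\<close>; the second serves the compact remainder of the
    wedge.\<close>
  define C' where "C' = 4 * C + M * (2 * l)\<^sup>2"
  have C': "0 \<le> C'" "4 * C \<le> C'" "M * (2 * l)\<^sup>2 \<le> C'"
    using C M0 by (auto simp: C'_def)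
  have qle: "cmod (Q z / z) \<le> C' / (cmod z)\<^sup>2" if z: "z \<in> wedge a c" for z
  proof (cases "cmod z \<le> 2 * l")
    case True
    have z0: "0 < cmod z"
      using z zero_notin_wedge by auto
    have "M * (cmod z)\<^sup>2 \<le> M * (2 * l)\<^sup>2"
      using M0 True by (intro mult_left_mono power_mono) auto
    then have "M \<le> C' / (cmod z)\<^sup>2"
      using C' z0 by (simp add: pos_le_divide_eq)
    then show ?thesis
      using M[OF z True] by linarith
  next
    case False
    have zl: "z \<noteq> of_real l"
      using False l0 by auto
    have "cmod z \<le> cmod (z - of_real l) + l"
      using norm_triangle_ineq[of "z - of_real l" "of_real l"] l0 by simp
    then have half: "cmod z / 2 \<le> cmod (z - of_real l)"
      using False by simp
    have "cmod (k z - k (of_real l)) \<le> 2 * C"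
      using norm_triangle_ineq4[of "k z" "k (of_real l)"] kle[OF z] kle[OF lw] by linarith
    then have "cmod (Q z) \<le> 2 * C / (cmod z / 2)"
      unfolding Q_def using zl half False l0 C by (simp only: if_False norm_divide) (intro frac_le, auto)
    then have "cmod (Q z / z) \<le> 2 * C / (cmod z / 2) / cmod z"
      unfolding norm_divide by (rule divide_right_mono) simp
    also have "\<dots> = 4 * C / (cmod z)\<^sup>2"
      by (simp add: power2_eq_square)
    also have "\<dots> \<le> C' / (cmod z)\<^sup>2"
      using C' by (intro divide_right_mono) auto
    finally show ?thesis .
  qed
  have hl: "continuous_on (wedge a c) (\<lambda>z. of_real l / z)"
    using zero_notin_wedge by (intro continuous_intros) auto
  have split: "(LINT \<rho>:{0..}|lborel. Q (ray a e \<rho>) / ray a e \<rho> * e)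
    = h (of_real l) * (LINT \<rho>:{0..}|lborel. of_real l / ray a e \<rho> * e / (of_real l - ray a e \<rho>))
      - (LINT \<rho>:{0..}|lborel. h (ray a e \<rho>) * e / (of_real l - ray a e \<rho>))" if e: "Re e = - c" "\<bar>Im e\<bar> = 1" for e
  proof -
    have "(LINT \<rho>:{0..}|lborel. Q (ray a e \<rho>) / ray a e \<rho> * e) = (LINT \<rho>:{0..}|lborel.
      h (of_real l) * (of_real l / ray a e \<rho> * e / (of_real l - ray a e \<rho>)) - h (ray a e \<rho>) * e / (of_real l - ray a e \<rho>))"
    proof (rule set_lebesgue_integral_cong, simp, intro allI impI)
      fix \<rho> :: real
      assume "\<rho> \<in> {0..}"
      then have nz: "ray a e \<rho> \<noteq> 0" "ray a e \<rho> \<noteq> of_real l"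
        using ray_ne_zero[OF e] ray_ne_real[OF e l] by auto
      define z L where "z = ray a e \<rho>" and "L = complex_of_real l"
      have nz': "z \<noteq> 0" "L - z \<noteq> 0" "z - L \<noteq> 0"
        using nz by (auto simp: z_def L_def)
      have "Q z / z * e = (z * h z - L * h L) / (z - L) / z * e"
        using nz by (simp add: Q_def k_def z_def L_def)
      also have "\<dots> = h L * (L / z * e / (L - z)) - h z * e / (L - z)"
        using nz' by (simp add: divide_simps) (simp add: algebra_simps)
      finally show "Q (ray a e \<rho>) / ray a e \<rho> * e = h (of_real l) * (of_real l / ray a e \<rho> * e / (of_real l - ray a e \<rho>)) - h (ray a e \<rho>) * e / (of_real l - ray a e \<rho>)"
        by (simp only: z_def L_def)
    qed
    also have "\<dots> = (LINT \<rho>:{0..}|lborel. h (of_real l) * (of_real l / ray a e \<rho> * e / (of_real l - ray a e \<rho>))) - (LINT \<rho>:{0..}|lborel. h (ray a e \<rho>) * e / (of_real l - ray a e \<rho>))"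
    proof (rule set_integral_diff(2))
      show "set_integrable lborel {0..} (\<lambda>\<rho>. h (of_real l) * (of_real l / ray a e \<rho> * e / (of_real l - ray a e \<rho>)))"
        by (intro set_integrable_mult_right set_integrable_ray_kernel[OF e l hl, of l]) (use l0 in \<open>auto simp: norm_divide\<close>)
      show "set_integrable lborel {0..} (\<lambda>\<rho>. h (ray a e \<rho>) * e / (of_real l - ray a e \<rho>))"
        by (rule set_integrable_ray_kernel[OF e l conth C le])
    qed
    finally show ?thesis
      by (simp only: set_integral_mult_right)
  qed
  have "(LINT \<rho>:{0..}|lborel. Q (ray a d \<rho>) / ray a d \<rho> * d) = (LINT \<rho>:{0..}|lborel. Q (ray a d' \<rho>) / ray a d' \<rho> * d')"
    by (rule contour_integral_two_rays[OF q sub C'(1) qle d])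
  then have "(LINT \<rho>:{0..}|lborel. h (ray a d \<rho>) * d / (of_real l - ray a d \<rho>)) - (LINT \<rho>:{0..}|lborel. h (ray a d' \<rho>) * d' / (of_real l - ray a d' \<rho>))
    = h (of_real l) * ((LINT \<rho>:{0..}|lborel. of_real l / ray a d \<rho> * d / (of_real l - ray a d \<rho>))
    - (LINT \<rho>:{0..}|lborel. of_real l / ray a d' \<rho> * d' / (of_real l - ray a d' \<rho>)))"
    unfolding split[OF dd(1,2)] split[OF dd(3,4)] by (simp add: algebra_simps)
  then show ?thesis
    unfolding ray_kernel_inverse_two_rays[OF l d] by simp
qed

end

section \<open>Vector-valued Laplace inversion\<close>

lemma exp_set_integral:
  fixes b :: real
  assumes "0 < b"
  shows "set_integrable lborel {0..} (\<lambda>x. exp (- b * x))" "(LINT x:{0..}|lborel. exp (- b * x)) = 1 / b"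
proof -
  have cont: "continuous_on {0..} (\<lambda>x. exp (- b * x))"
    by (intro continuous_intros)
  have "(\<lambda>x. exp (- b * x)) absolutely_integrable_on {0..}"
    using integrable_on_exp_minus_to_infinity[OF assms, of 0] by (intro nonnegative_absolutely_integrable_1) auto
  then have "integrable lebesgue (\<lambda>x. indicator {0..} x *\<^sub>R exp (- b * x))"
    by (simp add: set_integrable_def)
  then show int: "set_integrable lborel {0..} (\<lambda>x. exp (- b * x))"
    unfolding set_integrable_def
    using borel_measurable_continuous_on_indicator[OF _ cont] by (subst (asm) integrable_completion) auto
  have "(LINT x:{0..}|lborel. exp (- b * x)) = 0 - - (exp (- b * 0) / b)"
  proof (rule set_integral_FTC_atLeast[OF _ cont int, of "\<lambda>x. - (exp (- b * x) / b)"])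
    show "((\<lambda>x. - (exp (- b * x) / b)) has_vector_derivative exp (- b * x)) (at x within {0..})" for x
      using assms by (auto intro!: derivative_eq_intros simp flip: has_real_derivative_iff_has_vector_derivative)
    show "((\<lambda>x. - (exp (- b * x) / b)) \<longlongrightarrow> 0) at_top"
      using assms by real_asymp
  qed
  then show "(LINT x:{0..}|lborel. exp (- b * x)) = 1 / b"
    by simp
qed

lemma complex_exp_set_integral:
  fixes w :: complex
  assumes "Re w < 0"
  shows "(LINT t:{0..}|lborel. exp (w * of_real t)) = - 1 / w"
proof -
  have cont: "continuous_on {0..} (\<lambda>t. exp (w * of_real t))"
    by (intro continuous_intros)
  have w: "w \<noteq> 0"
    using assms by auto
  have "(LINT t:{0..}|lborel. exp (w * of_real t)) = 0 - exp (w * of_real 0) / w"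
  proof (rule set_integral_FTC_atLeast[OF _ cont])
    show "((\<lambda>t. exp (w * of_real t) / w) has_vector_derivative exp (w * of_real t)) (at t within {0..})" for t
    proof -
      have "((\<lambda>z. exp (w * z) / w) has_field_derivative exp (w * of_real t)) (at (of_real t))"
        using w by (auto intro!: derivative_eq_intros)
      then show ?thesis
        by (rule has_vector_derivative_real_field)
    qed
    show "set_integrable lborel {0..} (\<lambda>t. exp (w * of_real t))"
    proof (rule set_integrable_bound[OF exp_set_integral(1)[of "- Re w"]])
      show "set_borel_measurable lborel {0..} (\<lambda>t. exp (w * of_real t))"
        unfolding set_borel_measurable_def using borel_measurable_continuous_on_indicator[OF _ cont] by simp
    qed (use assms in \<open>auto simp: norm_exp_eq_Re\<close>)
    show "((\<lambda>t. exp (w * of_real t) / w) \<longlongrightarrow> 0) at_top"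
    proof (rule tendsto_norm_zero_cancel)
      have "((\<lambda>t. exp (Re w * t) / cmod w) \<longlongrightarrow> 0) at_top"
        using assms w by real_asymp
      then show "((\<lambda>t. cmod (exp (w * of_real t) / w)) \<longlongrightarrow> 0) at_top"
        by (simp add: norm_divide norm_exp_eq_Re)
    qed
  qed
  then show ?thesis
    by simp
qed

text \<open>The contour runs from \<open>\<infinity>\<close> along the lower ray to \<open>a\<close> and back to \<open>\<infinity>\<close> along the upper one.\<close>

definition ray_integral ::
    "real \<Rightarrow> complex \<Rightarrow> (complex \<Rightarrow> 'a::{complex_banach, second_countable_topology}) \<Rightarrow> real \<Rightarrow> 'a"
  where "ray_integral a d F t = (LINT \<rho>:{0..}|lborel. (exp (ray a d \<rho> * of_real t) * d) *C F (ray a d \<rho>))"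

definition inverse_laplace ::
    "real \<Rightarrow> real \<Rightarrow> (complex \<Rightarrow> 'a::{complex_banach, second_countable_topology}) \<Rightarrow> real \<Rightarrow> 'a"
  where "inverse_laplace a c F t = inverse (2 * of_real pi * \<i>) *C
    (ray_integral a (Complex (- c) 1) F t - ray_integral a (Complex (- c) (- 1)) F t)"

text \<open>Along the segment \<open>Re z * r\<close> is monotone in \<open>r\<close>, so the
  modulus of the exponential is largest at an endpoint.\<close>

lemma norm_exp_diff_le:
  fixes z :: complex
  assumes "0 \<le> s" "s \<le> t" "exp (Re z * s) \<le> M" "exp (Re z * t) \<le> M"
  shows "cmod (exp (z * of_real t) - exp (z * of_real s)) \<le> M * cmod z * (t - s)"
proof -
  have "cmod (exp (z * of_real t) - exp (z * of_real s)) \<le> (M * cmod z) * cmod (of_real t - of_real s :: complex)"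
  proof (rule field_differentiable_bound[where S = "closed_segment (of_real s) (of_real t)"])
    fix x :: complex
    assume x: "x \<in> closed_segment (of_real s) (of_real t)"
    show "((\<lambda>x. exp (z * x)) has_field_derivative exp (z * x) * z) (at x within closed_segment (of_real s) (of_real t))"
      by (auto intro!: derivative_eq_intros)
    obtain u where u: "0 \<le> u" "u \<le> 1" "x = of_real ((1 - u) * s + u * t)"
      using x by (auto simp: closed_segment_def scaleR_conv_of_real)
    define r where "r = (1 - u) * s + u * t"
    have r: "s \<le> r" "r \<le> t"
    proof -
      have "0 \<le> u * (t - s)" "0 \<le> (1 - u) * (t - s)"
        using u assms by auto
      then show "s \<le> r" "r \<le> t"
        by (auto simp: r_def algebra_simps)
    qed
    have "cmod (exp (z * x)) = exp (Re z * r)"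
      by (simp add: u(3) r_def[symmetric] norm_exp_eq_Re)
    also have "\<dots> \<le> M"
    proof (cases "0 \<le> Re z")
      case True
      then have "Re z * r \<le> Re z * t"
        using r by (intro mult_left_mono) auto
      then show ?thesis
        using assms(4) by (meson exp_le_cancel_iff order_trans)
    next
      case False
      then have "Re z * r \<le> Re z * s"
        using r by (intro mult_left_mono_neg) auto
      then show ?thesis
        using assms(3) by (meson exp_le_cancel_iff order_trans)
    qed
    finally show "cmod (exp (z * x) * z) \<le> M * cmod z"
      by (simp add: norm_mult mult_right_mono)
  qed auto
  then show ?thesis
    using assms by (simp flip: of_real_diff)
qed

context
  fixes a c :: real
  assumes a: "0 < a" and c: "0 < c" "c \<le> 1"
begin

context
  fixes d :: complex and F :: "complex \<Rightarrow> 'a::{complex_banach, second_countable_topology}"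
  assumes d: "Re d = - c" "\<bar>Im d\<bar> = 1" and F: "continuous_on (wedge a c) F"
begin

lemma continuous_on_ray_integrand:
  "continuous_on {0..} (\<lambda>\<rho>. (exp (ray a d \<rho> * of_real t) * d) *C F (ray a d \<rho>))"
  using ray_in_wedge[OF a c d]
  by (intro bounded_bilinear.continuous_on[OF bounded_bilinear_scaleC] continuous_intros continuous_on_compose2[OF F]) auto

lemma norm_exp_ray: "cmod (exp (ray a d \<rho> * of_real t)) = exp (a * t) * exp (- (c * t) * \<rho>)"
proof -
  have "Re (ray a d \<rho> * of_real t) = a * t + - (c * t) * \<rho>"
    by (simp add: Re_ray[OF a c d] algebra_simps)
  then show ?thesis
    by (simp only: norm_exp_eq_Re exp_add)
qed

text \<open>For \<open>t > 0\<close> the exponential alone makes the integral converge, at rate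
  \<open>c * t\<close>. No decay of \<open>F\<close> is asked, so the estimate also covers
  \<open>\<mu>0 - A\<close> applied to the inverse symbol.\<close>

lemma ray_integral_bound:
  assumes le: "\<And>z. z \<in> wedge a c \<Longrightarrow> norm (F z) \<le> K" and t: "0 < t"
  shows "set_integrable lborel {0..} (\<lambda>\<rho>. (exp (ray a d \<rho> * of_real t) * d) *C F (ray a d \<rho>))"
    and "norm (ray_integral a d F t) \<le> K * cmod d * exp (a * t) / (c * t)"
proof -
  have ct: "0 < c * t"
    using c t by simp
  let ?g = "\<lambda>\<rho>. (exp (ray a d \<rho> * of_real t) * d) *C F (ray a d \<rho>)"
  let ?b = "\<lambda>\<rho>. K * cmod d * exp (a * t) * exp (- (c * t) * \<rho>)"
  have intb: "set_integrable lborel {0..} ?b"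
    by (intro set_integrable_mult_right exp_set_integral[OF ct])
  have le': "norm (?g \<rho>) \<le> ?b \<rho>" if "0 \<le> \<rho>" for \<rho>
  proof -
    have "norm (?g \<rho>) = exp (a * t) * exp (- (c * t) * \<rho>) * cmod d * norm (F (ray a d \<rho>))"
      by (simp only: norm_scaleC norm_mult norm_exp_ray)
    also have "\<dots> \<le> exp (a * t) * exp (- (c * t) * \<rho>) * cmod d * K"
      by (intro mult_left_mono le ray_in_wedge[OF a c d that]) auto
    finally show ?thesis
      by (simp only: mult_ac)
  qed
  show int: "set_integrable lborel {0..} ?g"
  proof (rule set_integrable_bound[OF intb])
    show "set_borel_measurable lborel {0..} ?g"
      unfolding set_borel_measurable_def using borel_measurable_continuous_on_indicator[OF _ continuous_on_ray_integrand] by simp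
    show "AE \<rho> in lborel. \<rho> \<in> {0..} \<longrightarrow> norm (?g \<rho>) \<le> norm (?b \<rho>)"
      using le' abs_ge_self order_trans by (intro AE_I2) fastforce
  qed
  have "norm (ray_integral a d F t) \<le> (LINT \<rho>:{0..}|lborel. norm (?g \<rho>))"
    unfolding ray_integral_def by (rule set_integral_norm_bound[OF int])
  also have "\<dots> \<le> (LINT \<rho>:{0..}|lborel. ?b \<rho>)"
    by (intro set_integral_mono set_integrable_norm int intb) (use le' in auto)
  also have "\<dots> = K * cmod d * exp (a * t) / (c * t)"
    by (simp only: set_integral_mult_right exp_set_integral(2)[OF ct]) simp
  finally show "norm (ray_integral a d F t) \<le> K * cmod d * exp (a * t) / (c * t)" .
qed

text \<open>Differentiating the exponential produces a factor \<open>cmod z\<close>, which the decay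
  of \<open>F\<close> cancels; what remains decays like
  \<open>exp (- (c * \<epsilon>) * \<rho>)\<close>.\<close>

lemma ray_integral_Lipschitz:
  assumes C: "0 \<le> C" and le: "\<And>z. z \<in> wedge a c \<Longrightarrow> norm (F z) \<le> C / cmod z" and \<epsilon>: "0 < \<epsilon>" "\<epsilon> \<le> s" "s \<le> t" "t \<le> T"
  shows "norm (ray_integral a d F t - ray_integral a d F s) \<le> C * cmod d * exp (a * T) / (c * \<epsilon>) * (t - s)"
proof -
  have le2: "norm (F z) \<le> C / (a / 2)" if "z \<in> wedge a c" for z
    using le[OF that] wedge_norm_ge[OF a c that] a C
    by (meson divide_left_mono half_gt_zero mult_pos_pos order_less_le_trans order_trans)
  have s: "0 < s" "0 < t"
    using \<epsilon> by auto
  let ?g = "\<lambda>t \<rho>. (exp (ray a d \<rho> * of_real t) * d) *C F (ray a d \<rho>)"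
  have int: "set_integrable lborel {0..} (?g t)" "set_integrable lborel {0..} (?g s)"
    by (rule ray_integral_bound(1)[OF le2], use s in simp_all)+
  have ce: "0 < c * \<epsilon>"
    using c \<epsilon> by simp
  let ?b = "\<lambda>\<rho>. C * cmod d * exp (a * T) * (t - s) * exp (- (c * \<epsilon>) * \<rho>)"
  have intb: "set_integrable lborel {0..} ?b"
    by (intro set_integrable_mult_right exp_set_integral[OF ce])
  have le': "norm (?g t \<rho> - ?g s \<rho>) \<le> ?b \<rho>" if \<rho>: "0 \<le> \<rho>" for \<rho>
  proof -
    let ?z = "ray a d \<rho>"
    have z: "?z \<in> wedge a c"
      by (rule ray_in_wedge[OF a c d \<rho>])
    have z0: "0 < cmod ?z"
      using ray_ne_zero[OF a c d \<rho>] by simp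
    let ?M = "exp (a * T) * exp (- (c * \<epsilon>) * \<rho>)"
    have M: "exp (Re ?z * r) \<le> ?M" if "\<epsilon> \<le> r" "r \<le> T" for r
    proof -
      have "Re ?z * r = a * r + - (c * \<rho>) * r"
        by (simp add: Re_ray[OF a c d] algebra_simps)
      also have "\<dots> \<le> a * T + - (c * \<rho>) * \<epsilon>"
        using that a c \<rho> by (intro add_mono mult_left_mono mult_left_mono_neg) auto
      finally show ?thesis
        by (simp add: mult_ac flip: exp_add)
    qed
    have "norm (?g t \<rho> - ?g s \<rho>) = cmod (exp (?z * of_real t) - exp (?z * of_real s)) * cmod d * norm (F ?z)"
      by (simp add: norm_scaleC norm_mult flip: scaleC.diff_left left_diff_distrib)
    also have "\<dots> \<le> (?M * cmod ?z * (t - s)) * cmod d * (C / cmod ?z)"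
      using \<epsilon> C z0 by (intro mult_mono norm_exp_diff_le M le[OF z]) auto
    also have "\<dots> = ?b \<rho>"
      using z0 by simp
    finally show ?thesis .
  qed
  have "norm (ray_integral a d F t - ray_integral a d F s) = norm (LINT \<rho>:{0..}|lborel. ?g t \<rho> - ?g s \<rho>)"
    unfolding ray_integral_def set_integral_diff(2)[OF int] ..
  also have "\<dots> \<le> (LINT \<rho>:{0..}|lborel. norm (?g t \<rho> - ?g s \<rho>))"
    by (rule set_integral_norm_bound[OF set_integral_diff(1)[OF int]])
  also have "\<dots> \<le> (LINT \<rho>:{0..}|lborel. ?b \<rho>)"
    by (rule set_integral_mono[OF set_integrable_norm[OF set_integral_diff(1)[OF int]] intb], rule le') simp
  also have "\<dots> = C * cmod d * exp (a * T) * (t - s) * (1 / (c * \<epsilon>))"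
    by (simp only: set_integral_mult_right exp_set_integral(2)[OF ce])
  also have "\<dots> = C * cmod d * exp (a * T) / (c * \<epsilon>) * (t - s)"
    by (simp only: times_divide_eq_left times_divide_eq_right mult_1_right)
  finally show ?thesis .
qed

end

text \<open>Fubini. The inner integral of the modulus over \<open>t\<close> is proportional to
  \<open>1 / (l - Re z)\<close>, which contributes one power of decay in \<rho>; the decay of
  \<open>h\<close> contributes the other.\<close>

lemma ray_integral_laplace:
  fixes h :: "complex \<Rightarrow> complex"
  assumes d: "Re d = - c" "\<bar>Im d\<bar> = 1" and h: "continuous_on (wedge a c) h" and C: "0 \<le> C"
    and le: "\<And>z. z \<in> wedge a c \<Longrightarrow> cmod (h z) \<le> C / cmod z" and l: "a < l"
  shows "set_integrable lborel {0..} (\<lambda>t. exp (- of_real l * of_real t) * ray_integral a d h t)"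
    and "(LINT t:{0..}|lborel. exp (- of_real l * of_real t) * ray_integral a d h t)
      = (LINT \<rho>:{0..}|lborel. h (ray a d \<rho>) * d / (of_real l - ray a d \<rho>))"
proof -
  define \<phi> where "\<phi> x = exp ((ray a d (fst x) - of_real l) * of_real (snd x)) * d * h (ray a d (fst x))" for x :: "real \<times> real"
  define f where "f x = indicator ({0..} \<times> {0..}) x *\<^sub>R \<phi> x" for x
  have f_eq: "f (\<rho>, t) = indicator {0..} \<rho> *\<^sub>R (indicator {0..} t *\<^sub>R \<phi> (\<rho>, t))" for \<rho> t
    by (auto simp: f_def indicator_def)
  have "continuous_on ({0..} \<times> {0..}) \<phi>"
    unfolding \<phi>_def ray_def
    using ray_in_wedge[OF a c d]
    by (intro continuous_intros continuous_on_compose2[OF h]) (auto simp: ray_def)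
  then have meas: "f \<in> borel_measurable (lborel \<Otimes>\<^sub>M lborel)"
    unfolding f_def lborel_prod measurable_lborel2
    by (intro borel_measurable_continuous_on_indicator) (auto simp: closed_Times intro!: borel_closed)
  have neg: "Re (ray a d \<rho> - of_real l) < 0" if "0 \<le> \<rho>" for \<rho>
  proof -
    have "0 \<le> c * \<rho>"
      using that c by simp
    then show ?thesis
      using l Re_ray[OF a c d, of \<rho>] by simp
  qed
  have norm_\<phi>: "norm (\<phi> (\<rho>, t)) = cmod d * cmod (h (ray a d \<rho>)) * exp (- (l - Re (ray a d \<rho>)) * t)" for \<rho> t
    by (simp add: \<phi>_def norm_mult norm_exp_eq_Re)
  have inner_int: "set_integrable lborel {0..} (\<lambda>t. \<phi> (\<rho>, t))" if "0 \<le> \<rho>" for \<rho>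
  proof (rule set_integrable_bound)
    show "set_integrable lborel {0..} (\<lambda>t. cmod d * cmod (h (ray a d \<rho>)) * exp (- (l - Re (ray a d \<rho>)) * t))"
      using neg[OF that] by (intro set_integrable_mult_right exp_set_integral) auto
    show "set_borel_measurable lborel {0..} (\<lambda>t. \<phi> (\<rho>, t))"
      unfolding \<phi>_def set_borel_measurable_def fst_conv snd_conv measurable_lborel2
      by (intro borel_measurable_continuous_on_indicator continuous_intros) auto
  qed (auto simp: norm_\<phi>)
  have inner_norm: "(\<integral>t. norm (f (\<rho>, t)) \<partial>lborel)
      = indicator {0..} \<rho> *\<^sub>R (cmod d * cmod (h (ray a d \<rho>)) / (l - Re (ray a d \<rho>)))" for \<rho>
  proof (cases "0 \<le> \<rho>")
    case True
    have "(\<integral>t. norm (f (\<rho>, t)) \<partial>lborel) = (LINT t:{0..}|lborel. cmod d * cmod (h (ray a d \<rho>)) * exp (- (l - Re (ray a d \<rho>)) * t))"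
      unfolding set_lebesgue_integral_def f_eq using True by (intro Bochner_Integration.integral_cong) (auto simp: norm_\<phi>)
    also have "\<dots> = cmod d * cmod (h (ray a d \<rho>)) * (1 / (l - Re (ray a d \<rho>)))"
      unfolding set_integral_mult_right using neg[OF True] by (subst exp_set_integral(2)) auto
    finally show ?thesis
      using True by simp
  qed (simp add: f_eq)
  have "set_integrable lborel {0..} (\<lambda>\<rho>. cmod d * cmod (h (ray a d \<rho>)) / (l - Re (ray a d \<rho>)))"
  proof (rule set_integrable_inverse_square_bound)
    show "continuous_on {0..} (\<lambda>\<rho>. cmod d * cmod (h (ray a d \<rho>)) / (l - Re (ray a d \<rho>)))"
      using ray_in_wedge[OF a c d] neg by (intro continuous_intros continuous_on_compose2[OF h]) force+
    fix \<rho> :: real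
    assume \<rho>: "0 \<le> \<rho>"
    define m where "m = min a 2 / 4"
    define m' where "m' = min (l - a) c"
    have m: "0 < m" "0 < m'"
      using a c l by (auto simp: m_def m'_def)
    have n: "m * (1 + \<rho>) \<le> cmod (ray a d \<rho>)"
      using norm_ray_ge[OF a c d \<rho>] by (simp add: m_def)
    have "m' * \<rho> \<le> c * \<rho>"
      using \<rho> by (intro mult_right_mono) (auto simp: m'_def)
    then have n': "m' * (1 + \<rho>) \<le> l - Re (ray a d \<rho>)"
      unfolding Re_ray[OF a c d] distrib_left by (simp add: m'_def)
    have pos: "0 < m * (1 + \<rho>)" "0 < m' * (1 + \<rho>)"
      using m \<rho> by auto
    have "cmod (h (ray a d \<rho>)) \<le> C / (m * (1 + \<rho>))"
      using le[OF ray_in_wedge[OF a c d \<rho>]] n(1) pos(1) C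
      by (meson divide_left_mono mult_pos_pos order_less_le_trans order_trans)
    then have "cmod d * cmod (h (ray a d \<rho>)) / (l - Re (ray a d \<rho>)) \<le> cmod d * (C / (m * (1 + \<rho>))) / (m' * (1 + \<rho>))"
      using n' pos C by (intro frac_le mult_left_mono) auto
    also have "\<dots> = cmod d * C / (m * m') / (1 + \<rho>)\<^sup>2"
      by (simp add: power2_eq_square)
    finally show "norm (cmod d * cmod (h (ray a d \<rho>)) / (l - Re (ray a d \<rho>))) \<le> cmod d * C / (m * m') / (1 + \<rho>)\<^sup>2"
      using neg[OF \<rho>] by (simp add: norm_divide norm_mult)
  qed
  then have outer: "integrable lborel (\<lambda>\<rho>. \<integral>t. norm (f (\<rho>, t)) \<partial>lborel)"
    unfolding inner_norm set_integrable_def .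
  have "integrable lborel (\<lambda>t. f (\<rho>, t))" for \<rho>
    using inner_int[of \<rho>] by (cases "0 \<le> \<rho>") (auto simp: f_eq set_integrable_def)
  then have int_f: "integrable (lborel \<Otimes>\<^sub>M lborel) f"
    by (intro lborel_pair.Fubini_integrable meas outer AE_I2)
  have inner_t: "(\<integral>\<rho>. f (\<rho>, t) \<partial>lborel) = indicator {0..} t *\<^sub>R (exp (- of_real l * of_real t) * ray_integral a d h t)" for t
  proof -
    have "(\<integral>\<rho>. f (\<rho>, t) \<partial>lborel) = indicator {0..} t *\<^sub>R (LINT \<rho>:{0..}|lborel. exp (- of_real l * of_real t) * ((exp (ray a d \<rho> * of_real t) * d) *C h (ray a d \<rho>)))"
      unfolding set_lebesgue_integral_def integral_scaleR_right[symmetric] f_eq \<phi>_def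
      by (intro Bochner_Integration.integral_cong)
        (auto simp: scaleC_complex_def indicator_def algebra_simps exp_diff exp_minus field_simps)
    then show ?thesis
      by (simp only: set_integral_mult_right ray_integral_def)
  qed
  have inner_\<rho>: "(\<integral>t. f (\<rho>, t) \<partial>lborel) = indicator {0..} \<rho> *\<^sub>R (h (ray a d \<rho>) * d / (of_real l - ray a d \<rho>))" for \<rho>
  proof (cases "0 \<le> \<rho>")
    case True
    have "(\<integral>t. f (\<rho>, t) \<partial>lborel) = (LINT t:{0..}|lborel. exp ((ray a d \<rho> - of_real l) * of_real t) * (d * h (ray a d \<rho>)))"
      unfolding set_lebesgue_integral_def f_eq \<phi>_def using True by (intro Bochner_Integration.integral_cong) auto
    also have "\<dots> = - 1 / (ray a d \<rho> - of_real l) * (d * h (ray a d \<rho>))"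
      by (simp only: set_integral_mult_left complex_exp_set_integral[OF neg[OF True]])
    also have "\<dots> = h (ray a d \<rho>) * d / (of_real l - ray a d \<rho>)"
      using ray_ne_real[OF a c d l True] by (simp add: divide_simps) (simp add: algebra_simps)
    finally show ?thesis
      using True by simp
  qed (simp add: f_eq)
  have int_f': "integrable (lborel \<Otimes>\<^sub>M lborel) (case_prod (\<lambda>\<rho> t. f (\<rho>, t)))"
    using int_f by simp
  show "set_integrable lborel {0..} (\<lambda>t. exp (- of_real l * of_real t) * ray_integral a d h t)"
    using lborel_pair.integrable_snd[OF int_f'] unfolding inner_t set_integrable_def .
  show "(LINT t:{0..}|lborel. exp (- of_real l * of_real t) * ray_integral a d h t)
      = (LINT \<rho>:{0..}|lborel. h (ray a d \<rho>) * d / (of_real l - ray a d \<rho>))"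
    using lborel_pair.Fubini_integral[OF int_f'] unfolding inner_t inner_\<rho> set_lebesgue_integral_def .
qed

lemma laplace_inverse_laplace:
  fixes h :: "complex \<Rightarrow> complex"
  assumes hol: "h holomorphic_on U" "open U" and U: "wedge a c \<subseteq> U" and C: "0 \<le> C"
    and le: "\<And>z. z \<in> wedge a c \<Longrightarrow> cmod (h z) \<le> C / cmod z" and l: "a < l"
  shows "set_integrable lborel {0..} (\<lambda>t. exp (- of_real l * of_real t) * inverse_laplace a c h t)"
    and "(LINT t:{0..}|lborel. exp (- of_real l * of_real t) * inverse_laplace a c h t) = h (of_real l)"
proof -
  define d d' where "d = Complex (- c) 1" and "d' = Complex (- c) (- 1)"
  have dd: "Re d = - c" "\<bar>Im d\<bar> = 1" "Re d' = - c" "\<bar>Im d'\<bar> = 1"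
    by (auto simp: d_def d'_def)
  have conth: "continuous_on (wedge a c) h"
    by (rule holomorphic_on_imp_continuous_on[OF holomorphic_on_subset[OF hol(1) U]])
  note 1 = ray_integral_laplace[OF dd(1,2) conth C le l]
  note 2 = ray_integral_laplace[OF dd(3,4) conth C le l]
  let ?E = "\<lambda>t. exp (- complex_of_real l * of_real t)"
  have eq: "?E t * inverse_laplace a c h t
    = inverse (2 * of_real pi * \<i>) * (?E t * ray_integral a d h t - ?E t * ray_integral a d' h t)" for t
    unfolding inverse_laplace_def d_def[symmetric] d'_def[symmetric] scaleC_complex_def by (simp add: algebra_simps)
  show "set_integrable lborel {0..} (\<lambda>t. ?E t * inverse_laplace a c h t)"
    unfolding eq by (intro set_integrable_mult_right set_integral_diff 1(1) 2(1)) auto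
  show "(LINT t:{0..}|lborel. ?E t * inverse_laplace a c h t) = h (of_real l)"
  proof -
    have "(LINT t:{0..}|lborel. ?E t * inverse_laplace a c h t)
      = inverse (2 * of_real pi * \<i>) * (LINT t:{0..}|lborel. ?E t * ray_integral a d h t - ?E t * ray_integral a d' h t)"
      by (simp only: eq set_integral_mult_right)
    also have "\<dots> = inverse (2 * of_real pi * \<i>) * (2 * of_real pi * \<i> * h (of_real l))"
      using set_integral_diff(2)[OF 1(1) 2(1)] ray_inversion_kernel[OF a c hol U C le l d_def d'_def]
      by (simp only: 1(2) 2(2))
    also have "\<dots> = h (of_real l)"
    proof -
      have cancel: "inverse P * (P * x) = x" if "P \<noteq> 0" for P x :: complex
        by (simp add: that)
      show ?thesis
        by (rule cancel) simp
    qed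
    finally show ?thesis .
  qed
qed

end

text \<open>Lerch's argument. With \<open>u = exp (- t)\<close> the vanishing transforms say that
  the weight \<open>k\<close> annihilates all polynomials in \<open>u\<close>, hence by Weierstrass
  every continuous function of \<open>u\<close>; a tent around a point where \<open>k\<close> is
  positive gives a contradiction.\<close>

lemma laplace_zero_real:
  fixes g :: "real \<Rightarrow> real"
  assumes cont: "continuous_on {0<..} g" and int: "set_integrable lborel {0..} (\<lambda>t. exp (- l * t) * g t)"
    and zero: "\<And>n::nat. (LINT t:{0..}|lborel. exp (- (l + real n) * t) * g t) = 0" and t0: "0 < t0"
  shows "g t0 \<le> 0"
proof (rule ccontr)
  assume "\<not> g t0 \<le> 0"
  define k where "k t = exp (- l * t) * g t" for t
  have kcont: "continuous_on {0<..} k"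
    unfolding k_def by (intro continuous_intros cont)
  have kint: "set_integrable lborel {0..} k"
    using int unfolding k_def .
  have "0 < k t0"
    using \<open>\<not> g t0 \<le> 0\<close> by (simp add: k_def)
  have "isCont k t0"
    using kcont t0 by (auto simp: continuous_on_eq_continuous_at open_greaterThan)
  then have "\<forall>\<^sub>F t in at t0. k t0 / 2 < k t"
    using \<open>0 < k t0\<close> by (intro order_tendstoD) (auto simp: isCont_def)
  then obtain \<delta>0 where \<delta>0: "0 < \<delta>0" "\<And>t. t \<noteq> t0 \<Longrightarrow> dist t t0 < \<delta>0 \<Longrightarrow> k t0 / 2 < k t"
    unfolding eventually_at by auto
  define \<delta> where "\<delta> = min (\<delta>0 / 2) (t0 / 2)"
  have \<delta>: "0 < \<delta>" "\<delta> < \<delta>0" "\<delta> < t0"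
    using \<delta>0 t0 by (auto simp: \<delta>_def min_def)
  have kge: "k t0 / 2 \<le> k t" if "\<bar>t - t0\<bar> \<le> \<delta>" for t
    using \<delta>0(2)[of t] that \<delta> \<open>0 < k t0\<close> by (cases "t = t0") (auto simp: dist_real_def)
  have zero_poly: "(LINT t:{0..}|lborel. k t * (\<Sum>i\<le>n. b i * exp (- t) ^ i)) = 0" for b :: "nat \<Rightarrow> real" and n :: nat
  proof -
    have intn: "set_integrable lborel {0..} (\<lambda>t. b i * (exp (- (l + real i) * t) * g t))" for i
    proof (intro set_integrable_mult_right set_integrable_bound[OF kint])
      have "(\<lambda>t. exp (- real i * t) * (indicator {0..} t *\<^sub>R k t)) \<in> borel_measurable lborel"
        using kint unfolding set_integrable_def by measurable
      then show "set_borel_measurable lborel {0..} (\<lambda>t. exp (- (l + real i) * t) * g t)"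
        unfolding set_borel_measurable_def k_def
        by (rule measurable_cong[THEN iffD1, rotated]) (auto simp: indicator_def algebra_simps simp flip: exp_add)
      have "exp (- (l + real i) * t) \<le> exp (- l * t)" if "0 \<le> t" for t
        using that by (simp add: algebra_simps)
      then show "AE t in lborel. t \<in> {0..} \<longrightarrow> norm (exp (- (l + real i) * t) * g t) \<le> norm (k t)"
        by (intro AE_I2) (auto simp: k_def abs_mult intro!: mult_right_mono)
    qed
    have "k t * (\<Sum>i\<le>n. b i * exp (- t) ^ i) = (\<Sum>i\<le>n. b i * (exp (- (l + real i) * t) * g t))" for t
      by (simp add: k_def sum_distrib_left exp_of_nat_mult[symmetric] algebra_simps flip: exp_add)
    then have "(LINT t:{0..}|lborel. k t * (\<Sum>i\<le>n. b i * exp (- t) ^ i)) = (LINT t:{0..}|lborel. (\<Sum>i\<le>n. b i * (exp (- (l + real i) * t) * g t)))"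
      by simp
    also have "\<dots> = (\<Sum>i\<le>n. LINT t:{0..}|lborel. b i * (exp (- (l + real i) * t) * g t))"
      using intn unfolding set_lebesgue_integral_def set_integrable_def scaleR_sum_right
      by (intro Bochner_Integration.integral_sum) auto
    also have "\<dots> = 0"
      by (simp only: set_integral_mult_right zero) simp
    finally show ?thesis .
  qed
  \<comment> \<open>A tent of half-width \<delta> around \<open>t0\<close>, as a function of
    \<open>u = exp (- t)\<close>. It vanishes for small positive \<open>u\<close>, namely up to
    \<open>exp (- (t0 + \<delta>))\<close>, and so extends continuously to \<open>u = 0\<close>,
    which stands for infinite time.\<close>
  define q where "q u = max 0 (\<delta> - \<bar>- ln u - t0\<bar>)" for u :: real
  define q' where "q' u = (if u = 0 then 0 else q u)" for u :: real
  have cont_q: "continuous_on {0..1} q'"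
  proof -
    define e where "e = exp (- (t0 + \<delta>))"
    have e: "0 < e" "e < 1"
      using t0 \<delta> by (auto simp: e_def)
    have "continuous_on {e..1} q"
      unfolding q_def using e by (intro continuous_intros) auto
    then have c1: "continuous_on {e..1} q'"
      by (rule continuous_on_eq) (use e in \<open>auto simp: q'_def\<close>)
    have q0: "q' u = 0" if "0 \<le> u" "u \<le> e" for u
    proof (cases "u = 0")
      case False
      then have "ln u \<le> ln e"
        using that by (intro ln_mono) auto
      then show ?thesis
        by (auto simp: q'_def q_def e_def)
    qed (simp add: q'_def)
    have c2: "continuous_on {0..e} q'"
      by (rule continuous_on_eq[of _ "\<lambda>_. 0"]) (use q0 in auto)
    have "{0..1} = {0..e} \<union> {e..1}"
      using e by auto
    then show ?thesis
      using continuous_on_closed_Un[OF _ _ c2 c1] by auto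
  qed
  have qe: "q' (exp (- t)) = max 0 (\<delta> - \<bar>t - t0\<bar>)" for t
    by (simp add: q'_def q_def)
  define I where "I = (LINT t:{0..}|lborel. \<bar>k t\<bar>)"
  have kabs: "set_integrable lborel {0..} (\<lambda>t. \<bar>k t\<bar>)"
    using set_integrable_norm[OF kint] by simp
  have measq: "(\<lambda>t. max 0 (\<delta> - \<bar>t - t0\<bar>)) \<in> borel_measurable lborel"
    by measurable
  have bound_int: "set_integrable lborel {0..} (\<lambda>t. k t * r t)"
    if "r \<in> borel_measurable lborel" "\<And>t. 0 \<le> t \<Longrightarrow> \<bar>r t\<bar> \<le> B" for r B
  proof (rule set_integrable_bound[OF set_integrable_mult_right[OF kint, of B]])
    have "(\<lambda>t. (indicator {0..} t *\<^sub>R k t) * r t) \<in> borel_measurable lborel"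
      using kint that(1) unfolding set_integrable_def by measurable
    then show "set_borel_measurable lborel {0..} (\<lambda>t. k t * r t)"
      by (simp add: set_borel_measurable_def mult.assoc)
    have "norm (k t * r t) \<le> norm (B * k t)" if "0 \<le> t" for t
      using mult_left_mono[OF \<open>\<And>t. 0 \<le> t \<Longrightarrow> \<bar>r t\<bar> \<le> B\<close>[OF that], of "\<bar>k t\<bar>"]
        mult_right_mono[OF abs_ge_self[of B], of "\<bar>k t\<bar>"] by (simp add: abs_mult mult_ac)
    then show "AE t in lborel. t \<in> {0..} \<longrightarrow> norm (k t * r t) \<le> norm (B * k t)"
      by auto
  qed
  have Q0: "\<bar>LINT t:{0..}|lborel. k t * q' (exp (- t))\<bar> \<le> I * e" if e: "0 < e" for e
  proof -
    obtain p where "real_polynomial_function p" and p: "\<And>x. x \<in> {0..1} \<Longrightarrow> \<bar>q' x - p x\<bar> < e"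
      using Stone_Weierstrass_real_polynomial_function[OF compact_Icc cont_q e] by blast
    then obtain b n where pe: "p = (\<lambda>x. \<Sum>i\<le>n. b i * x ^ i)"
      unfolding real_polynomial_function_iff_sum by blast
    have mp: "(\<lambda>t. p (exp (- t))) \<in> borel_measurable lborel"
      unfolding pe by measurable
    have le: "\<bar>q' (exp (- t)) - p (exp (- t))\<bar> \<le> e" if "0 \<le> t" for t
      using p[of "exp (- t)"] that by (simp add: less_imp_le)
    have i1: "set_integrable lborel {0..} (\<lambda>t. k t * q' (exp (- t)))"
      unfolding qe by (rule bound_int[OF measq, of \<delta>]) (use \<delta> in auto)
    have i3: "set_integrable lborel {0..} (\<lambda>t. k t * (q' (exp (- t)) - p (exp (- t))))"
      by (rule bound_int[OF _ le]) (use measq mp in \<open>auto simp: qe\<close>)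
    have "(LINT t:{0..}|lborel. k t * q' (exp (- t))) - (LINT t:{0..}|lborel. k t * (q' (exp (- t)) - p (exp (- t))))
      = (LINT t:{0..}|lborel. k t * p (exp (- t)))"
      unfolding set_integral_diff(2)[OF i1 i3, symmetric] by (simp add: algebra_simps)
    also have "\<dots> = 0"
      unfolding pe by (rule zero_poly)
    finally have "\<bar>LINT t:{0..}|lborel. k t * q' (exp (- t))\<bar> = \<bar>LINT t:{0..}|lborel. k t * (q' (exp (- t)) - p (exp (- t)))\<bar>"
      by simp
    also have "\<dots> \<le> (LINT t:{0..}|lborel. \<bar>k t * (q' (exp (- t)) - p (exp (- t)))\<bar>)"
      using set_integral_norm_bound[OF i3] by simp
    also have "\<dots> \<le> (LINT t:{0..}|lborel. \<bar>k t\<bar> * e)"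
      by (intro set_integral_mono set_integrable_abs i3 set_integrable_mult_left kabs)
        (use le in \<open>auto simp: abs_mult intro: mult_left_mono\<close>)
    also have "\<dots> = I * e"
      by (simp only: set_integral_mult_left I_def)
    finally show ?thesis .
  qed
  have i1: "set_integrable lborel {0..} (\<lambda>t. k t * max 0 (\<delta> - \<bar>t - t0\<bar>))"
    by (rule bound_int[OF measq, of \<delta>]) (use \<delta> in auto)
  have "0 < k t0 / 2 * (\<delta> / 2) * \<delta>"
    using \<open>0 < k t0\<close> \<delta> by simp
  also have "\<dots> = (LINT t:{t0 - \<delta>/2..t0 + \<delta>/2}|lborel. k t0 / 2 * (\<delta> / 2))"
    using \<delta> by (simp add: set_lebesgue_integral_def)
  also have "\<dots> \<le> (LINT t:{t0 - \<delta>/2..t0 + \<delta>/2}|lborel. k t * max 0 (\<delta> - \<bar>t - t0\<bar>))"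
  proof (rule set_integral_mono)
    show "set_integrable lborel {t0 - \<delta>/2..t0 + \<delta>/2} (\<lambda>t. k t * max 0 (\<delta> - \<bar>t - t0\<bar>))"
      by (rule set_integrable_subset[OF i1]) (use \<delta> in auto)
    show "set_integrable lborel {t0 - \<delta>/2..t0 + \<delta>/2} (\<lambda>t. k t0 / 2 * (\<delta> / 2))"
      by (intro borel_integrable_atLeastAtMost' continuous_intros)
    fix t
    assume "t \<in> {t0 - \<delta>/2..t0 + \<delta>/2}"
    then have "\<bar>t - t0\<bar> \<le> \<delta> / 2"
      by (auto simp: abs_if)
    then show "k t0 / 2 * (\<delta> / 2) \<le> k t * max 0 (\<delta> - \<bar>t - t0\<bar>)"
      using kge[of t] \<open>0 < k t0\<close> \<delta> by (intro mult_mono) auto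
  qed
  also have "\<dots> \<le> (LINT t:{0..}|lborel. k t * max 0 (\<delta> - \<bar>t - t0\<bar>))"
  proof -
    have nonneg: "0 \<le> k t * max 0 (\<delta> - \<bar>t - t0\<bar>)" for t
      using kge[of t] \<open>0 < k t0\<close> by (cases "\<bar>t - t0\<bar> \<le> \<delta>") auto
    show ?thesis
      unfolding set_lebesgue_integral_def
    proof (rule integral_mono)
      show "integrable lborel (\<lambda>t. indicat_real {t0 - \<delta>/2..t0 + \<delta>/2} t *\<^sub>R (k t * max 0 (\<delta> - \<bar>t - t0\<bar>)))"
        using set_integrable_subset[OF i1, of "{t0 - \<delta>/2..t0 + \<delta>/2}"] \<delta> by (auto simp: set_integrable_def)
      show "integrable lborel (\<lambda>t. indicat_real {0..} t *\<^sub>R (k t * max 0 (\<delta> - \<bar>t - t0\<bar>)))"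
        using i1 by (simp add: set_integrable_def)
    qed (use nonneg \<delta> in \<open>auto simp: indicator_def\<close>)
  qed
  finally have pos: "0 < (LINT t:{0..}|lborel. k t * q' (exp (- t)))"
    by (simp add: qe)
  have I: "0 \<le> I"
    unfolding I_def set_lebesgue_integral_def by (intro Bochner_Integration.integral_nonneg) auto
  define X where "X = (LINT t:{0..}|lborel. k t * q' (exp (- t)))"
  \<comment> \<open>Approximation with tolerance \<open>X / (2 * (I + 1))\<close> bounds
    \<open>X\<close> by \<open>X / 2\<close>; the \<open>+ 1\<close> avoids dividing by
    zero.\<close>
  have X: "0 < X" "\<bar>X\<bar> \<le> I * (X / (2 * (I + 1)))"
    using pos Q0[of "X / (2 * (I + 1))"] I by (auto simp: X_def)
  have "I * (X / (2 * (I + 1))) \<le> (I + 1) * (X / (2 * (I + 1)))"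
    using X(1) I by (intro mult_right_mono) auto
  also have "\<dots> = X / 2"
  proof -
    have cancel: "Y * (X / (2 * Y)) = X / 2" if "Y \<noteq> 0" for Y
      by (simp add: that)
    show ?thesis
      by (rule cancel) (use I in simp)
  qed
  finally show False
    using X by linarith
qed

text \<open>The real lemma is one-sided, so it is applied to the difference composed with each of
  \<open>Re\<close>, \<open>- Re\<close>, \<open>Im\<close> and \<open>- Im\<close>, with the
  transform taken at the points \<open>l + 1 + n\<close>.\<close>

theorem laplace_unique:
  fixes g g' :: "real \<Rightarrow> complex"
  assumes cont: "continuous_on {0<..} g" "continuous_on {0<..} g'"
    and int: "\<And>r. l < r \<Longrightarrow> set_integrable lborel {0..} (\<lambda>t. exp (- of_real r * of_real t) * g t)"
      "\<And>r. l < r \<Longrightarrow> set_integrable lborel {0..} (\<lambda>t. exp (- of_real r * of_real t) * g' t)"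
    and eq: "\<And>r. l < r \<Longrightarrow> (LINT t:{0..}|lborel. exp (- of_real r * of_real t) * g t)
      = (LINT t:{0..}|lborel. exp (- of_real r * of_real t) * g' t)" and t: "0 < t"
  shows "g t = g' t"
proof -
  have *: "\<phi> (g t) \<le> \<phi> (g' t)" if \<phi>: "bounded_linear \<phi>" for \<phi> :: "complex \<Rightarrow> real"
  proof -
    interpret \<phi>: bounded_linear \<phi>
      by fact
    have e: "exp (- of_real r * of_real t) * (z::complex) = exp (- r * t) *\<^sub>R z" for r t z
      by (simp add: scaleR_conv_of_real exp_of_real[symmetric])
    have i: "set_integrable lborel {0..} (\<lambda>t. exp (- r * t) *\<^sub>R (g t - g' t))" if "l < r" for r
      using set_integral_diff(1)[OF int(1)[OF that] int(2)[OF that]] unfolding e by (simp add: scaleR_diff_right)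
    have "\<phi> (g t - g' t) \<le> 0"
    proof (rule laplace_zero_real[of "\<lambda>t. \<phi> (g t - g' t)" "l + 1"])
      show "continuous_on {0<..} (\<lambda>t. \<phi> (g t - g' t))"
        by (intro \<phi>.continuous_on continuous_intros cont)
      show "set_integrable lborel {0..} (\<lambda>t. exp (- (l + 1) * t) * \<phi> (g t - g' t))"
        using integrable_bounded_linear[OF \<phi> i[of "l + 1", unfolded set_integrable_def]]
        by (simp add: set_integrable_def \<phi>.scaleR mult.assoc)
      fix n :: nat
      have ln: "l < l + 1 + real n"
        by simp
      have "(LINT t:{0..}|lborel. exp (- (l + 1 + real n) * t) * \<phi> (g t - g' t)) = \<phi> (LINT t:{0..}|lborel. exp (- (l + 1 + real n) * t) *\<^sub>R (g t - g' t))"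
        using integral_bounded_linear[OF \<phi> i[OF ln, unfolded set_integrable_def]]
        by (simp add: set_lebesgue_integral_def \<phi>.scaleR mult.assoc)
      also have "(LINT t:{0..}|lborel. exp (- (l + 1 + real n) * t) *\<^sub>R (g t - g' t)) = 0"
        using set_integral_diff(2)[OF int(1)[OF ln] int(2)[OF ln]] eq[OF ln] unfolding e by (simp add: scaleR_diff_right)
      finally show "(LINT t:{0..}|lborel. exp (- (l + 1 + real n) * t) * \<phi> (g t - g' t)) = 0"
        by (simp add: \<phi>.zero)
    qed fact
    then show ?thesis
      by (simp add: \<phi>.diff)
  qed
  have "Re (g t) = Re (g' t)"
    using *[OF bounded_linear_Re] *[OF bounded_linear_minus[OF bounded_linear_Re]] by linarith
  moreover have "Im (g t) = Im (g' t)"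
    using *[OF bounded_linear_Im] *[OF bounded_linear_minus[OF bounded_linear_Im]] by linarith
  ultimately show ?thesis
    by (simp add: complex_eq_iff)
qed

section \<open>Invertibility of the symbol\<close>

text \<open>Reason for the slope \<open>- cos \<nu>\<close>: the boundary of the sector is
  \<open>Re z = cos \<nu> * cmod z\<close>, and since \<open>cos \<nu>\<close> is negative,
  replacing \<open>cmod z\<close> by \<open>\<bar>Im z\<bar>\<close> moves to the right. The slope
  also lies in the range that the contour estimates require.\<close>

lemma wedge_subset_sector:
  assumes \<nu>: "pi / 2 < \<nu>" "\<nu> < pi" and a: "0 < a"
  shows "wedge a (- cos \<nu>) \<subseteq> sector \<nu>"
proof
  fix z
  assume z: "z \<in> wedge a (- cos \<nu>)"
  have c: "0 \<le> - cos \<nu>"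
    using cos_monotone_0_pi_le[of "pi / 2" \<nu>] \<nu> by simp
  have z0: "z \<noteq> 0"
    using z a by (auto simp: wedge_def)
  have "- cos \<nu> * \<bar>Im z\<bar> \<le> - cos \<nu> * cmod z"
    using c abs_Im_le_cmod by (intro mult_left_mono) auto
  then have "cos \<nu> * cmod z < Re z"
    using z a by (simp add: wedge_def)
  moreover have "Re z = cmod z * cos \<bar>Arg z\<bar>"
  proof -
    have "Re z = Re (of_real (cmod z) * exp (\<i> * of_real (Arg z)))"
      using Arg_eq[OF z0] by simp
    then show ?thesis
      by (simp add: Re_exp)
  qed
  ultimately have "cos \<nu> < cos \<bar>Arg z\<bar>"
    using z0 by (simp add: mult.commute)
  then have "\<bar>Arg z\<bar> < \<nu>"
  proof (rule contrapos_pp)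
    assume "\<not> \<bar>Arg z\<bar> < \<nu>"
    moreover have "\<bar>Arg z\<bar> \<le> pi"
      using Arg_bounded[of z] by linarith
    ultimately show "\<not> cos \<nu> < cos \<bar>Arg z\<bar>"
      using cos_monotone_0_pi_le[of \<nu> "\<bar>Arg z\<bar>"] \<nu> by simp
  qed
  then show "z \<in> sector \<nu>"
    using z0 by (simp add: sector_def)
qed

definition open_wedge :: "real \<Rightarrow> real \<Rightarrow> complex set"
  where "open_wedge a c = {z. a - c * \<bar>Im z\<bar> < Re z}"

lemma open_open_wedge: "open (open_wedge a c)"
  unfolding open_wedge_def by (intro open_Collect_less continuous_intros)

lemma wedge_subset_open_wedge: "a < b \<Longrightarrow> wedge b c \<subseteq> open_wedge a c"
  and open_wedge_subset_wedge: "open_wedge a c \<subseteq> wedge a c"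
  by (auto simp: wedge_def open_wedge_def)

text \<open>A bound on the quotients makes the supremum in \<open>onorm_on\<close> a genuine least
  upper bound; where \<open>n\<close> vanishes the bound gives \<open>F z = 0\<close>
  directly.\<close>

lemma onorm_on_bound:
  assumes bdd: "\<And>x. x \<in> D \<Longrightarrow> norm (F x) \<le> k * n x" and n: "\<And>x. x \<in> D \<Longrightarrow> 0 \<le> n x" and z: "z \<in> D"
  shows "norm (F z) \<le> onorm_on D n F * n z"
proof (cases "n z = 0")
  case True
  then show ?thesis
    using bdd[OF z] by simp
next
  case False
  then have pos: "0 < n z"
    using n[OF z] by simp
  have "norm (F x) / n x \<le> \<bar>k\<bar>" if "x \<in> D" for x
  proof (cases "n x = 0")
    case False
    then have "0 < n x"
      using n[OF that] by simp
    moreover have "norm (F x) \<le> \<bar>k\<bar> * n x"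
      using bdd[OF that] n[OF that] mult_right_mono[OF abs_ge_self[of k], of "n x"] by linarith
    ultimately show ?thesis
      by (simp add: pos_divide_le_eq)
  qed simp
  then have "bdd_above ((\<lambda>x. norm (F x) / n x) ` D)"
    by (intro bdd_aboveI) auto
  then have "norm (F z) / n z \<le> onorm_on D n F"
    unfolding onorm_on_def by (rule cSUP_upper[OF z])
  then show ?thesis
    using pos by (simp add: pos_divide_le_eq)
qed

text \<open>Operator-norm differentiability implies strong differentiability. The open set
  \<open>V\<close> guarantees that \<open>F (\<mu> + h)\<close> is bounded for small
  \<open>h\<close>, without which the supremum in \<open>onorm_on\<close> would carry no
  information.\<close>

lemma operator_analytic_on_pointwise:
  fixes F :: "complex \<Rightarrow> 'a::complex_normed_vector \<Rightarrow> 'b::complex_normed_vector"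
  assumes an: "operator_analytic_on D n \<Omega> F" and V: "open V" "V \<subseteq> \<Omega>" "\<mu> \<in> V"
    and n: "\<And>x. x \<in> D \<Longrightarrow> 0 \<le> n x" and z: "z \<in> D"
  shows "\<exists>L. ((\<lambda>h. inverse h *C (F (\<mu> + h) z - F \<mu> z)) \<longlongrightarrow> L) (at 0)"
proof -
  obtain L where L: "bounded_operator_on D n L"
    "((\<lambda>h. onorm_on D n (\<lambda>x. inverse h *C (F (\<mu> + h) x - F \<mu> x) - L x)) \<longlongrightarrow> 0) (at 0)"
    using an V unfolding operator_analytic_on_def by blast
  have bop: "\<exists>k. \<forall>x\<in>D. norm (F \<mu>' x) \<le> k * n x" if "\<mu>' \<in> V" for \<mu>'
    using an V that unfolding operator_analytic_on_def bounded_operator_on_def by blast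
  obtain k1 where k1: "\<forall>x\<in>D. norm (F \<mu> x) \<le> k1 * n x"
    using bop V by blast
  obtain k2 where k2: "\<forall>x\<in>D. norm (L x) \<le> k2 * n x"
    using L unfolding bounded_operator_on_def by blast
  have "\<forall>\<^sub>F h in at 0. \<mu> + h \<in> V"
  proof -
    have "((\<lambda>h. \<mu> + h) \<longlongrightarrow> \<mu> + 0) (at 0)"
      by (intro tendsto_intros)
    then show ?thesis
      using topological_tendstoD[OF _ V(1), of "\<lambda>h. \<mu> + h" "\<mu> + 0"] V(3) by simp
  qed
  then have "\<forall>\<^sub>F h in at 0. norm (inverse h *C (F (\<mu> + h) z - F \<mu> z) - L z)
    \<le> onorm_on D n (\<lambda>x. inverse h *C (F (\<mu> + h) x - F \<mu> x) - L x) * n z"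
  proof eventually_elim
    case (elim h)
    obtain k3 where k3: "\<forall>x\<in>D. norm (F (\<mu> + h) x) \<le> k3 * n x"
      using bop elim by blast
    show ?case
    proof (rule onorm_on_bound[OF _ n z])
      fix x
      assume x: "x \<in> D"
      have "norm (F (\<mu> + h) x - F \<mu> x) \<le> (k3 + k1) * n x"
      proof -
        have "norm (F (\<mu> + h) x) \<le> k3 * n x" "norm (F \<mu> x) \<le> k1 * n x"
          using k3 k1 x by auto
        then show ?thesis
          using norm_triangle_ineq4[of "F (\<mu> + h) x" "F \<mu> x"] by (simp add: distrib_right)
      qed
      then have "cmod (inverse h) * norm (F (\<mu> + h) x - F \<mu> x) \<le> cmod (inverse h) * ((k3 + k1) * n x)"
        by (intro mult_left_mono) auto
      moreover have "norm (L x) \<le> k2 * n x"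
        using k2 x by blast
      ultimately have "cmod (inverse h) * norm (F (\<mu> + h) x - F \<mu> x) + norm (L x) \<le> (cmod (inverse h) * (k3 + k1) + k2) * n x"
        by (simp add: distrib_right mult.assoc)
      then show "norm (inverse h *C (F (\<mu> + h) x - F \<mu> x) - L x) \<le> (cmod (inverse h) * (k3 + k1) + k2) * n x"
        using norm_triangle_ineq4[of "inverse h *C (F (\<mu> + h) x - F \<mu> x)" "L x"] by (simp add: norm_scaleC)
    qed
  qed
  then have "((\<lambda>h. inverse h *C (F (\<mu> + h) z - F \<mu> z) - L z) \<longlongrightarrow> 0) (at 0)"
    by (rule Lim_null_comparison) (use tendsto_mult[OF L(2) tendsto_const] in simp)
  then show ?thesis
    using Lim_null by blast
qed

lemma graph_norm_nonneg: "0 \<le> graph_norm A z"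
  by (simp add: graph_norm_def)

lemma linear_operator_diff:
  assumes "linear_operator D A" "x \<in> D" "y \<in> D"
  shows "x - y \<in> D" "A (x - y) = A x - A y"
proof -
  have neg: "- 1 *C y = - y"
    by (simp add: scaleC.minus_left)
  have my: "- y \<in> D"
    using assms neg unfolding linear_operator_def csubspace_def by metis
  have Amy: "A (- y) = - A y"
    using assms neg unfolding linear_operator_def by (metis scaleC_one scaleC.minus_left)
  show "x - y \<in> D"
    using assms my unfolding linear_operator_def csubspace_def by (metis diff_conv_add_uminus)
  show "A (x - y) = A x - A y"
    using assms my Amy unfolding linear_operator_def by (metis diff_conv_add_uminus)
qed

lemma resolvent_facts:
  assumes "\<mu> \<in> resolvent_set D A"
  shows "resolvent D A \<mu> x \<in> D" "\<mu> *C resolvent D A \<mu> x - A (resolvent D A \<mu> x) = x"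
    "z \<in> D \<Longrightarrow> resolvent D A \<mu> (\<mu> *C z - A z) = z" "bounded_linear (resolvent D A \<mu>)"
  using assms unfolding resolvent_set_def resolvent_def
  by (auto simp: bij_betw_def inv_into_into f_inv_into_f[of x "\<lambda>x. \<mu> *C x - A x" D]
      inv_into_f_f[of "\<lambda>x. \<mu> *C x - A x" D z])

context
  fixes \<nu> \<alpha> :: real and D :: "'w::{complex_banach, second_countable_topology} set" and A :: "'w \<Rightarrow> 'w"
    and G :: "real \<Rightarrow> 'w \<Rightarrow>\<^sub>L 'w" and Gh :: "complex \<Rightarrow> 'w \<Rightarrow>\<^sub>L 'w"
    and DN :: "real \<Rightarrow> 'w set" and N :: "real \<Rightarrow> 'w \<Rightarrow> 'w" and Nh :: "complex \<Rightarrow> 'w \<Rightarrow> 'w"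
  assumes A: "closed_operator D A" and Cd1: "Cd1 \<nu> D A" and Cd2: "Cd2 \<nu> \<alpha> D A G Gh" and Cd3: "Cd3 \<nu> D A DN N Nh"
begin

definition symbol :: "complex \<Rightarrow> 'w \<Rightarrow> 'w"
  where "symbol \<mu> z = \<mu> *C z + \<mu> *C Gh \<mu> z - A z - Nh \<mu> z"

text \<open>The operator \<open>F(\<lambda>)\<close> of the contour formula as a total function; its
  values are meaningful where \<open>symbol \<mu>\<close> is a bijection from
  \<open>D\<close>.\<close>

definition symbol_inverse :: "complex \<Rightarrow> 'w \<Rightarrow> 'w"
  where "symbol_inverse \<mu> x = (THE z. z \<in> D \<and> symbol \<mu> z = x)"

lemma A_linear: "linear_operator D A"
  using A by (simp add: closed_operator_def)

lemma Nh_linear: "\<mu> \<in> sector \<nu> \<Longrightarrow> linear_operator D (Nh \<mu>)"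
  using Cd3 by (simp add: Cd3_def operator_analytic_on_def bounded_operator_on_def)

lemma symbol_diff:
  assumes "\<mu> \<in> sector \<nu>" "x \<in> D" "y \<in> D"
  shows "symbol \<mu> (x - y) = symbol \<mu> x - symbol \<mu> y"
  unfolding symbol_def linear_operator_diff(2)[OF A_linear assms(2,3)]
    linear_operator_diff(2)[OF Nh_linear[OF assms(1)] assms(2,3)]
  by (simp add: scaleC.diff_right blinfun.diff_right algebra_simps)

text \<open>Since \<open>symbol \<mu> = (1 + P) (\<mu> - A)\<close> with \<open>P = \<mu> Gh \<mu> R(\<mu>, A) - Nh \<mu> R(\<mu>, A)\<close>, the symbol is
  invertible wherever \<open>P\<close> has norm at most \<open>1/2\<close>, which holds far out in the sector.\<close>

lemma symbol_invertible:
  "\<exists>r C. 0 < r \<and> 0 < C \<and> (\<forall>\<mu>\<in>sector \<nu>. r \<le> cmod \<mu> \<longrightarrow>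
    (\<forall>x. symbol_inverse \<mu> x \<in> D \<and> symbol \<mu> (symbol_inverse \<mu> x) = x \<and>
      norm (symbol_inverse \<mu> x) \<le> C / cmod \<mu> * norm x \<and> graph_norm A (symbol_inverse \<mu> x) \<le> C * norm x) \<and>
    (\<forall>z\<in>D. symbol_inverse \<mu> (symbol \<mu> z) = z))"
proof -
  obtain M0 where M0: "0 < M0" "\<And>\<mu>. \<mu> \<in> sector \<nu> \<Longrightarrow> onorm (resolvent D A \<mu>) \<le> M0 / cmod \<mu>"
    and res: "sector \<nu> \<subseteq> resolvent_set D A"
    using Cd1 by (auto simp: Cd1_def)
  obtain N1 where N1: "0 < N1" "\<And>\<mu>. \<mu> \<in> sector \<nu> \<Longrightarrow> norm (Gh \<mu>) \<le> N1 * cmod \<mu> powr (- \<alpha>)"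
    using Cd2 by (auto simp: Cd2_def)
  have \<alpha>: "0 < \<alpha>"
    using Cd2 by (simp add: Cd2_def)
  \<comment> \<open>The summands bound \<open>resolvent D A \<mu>\<close> and \<open>A\<close> times
    it for \<open>cmod \<mu> \<ge> 1\<close>, so \<open>K\<close> is a bound into the graph norm.
    Each of the two parts of \<open>P\<close> is later given the share 1/4.\<close>
  define K where "K = M0 + (M0 + 1)"
  have K: "0 < K"
    using M0 by (simp add: K_def)
  have "((\<lambda>x. N1 * M0 * x powr (- \<alpha>)) \<longlongrightarrow> 0) at_top"
    using \<alpha> by real_asymp
  then have "\<forall>\<^sub>F x in at_top. N1 * M0 * x powr (- \<alpha>) < 1 / 4"
    by (rule order_tendstoD) simp
  then obtain r1 where r1: "\<And>x. r1 \<le> x \<Longrightarrow> N1 * M0 * x powr (- \<alpha>) < 1 / 4"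
    by (auto simp: eventually_at_top_linorder)
  have "((\<lambda>\<mu>. onorm_on D (graph_norm A) (Nh \<mu>)) \<longlongrightarrow> 0) (inf at_infinity (principal (sector \<nu>)))"
    using Cd3 by (simp add: Cd3_def)
  then have "\<forall>\<^sub>F \<mu> in inf at_infinity (principal (sector \<nu>)). onorm_on D (graph_norm A) (Nh \<mu>) < 1 / (4 * K)"
    by (rule order_tendstoD) (use K in simp)
  then obtain r2 where r2: "\<And>\<mu>. r2 \<le> cmod \<mu> \<Longrightarrow> \<mu> \<in> sector \<nu> \<Longrightarrow> onorm_on D (graph_norm A) (Nh \<mu>) < 1 / (4 * K)"
    by (auto simp: eventually_inf_principal eventually_at_infinity)
  define r where "r = max 1 (max r1 r2)"
  \<comment> \<open>The factor 2 is the bound for the inverse of \<open>1 + P\<close>.\<close>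
  define C where "C = 2 * K"
  have "(\<forall>x. symbol_inverse \<mu> x \<in> D \<and> symbol \<mu> (symbol_inverse \<mu> x) = x \<and>
      norm (symbol_inverse \<mu> x) \<le> C / cmod \<mu> * norm x \<and> graph_norm A (symbol_inverse \<mu> x) \<le> C * norm x) \<and>
    (\<forall>z\<in>D. symbol_inverse \<mu> (symbol \<mu> z) = z)" if \<mu>: "\<mu> \<in> sector \<nu>" "r \<le> cmod \<mu>" for \<mu>
  proof -
    have m1: "1 \<le> cmod \<mu>" "r1 \<le> cmod \<mu>" "r2 \<le> cmod \<mu>"
      using \<mu>(2) by (auto simp: r_def)
    then have \<mu>0: "\<mu> \<noteq> 0"
      by auto
    let ?R = "resolvent D A \<mu>"
    note R = resolvent_facts[OF subsetD[OF res \<mu>(1)]]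
    interpret R: bounded_linear ?R
      by (rule R(4))
    have nR: "norm (?R x) \<le> M0 / cmod \<mu> * norm x" for x
      using onorm[OF R(4), of x] mult_right_mono[OF M0(2)[OF \<mu>(1)], of "norm x"] by simp
    have AR: "A (?R x) = \<mu> *C ?R x - x" for x
      using R(2)[of x] by (simp add: algebra_simps)
    have nAR: "norm (A (?R x)) \<le> (M0 + 1) * norm x" for x
    proof -
      have "norm (A (?R x)) \<le> cmod \<mu> * norm (?R x) + norm x"
        unfolding AR using norm_triangle_ineq4[of "\<mu> *C ?R x" x] by (simp add: norm_scaleC)
      also have "cmod \<mu> * norm (?R x) \<le> cmod \<mu> * (M0 / cmod \<mu> * norm x)"
        by (intro mult_left_mono nR) auto
      also have "\<dots> = M0 * norm x"
        using \<mu>0 by simp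
      finally show ?thesis
        by (simp add: distrib_right)
    qed
    have gR: "graph_norm A (?R x) \<le> K * norm x" for x
    proof -
      have "M0 / cmod \<mu> * norm x \<le> M0 * norm x"
        using m1 M0 by (intro mult_right_mono) (auto simp: divide_le_eq)
      then show ?thesis
        using nR[of x] nAR[of x] by (simp add: graph_norm_def K_def distrib_right)
    qed
    define P where "P y = \<mu> *C Gh \<mu> (?R y) - Nh \<mu> (?R y)" for y
    have P_diff: "P (x - y) = P x - P y" for x y
      unfolding P_def R.diff using linear_operator_diff[OF Nh_linear[OF \<mu>(1)] R(1) R(1)]
      by (simp add: blinfun.diff_right scaleC.diff_right)
    have P_le: "norm (P y) \<le> 1 / 2 * norm y" for y
    proof -
      have "norm (\<mu> *C Gh \<mu> (?R y)) \<le> cmod \<mu> * ((N1 * cmod \<mu> powr (- \<alpha>)) * (M0 / cmod \<mu> * norm y))"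
        unfolding norm_scaleC
        using N1(1) by (intro mult_left_mono order_trans[OF norm_blinfun] mult_mono N1(2) \<mu> nR) auto
      also have "\<dots> = N1 * M0 * cmod \<mu> powr (- \<alpha>) * norm y"
        using \<mu>0 by simp
      also have "\<dots> \<le> 1 / 4 * norm y"
        using r1[OF m1(2)] by (intro mult_right_mono) auto
      finally have 1: "norm (\<mu> *C Gh \<mu> (?R y)) \<le> 1 / 4 * norm y" .
      have "norm (Nh \<mu> (?R y)) \<le> onorm_on D (graph_norm A) (Nh \<mu>) * graph_norm A (?R y)"
        using Cd3 \<mu>(1) R(1) by (simp add: Cd3_def)
      also have "\<dots> \<le> 1 / (4 * K) * graph_norm A (?R y)"
        using r2[OF m1(3) \<mu>(1)] by (intro mult_right_mono graph_norm_nonneg) auto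
      also have "\<dots> \<le> 1 / (4 * K) * (K * norm y)"
        using K by (intro mult_left_mono gR) auto
      also have "\<dots> = 1 / 4 * norm y"
        using K by simp
      finally show ?thesis
        using 1 norm_triangle_ineq4[of "\<mu> *C Gh \<mu> (?R y)" "Nh \<mu> (?R y)"] unfolding P_def by argo
    qed
    have symR: "symbol \<mu> (?R y) = y + P y" for y
      by (simp add: symbol_def P_def AR)
    \<comment> \<open>A fixed point of a contraction with constant 1/2 replaces the Neumann
      series.\<close>
    have ex1: "\<exists>!y. y + P y = x" for x
    proof -
      have "\<exists>!y. x - P y = y"
      proof (rule banach_fix_type[of "1/2"], simp, simp, intro allI)
        fix u v
        have "dist (x - P u) (x - P v) = norm (P (u - v))"
          by (simp add: P_diff dist_norm norm_minus_commute)
        then show "dist (x - P u) (x - P v) \<le> 1 / 2 * dist u v"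
          using P_le[of "u - v"] by (simp add: dist_norm)
      qed
      moreover have "x - P y = y \<longleftrightarrow> y + P y = x" for y
        by (auto simp: algebra_simps)
      ultimately show ?thesis
        by simp
    qed
    have uniq: "z = z'" if "z \<in> D" "z' \<in> D" "symbol \<mu> z = symbol \<mu> z'" for z z'
      using ex1[of "symbol \<mu> z'"] R(3)[OF that(1)] R(3)[OF that(2)] symR that(3) by metis
    have inv: "symbol_inverse \<mu> x = z" if "z \<in> D" "symbol \<mu> z = x" for x z
      unfolding symbol_inverse_def using uniq that by (intro the_equality) auto
    have "symbol_inverse \<mu> x \<in> D \<and> symbol \<mu> (symbol_inverse \<mu> x) = x \<and>
      norm (symbol_inverse \<mu> x) \<le> C / cmod \<mu> * norm x \<and> graph_norm A (symbol_inverse \<mu> x) \<le> C * norm x" for x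
    proof -
      obtain y where y: "y + P y = x"
        using ex1 by blast
      have "symbol_inverse \<mu> x = ?R y"
        by (rule inv) (use R(1) symR y in auto)
      moreover have "norm y \<le> 2 * norm x"
      proof -
        have "y = x - P y"
          using y by (simp add: algebra_simps)
        then have "norm y \<le> norm x + norm (P y)"
          using norm_triangle_ineq4[of x "P y"] by simp
        then show ?thesis
          using P_le[of y] by simp
      qed
      moreover have "M0 / cmod \<mu> * norm y \<le> C / cmod \<mu> * norm x"
      proof -
        have "M0 / cmod \<mu> * norm y \<le> K / cmod \<mu> * (2 * norm x)"
          using M0 \<open>norm y \<le> _\<close> m1 by (intro mult_mono divide_right_mono) (auto simp: K_def)
        then show ?thesis
          by (simp add: C_def mult_ac)
      qed
      moreover have "K * norm y \<le> C * norm x"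
        using mult_left_mono[OF \<open>norm y \<le> _\<close>, of K] K by (simp add: C_def)
      ultimately show ?thesis
        using nR[of y] gR[of y] R(1) symR y by auto
    qed
    then show ?thesis
      using inv by blast
  qed
  then show ?thesis
    using K by (intro exI[of _ r] exI[of _ C]) (auto simp: r_def C_def)
qed

lemma symbol_derivative:
  assumes V: "open V" "V \<subseteq> sector \<nu>" "\<mu> \<in> V" and z: "z \<in> D"
  shows "\<exists>L. ((\<lambda>h. inverse h *C (symbol (\<mu> + h) z - symbol \<mu> z)) \<longlongrightarrow> L) (at 0)"
proof -
  have "operator_analytic_on UNIV norm (sector \<nu>) (\<lambda>\<mu>. blinfun_apply (Gh \<mu>))"
    using Cd2 by (simp add: Cd2_def)
  from operator_analytic_on_pointwise[OF this V]
  obtain L1 where L1: "((\<lambda>h. inverse h *C (Gh (\<mu> + h) z - Gh \<mu> z)) \<longlongrightarrow> L1) (at 0)"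
    by auto
  have "operator_analytic_on D (graph_norm A) (sector \<nu>) Nh"
    using Cd3 by (simp add: Cd3_def)
  from operator_analytic_on_pointwise[OF this V graph_norm_nonneg z]
  obtain L2 where L2: "((\<lambda>h. inverse h *C (Nh (\<mu> + h) z - Nh \<mu> z)) \<longlongrightarrow> L2) (at 0)"
    by auto
  have eq: "inverse h *C (symbol (\<mu> + h) z - symbol \<mu> z)
    = z + (\<mu> + h) *C (inverse h *C (Gh (\<mu> + h) z - Gh \<mu> z)) + Gh \<mu> z - inverse h *C (Nh (\<mu> + h) z - Nh \<mu> z)"
    if "h \<noteq> 0" for h
  proof -
    have eq: "symbol (\<mu> + h) z - symbol \<mu> z
      = h *C z + (\<mu> + h) *C (Gh (\<mu> + h) z - Gh \<mu> z) + h *C Gh \<mu> z - (Nh (\<mu> + h) z - Nh \<mu> z)"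
      by (simp add: symbol_def scaleC_add_left scaleC.diff_right algebra_simps)
    show ?thesis
      unfolding eq using that by (simp add: scaleC_add_right scaleC.diff_right scaleC_scaleC mult.commute)
  qed
  have "((\<lambda>h. z + (\<mu> + h) *C (inverse h *C (Gh (\<mu> + h) z - Gh \<mu> z)) + Gh \<mu> z - inverse h *C (Nh (\<mu> + h) z - Nh \<mu> z))
    \<longlongrightarrow> z + (\<mu> + 0) *C L1 + Gh \<mu> z - L2) (at 0)"
    by (intro tendsto_intros scaleC.tendsto L1 L2)
  then have "((\<lambda>h. inverse h *C (symbol (\<mu> + h) z - symbol \<mu> z)) \<longlongrightarrow> z + (\<mu> + 0) *C L1 + Gh \<mu> z - L2) (at 0)"
    by (rule Lim_transform_eventually) (auto simp: eventually_at_filter eq)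
  then show ?thesis
    by blast
qed

text \<open>The wedge with vertex \<open>a\<close> stays at distance \<open>a / 2\<close> from 0,
  hence the vertex \<open>2 * r\<close>.\<close>

lemma symbol_inverse_exists:
  "\<exists>a C. 0 < a \<and> 0 < C \<and> wedge a (- cos \<nu>) \<subseteq> sector \<nu> \<and> (\<forall>\<mu>\<in>wedge a (- cos \<nu>).
    (\<forall>x. symbol_inverse \<mu> x \<in> D \<and> symbol \<mu> (symbol_inverse \<mu> x) = x \<and>
      norm (symbol_inverse \<mu> x) \<le> C / cmod \<mu> * norm x \<and> graph_norm A (symbol_inverse \<mu> x) \<le> C * norm x) \<and>
    (\<forall>z\<in>D. symbol_inverse \<mu> (symbol \<mu> z) = z))"
proof -
  obtain r C where rC: "0 < r" "0 < C" "\<And>\<mu>. \<mu> \<in> sector \<nu> \<Longrightarrow> r \<le> cmod \<mu> \<Longrightarrow>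
    (\<forall>x. symbol_inverse \<mu> x \<in> D \<and> symbol \<mu> (symbol_inverse \<mu> x) = x \<and>
      norm (symbol_inverse \<mu> x) \<le> C / cmod \<mu> * norm x \<and> graph_norm A (symbol_inverse \<mu> x) \<le> C * norm x) \<and>
    (\<forall>z\<in>D. symbol_inverse \<mu> (symbol \<mu> z) = z)"
    using symbol_invertible by blast
  have \<nu>: "pi / 2 < \<nu>" "\<nu> < pi"
    using Cd1 by (auto simp: Cd1_def)
  have c: "0 < - cos \<nu>" "- cos \<nu> \<le> 1"
    using cos_monotone_0_pi[of "pi / 2" \<nu>] \<nu> cos_ge_minus_one[of \<nu>] by auto
  have sub: "wedge (2 * r) (- cos \<nu>) \<subseteq> sector \<nu>"
    using wedge_subset_sector[OF \<nu>] rC(1) by simp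
  have "r \<le> cmod \<mu>" if "\<mu> \<in> wedge (2 * r) (- cos \<nu>)" for \<mu>
    using wedge_norm_ge[OF _ c that] rC(1) by simp
  then show ?thesis
    using rC sub by (intro exI[of _ "2 * r"] exI[of _ C]) (simp add: subset_iff)
qed

section \<open>Continuity and holomorphy of the inverse symbol\<close>

context
  fixes a C :: real
  assumes a: "0 < a" and C: "0 < C" and sub: "wedge a (- cos \<nu>) \<subseteq> sector \<nu>"
    and inv_D: "\<And>\<mu> x. \<mu> \<in> wedge a (- cos \<nu>) \<Longrightarrow> symbol_inverse \<mu> x \<in> D"
    and inv_right: "\<And>\<mu> x. \<mu> \<in> wedge a (- cos \<nu>) \<Longrightarrow> symbol \<mu> (symbol_inverse \<mu> x) = x"
    and inv_norm: "\<And>\<mu> x. \<mu> \<in> wedge a (- cos \<nu>) \<Longrightarrow> norm (symbol_inverse \<mu> x) \<le> C / cmod \<mu> * norm x"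
    and inv_graph: "\<And>\<mu> x. \<mu> \<in> wedge a (- cos \<nu>) \<Longrightarrow> graph_norm A (symbol_inverse \<mu> x) \<le> C * norm x"
    and inv_left: "\<And>\<mu> z. \<mu> \<in> wedge a (- cos \<nu>) \<Longrightarrow> z \<in> D \<Longrightarrow> symbol_inverse \<mu> (symbol \<mu> z) = z"
begin

lemma symbol_inverse_diff:
  assumes "\<mu> \<in> wedge a (- cos \<nu>)"
  shows "symbol_inverse \<mu> (x - y) = symbol_inverse \<mu> x - symbol_inverse \<mu> y"
proof -
  have "symbol \<mu> (symbol_inverse \<mu> x - symbol_inverse \<mu> y) = x - y"
    using symbol_diff[of \<mu>] inv_D[OF assms] inv_right[OF assms] sub assms by auto
  then show ?thesis
    using inv_left[OF assms linear_operator_diff(1)[OF A_linear inv_D[OF assms] inv_D[OF assms]]] by metis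
qed

text \<open>The resolvent identity, with S for the symbol and F for its inverse: F(\<mu> + h) -
  F(\<mu>) = - F(\<mu> + h) (S(\<mu> + h) - S(\<mu>)) F(\<mu>). Strong differentiability of S on
  \<open>D\<close> and the uniform bounds for F near \<mu> give graph-norm continuity, then
  differentiability.\<close>

lemma symbol_inverse_limits:
  assumes \<mu>: "\<mu> \<in> open_wedge a (- cos \<nu>)"
  shows "((\<lambda>h. graph_norm A (symbol_inverse (\<mu> + h) x - symbol_inverse \<mu> x)) \<longlongrightarrow> 0) (at 0)"
    and "\<exists>L. ((\<lambda>h. inverse h *C (symbol_inverse (\<mu> + h) x - symbol_inverse \<mu> x)) \<longlongrightarrow> L) (at 0)"
proof -
  let ?W = "wedge a (- cos \<nu>)"
  have \<mu>W: "\<mu> \<in> ?W"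
    using \<mu> open_wedge_subset_wedge by blast
  have near: "\<forall>\<^sub>F h in at 0. \<mu> + h \<in> ?W"
  proof -
    have "((\<lambda>h. \<mu> + h) \<longlongrightarrow> \<mu> + 0) (at 0)"
      by (intro tendsto_intros)
    then have "\<forall>\<^sub>F h in at 0. \<mu> + h \<in> open_wedge a (- cos \<nu>)"
      using topological_tendstoD[OF _ open_open_wedge, of "\<lambda>h. \<mu> + h" "\<mu> + 0"] \<mu> by simp
    then show ?thesis
      by (rule eventually_mono) (use open_wedge_subset_wedge in blast)
  qed
  have cos: "0 < - cos \<nu>" "- cos \<nu> \<le> 1"
    using cos_monotone_0_pi[of "pi / 2" \<nu>] Cd1 cos_ge_minus_one[of \<nu>] by (auto simp: Cd1_def)
  have inv_norm': "norm (symbol_inverse \<mu>' y) \<le> C / (a / 2) * norm y" if "\<mu>' \<in> ?W" for \<mu>' y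
  proof -
    have "C / cmod \<mu>' \<le> C / (a / 2)"
      using wedge_norm_ge[OF a cos that] a C by (intro divide_left_mono mult_pos_pos) auto
    then show ?thesis
      by (intro order_trans[OF inv_norm[OF that] mult_right_mono]) auto
  qed
  have sub': "open_wedge a (- cos \<nu>) \<subseteq> sector \<nu>"
    using sub open_wedge_subset_wedge by blast
  have diff: "symbol_inverse (\<mu> + h) y - symbol_inverse \<mu> y
      = - symbol_inverse (\<mu> + h) (symbol (\<mu> + h) (symbol_inverse \<mu> y) - symbol \<mu> (symbol_inverse \<mu> y))"
    if "\<mu> + h \<in> ?W" for h y
    using symbol_inverse_diff[OF that] inv_left[OF that inv_D[OF \<mu>W]] inv_right[OF \<mu>W] by simp
  have sym_cont: "((\<lambda>h. symbol (\<mu> + h) (symbol_inverse \<mu> y) - symbol \<mu> (symbol_inverse \<mu> y)) \<longlongrightarrow> 0) (at 0)" for y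
  proof -
    obtain L where L: "((\<lambda>h. inverse h *C (symbol (\<mu> + h) (symbol_inverse \<mu> y) - symbol \<mu> (symbol_inverse \<mu> y))) \<longlongrightarrow> L) (at 0)"
      using symbol_derivative[OF open_open_wedge sub' \<mu> inv_D[OF \<mu>W]] by blast
    have "((\<lambda>h. h *C inverse h *C (symbol (\<mu> + h) (symbol_inverse \<mu> y) - symbol \<mu> (symbol_inverse \<mu> y))) \<longlongrightarrow> 0 *C L) (at 0)"
      by (intro scaleC.tendsto L tendsto_ident_at)
    then show ?thesis
      unfolding scaleC.zero_left
      by (rule Lim_transform_eventually) (auto simp: eventually_at_filter scaleC_scaleC)
  qed
  have graph_lim: "((\<lambda>h. graph_norm A (symbol_inverse (\<mu> + h) y - symbol_inverse \<mu> y)) \<longlongrightarrow> 0) (at 0)" for y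
  proof (rule Lim_null_comparison)
    show "((\<lambda>h. C * norm (symbol (\<mu> + h) (symbol_inverse \<mu> y) - symbol \<mu> (symbol_inverse \<mu> y))) \<longlongrightarrow> 0) (at 0)"
      by (intro tendsto_mult_right_zero tendsto_norm_zero sym_cont)
    show "\<forall>\<^sub>F h in at 0. norm (graph_norm A (symbol_inverse (\<mu> + h) y - symbol_inverse \<mu> y))
      \<le> C * norm (symbol (\<mu> + h) (symbol_inverse \<mu> y) - symbol \<mu> (symbol_inverse \<mu> y))"
      using near
    proof eventually_elim
      case (elim h)
      let ?x = "symbol (\<mu> + h) (symbol_inverse \<mu> y) - symbol \<mu> (symbol_inverse \<mu> y)"
      have "symbol_inverse (\<mu> + h) y - symbol_inverse \<mu> y = symbol_inverse (\<mu> + h) (0 - ?x)"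
        unfolding diff[OF elim] symbol_inverse_diff[OF elim, of 0] using symbol_inverse_diff[OF elim, of 0 0] by simp
      then have "graph_norm A (symbol_inverse (\<mu> + h) y - symbol_inverse \<mu> y) \<le> C * norm (0 - ?x)"
        using inv_graph[OF elim, of "0 - ?x"] by (simp only:)
      then show ?case
        by (simp only: diff_0 norm_minus_cancel real_norm_def abs_of_nonneg[OF graph_norm_nonneg])
    qed
  qed
  show "((\<lambda>h. graph_norm A (symbol_inverse (\<mu> + h) x - symbol_inverse \<mu> x)) \<longlongrightarrow> 0) (at 0)"
    by (rule graph_lim)
  obtain L where L: "((\<lambda>h. inverse h *C (symbol (\<mu> + h) (symbol_inverse \<mu> x) - symbol \<mu> (symbol_inverse \<mu> x))) \<longlongrightarrow> L) (at 0)"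
    using symbol_derivative[OF open_open_wedge sub' \<mu> inv_D[OF \<mu>W]] by blast
  let ?y = "\<lambda>h. inverse h *C (symbol (\<mu> + h) (symbol_inverse \<mu> x) - symbol \<mu> (symbol_inverse \<mu> x))"
  have inv_scaleC: "symbol_inverse \<mu>' (c *C y) = c *C symbol_inverse \<mu>' y" if "\<mu>' \<in> ?W" for \<mu>' c y
  proof -
    have "c *C symbol_inverse \<mu>' y \<in> D"
      using A_linear inv_D[OF that] by (auto simp: linear_operator_def csubspace_def)
    moreover have "symbol \<mu>' (c *C symbol_inverse \<mu>' y) = c *C y"
    proof -
      have "A (c *C symbol_inverse \<mu>' y) = c *C A (symbol_inverse \<mu>' y)"
        "Nh \<mu>' (c *C symbol_inverse \<mu>' y) = c *C Nh \<mu>' (symbol_inverse \<mu>' y)"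
        using A_linear Nh_linear[of \<mu>'] inv_D[OF that] sub that by (auto simp: linear_operator_def)
      moreover have "Gh \<mu>' (c *C symbol_inverse \<mu>' y) = c *C Gh \<mu>' (symbol_inverse \<mu>' y)"
        using Cd2 sub that by (auto simp: Cd2_def operator_analytic_on_def bounded_operator_on_def linear_operator_def)
      ultimately have "symbol \<mu>' (c *C symbol_inverse \<mu>' y) = c *C symbol \<mu>' (symbol_inverse \<mu>' y)"
        by (simp add: symbol_def scaleC_add_right scaleC.diff_right scaleC_scaleC mult.commute)
      then show ?thesis
        using inv_right[OF that] by simp
    qed
    ultimately show ?thesis
      using inv_left[OF that] by metis
  qed
  have inv_cont: "((\<lambda>h. symbol_inverse (\<mu> + h) y - symbol_inverse \<mu> y) \<longlongrightarrow> 0) (at 0)" for y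
    by (rule Lim_null_comparison[OF _ graph_lim[of y]]) (simp add: graph_norm_def)
  \<comment> \<open>The difference quotient \<open>?y h\<close> varies with \<open>h\<close>
    together with the operator applied to it: the uniform bound treats \<open>?y h - L\<close>,
    strong continuity treats the fixed vector \<open>L\<close>.\<close>
  have "((\<lambda>h. symbol_inverse (\<mu> + h) (?y h - L)) \<longlongrightarrow> 0) (at 0)"
  proof (rule Lim_null_comparison)
    show "\<forall>\<^sub>F h in at 0. norm (symbol_inverse (\<mu> + h) (?y h - L)) \<le> C / (a / 2) * norm (?y h - L)"
      using near by eventually_elim (rule inv_norm')
    show "((\<lambda>h. C / (a / 2) * norm (?y h - L)) \<longlongrightarrow> 0) (at 0)"
      using L by (intro tendsto_mult_right_zero tendsto_norm_zero) (simp add: Lim_null[symmetric])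
  qed
  from tendsto_add[OF this inv_cont[of L]]
  have "((\<lambda>h. - (symbol_inverse (\<mu> + h) (?y h - L) + (symbol_inverse (\<mu> + h) L - symbol_inverse \<mu> L)) - symbol_inverse \<mu> L)
    \<longlongrightarrow> - (0 + 0) - symbol_inverse \<mu> L) (at 0)"
    by (intro tendsto_diff tendsto_minus tendsto_const)
  then have "((\<lambda>h. inverse h *C (symbol_inverse (\<mu> + h) x - symbol_inverse \<mu> x)) \<longlongrightarrow> - (0 + 0) - symbol_inverse \<mu> L) (at 0)"
  proof (rule Lim_transform_eventually)
    show "\<forall>\<^sub>F h in at 0. - (symbol_inverse (\<mu> + h) (?y h - L) + (symbol_inverse (\<mu> + h) L - symbol_inverse \<mu> L)) - symbol_inverse \<mu> L
      = inverse h *C (symbol_inverse (\<mu> + h) x - symbol_inverse \<mu> x)"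
      using near
    proof eventually_elim
      case (elim h)
      show ?case
        unfolding diff[OF elim, of x] symbol_inverse_diff[OF elim] inv_scaleC[OF elim]
        by (simp add: scaleC.diff_right scaleC.minus_right)
    qed
  qed
  then show "\<exists>L. ((\<lambda>h. inverse h *C (symbol_inverse (\<mu> + h) x - symbol_inverse \<mu> x)) \<longlongrightarrow> L) (at 0)"
    by blast
qed

lemma holomorphic_symbol_inverse:
  assumes "\<phi> \<in> cdual"
  shows "(\<lambda>\<mu>. blinfun_apply \<phi> (symbol_inverse \<mu> x)) holomorphic_on open_wedge a (- cos \<nu>)"
  unfolding holomorphic_on_open[OF open_open_wedge]
proof
  fix \<mu>
  assume "\<mu> \<in> open_wedge a (- cos \<nu>)"
  then obtain L where "((\<lambda>h. inverse h *C (symbol_inverse (\<mu> + h) x - symbol_inverse \<mu> x)) \<longlongrightarrow> L) (at 0)"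
    using symbol_inverse_limits(2) by blast
  then have "((\<lambda>h. \<phi> (inverse h *C (symbol_inverse (\<mu> + h) x - symbol_inverse \<mu> x))) \<longlongrightarrow> \<phi> L) (at 0)"
    by (intro tendsto_intros)
  then have "((\<lambda>\<mu>. \<phi> (symbol_inverse \<mu> x)) has_field_derivative \<phi> L) (at \<mu>)"
    unfolding DERIV_def cdual_functional[OF assms] blinfun.diff_right by (simp add: divide_inverse mult.commute)
  then show "\<exists>f'. ((\<lambda>\<mu>. \<phi> (symbol_inverse \<mu> x)) has_field_derivative f') (at \<mu>)"
    by blast
qed

text \<open>The second claim is what graph-norm continuity adds; the factorisation of
  \<open>R t\<close> through the resolvent of \<open>A\<close> integrates this function.\<close>

lemma continuous_on_symbol_inverse:
  "continuous_on (open_wedge a (- cos \<nu>)) (\<lambda>\<mu>. symbol_inverse \<mu> x)"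
  "continuous_on (open_wedge a (- cos \<nu>)) (\<lambda>\<mu>. A (symbol_inverse \<mu> x))"
proof -
  have "isCont (\<lambda>\<mu>. symbol_inverse \<mu> x) \<mu> \<and> isCont (\<lambda>\<mu>. A (symbol_inverse \<mu> x)) \<mu>"
    if \<mu>: "\<mu> \<in> open_wedge a (- cos \<nu>)" for \<mu>
  proof -
    let ?W = "wedge a (- cos \<nu>)"
    have \<mu>W: "\<mu> \<in> ?W"
      using \<mu> open_wedge_subset_wedge by blast
    note lim = symbol_inverse_limits(1)[OF \<mu>, of x]
    have 1: "((\<lambda>h. symbol_inverse (\<mu> + h) x - symbol_inverse \<mu> x) \<longlongrightarrow> 0) (at 0)"
      by (rule Lim_null_comparison[OF _ lim]) (simp add: graph_norm_def)
    have "((\<lambda>h. \<mu> + h) \<longlongrightarrow> \<mu> + 0) (at 0)"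
      by (intro tendsto_intros)
    then have "\<forall>\<^sub>F h in at 0. \<mu> + h \<in> open_wedge a (- cos \<nu>)"
      using topological_tendstoD[OF _ open_open_wedge, of "\<lambda>h. \<mu> + h" "\<mu> + 0"] \<mu> by simp
    then have "\<forall>\<^sub>F h in at 0. norm (A (symbol_inverse (\<mu> + h) x) - A (symbol_inverse \<mu> x))
      \<le> graph_norm A (symbol_inverse (\<mu> + h) x - symbol_inverse \<mu> x)"
    proof eventually_elim
      case (elim h)
      then have "symbol_inverse (\<mu> + h) x \<in> D"
        using inv_D open_wedge_subset_wedge by blast
      then show ?case
        using linear_operator_diff(2)[OF A_linear _ inv_D[OF \<mu>W]] by (simp add: graph_norm_def)
    qed
    then have 2: "((\<lambda>h. A (symbol_inverse (\<mu> + h) x) - A (symbol_inverse \<mu> x)) \<longlongrightarrow> 0) (at 0)"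
      by (rule Lim_null_comparison) (rule lim)
    show ?thesis
      using 1 2 unfolding isCont_iff by (simp add: Lim_null[symmetric])
  qed
  then show "continuous_on (open_wedge a (- cos \<nu>)) (\<lambda>\<mu>. symbol_inverse \<mu> x)"
    "continuous_on (open_wedge a (- cos \<nu>)) (\<lambda>\<mu>. A (symbol_inverse \<mu> x))"
    by (auto simp: continuous_on_eq_continuous_at open_open_wedge)
qed

end

end

section \<open>Laplace transforms of operator families\<close>

text \<open>The evolution equations use the completed measure; sigma-finiteness opens Fubini's
  theorem to their convolutions.\<close>

lemma sigma_finite_lebesgue: "sigma_finite_measure (lebesgue :: real measure)"
proof
  have "\<Union> (range (\<lambda>n::nat. {- real n..real n})) = UNIV"
  proof (intro set_eqI iffI UNIV_I)
    fix x :: real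
    obtain n :: nat where "\<bar>x\<bar> \<le> real n"
      using real_arch_simple by blast
    then show "x \<in> \<Union> (range (\<lambda>n::nat. {- real n..real n}))"
      by (auto intro!: exI[of _ n])
  qed
  then show "\<exists>A :: real set set. countable A \<and> A \<subseteq> sets lebesgue \<and> \<Union> A = space lebesgue \<and> (\<forall>a\<in>A. emeasure lebesgue a \<noteq> \<infinity>)"
    by (intro exI[of _ "range (\<lambda>n::nat. {- real n..real n})"]) auto
qed

interpretation lebesgue: sigma_finite_measure "lebesgue :: real measure"
  by (rule sigma_finite_lebesgue)

interpretation lebesgue_pair: pair_sigma_finite "lebesgue :: real measure" "lebesgue :: real measure" ..

lemma measurable_lebesgue_ident: "(\<lambda>x. x) \<in> borel_measurable (lebesgue :: real measure)"
  by (rule measurable_completion) simp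

lemma borel_imp_lebesgue_measurable: "f \<in> borel_measurable borel \<Longrightarrow> f \<in> borel_measurable (lebesgue :: real measure)"
  by (rule measurable_completion) simp

lemma set_integrable_lborel_lebesgue:
  fixes f :: "real \<Rightarrow> 'a::{banach, second_countable_topology}"
  assumes "set_integrable lborel S f"
  shows "set_integrable lebesgue S f" "(LINT x:S|lebesgue. f x) = (LINT x:S|lborel. f x)"
proof -
  have "(\<lambda>x. indicator S x *\<^sub>R f x) \<in> borel_measurable lborel"
    using assms unfolding set_integrable_def by (rule borel_measurable_integrable)
  then show "set_integrable lebesgue S f" "(LINT x:S|lebesgue. f x) = (LINT x:S|lborel. f x)"
    using assms unfolding set_integrable_def set_lebesgue_integral_def
    by (auto simp: integrable_completion integral_completion)
qed

lemma set_integral_lebesgue_on: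
  fixes f :: "real \<Rightarrow> 'a::{banach, second_countable_topology}"
  assumes "S \<in> sets lebesgue"
  shows "(LINT s|lebesgue_on S. f s) = (LINT s:S|lebesgue. f s)"
    "integrable (lebesgue_on S) f \<longleftrightarrow> set_integrable lebesgue S f"
  using assms by (auto simp: integral_restrict_space integrable_restrict_space set_lebesgue_integral_def set_integrable_def)

lemma set_integral_lebesgue_tendsto_at_top:
  fixes f :: "real \<Rightarrow> 'a::{banach, second_countable_topology}"
  assumes f: "set_integrable lebesgue {0..} f"
  shows "(\<lambda>n. LINT t:{0..real n}|lebesgue. f t) \<longlonglongrightarrow> (LINT t:{0..}|lebesgue. f t)"
  unfolding set_lebesgue_integral_def
proof (rule integral_dominated_convergence)
  show int: "integrable lebesgue (\<lambda>t. norm (indicator {0..} t *\<^sub>R f t))"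
    using f unfolding set_integrable_def by (rule integrable_norm)
  show m: "(\<lambda>t. indicator {0..} t *\<^sub>R f t) \<in> borel_measurable lebesgue"
    using f unfolding set_integrable_def by (rule borel_measurable_integrable)
  show "(\<lambda>t. indicator {0..real n} t *\<^sub>R f t) \<in> borel_measurable lebesgue" for n
  proof -
    have "(\<lambda>t. indicator {..real n} t *\<^sub>R (indicator {0..} t *\<^sub>R f t)) \<in> borel_measurable lebesgue"
      by (intro borel_measurable_scaleR m borel_measurable_indicator) auto
    then show ?thesis
      by (rule measurable_cong[THEN iffD1, rotated]) (auto simp: indicator_def)
  qed
  show "AE t in lebesgue. (\<lambda>n. indicator {0..real n} t *\<^sub>R f t) \<longlonglongrightarrow> indicator {0..} t *\<^sub>R f t"
  proof (intro AE_I2)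
    fix t :: real
    obtain n0 :: nat where "t \<le> real n0"
      using real_arch_simple by blast
    then have "\<forall>\<^sub>F n in sequentially. indicator {0..} t *\<^sub>R f t = indicator {0..real n} t *\<^sub>R f t"
      unfolding eventually_sequentially by (intro exI[of _ n0]) (auto simp: indicator_def)
    then show "(\<lambda>n. indicator {0..real n} t *\<^sub>R f t) \<longlonglongrightarrow> indicator {0..} t *\<^sub>R f t"
      by (rule Lim_transform_eventually[OF tendsto_const])
  qed
  show "AE t in lebesgue. norm (indicator {0..real n} t *\<^sub>R f t) \<le> norm (indicator {0..} t *\<^sub>R f t)" for n
    by (auto simp: indicator_def)
qed

section \<open>Laplace transforms of a strongly continuous family and of its convolutions\<close>

context
  fixes R :: "real \<Rightarrow> 'w::{complex_banach, second_countable_topology} \<Rightarrow>\<^sub>L 'w" and M \<omega> :: real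
  assumes bound: "\<And>t. 0 \<le> t \<Longrightarrow> norm (R t) \<le> M * exp (\<omega> * t)" and \<omega>: "0 < \<omega>"
    and cont: "\<And>z. continuous_on {0..} (\<lambda>t. R t z)"
begin

lemma M_nonneg: "0 \<le> M"
  using order_trans[OF norm_ge_zero bound[of 0]] by simp

lemma bound_apply: "0 \<le> t \<Longrightarrow> norm (R t x) \<le> M * exp (\<omega> * t) * norm x"
  by (meson bound mult_right_mono norm_blinfun norm_ge_zero order_trans)

text \<open>Strong continuity and local boundedness give joint continuity. Extending by
  \<open>max 0\<close> to the whole line makes the integrands of convolutions measurable by
  composition.\<close>

lemma continuous_on_family: "continuous_on UNIV (\<lambda>p. R (max 0 (fst p)) (snd p))"
proof (rule continuous_at_imp_continuous_on, intro ballI)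
  fix p :: "real \<times> 'w"
  define r x where "r = fst p" and "x = snd p"
  have "continuous_on UNIV (\<lambda>t. R (max 0 t) x)"
    by (rule continuous_on_compose2[OF cont]) (auto intro!: continuous_intros)
  then have 1: "((\<lambda>q. R (max 0 (fst q)) x) \<longlongrightarrow> R (max 0 r) x) (at p)"
    by (intro isCont_tendsto_compose[where g = "\<lambda>t. R (max 0 t) x" and l = r])
      (auto simp: continuous_on_eq_continuous_at r_def intro!: tendsto_intros)
  have fl: "((\<lambda>q. fst q) \<longlongrightarrow> fst p) (at p)" and sl: "((\<lambda>q. snd q) \<longlongrightarrow> snd p) (at p)"
    by (intro tendsto_intros)+
  have "\<forall>\<^sub>F q in at p. fst q < r + 1"
    by (rule order_tendstoD(2)[OF fl]) (simp add: r_def)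
  then have "\<forall>\<^sub>F q in at p. norm (R (max 0 (fst q)) (snd q - x)) \<le> M * exp (\<omega> * max 0 (r + 1)) * norm (snd q - x)"
  proof eventually_elim
    case (elim q)
    have "norm (R (max 0 (fst q)) (snd q - x)) \<le> M * exp (\<omega> * max 0 (fst q)) * norm (snd q - x)"
      by (rule bound_apply) simp
    also have "\<dots> \<le> M * exp (\<omega> * max 0 (r + 1)) * norm (snd q - x)"
      using elim \<omega> M_nonneg by (intro mult_right_mono mult_left_mono) auto
    finally show ?case .
  qed
  then have "((\<lambda>q. R (max 0 (fst q)) (snd q - x)) \<longlongrightarrow> 0) (at p)"
  proof (rule Lim_null_comparison)
    show "((\<lambda>q. M * exp (\<omega> * max 0 (r + 1)) * norm (snd q - x)) \<longlongrightarrow> 0) (at p)"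
      using sl by (intro tendsto_mult_right_zero tendsto_norm_zero) (simp add: Lim_null[symmetric] x_def)
  qed
  from tendsto_add[OF this 1] show "isCont (\<lambda>p. R (max 0 (fst p)) (snd p)) p"
    by (simp add: isCont_def blinfun.diff_right r_def x_def)
qed

lemma measurable_family:
  "f \<in> borel_measurable Q \<Longrightarrow> y \<in> borel_measurable Q \<Longrightarrow> (\<lambda>x. R (max 0 (f x)) (y x)) \<in> borel_measurable Q"
  using continuous_on_family by (rule borel_measurable_continuous_Pair[of f Q y "\<lambda>r. blinfun_apply (R (max 0 r))", rotated -1])

text \<open>Defined vector by vector, since the family is only strongly continuous.\<close>

definition laplace_op :: "real \<Rightarrow> 'w \<Rightarrow> 'w"
  where "laplace_op l x = (LINT t:{0..}|lborel. exp (- l * t) *\<^sub>R R t x)"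

lemma norm_weighted_le: "0 \<le> t \<Longrightarrow> norm (exp (- l * t) *\<^sub>R R t x) \<le> M * norm x * exp (- (l - \<omega>) * t)"
  using mult_left_mono[OF bound_apply[of t x], of "exp (- l * t)"] by (simp add: algebra_simps exp_diff exp_minus field_simps)

lemma set_integrable_weighted:
  assumes l: "\<omega> < l"
  shows "set_integrable lborel {0..} (\<lambda>t. exp (- l * t) *\<^sub>R R t x)"
proof (rule set_integrable_bound)
  show "set_integrable lborel {0..} (\<lambda>t. M * norm x * exp (- (l - \<omega>) * t))"
    using l by (intro set_integrable_mult_right exp_set_integral) auto
  have "continuous_on {0..} (\<lambda>t. exp (- l * t) *\<^sub>R R t x)"
    by (intro continuous_intros cont)
  then show "set_borel_measurable lborel {0..} (\<lambda>t. exp (- l * t) *\<^sub>R R t x)"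
    unfolding set_borel_measurable_def measurable_lborel2 by (intro borel_measurable_continuous_on_indicator) auto
  show "AE t in lborel. t \<in> {0..} \<longrightarrow> norm (exp (- l * t) *\<^sub>R R t x) \<le> norm (M * norm x * exp (- (l - \<omega>) * t))"
    using norm_weighted_le[of _ l x] M_nonneg by (intro AE_I2) (auto intro: order_trans[OF _ abs_ge_self])
qed

lemma norm_laplace_op_integrand:
  assumes l: "\<omega> < l"
  shows "(LINT t:{0..}|lborel. norm (exp (- l * t) *\<^sub>R R t x)) \<le> M / (l - \<omega>) * norm x"
proof -
  have "(LINT t:{0..}|lborel. norm (exp (- l * t) *\<^sub>R R t x)) \<le> (LINT t:{0..}|lborel. M * norm x * exp (- (l - \<omega>) * t))"
  proof (rule set_integral_mono)
    show "set_integrable lborel {0..} (\<lambda>t. norm (exp (- l * t) *\<^sub>R R t x))"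
      by (rule set_integrable_norm[OF set_integrable_weighted[OF l]])
    show "set_integrable lborel {0..} (\<lambda>t. M * norm x * exp (- (l - \<omega>) * t))"
      using l by (intro set_integrable_mult_right exp_set_integral) auto
  qed (rule norm_weighted_le, simp)
  also have "\<dots> = M * norm x * (1 / (l - \<omega>))"
    unfolding set_integral_mult_right using l by (subst exp_set_integral(2)) auto
  finally show ?thesis
    by simp
qed

lemma bounded_linear_laplace_op:
  assumes l: "\<omega> < l"
  shows "bounded_linear (laplace_op l)"
proof (rule bounded_linear_intro)
  show "laplace_op l (x + y) = laplace_op l x + laplace_op l y" for x y
    unfolding laplace_op_def blinfun.add_right scaleR_add_right
    by (rule set_integral_add(2)[OF set_integrable_weighted[OF l] set_integrable_weighted[OF l]])
  show "laplace_op l (r *\<^sub>R x) = r *\<^sub>R laplace_op l x" for r x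
    unfolding laplace_op_def blinfun.scaleR_right scaleR_left_commute[of _ r] set_integral_scaleR_right ..
  show "norm (laplace_op l x) \<le> norm x * (M / (l - \<omega>))" for x
    using order_trans[OF set_integral_norm_bound[OF set_integrable_weighted[OF l]] norm_laplace_op_integrand[OF l]]
    unfolding laplace_op_def by (simp only: mult.commute)
qed

definition convolution :: "(real \<Rightarrow> 'w) \<Rightarrow> real \<Rightarrow> 'w"
  where "convolution y t = (LINT s:{0..t}|lebesgue. R (t - s) (y s))"

context
  fixes y :: "real \<Rightarrow> 'w"
  assumes y: "\<And>l. 0 < l \<Longrightarrow> set_integrable lebesgue {0..} (\<lambda>s. exp (- l * s) *\<^sub>R y s)"
begin

lemma measurable_cutoff: "(\<lambda>s. indicator {0..} s *\<^sub>R y s) \<in> borel_measurable lebesgue"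
proof -
  have "(\<lambda>s. exp s *\<^sub>R (indicator {0..} s *\<^sub>R (exp (- 1 * s) *\<^sub>R y s))) \<in> borel_measurable lebesgue"
    by (rule borel_measurable_scaleR[OF borel_imp_lebesgue_measurable
          borel_measurable_integrable[OF y[of 1, unfolded set_integrable_def]]]) auto
  then show ?thesis
    by (rule measurable_cong[THEN iffD1, rotated]) (auto simp: indicator_def simp flip: exp_add)
qed

text \<open>Writing \<open>exp (\<omega> * (t - s))\<close> as a product separates \<open>t\<close>
  from \<open>s\<close>; the convolution inherits the growth rate \<omega> of the family, with the
  transform of the norm of \<open>y\<close> at \<omega> in the constant.\<close>

lemma set_integrable_convolution:
  assumes "0 \<le> t"
  shows "set_integrable lebesgue {0..t} (\<lambda>s. R (t - s) (y s))"
    and "norm (convolution y t) \<le> M * (LINT s:{0..}|lebesgue. norm (exp (- \<omega> * s) *\<^sub>R y s)) * exp (\<omega> * t)"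
proof -
  have m: "(\<lambda>s. R (max 0 (t - s)) (indicator {0..} s *\<^sub>R y s)) \<in> borel_measurable lebesgue"
    by (intro measurable_family measurable_cutoff borel_imp_lebesgue_measurable) auto
  have "(\<lambda>s. indicator {0..t} s *\<^sub>R R (max 0 (t - s)) (indicator {0..} s *\<^sub>R y s)) \<in> borel_measurable lebesgue"
    by (intro borel_measurable_scaleR m borel_measurable_indicator) auto
  then have m': "(\<lambda>s. indicator {0..t} s *\<^sub>R R (t - s) (y s)) \<in> borel_measurable lebesgue"
    by (rule measurable_cong[THEN iffD1, rotated]) (auto simp: indicator_def)
  let ?g = "\<lambda>s. M * exp (\<omega> * t) * norm (exp (- \<omega> * s) *\<^sub>R y s)"
  have g: "set_integrable lebesgue {0..} ?g"
    using y[OF \<omega>] by (intro set_integrable_mult_right set_integrable_norm)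
  have le: "norm (R (t - s) (y s)) \<le> ?g s" if "s \<in> {0..t}" for s
  proof -
    have "norm (R (t - s) (y s)) \<le> M * exp (\<omega> * (t - s)) * norm (y s)"
      by (rule bound_apply) (use that in simp)
    also have "exp (\<omega> * (t - s)) = exp (\<omega> * t) * exp (- \<omega> * s)"
      by (simp add: algebra_simps flip: exp_add)
    finally show ?thesis
      by (simp add: mult.assoc)
  qed
  have g': "set_integrable lebesgue {0..t} ?g"
    by (rule set_integrable_subset[OF g]) auto
  show int: "set_integrable lebesgue {0..t} (\<lambda>s. R (t - s) (y s))"
    by (rule set_integrable_bound[OF g']) (use m' le M_nonneg in \<open>auto simp: set_borel_measurable_def intro!: AE_I2\<close>)
  have "norm (convolution y t) \<le> (LINT s:{0..t}|lebesgue. norm (R (t - s) (y s)))"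
    unfolding convolution_def by (rule set_integral_norm_bound[OF int])
  also have "\<dots> \<le> (LINT s:{0..t}|lebesgue. ?g s)"
    by (rule set_integral_mono[OF set_integrable_norm[OF int] g' le])
  also have "\<dots> \<le> (LINT s:{0..}|lebesgue. ?g s)"
    unfolding set_lebesgue_integral_def
  proof (rule integral_mono)
    show "integrable lebesgue (\<lambda>s. indicat_real {0..t} s *\<^sub>R ?g s)" "integrable lebesgue (\<lambda>s. indicat_real {0..} s *\<^sub>R ?g s)"
      using g g' by (auto simp: set_integrable_def)
  qed (use M_nonneg in \<open>auto simp: indicator_def\<close>)
  also have "\<dots> = M * exp (\<omega> * t) * (LINT s:{0..}|lebesgue. norm (exp (- \<omega> * s) *\<^sub>R y s))"
    by (rule set_integral_mult_right)
  finally show "norm (convolution y t) \<le> M * (LINT s:{0..}|lebesgue. norm (exp (- \<omega> * s) *\<^sub>R y s)) * exp (\<omega> * t)"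
    by (simp only: mult_ac)
qed

text \<open>Fubini on the region \<open>0 \<le> s \<le> t\<close>, followed by the substitution
  \<open>t - s\<close>; the transform of the family is a bounded operator and moves out of the
  remaining integral.\<close>

lemma laplace_convolution:
  assumes l: "\<omega> < l"
  shows "set_integrable lebesgue {0..} (\<lambda>t. exp (- l * t) *\<^sub>R convolution y t)"
    and "(LINT t:{0..}|lebesgue. exp (- l * t) *\<^sub>R convolution y t)
      = laplace_op l (LINT s:{0..}|lebesgue. exp (- l * s) *\<^sub>R y s)"
proof -
  \<comment> \<open>The factor \<open>indicator {0..} (t - s)\<close> cuts to
    \<open>s \<le> t\<close>, and \<open>max 0\<close> keeps the argument of \<open>R\<close>
    admissible off this region, so that the integrand is jointly measurable on the whole
    plane.\<close>
  define f where "f s t = indicator {0..} (t - s) *\<^sub>R (exp (- l * t) *\<^sub>R R (max 0 (t - s)) (indicator {0..} s *\<^sub>R y s))" for s t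
  have l0: "0 < l"
    using l \<omega> by simp
  have fm: "(\<lambda>p. f (fst p) (snd p)) \<in> borel_measurable (lebesgue \<Otimes>\<^sub>M lebesgue)"
  proof -
    have 1: "(\<lambda>p :: real \<times> real. fst p) \<in> borel_measurable (lebesgue \<Otimes>\<^sub>M lebesgue)"
      "(\<lambda>p :: real \<times> real. snd p) \<in> borel_measurable (lebesgue \<Otimes>\<^sub>M lebesgue)"
      using measurable_compose[OF measurable_fst measurable_lebesgue_ident]
        measurable_compose[OF measurable_snd measurable_lebesgue_ident] by auto
    have 2: "(\<lambda>p. indicator {0..} (fst p) *\<^sub>R y (fst p)) \<in> borel_measurable (lebesgue \<Otimes>\<^sub>M lebesgue)"
      by (rule measurable_compose[OF measurable_fst measurable_cutoff])
    have 3: "(\<lambda>p. R (max 0 (snd p - fst p)) (indicator {0..} (fst p) *\<^sub>R y (fst p))) \<in> borel_measurable (lebesgue \<Otimes>\<^sub>M lebesgue)"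
      by (rule measurable_family[OF borel_measurable_diff[OF 1(2,1)] 2])
    have 4: "(\<lambda>p :: real \<times> real. exp (- l * snd p)) \<in> borel_measurable (lebesgue \<Otimes>\<^sub>M lebesgue)"
      by (rule measurable_compose[OF 1(2)]) measurable
    have 5: "(\<lambda>p. indicat_real {0..} (snd p - fst p)) \<in> borel_measurable (lebesgue \<Otimes>\<^sub>M lebesgue :: (real \<times> real) measure)"
      by (rule measurable_compose[OF borel_measurable_diff[OF 1(2,1)]]) simp
    show ?thesis
      unfolding f_def by (rule borel_measurable_scaleR[OF 5 borel_measurable_scaleR[OF 4 3]])
  qed
  have shift: "(\<integral>t. indicator {0..} (t - s) *\<^sub>R h (t - s) \<partial>lborel) = (LINT t:{0..}|lborel. h t)"
    "integrable lborel (\<lambda>t. indicator {0..} (t - s) *\<^sub>R h (t - s)) \<longleftrightarrow> set_integrable lborel {0..} h"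
    for h :: "real \<Rightarrow> 'b::{banach, second_countable_topology}" and s
    using lborel_integral_real_affine[of 1 "\<lambda>t. indicator {0..} t *\<^sub>R h t" "- s"]
      lborel_integrable_real_affine_iff[of 1 "\<lambda>t. indicator {0..} t *\<^sub>R h t" "- s"]
    by (auto simp: set_lebesgue_integral_def set_integrable_def)
  define H where "H s \<tau> = exp (- l * s) *\<^sub>R (exp (- l * \<tau>) *\<^sub>R R \<tau> (indicator {0..} s *\<^sub>R y s))" for s \<tau>
  have f_eq: "f s = (\<lambda>t. indicator {0..} (t - s) *\<^sub>R H s (t - s))" for s
    by (rule ext) (auto simp: f_def H_def indicator_def algebra_simps simp flip: exp_add)
  have int_H: "set_integrable lborel {0..} (H s)" for s
    unfolding H_def by (intro set_integrable_scaleR_right) (rule set_integrable_weighted[OF l])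
  then have int_t: "integrable lborel (f s)" for s
    unfolding f_eq shift(2) .
  then have int_t': "integrable lebesgue (f s)" for s
    using borel_measurable_integrable[OF int_t] by (simp add: integrable_completion)
  have norm_t: "(\<integral>t. norm (f s t) \<partial>lebesgue) \<le> M / (l - \<omega>) * norm (indicator {0..} s *\<^sub>R (exp (- l * s) *\<^sub>R y s))" for s
  proof -
    let ?x = "indicator {0..} s *\<^sub>R y s"
    have "(\<integral>t. norm (f s t) \<partial>lebesgue) = (\<integral>t. norm (f s t) \<partial>lborel)"
      using borel_measurable_integrable[OF int_t[of s]] by (simp add: integral_completion)
    also have "\<dots> = (\<integral>t. indicator {0..} (t - s) *\<^sub>R (\<lambda>\<tau>. norm (H s \<tau>)) (t - s) \<partial>lborel)"
      unfolding f_eq by (intro Bochner_Integration.integral_cong) auto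
    also have "\<dots> = (LINT \<tau>:{0..}|lborel. norm (H s \<tau>))"
      by (rule shift(1))
    also have "\<dots> = (LINT \<tau>:{0..}|lborel. exp (- l * s) * norm (exp (- l * \<tau>) *\<^sub>R R \<tau> ?x))"
      by (simp add: H_def mult.assoc)
    also have "\<dots> = exp (- l * s) * (LINT \<tau>:{0..}|lborel. norm (exp (- l * \<tau>) *\<^sub>R R \<tau> ?x))"
      by (rule set_integral_mult_right)
    also have "\<dots> \<le> exp (- l * s) * (M / (l - \<omega>) * norm ?x)"
      by (intro mult_left_mono norm_laplace_op_integrand[OF l]) auto
    finally show ?thesis
      by (simp add: mult_ac)
  qed
  have outer: "integrable lebesgue (\<lambda>s. \<integral>t. norm (f s t) \<partial>lebesgue)"
  proof (rule Bochner_Integration.integrable_bound)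
    show "integrable lebesgue (\<lambda>s. M / (l - \<omega>) * norm (indicator {0..} s *\<^sub>R (exp (- l * s) *\<^sub>R y s)))"
      using y[OF l0] unfolding set_integrable_def by (intro integrable_mult_right integrable_norm)
    show "(\<lambda>s. \<integral>t. norm (f s t) \<partial>lebesgue) \<in> borel_measurable lebesgue"
      using fm by (intro lebesgue.borel_measurable_lebesgue_integral) (simp add: case_prod_beta')
    show "AE s in lebesgue. norm (\<integral>t. norm (f s t) \<partial>lebesgue) \<le> norm (M / (l - \<omega>) * norm (indicator {0..} s *\<^sub>R (exp (- l * s) *\<^sub>R y s)))"
    proof (intro AE_I2)
      fix s
      have "0 \<le> (\<integral>t. norm (f s t) \<partial>lebesgue)"
        by (intro Bochner_Integration.integral_nonneg) auto
      with norm_t[of s] show "norm (\<integral>t. norm (f s t) \<partial>lebesgue) \<le> norm (M / (l - \<omega>) * norm (indicator {0..} s *\<^sub>R (exp (- l * s) *\<^sub>R y s)))"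
        unfolding real_norm_def by linarith
    qed
  qed
  have int_f: "integrable (lebesgue \<Otimes>\<^sub>M lebesgue) (case_prod f)"
    using fm outer int_t' by (intro lebesgue_pair.Fubini_integrable AE_I2) (auto simp: case_prod_beta')
  have inner_s: "(\<integral>t. f s t \<partial>lebesgue) = indicator {0..} s *\<^sub>R (laplace_op l (exp (- l * s) *\<^sub>R y s))" for s
  proof -
    have "(\<integral>t. f s t \<partial>lebesgue) = (\<integral>t. f s t \<partial>lborel)"
      using borel_measurable_integrable[OF int_t[of s]] by (simp add: integral_completion)
    also have "\<dots> = exp (- l * s) *\<^sub>R laplace_op l (indicator {0..} s *\<^sub>R y s)"
      unfolding f_eq shift(1) laplace_op_def unfolding H_def by (rule set_integral_scaleR_right)
    finally show ?thesis
      using linear_cmul[OF bounded_linear.linear[OF bounded_linear_laplace_op[OF l]]] by (simp add: mult.commute)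
  qed
  have inner_t: "(\<integral>s. f s t \<partial>lebesgue) = indicator {0..} t *\<^sub>R (exp (- l * t) *\<^sub>R convolution y t)" for t
  proof -
    have "f s t = exp (- l * t) *\<^sub>R (indicator {0..t} s *\<^sub>R R (t - s) (y s))" for s
      by (auto simp: f_def indicator_def)
    then have "(\<integral>s. f s t \<partial>lebesgue) = (\<integral>s. exp (- l * t) *\<^sub>R (indicator {0..t} s *\<^sub>R R (t - s) (y s)) \<partial>lebesgue)"
      by (simp only:)
    also have "\<dots> = exp (- l * t) *\<^sub>R convolution y t"
      unfolding convolution_def set_lebesgue_integral_def by (rule integral_scaleR_right)
    finally have "(\<integral>s. f s t \<partial>lebesgue) = exp (- l * t) *\<^sub>R convolution y t" .
    moreover have "convolution y t = 0" if "t < 0"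
      using that by (simp add: convolution_def set_lebesgue_integral_def)
    ultimately show ?thesis
      by (cases "0 \<le> t") auto
  qed
  show "set_integrable lebesgue {0..} (\<lambda>t. exp (- l * t) *\<^sub>R convolution y t)"
    using lebesgue_pair.integrable_snd[OF int_f] unfolding inner_t set_integrable_def .
  have "(LINT t:{0..}|lebesgue. exp (- l * t) *\<^sub>R convolution y t) = (\<integral>s. indicator {0..} s *\<^sub>R (laplace_op l (exp (- l * s) *\<^sub>R y s)) \<partial>lebesgue)"
    using lebesgue_pair.Fubini_integral[OF int_f] unfolding inner_t inner_s set_lebesgue_integral_def .
  also have "\<dots> = (\<integral>s. laplace_op l (indicator {0..} s *\<^sub>R (exp (- l * s) *\<^sub>R y s)) \<partial>lebesgue)"
    using linear_cmul[OF bounded_linear.linear[OF bounded_linear_laplace_op[OF l]]] by simp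
  also have "\<dots> = laplace_op l (LINT s:{0..}|lebesgue. exp (- l * s) *\<^sub>R y s)"
    unfolding set_lebesgue_integral_def
    using y[OF l0] by (intro integral_bounded_linear[OF bounded_linear_laplace_op[OF l]]) (simp add: set_integrable_def)
  finally show "(LINT t:{0..}|lebesgue. exp (- l * t) *\<^sub>R convolution y t)
      = laplace_op l (LINT s:{0..}|lebesgue. exp (- l * s) *\<^sub>R y s)" .
qed

end

text \<open>The function \<open>exp (- l * t) *\<^sub>R v t\<close> starts at \<open>z\<close> and
  vanishes at infinity, because \<open>v\<close> grows at most like
  \<open>exp (\<omega> * t)\<close>. Its derivative therefore integrates to \<open>- z\<close>, and
  the pieces of the derivative have known transforms.\<close>

lemma laplace_evolution_equation:
  fixes y1 y2 :: "real \<Rightarrow> 'w"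
  assumes y1: "\<And>l. 0 < l \<Longrightarrow> set_integrable lebesgue {0..} (\<lambda>s. exp (- l * s) *\<^sub>R y1 s)"
    and y2: "\<And>l. 0 < l \<Longrightarrow> set_integrable lebesgue {0..} (\<lambda>s. exp (- l * s) *\<^sub>R y2 s)"
    and R0: "R 0 = id_blinfun"
    and deriv: "\<And>t. 0 \<le> t \<Longrightarrow> ((\<lambda>t. R t z + convolution y1 t) has_vector_derivative R t x + convolution y2 t) (at t within {0..})"
    and l: "\<omega> < l"
  shows "l *\<^sub>R (laplace_op l z + laplace_op l (LINT s:{0..}|lebesgue. exp (- l * s) *\<^sub>R y1 s)) - z
    = laplace_op l x + laplace_op l (LINT s:{0..}|lebesgue. exp (- l * s) *\<^sub>R y2 s)"
proof -
  define v where "v t = R t z + convolution y1 t" for t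
  define k where "k t = R t x + convolution y2 t" for t
  let ?L = "laplace_op l"
  have iR: "set_integrable lebesgue {0..} (\<lambda>t. exp (- l * t) *\<^sub>R R t u)" "(LINT t:{0..}|lebesgue. exp (- l * t) *\<^sub>R R t u) = ?L u" for u
    using set_integrable_lborel_lebesgue[OF set_integrable_weighted[OF l]] by (auto simp: laplace_op_def)
  note c1 = laplace_convolution[OF y1 l] and c2 = laplace_convolution[OF y2 l]
  have iv: "set_integrable lebesgue {0..} (\<lambda>t. exp (- l * t) *\<^sub>R v t)"
    "(LINT t:{0..}|lebesgue. exp (- l * t) *\<^sub>R v t) = ?L z + ?L (LINT s:{0..}|lebesgue. exp (- l * s) *\<^sub>R y1 s)"
    unfolding v_def scaleR_add_right using set_integral_add[OF iR(1) c1(1)] iR(2) c1(2) by auto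
  have ik: "set_integrable lebesgue {0..} (\<lambda>t. exp (- l * t) *\<^sub>R k t)"
    "(LINT t:{0..}|lebesgue. exp (- l * t) *\<^sub>R k t) = ?L x + ?L (LINT s:{0..}|lebesgue. exp (- l * s) *\<^sub>R y2 s)"
    unfolding k_def scaleR_add_right using set_integral_add[OF iR(1) c2(1)] iR(2) c2(2) by auto
  define w where "w t = exp (- l * t) *\<^sub>R k t - l *\<^sub>R (exp (- l * t) *\<^sub>R v t)" for t
  have iw: "set_integrable lebesgue {0..} w"
    "(LINT t:{0..}|lebesgue. w t) = (?L x + ?L (LINT s:{0..}|lebesgue. exp (- l * s) *\<^sub>R y2 s))
      - l *\<^sub>R (?L z + ?L (LINT s:{0..}|lebesgue. exp (- l * s) *\<^sub>R y1 s))"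
  proof -
    have i: "set_integrable lebesgue {0..} (\<lambda>t. l *\<^sub>R (exp (- l * t) *\<^sub>R v t))"
      by (rule set_integrable_scaleR_right) (rule iv(1))
    show "set_integrable lebesgue {0..} w"
      unfolding w_def by (rule set_integral_diff(1)[OF ik(1) i])
    show "(LINT t:{0..}|lebesgue. w t) = (?L x + ?L (LINT s:{0..}|lebesgue. exp (- l * s) *\<^sub>R y2 s))
      - l *\<^sub>R (?L z + ?L (LINT s:{0..}|lebesgue. exp (- l * s) *\<^sub>R y1 s))"
      unfolding w_def set_integral_diff(2)[OF ik(1) i] set_integral_scaleR_right ik(2) iv(2) ..
  qed
  have du: "((\<lambda>t. exp (- l * t) *\<^sub>R v t) has_vector_derivative w t) (at t within {0..})" if "0 \<le> t" for t
  proof -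
    have "((\<lambda>t. exp (- l * t)) has_field_derivative exp (- l * t) * - l) (at t within {0..})"
      by (auto intro!: derivative_eq_intros)
    from has_vector_derivative_scaleR[OF this deriv[OF that]]
    show ?thesis
      by (simp add: v_def k_def w_def algebra_simps)
  qed
  have u_lim: "(\<lambda>n. exp (- l * real n) *\<^sub>R v (real n)) \<longlonglongrightarrow> 0"
  proof (rule Lim_null_comparison)
    define K where "K = M * norm z + M * (LINT s:{0..}|lebesgue. norm (exp (- \<omega> * s) *\<^sub>R y1 s))"
    have "norm (exp (- l * t) *\<^sub>R v t) \<le> K * exp (- (l - \<omega>) * t)" if t: "0 \<le> t" for t
    proof -
      have "norm (v t) \<le> K * exp (\<omega> * t)"
        using norm_triangle_ineq[of "R t z" "convolution y1 t"] bound_apply[OF t, of z] set_integrable_convolution(2)[OF y1 t]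
        by (simp add: v_def K_def algebra_simps)
      then have "exp (- l * t) * norm (v t) \<le> exp (- l * t) * (K * exp (\<omega> * t))"
        by (intro mult_left_mono) auto
      also have "\<dots> = K * exp (- (l - \<omega>) * t)"
        by (simp add: left_diff_distrib exp_diff exp_minus field_simps)
      finally show ?thesis
        by simp
    qed
    then show "\<forall>\<^sub>F n in sequentially. norm (exp (- l * real n) *\<^sub>R v (real n)) \<le> K * exp (- (l - \<omega>) * real n)"
      by simp
    show "(\<lambda>n. K * exp (- (l - \<omega>) * real n)) \<longlonglongrightarrow> 0"
      using l by real_asymp
  qed
  have v0: "v 0 = z"
  proof -
    have "convolution y1 0 = 0"
    proof -
      have "AE s in lebesgue. s \<noteq> (0::real)"
        by (rule AE_completion) (rule AE_lborel_singleton)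
      then have "(\<integral>s. indicator {0..0} s *\<^sub>R R (0 - s) (y1 s) \<partial>lebesgue) = 0"
        by (intro integral_eq_zero_AE) (auto elim!: eventually_mono)
      then show ?thesis
        by (simp add: convolution_def set_lebesgue_integral_def)
    qed
    then show ?thesis
      by (simp add: v_def R0)
  qed
  \<comment> \<open>No continuity of the derivative is at hand. After testing with functionals the
    fundamental theorem for gauge integrals applies, and for the integrable scalar derivative the
    two notions of integral agree.\<close>
  have "(LINT t:{0..}|lebesgue. w t) = - z"
  proof (rule cdual_separates)
    fix \<phi> :: "'w \<Rightarrow>\<^sub>L complex"
    have bl: "bounded_linear (blinfun_apply \<phi>)"
      by (rule blinfun.bounded_linear_right)
    have i\<phi>: "set_integrable lebesgue {0..} (\<lambda>t. \<phi> (w t))" "(LINT t:{0..}|lebesgue. \<phi> (w t)) = \<phi> (LINT t:{0..}|lebesgue. w t)"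
      using integrable_bounded_linear[OF bl iw(1)[unfolded set_integrable_def]] integral_bounded_linear[OF bl iw(1)[unfolded set_integrable_def]]
      by (auto simp: set_integrable_def set_lebesgue_integral_def blinfun.scaleR_right)
    have "(LINT t:{0..real n}|lebesgue. \<phi> (w t)) = \<phi> (exp (- l * real n) *\<^sub>R v (real n)) - \<phi> z" for n
    proof -
      have h1: "((\<lambda>t. \<phi> (w t)) has_integral \<phi> (exp (- l * real n) *\<^sub>R v (real n)) - \<phi> (exp (- l * 0) *\<^sub>R v 0)) {0..real n}"
      proof (rule fundamental_theorem_of_calculus)
        fix t
        assume "t \<in> {0..real n}"
        then show "((\<lambda>t. \<phi> (exp (- l * t) *\<^sub>R v t)) has_vector_derivative \<phi> (w t)) (at t within {0..real n})"
          using bounded_linear.has_vector_derivative[OF bl has_vector_derivative_within_subset[OF du[of t], of "{0..real n}"]] by auto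
      qed simp
      have h2: "((\<lambda>t. \<phi> (w t)) has_integral (LINT t:{0..real n}|lebesgue. \<phi> (w t))) {0..real n}"
        by (rule has_integral_set_lebesgue[OF set_integrable_subset[OF i\<phi>(1)]]) auto
      show ?thesis
        using has_integral_unique[OF h2 h1] by (simp add: v0)
    qed
    then have "(\<lambda>n. LINT t:{0..real n}|lebesgue. \<phi> (w t)) \<longlonglongrightarrow> \<phi> 0 - \<phi> z"
      by (simp only:) (intro tendsto_intros u_lim)
    then have "(LINT t:{0..}|lebesgue. \<phi> (w t)) = \<phi> 0 - \<phi> z"
      using set_integral_lebesgue_tendsto_at_top[OF i\<phi>(1)] LIMSEQ_unique by blast
    then show "\<phi> (LINT t:{0..}|lebesgue. w t) = \<phi> (- z)"
      by (simp add: i\<phi>(2) blinfun.zero_right blinfun.minus_right)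
  qed
  then show ?thesis
    unfolding iw(2) by (simp add: algebra_simps)
qed

end

section \<open>Contour representation of the resolvent operator\<close>

text \<open>Completeness of Lebesgue measure: changing a measurable limit on a null set keeps it
  measurable.\<close>

lemma borel_measurable_lebesgue_AE_limit:
  fixes s :: "nat \<Rightarrow> real \<Rightarrow> 'a::{banach, second_countable_topology}"
  assumes s: "\<And>n. s n \<in> borel_measurable lebesgue" and lim: "AE x in lebesgue. (\<lambda>n. s n x) \<longlonglongrightarrow> g x"
  shows "g \<in> borel_measurable lebesgue"
proof (rule measurableI)
  define g' where "g' x = lim (\<lambda>n. s n x)" for x
  have g': "g' \<in> borel_measurable lebesgue"
    unfolding g'_def by (rule borel_measurable_lim_metric[OF s])
  have ae: "AE x in lebesgue. g' x = g x"
    using lim by eventually_elim (simp add: g'_def limI)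
  fix B :: "'a set"
  assume B: "B \<in> sets borel"
  have "g -` B \<in> sets lebesgue"
  proof (rule completion.in_sets_AE)
    show "AE x in lebesgue. x \<in> g' -` B \<longleftrightarrow> x \<in> g -` B"
      using ae by eventually_elim simp
    show "g' -` B \<in> sets lebesgue"
      using measurable_sets[OF g' B] by simp
  qed simp
  then show "g -` B \<inter> space lebesgue \<in> sets lebesgue"
    by simp
qed simp

lemma strongly_measurable_imp_borel_measurable:
  fixes g :: "real \<Rightarrow> 'a::{banach, second_countable_topology}"
  assumes S: "S \<in> sets lebesgue" and g: "strongly_measurable (lebesgue_on S) g"
  shows "(\<lambda>x. indicator S x *\<^sub>R g x) \<in> borel_measurable lebesgue"
proof -
  obtain s where s: "\<And>n::nat. simple_function (lebesgue_on S) (s n)"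
    and lim: "AE x in lebesgue_on S. (\<lambda>n. s n x) \<longlonglongrightarrow> g x"
    using g by (auto simp: strongly_measurable_def)
  have "s n \<in> borel_measurable (lebesgue_on S)" for n
    by (rule borel_measurable_simple_function[OF s])
  then have sm: "(\<lambda>x. indicator S x *\<^sub>R s n x) \<in> borel_measurable lebesgue" for n
    using S borel_measurable_restrict_space_iff[of S lebesgue "s n"] by simp
  have "AE x in lebesgue. x \<in> S \<longrightarrow> (\<lambda>n. s n x) \<longlonglongrightarrow> g x"
    using lim S by (simp add: AE_restrict_space_iff)
  then have "AE x in lebesgue. (\<lambda>n. indicator S x *\<^sub>R s n x) \<longlonglongrightarrow> indicator S x *\<^sub>R g x"
    by eventually_elim (auto simp: indicator_def)
  then show ?thesis
    by (rule borel_measurable_lebesgue_AE_limit[OF sm])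
qed

lemma norm_inverse_two_pi_i: "cmod (inverse (2 * of_real pi * \<i>)) = 1 / (2 * pi)"
  unfolding norm_inverse norm_mult by (simp add: inverse_eq_divide)

lemma average_two_pi: "1 / (2 * pi) * (B + B) = 1 / pi * B"
  by (simp add: field_simps)

text \<open>The 2 in the constant bounds the modulus of the directions; two rays with the prefactor
  \<open>1 / (2 * pi)\<close> contribute \<open>1 / pi\<close>, which is at most 1.\<close>

lemma inverse_laplace_Lipschitz:
  fixes F :: "complex \<Rightarrow> 'a::{complex_banach, second_countable_topology}"
  assumes a: "0 < a" and c: "0 < c" "c \<le> 1" and F: "continuous_on (wedge a c) F" and C: "0 \<le> C"
    and le: "\<And>z. z \<in> wedge a c \<Longrightarrow> norm (F z) \<le> C / cmod z" and \<epsilon>: "0 < \<epsilon>" "\<epsilon> \<le> s" "s \<le> t" "t \<le> T"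
  shows "norm (inverse_laplace a c F t - inverse_laplace a c F s) \<le> C * (2 * exp (a * T) / (c * \<epsilon>)) * (t - s)"
proof -
  define d d' where "d = Complex (- c) 1" and "d' = Complex (- c) (- 1)"
  have dd: "Re d = - c" "\<bar>Im d\<bar> = 1" "Re d' = - c" "\<bar>Im d'\<bar> = 1"
    by (auto simp: d_def d'_def)
  have nd: "cmod e \<le> 2" if "Re e = - c" "\<bar>Im e\<bar> = 1" for e
    using cmod_le[of e] that c by simp
  have le': "norm (ray_integral a e F t - ray_integral a e F s) \<le> C * (2 * exp (a * T) / (c * \<epsilon>)) * (t - s)"
    if e: "Re e = - c" "\<bar>Im e\<bar> = 1" for e
  proof -
    have "norm (ray_integral a e F t - ray_integral a e F s) \<le> C * cmod e * exp (a * T) / (c * \<epsilon>) * (t - s)"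
      by (rule ray_integral_Lipschitz[OF a c e F C le \<epsilon>])
    also have "\<dots> \<le> C * 2 * exp (a * T) / (c * \<epsilon>) * (t - s)"
      using nd[OF e] C c \<epsilon> by (intro mult_right_mono divide_right_mono mult_left_mono) auto
    finally show ?thesis
      by (simp add: mult.assoc)
  qed
  let ?B = "C * (2 * exp (a * T) / (c * \<epsilon>)) * (t - s)"
  have "inverse_laplace a c F t - inverse_laplace a c F s = inverse (2 * of_real pi * \<i>) *C
    ((ray_integral a d F t - ray_integral a d F s) - (ray_integral a d' F t - ray_integral a d' F s))"
  proof -
    have rearrange: "(p - q) - (p' - q') = (p - p') - (q - q')" for p q p' q' :: 'a
      by (simp add: algebra_simps)
    show ?thesis
      by (simp only: inverse_laplace_def d_def d'_def scaleC.diff_right[symmetric] rearrange)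
  qed
  then have "norm (inverse_laplace a c F t - inverse_laplace a c F s)
    = 1 / (2 * pi) * norm ((ray_integral a d F t - ray_integral a d F s) - (ray_integral a d' F t - ray_integral a d' F s))"
    by (simp only: norm_scaleC norm_inverse_two_pi_i)
  also have "\<dots> \<le> 1 / (2 * pi) * (?B + ?B)"
    by (rule mult_left_mono[OF order_trans[OF norm_triangle_ineq4 add_mono[OF le'[OF dd(1,2)] le'[OF dd(3,4)]]]]) simp
  also have "\<dots> = (1 / pi) * ?B"
    by (rule average_two_pi)
  also have "\<dots> \<le> 1 * ?B"
    using C c \<epsilon> pi_ge_two by (intro mult_right_mono) (auto simp: divide_le_eq)
  finally show ?thesis
    by simp
qed

lemma norm_inverse_laplace_le:
  fixes F :: "complex \<Rightarrow> 'a::{complex_banach, second_countable_topology}"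
  assumes a: "0 < a" and c: "0 < c" "c \<le> 1" and F: "continuous_on (wedge a c) F"
    and le: "\<And>z. z \<in> wedge a c \<Longrightarrow> norm (F z) \<le> K" and t: "0 < t"
  shows "norm (inverse_laplace a c F t) \<le> K * (2 * exp (a * t) / (c * t))"
proof -
  define d d' where "d = Complex (- c) 1" and "d' = Complex (- c) (- 1)"
  have dd: "Re d = - c" "\<bar>Im d\<bar> = 1" "Re d' = - c" "\<bar>Im d'\<bar> = 1"
    by (auto simp: d_def d'_def)
  have K: "0 \<le> K"
  proof -
    have "of_real a \<in> wedge a c"
      by (simp add: wedge_def)
    then show ?thesis
      using order_trans[OF norm_ge_zero le] by blast
  qed
  have nd: "cmod e \<le> 2" if "Re e = - c" "\<bar>Im e\<bar> = 1" for e
    using cmod_le[of e] that c by simp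
  have le': "norm (ray_integral a e F t) \<le> K * (2 * exp (a * t) / (c * t))" if e: "Re e = - c" "\<bar>Im e\<bar> = 1" for e
  proof -
    have "norm (ray_integral a e F t) \<le> K * cmod e * exp (a * t) / (c * t)"
      by (rule ray_integral_bound(2)[OF a c e F le t])
    also have "\<dots> \<le> K * 2 * exp (a * t) / (c * t)"
      using nd[OF e] K c t by (intro mult_right_mono divide_right_mono mult_left_mono) auto
    finally show ?thesis
      by (simp add: mult.assoc)
  qed
  let ?B = "K * (2 * exp (a * t) / (c * t))"
  have "norm (inverse_laplace a c F t) = 1 / (2 * pi) * norm (ray_integral a d F t - ray_integral a d' F t)"
    unfolding inverse_laplace_def d_def[symmetric] d'_def[symmetric]
    by (simp only: norm_scaleC norm_inverse_two_pi_i)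
  also have "\<dots> \<le> 1 / (2 * pi) * (?B + ?B)"
    by (rule mult_left_mono[OF order_trans[OF norm_triangle_ineq4 add_mono[OF le'[OF dd(1,2)] le'[OF dd(3,4)]]]]) simp
  also have "\<dots> = (1 / pi) * ?B"
    by (rule average_two_pi)
  also have "\<dots> \<le> 1 * ?B"
    using K c t pi_ge_two by (intro mult_right_mono) (auto simp: divide_le_eq)
  finally show ?thesis
    by simp
qed

lemma inverse_laplace_bounded_linear:
  fixes F :: "complex \<Rightarrow> 'a::{complex_banach, second_countable_topology}"
    and L :: "'a \<Rightarrow> 'b::{complex_banach, second_countable_topology}"
  assumes L: "bounded_linear L" "\<And>c x. L (c *C x) = c *C L x"
    and a: "0 < a" and c: "0 < c" "c \<le> 1" and F: "continuous_on (wedge a c) F"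
    and le: "\<And>z. z \<in> wedge a c \<Longrightarrow> norm (F z) \<le> K" and t: "0 < t"
  shows "L (inverse_laplace a c F t) = inverse_laplace a c (\<lambda>z. L (F z)) t"
proof -
  interpret L: bounded_linear L
    by fact
  have *: "L (ray_integral a e F t) = ray_integral a e (\<lambda>z. L (F z)) t" if e: "Re e = - c" "\<bar>Im e\<bar> = 1" for e
    using integral_bounded_linear[OF L(1) ray_integral_bound(1)[OF a c e F le t, unfolded set_integrable_def]]
    by (simp add: ray_integral_def set_lebesgue_integral_def L.scaleR L(2))
  show ?thesis
    by (simp add: inverse_laplace_def L(2) L.diff *)
qed

section \<open>Identification of the resolvent operator with the contour integral\<close>

context
  fixes \<nu> \<alpha> :: real and D :: "'w::{complex_banach, second_countable_topology} set" and A :: "'w \<Rightarrow> 'w"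
    and G :: "real \<Rightarrow> 'w \<Rightarrow>\<^sub>L 'w" and Gh :: "complex \<Rightarrow> 'w \<Rightarrow>\<^sub>L 'w"
    and DN :: "real \<Rightarrow> 'w set" and N :: "real \<Rightarrow> 'w \<Rightarrow> 'w" and Nh :: "complex \<Rightarrow> 'w \<Rightarrow> 'w"
    and R :: "real \<Rightarrow> 'w \<Rightarrow>\<^sub>L 'w"
  assumes A: "closed_operator D A" and Cd1: "Cd1 \<nu> D A" and Cd2: "Cd2 \<nu> \<alpha> D A G Gh" and Cd3: "Cd3 \<nu> D A DN N Nh"
    and R: "resolvent_operator D A G N R"
begin

lemma exp_scaleC: "exp (- complex_of_real l * complex_of_real t) *C (x::'x::complex_normed_vector) = exp (- l * t) *\<^sub>R x"
  by (simp add: scaleR_scaleC exp_of_real[symmetric])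

lemma resolvent_bound: "\<exists>M \<omega>. 0 < \<omega> \<and> (\<forall>t\<ge>0. norm (R t) \<le> M * exp (\<omega> * t))"
proof -
  obtain M \<omega> where M: "\<And>t. 0 \<le> t \<Longrightarrow> norm (R t) \<le> M * exp (\<omega> * t)"
    using R by (auto simp: resolvent_operator_def)
  \<comment> \<open>A positive rate is arranged: the half-line \<open>l > \<omega>\<close> then lies
    where the transforms of \<open>G\<close> and \<open>N\<close> exist.\<close>
  have "norm (R t) \<le> \<bar>M\<bar> * exp (max 1 \<omega> * t)" if "0 \<le> t" for t
  proof -
    have "M * exp (\<omega> * t) \<le> \<bar>M\<bar> * exp (max 1 \<omega> * t)"
      using that by (intro mult_mono) (auto intro: mult_right_mono)
    then show ?thesis
      using M[OF that] by linarith
  qed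
  then show ?thesis
    by (intro exI[of _ "\<bar>M\<bar>"] exI[of _ "max 1 \<omega>"]) auto
qed

lemma cont_R: "continuous_on {0..} (\<lambda>t. R t z)"
  using R by (simp add: resolvent_operator_def)

lemma laplace_G:
  assumes l: "0 < l"
  shows "set_integrable lebesgue {0..} (\<lambda>s. exp (- l * s) *\<^sub>R G s z)"
    and "(LINT s:{0..}|lebesgue. exp (- l * s) *\<^sub>R G s z) = Gh (of_real l) z"
proof -
  have *: "laplace_exists (\<lambda>t. G t z) (of_real l)" "Gh (of_real l) z = laplace (\<lambda>t. G t z) (of_real l)"
    using Cd2 l by (auto simp: Cd2_def)
  have "{0..} \<in> sets (lebesgue :: real measure)"
    by simp
  note s = set_integral_lebesgue_on[OF this]
  show "set_integrable lebesgue {0..} (\<lambda>s. exp (- l * s) *\<^sub>R G s z)"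
    "(LINT s:{0..}|lebesgue. exp (- l * s) *\<^sub>R G s z) = Gh (of_real l) z"
    using * unfolding laplace_exists_def laplace_def exp_scaleC s by auto
qed

lemma laplace_N:
  assumes l: "0 < l" and z: "z \<in> D"
  shows "set_integrable lebesgue {0..} (\<lambda>s. exp (- l * s) *\<^sub>R N s z)"
    and "(LINT s:{0..}|lebesgue. exp (- l * s) *\<^sub>R N s z) = Nh (of_real l) z"
proof -
  have S: "{0..} \<in> sets (lebesgue :: real measure)" "{0<..} \<in> sets (lebesgue :: real measure)"
    by auto
  note s = set_integral_lebesgue_on[OF S(1)]
  obtain \<kappa> :: "real \<Rightarrow> real" where "laplace_exists (\<lambda>t. complex_of_real (\<kappa> t)) (of_real l)"
    and le: "\<And>t. 0 < t \<Longrightarrow> norm (N t z) \<le> \<kappa> t * graph_norm A z"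
  proof -
    have "\<exists>\<pi> :: real \<Rightarrow> real.
      (\<forall>a>0. integrable (lebesgue_on {0..a}) \<pi>) \<and>
      (\<forall>\<mu>. 0 < Re \<mu> \<longrightarrow> laplace_exists (\<lambda>t. complex_of_real (\<pi> t)) \<mu>) \<and>
      (\<forall>t>0. \<forall>z\<in>D. norm (N t z) \<le> \<pi> t * graph_norm A z)"
      using Cd3 unfolding Cd3_def by blast
    then obtain \<pi> :: "real \<Rightarrow> real" where "\<forall>\<mu>. 0 < Re \<mu> \<longrightarrow> laplace_exists (\<lambda>t. complex_of_real (\<pi> t)) \<mu>"
      "\<forall>t>0. \<forall>z\<in>D. norm (N t z) \<le> \<pi> t * graph_norm A z"
      by blast
    then show ?thesis
      using that[of \<pi>] l z by simp
  qed
  then have \<kappa>: "set_integrable lebesgue {0..} (\<lambda>t. exp (- l * t) *\<^sub>R complex_of_real (\<kappa> t))"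
    unfolding laplace_exists_def exp_scaleC s by simp
  have "(\<lambda>t. indicator {0<..} t *\<^sub>R N t z) \<in> borel_measurable lebesgue"
    using Cd3 z by (intro strongly_measurable_imp_borel_measurable S(2)) (simp add: Cd3_def)
  then have m1: "(\<lambda>t. exp (- l * t) *\<^sub>R (indicator {0<..} t *\<^sub>R N t z)) \<in> borel_measurable lebesgue"
    by (rule borel_measurable_scaleR[OF borel_imp_lebesgue_measurable, rotated]) auto
  \<comment> \<open>Measurability is given on the open half-line; the value \<open>N 0 z\<close> at
    the single point 0 is added separately.\<close>
  have m2: "(\<lambda>t. indicator {0} t *\<^sub>R N 0 z) \<in> borel_measurable lebesgue"
    by (intro borel_measurable_scaleR borel_measurable_indicator borel_measurable_const) auto
  have m: "(\<lambda>t. indicator {0..} t *\<^sub>R (exp (- l * t) *\<^sub>R N t z)) \<in> borel_measurable lebesgue"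
    by (rule measurable_cong[THEN iffD1, OF _ borel_measurable_add[OF m1 m2]]) (auto simp: indicator_def)
  show "set_integrable lebesgue {0..} (\<lambda>s. exp (- l * s) *\<^sub>R N s z)"
  proof (rule set_integrable_bound)
    show "set_integrable lebesgue {0..} (\<lambda>t. graph_norm A z *\<^sub>R (exp (- l * t) *\<^sub>R complex_of_real (\<kappa> t)))"
      by (rule set_integrable_scaleR_right) (rule \<kappa>)
    show "set_borel_measurable lebesgue {0..} (\<lambda>s. exp (- l * s) *\<^sub>R N s z)"
      unfolding set_borel_measurable_def by (rule m)
    have "AE s in lebesgue. s \<noteq> (0::real)"
      by (rule AE_completion) (rule AE_lborel_singleton)
    then show "AE s in lebesgue. s \<in> {0..} \<longrightarrow> norm (exp (- l * s) *\<^sub>R N s z) \<le> norm (graph_norm A z *\<^sub>R (exp (- l * s) *\<^sub>R complex_of_real (\<kappa> s)))"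
    proof eventually_elim
      case (elim s)
      have "norm (N s z) \<le> graph_norm A z * \<bar>\<kappa> s\<bar>" if "0 < s"
        using le[OF that] mult_right_mono[OF abs_ge_self[of "\<kappa> s"] graph_norm_nonneg[of A z]] by (simp add: mult.commute)
      then show ?case
        using elim graph_norm_nonneg[of A z] by (auto simp: mult.left_commute intro!: mult_left_mono)
    qed
  qed
  have "Nh (of_real l) z = laplace (\<lambda>t. N t z) (of_real l)"
    using Cd3 z l unfolding Cd3_def by (metis Re_complex_of_real)
  then show "(LINT s:{0..}|lebesgue. exp (- l * s) *\<^sub>R N s z) = Nh (of_real l) z"
    unfolding laplace_def exp_scaleC s by simp
qed

text \<open>In the second resolvent equation \<open>R\<close> stands to the left of
  \<open>A\<close>, \<open>G\<close> and \<open>N\<close>, so its transform makes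
  \<open>laplace_op R l\<close> a left inverse of the symbol on \<open>D\<close>. Since
  \<open>symbol_inverse\<close> is a right inverse with values in \<open>D\<close>, the two
  agree.\<close>

lemma laplace_op_symbol:
  assumes M: "\<And>t. 0 \<le> t \<Longrightarrow> norm (R t) \<le> M * exp (\<omega> * t)" and \<omega>: "0 < \<omega>" and l: "\<omega> < l" and z: "z \<in> D"
  shows "laplace_op R l (symbol A Gh Nh (of_real l) z) = z"
proof -
  have l0: "0 < l"
    using l \<omega> by simp
  interpret L: bounded_linear "laplace_op R l"
    by (rule bounded_linear_laplace_op[OF M \<omega> cont_R l])
  have conv: "convolution R y t = (LINT s|lebesgue_on {0..t}. R (t - s) (y s))" for y t
    using set_integral_lebesgue_on(1)[of "{0..t}" "\<lambda>s. R (t - s) (y s)"] by (simp add: convolution_def[OF M \<omega> cont_R])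
  have "l *\<^sub>R (laplace_op R l z + laplace_op R l (LINT s:{0..}|lebesgue. exp (- l * s) *\<^sub>R G s z)) - z
    = laplace_op R l (A z) + laplace_op R l (LINT s:{0..}|lebesgue. exp (- l * s) *\<^sub>R N s z)"
  proof (rule laplace_evolution_equation[OF M \<omega> cont_R laplace_G(1) laplace_N(1)[OF _ z] _ _ l])
    show "R 0 = id_blinfun"
      using R by (simp add: resolvent_operator_def)
    fix t :: real
    assume "0 \<le> t"
    then show "((\<lambda>t. R t z + convolution R (\<lambda>s. G s z) t) has_vector_derivative R t (A z) + convolution R (\<lambda>s. N s z) t) (at t within {0..})"
      using R z unfolding conv resolvent_operator_def by blast
  qed
  then have "z = l *\<^sub>R (laplace_op R l z + laplace_op R l (Gh (of_real l) z)) - (laplace_op R l (A z) + laplace_op R l (Nh (of_real l) z))"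
    unfolding laplace_G(2)[OF l0] laplace_N(2)[OF l0 z] by (simp add: algebra_simps)
  also have "\<dots> = laplace_op R l (symbol A Gh Nh (of_real l) z)"
    by (simp add: symbol_def[OF A Cd1 Cd2 Cd3] L.diff L.add L.scaleR scaleR_add_right flip: scaleR_scaleC)
  finally show ?thesis
    by simp
qed

text \<open>For real \<open>l > a\<close> the transform of \<open>R\<close> is the inverse symbol,
  and so is that of the contour integral. Composed with functionals both are continuous on the open
  half-line, so uniqueness of the transform applies.\<close>

lemma resolvent_operator_representation:
  "\<exists>a C. 0 < a \<and> 0 < C \<and>
    (\<forall>x. continuous_on (wedge a (- cos \<nu>)) (\<lambda>\<mu>. symbol_inverse D A Gh Nh \<mu> x)
      \<and> continuous_on (wedge a (- cos \<nu>)) (\<lambda>\<mu>. A (symbol_inverse D A Gh Nh \<mu> x))) \<and>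
    (\<forall>\<mu>\<in>wedge a (- cos \<nu>). \<forall>x. symbol_inverse D A Gh Nh \<mu> x \<in> D \<and>
      norm (symbol_inverse D A Gh Nh \<mu> x) \<le> C / cmod \<mu> * norm x \<and> graph_norm A (symbol_inverse D A Gh Nh \<mu> x) \<le> C * norm x) \<and>
    (\<forall>t>0. \<forall>x. R t x = inverse_laplace a (- cos \<nu>) (\<lambda>\<mu>. symbol_inverse D A Gh Nh \<mu> x) t)"
proof -
  let ?S = "symbol_inverse D A Gh Nh"
  obtain a0 C where a0: "0 < a0" and C: "0 < C" and sub: "wedge a0 (- cos \<nu>) \<subseteq> sector \<nu>"
    and S: "\<And>\<mu>. \<mu> \<in> wedge a0 (- cos \<nu>) \<Longrightarrow> (\<forall>x. ?S \<mu> x \<in> D \<and> symbol A Gh Nh \<mu> (?S \<mu> x) = x \<and>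
      norm (?S \<mu> x) \<le> C / cmod \<mu> * norm x \<and> graph_norm A (?S \<mu> x) \<le> C * norm x) \<and>
    (\<forall>z\<in>D. ?S \<mu> (symbol A Gh Nh \<mu> z) = z)"
    using symbol_inverse_exists[OF A Cd1 Cd2 Cd3] by blast
  obtain M \<omega> where \<omega>: "0 < \<omega>" and M: "\<And>t. 0 \<le> t \<Longrightarrow> norm (R t) \<le> M * exp (\<omega> * t)"
    using resolvent_bound by blast
  define c where "c = - cos \<nu>"
  have c: "0 < c" "c \<le> 1"
    using cos_monotone_0_pi[of "pi / 2" \<nu>] Cd1 cos_ge_minus_one[of \<nu>] by (auto simp: Cd1_def c_def)
  \<comment> \<open>Exceeding \<open>a0\<close> puts the closed wedge into the open one, where the
    inverse symbol is holomorphic; exceeding \<omega> makes the transform of \<open>R\<close>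
    converge for all \<open>l > a\<close>.\<close>
  define a where "a = max a0 \<omega> + 1"
  have a: "0 < a" "a0 < a" "\<omega> < a"
    using a0 by (auto simp: a_def)
  have sub': "wedge a c \<subseteq> open_wedge a0 c"
    by (rule wedge_subset_open_wedge[OF a(2)])
  then have sub0: "wedge a c \<subseteq> wedge a0 c"
    using open_wedge_subset_wedge by blast
  note facts = S[folded c_def]
  have cont: "continuous_on (open_wedge a0 c) (\<lambda>\<mu>. ?S \<mu> x)" "continuous_on (open_wedge a0 c) (\<lambda>\<mu>. A (?S \<mu> x))" for x
    unfolding c_def using continuous_on_symbol_inverse[OF A Cd1 Cd2 Cd3 a0 C sub] S by blast+
  have hol: "(\<lambda>\<mu>. \<phi> (?S \<mu> x)) holomorphic_on open_wedge a0 c" if "\<phi> \<in> cdual" for \<phi> :: "'w \<Rightarrow>\<^sub>L complex" and x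
    unfolding c_def using holomorphic_symbol_inverse[OF A Cd1 Cd2 Cd3 a0 C sub _ _ _ _ _ that] S by blast
  have cont': "continuous_on (wedge a c) (\<lambda>\<mu>. ?S \<mu> x)" for x
    by (rule continuous_on_subset[OF cont(1) sub'])
  have norm_le: "norm (?S \<mu> x) \<le> (C * norm x) / cmod \<mu>" if "\<mu> \<in> wedge a c" for \<mu> x
    using facts[of \<mu>] sub0 that by (auto simp: subset_iff)
  have norm_le': "norm (?S \<mu> x) \<le> C * norm x" if "\<mu> \<in> wedge a c" for \<mu> x
  proof -
    have "norm (?S \<mu> x) \<le> graph_norm A (?S \<mu> x)"
      by (simp add: graph_norm_def)
    also have "\<dots> \<le> C * norm x"
      using facts[of \<mu>] sub0 that by (auto simp: subset_iff)
    finally show ?thesis .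
  qed
  have laplace: "laplace_op R l x = ?S (of_real l) x" if "a < l" for l x
  proof -
    have "of_real l \<in> wedge a0 c"
      using that a by (simp add: wedge_def)
    then have "?S (of_real l) x \<in> D" "symbol A Gh Nh (of_real l) (?S (of_real l) x) = x"
      using facts by auto
    then show ?thesis
      using laplace_op_symbol[OF M \<omega> _, of l "?S (of_real l) x"] that a by simp
  qed
  have "R t x = inverse_laplace a c (\<lambda>\<mu>. ?S \<mu> x) t" if t: "0 < t" for t x
  proof (rule cdual_separates)
    fix \<phi> :: "'w \<Rightarrow>\<^sub>L complex"
    assume \<phi>: "\<phi> \<in> cdual"
    have bl: "bounded_linear (blinfun_apply \<phi>)"
      by (rule blinfun.bounded_linear_right)
    have \<phi>C: "\<phi> (k *C y) = k *C \<phi> y" for k y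
      using cdual_functional[OF \<phi>] by (simp add: scaleC_complex_def)
    let ?h = "\<lambda>\<mu>. \<phi> (?S \<mu> x)"
    have comm: "\<phi> (inverse_laplace a c (\<lambda>\<mu>. ?S \<mu> x) t) = inverse_laplace a c ?h t" if "0 < t" for t
      by (rule inverse_laplace_bounded_linear[OF bl \<phi>C a(1) c cont' norm_le' that])
    have hle: "cmod (?h z) \<le> (norm \<phi> * (C * norm x)) / cmod z" if "z \<in> wedge a c" for z
    proof -
      have "cmod (?h z) \<le> norm \<phi> * ((C * norm x) / cmod z)"
        by (intro order_trans[OF norm_blinfun] mult_left_mono norm_le that) auto
      then show ?thesis
        by simp
    qed
    have C0: "0 \<le> norm \<phi> * (C * norm x)"
      using C by simp
    have conth: "continuous_on (wedge a c) ?h"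
      by (intro continuous_intros cont')
    have "\<phi> (R t x) = inverse_laplace a c ?h t"
    proof (rule laplace_unique[OF _ _ _ _ _ t])
      show "continuous_on {0<..} (\<lambda>t. \<phi> (R t x))"
        by (intro continuous_intros continuous_on_subset[OF cont_R]) auto
      show "continuous_on {0<..} (inverse_laplace a c ?h)"
      proof (rule continuous_at_imp_continuous_on, intro ballI)
        fix s :: real
        assume "s \<in> {0<..}"
        then have s: "0 < s"
          by simp
        \<comment> \<open>The Lipschitz constant for \<open>\<epsilon> = s / 2\<close> and final
          time \<open>s + 1\<close>, which serves a neighbourhood of the point
          \<open>s\<close>.\<close>
        define K where "K = (norm \<phi> * (C * norm x)) * (2 * exp (a * (s + 1)) / (c * (s / 2)))"
        have Lip: "norm (inverse_laplace a c ?h t2 - inverse_laplace a c ?h t1) \<le> K * (t2 - t1)"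
          if "s / 2 \<le> t1" "t1 \<le> t2" "t2 \<le> s + 1" for t1 t2
          unfolding K_def
          by (rule inverse_laplace_Lipschitz[OF a(1) c conth C0 hle]) (use s that in auto)
        have K: "0 \<le> K"
          unfolding K_def using C0 s c by simp
        have "K-lipschitz_on {s/2..s+1} (inverse_laplace a c ?h)"
        proof (rule lipschitz_onI)
          fix t1 t2
          assume t12: "t1 \<in> {s/2..s+1}" "t2 \<in> {s/2..s+1}"
          show "dist (inverse_laplace a c ?h t1) (inverse_laplace a c ?h t2) \<le> K * dist t1 t2"
          proof (cases "t1 \<le> t2")
            case True
            then show ?thesis
              using Lip[of t1 t2] t12 by (simp add: dist_norm norm_minus_commute)
          next
            case False
            then show ?thesis
              using Lip[of t2 t1] t12 by (simp add: dist_norm)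
          qed
        qed (rule K)
        then have "continuous_on {s/2..s+1} (inverse_laplace a c ?h)"
          by (rule lipschitz_on_continuous_on)
        then show "isCont (inverse_laplace a c ?h) s"
          using s by (intro continuous_on_interior[of "{s/2..s+1}"]) auto
      qed
      fix r
      assume r: "a < r"
      then have \<omega>r: "\<omega> < r"
        using a by simp
      note iw = set_integrable_weighted[OF M \<omega> cont_R \<omega>r, of x]
      have e: "exp (- of_real r * of_real t) * \<phi> y = \<phi> (exp (- r * t) *\<^sub>R y)" for t y
        using exp_scaleC[of r t "\<phi> y"] by (simp add: scaleC_complex_def blinfun.scaleR_right)
      show "set_integrable lborel {0..} (\<lambda>t. exp (- of_real r * of_real t) * \<phi> (R t x))"
        unfolding e using integrable_bounded_linear[OF bl iw[unfolded set_integrable_def]]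
        by (simp add: set_integrable_def blinfun.scaleR_right)
      show "set_integrable lborel {0..} (\<lambda>t. exp (- of_real r * of_real t) * inverse_laplace a c ?h t)"
        by (rule laplace_inverse_laplace(1)[OF a(1) c hol[OF \<phi>] open_open_wedge sub' C0 hle r])
      have "(LINT t:{0..}|lborel. exp (- of_real r * of_real t) * \<phi> (R t x)) = \<phi> (laplace_op R r x)"
        unfolding e using integral_bounded_linear[OF bl iw[unfolded set_integrable_def]]
        by (simp add: set_lebesgue_integral_def laplace_op_def[OF M \<omega> cont_R] blinfun.scaleR_right)
      also have "\<dots> = (LINT t:{0..}|lborel. exp (- of_real r * of_real t) * inverse_laplace a c ?h t)"
        unfolding laplace[OF r] by (rule laplace_inverse_laplace(2)[OF a(1) c hol[OF \<phi>] open_open_wedge sub' C0 hle r, symmetric])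
      finally show "(LINT t:{0..}|lborel. exp (- of_real r * of_real t) * \<phi> (R t x)) = (LINT t:{0..}|lborel. exp (- of_real r * of_real t) * inverse_laplace a c ?h t)" .
    qed
    then show "\<phi> (R t x) = \<phi> (inverse_laplace a c (\<lambda>\<mu>. ?S \<mu> x) t)"
      using comm[OF t] by simp
  qed
  moreover have "\<forall>x. continuous_on (wedge a c) (\<lambda>\<mu>. ?S \<mu> x) \<and> continuous_on (wedge a c) (\<lambda>\<mu>. A (?S \<mu> x))"
    using continuous_on_subset[OF cont(1) sub'] continuous_on_subset[OF cont(2) sub'] by blast
  moreover have "\<forall>\<mu>\<in>wedge a c. \<forall>x. ?S \<mu> x \<in> D \<and> norm (?S \<mu> x) \<le> C / cmod \<mu> * norm x \<and> graph_norm A (?S \<mu> x) \<le> C * norm x"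
    using facts sub0 by blast
  ultimately show ?thesis
    unfolding c_def[symmetric] using a(1) C by blast
qed

text \<open>The contour formula holds vector by vector, but its Lipschitz constant is proportional
  to \<open>norm x\<close>; this upgrades strong continuity to norm continuity. The constant
  obtained grows like \<open>1 / \<epsilon>\<close>.\<close>

lemma resolvent_operator_Lipschitz:
  "\<exists>K. \<forall>\<epsilon> T s t. 0 < \<epsilon> \<and> \<epsilon> \<le> s \<and> s \<le> t \<and> t \<le> T \<longrightarrow> norm (R t - R s) \<le> K \<epsilon> T * (t - s)"
proof -
  define c where "c = - cos \<nu>"
  have c: "0 < c" "c \<le> 1"
    using cos_monotone_0_pi[of "pi / 2" \<nu>] Cd1 cos_ge_minus_one[of \<nu>] by (auto simp: Cd1_def c_def)
  let ?S = "symbol_inverse D A Gh Nh"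
  obtain a C where a: "0 < a" and C: "0 < C" and cont: "\<And>x. continuous_on (wedge a c) (\<lambda>\<mu>. ?S \<mu> x)"
    and le: "\<And>\<mu> x. \<mu> \<in> wedge a c \<Longrightarrow> norm (?S \<mu> x) \<le> C / cmod \<mu> * norm x"
    and rep: "\<And>t x. 0 < t \<Longrightarrow> R t x = inverse_laplace a c (\<lambda>\<mu>. ?S \<mu> x) t"
    using resolvent_operator_representation unfolding c_def[symmetric] by blast
  have "norm (R t - R s) \<le> C * (2 * exp (a * T) / (c * \<epsilon>)) * (t - s)"
    if \<epsilon>: "0 < \<epsilon>" "\<epsilon> \<le> s" "s \<le> t" "t \<le> T" for \<epsilon> T s t
  proof (rule norm_blinfun_bound)
    show "0 \<le> C * (2 * exp (a * T) / (c * \<epsilon>)) * (t - s)"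
      using C c \<epsilon> by simp
    fix x
    have "norm (inverse_laplace a c (\<lambda>\<mu>. ?S \<mu> x) t - inverse_laplace a c (\<lambda>\<mu>. ?S \<mu> x) s) \<le> (C * norm x) * (2 * exp (a * T) / (c * \<epsilon>)) * (t - s)"
      by (rule inverse_laplace_Lipschitz[OF a c cont]) (use C \<epsilon> le in auto)
    then show "norm ((R t - R s) x) \<le> C * (2 * exp (a * T) / (c * \<epsilon>)) * (t - s) * norm x"
      using \<epsilon> by (simp add: blinfun.diff_left rep mult_ac)
  qed
  then show ?thesis
    by (intro exI[of _ "\<lambda>\<epsilon> T. C * (2 * exp (a * T) / (c * \<epsilon>))"]) blast
qed

text \<open>By the contour representation \<open>R t = resolvent D A \<mu>0 \<circ> Y\<close> with \<open>Y\<close> the bounded contour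
  integral of \<open>(\<mu>0 - A) symbol_inverse\<close>.\<close>

lemma resolvent_operator_compact:
  assumes \<mu>0: "\<mu>0 \<in> resolvent_set D A" and K: "compact_operator (resolvent D A \<mu>0)" and t: "0 < t"
  shows "compact (closure (R t ` cball 0 r))"
proof -
  define c where "c = - cos \<nu>"
  have c: "0 < c" "c \<le> 1"
    using cos_monotone_0_pi[of "pi / 2" \<nu>] Cd1 cos_ge_minus_one[of \<nu>] by (auto simp: Cd1_def c_def)
  let ?S = "symbol_inverse D A Gh Nh"
  obtain a C where a: "0 < a" and C: "0 < C"
    and cont: "\<And>x. continuous_on (wedge a c) (\<lambda>\<mu>. ?S \<mu> x)" "\<And>x. continuous_on (wedge a c) (\<lambda>\<mu>. A (?S \<mu> x))"
    and S: "\<And>\<mu> x. \<mu> \<in> wedge a c \<Longrightarrow> ?S \<mu> x \<in> D" "\<And>\<mu> x. \<mu> \<in> wedge a c \<Longrightarrow> graph_norm A (?S \<mu> x) \<le> C * norm x"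
    and rep: "\<And>t x. 0 < t \<Longrightarrow> R t x = inverse_laplace a c (\<lambda>\<mu>. ?S \<mu> x) t"
    using resolvent_operator_representation unfolding c_def[symmetric] by blast
  let ?K = "resolvent D A \<mu>0"
  note KR = resolvent_facts[OF \<mu>0]
  have Kc: "?K (k *C x) = k *C ?K x" for k x
  proof -
    have "k *C ?K x \<in> D" "\<mu>0 *C k *C ?K x - A (k *C ?K x) = k *C x"
    proof -
      show "k *C ?K x \<in> D"
        using A_linear[OF A Cd1 Cd2 Cd3] KR(1)[of x] by (auto simp: linear_operator_def csubspace_def)
      have "A (k *C ?K x) = k *C A (?K x)"
        using A_linear[OF A Cd1 Cd2 Cd3] KR(1)[of x] by (auto simp: linear_operator_def)
      then have "\<mu>0 *C k *C ?K x - A (k *C ?K x) = k *C (\<mu>0 *C ?K x - A (?K x))"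
        by (simp add: scaleC.diff_right scaleC_scaleC mult.commute)
      then show "\<mu>0 *C k *C ?K x - A (k *C ?K x) = k *C x"
        by (simp add: KR(2))
    qed
    then show ?thesis
      using KR(3) by metis
  qed
  \<comment> \<open>This is \<open>\<mu>0 - A\<close> applied to the inverse symbol. The graph-norm
    estimate bounds it on the wedge, with no decay to rely on, so the exponential has to make its
    contour integral converge.\<close>
  define y where "y x \<mu> = \<mu>0 *C ?S \<mu> x - A (?S \<mu> x)" for x \<mu>
  have conty: "continuous_on (wedge a c) (y x)" for x
    unfolding y_def by (intro continuous_intros scaleC.continuous_on cont)
  have yle: "norm (y x \<mu>) \<le> (cmod \<mu>0 + 1) * (C * norm x)" if "\<mu> \<in> wedge a c" for x \<mu>
  proof -
    have "norm (y x \<mu>) \<le> cmod \<mu>0 * norm (?S \<mu> x) + norm (A (?S \<mu> x))"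
      unfolding y_def using norm_triangle_ineq4[of "\<mu>0 *C ?S \<mu> x" "A (?S \<mu> x)"] by (simp add: norm_scaleC)
    also have "\<dots> \<le> cmod \<mu>0 * graph_norm A (?S \<mu> x) + graph_norm A (?S \<mu> x)"
      by (intro add_mono mult_left_mono) (auto simp: graph_norm_def)
    also have "\<dots> = (cmod \<mu>0 + 1) * graph_norm A (?S \<mu> x)"
      by (simp add: distrib_right)
    also have "\<dots> \<le> (cmod \<mu>0 + 1) * (C * norm x)"
      by (intro mult_left_mono S(2)[OF that]) auto
    finally show ?thesis .
  qed
  have Ky: "?K (y x \<mu>) = ?S \<mu> x" if "\<mu> \<in> wedge a c" for x \<mu>
    unfolding y_def by (rule KR(3)[OF S(1)[OF that]])
  define E where "E = 2 * exp (a * t) / (c * t)"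
  have E: "0 \<le> E"
    using c t by (simp add: E_def)
  have "R t ` cball 0 r \<subseteq> ?K ` cball 0 ((cmod \<mu>0 + 1) * (C * r) * E)"
  proof
    fix v
    assume "v \<in> R t ` cball 0 r"
    then obtain x where x: "norm x \<le> r" and v: "v = R t x"
      by auto
    have "?K (inverse_laplace a c (y x) t) = inverse_laplace a c (\<lambda>\<mu>. ?K (y x \<mu>)) t"
      by (rule inverse_laplace_bounded_linear[OF KR(4) Kc a c conty yle t])
    also have "\<dots> = inverse_laplace a c (\<lambda>\<mu>. ?S \<mu> x) t"
    proof -
      have "ray_integral a e (\<lambda>\<mu>. ?K (y x \<mu>)) t = ray_integral a e (\<lambda>\<mu>. ?S \<mu> x) t" if "Re e = - c" "\<bar>Im e\<bar> = 1" for e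
        unfolding ray_integral_def
        by (rule set_lebesgue_integral_cong) (use Ky ray_in_wedge[OF a c that] in auto)
      then show ?thesis
        by (simp add: inverse_laplace_def)
    qed
    finally have "v = ?K (inverse_laplace a c (y x) t)"
      using rep[OF t] v by simp
    moreover have "norm (inverse_laplace a c (y x) t) \<le> (cmod \<mu>0 + 1) * (C * r) * E"
    proof -
      have "norm (inverse_laplace a c (y x) t) \<le> (cmod \<mu>0 + 1) * (C * norm x) * E"
        unfolding E_def by (rule norm_inverse_laplace_le[OF a c conty yle t])
      also have "\<dots> \<le> (cmod \<mu>0 + 1) * (C * r) * E"
        using x C E by (intro mult_right_mono mult_left_mono) auto
      finally show ?thesis .
    qed
    ultimately show "v \<in> ?K ` cball 0 ((cmod \<mu>0 + 1) * (C * r) * E)"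
      by auto
  qed
  then have "closure (R t ` cball 0 r) \<subseteq> closure (?K ` cball 0 ((cmod \<mu>0 + 1) * (C * r) * E))"
    by (rule closure_mono)
  moreover have "compact (closure (?K ` cball 0 ((cmod \<mu>0 + 1) * (C * r) * E)))"
    using K bounded_cball by (auto simp: compact_operator_def)
  ultimately show ?thesis
    by (metis closed_closure compact_closure closure_closure bounded_subset compact_imp_closed compact_Int_closed inf.absorb_iff2)
qed

end

section \<open>Compactness of the Duhamel operator\<close>

text \<open>Members of \<open>X\<close> that choose the same net points on a fine grid differ by at
  most \<open>e / 2\<close> everywhere, four errors of \<open>e / 8\<close>, and there are only
  finitely many choices. Each choice that occurs is represented by a member of \<open>X\<close>;
  clamping reduces the line to the interval.\<close>

lemma Arzela_Ascoli_totally_bounded: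
  fixes X :: "(real \<Rightarrow>\<^sub>C 'a::metric_space) set" and T :: real
  assumes T: "0 \<le> T" and clamp: "\<And>x t. x \<in> X \<Longrightarrow> x t = x (max 0 (min T t))"
    and equi: "\<And>e. 0 < e \<Longrightarrow> \<exists>d>0. \<forall>x\<in>X. \<forall>s t. 0 \<le> s \<and> s \<le> t \<and> t \<le> T \<and> t - s < d \<longrightarrow> dist (x t) (x s) \<le> e"
    and pointwise: "\<And>t e. 0 \<le> t \<Longrightarrow> t \<le> T \<Longrightarrow> 0 < e \<Longrightarrow> \<exists>k. finite k \<and> (\<forall>x\<in>X. \<exists>c\<in>k. dist (x t) c < e)"
    and e: "0 < e"
  shows "\<exists>k. finite k \<and> X \<subseteq> (\<Union>x\<in>k. ball x e)"
proof -
  have "0 < e / 8"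
    using e by simp
  then obtain d where d: "0 < d"
    and equi': "\<And>x s t. x \<in> X \<Longrightarrow> 0 \<le> s \<Longrightarrow> s \<le> t \<Longrightarrow> t \<le> T \<Longrightarrow> t - s < d \<Longrightarrow> dist (x t) (x s) \<le> e / 8"
    using equi by metis
  obtain n :: nat where n: "T / d < real n"
    using reals_Archimedean2 by blast
  have n0: "0 < n"
  proof -
    have "0 \<le> T / d"
      using T d by simp
    then show ?thesis
      using n by (cases "n = 0") auto
  qed
  define q where "q i = real i * T / real n" for i
  have q: "0 \<le> q i \<and> q i \<le> T" if "i \<le> n" for i
    using that T n0 mult_right_mono[of "real i" "real n" T] by (simp add: q_def divide_le_eq mult.commute)
  have "\<exists>k. finite k \<and> (\<forall>x\<in>X. \<exists>c\<in>k. dist (x (q i)) c < e / 8)" if "i \<le> n" for i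
    using pointwise[of "q i" "e / 8"] q[OF that] e by simp
  then obtain k where k: "\<And>i. i \<le> n \<Longrightarrow> finite (k i)" "\<And>i x. i \<le> n \<Longrightarrow> x \<in> X \<Longrightarrow> \<exists>c\<in>k i. dist (x (q i)) c < e / 8"
    by metis
  \<comment> \<open>Records a nearby net point at every grid node. The values lie in a finite
    product, so finitely many balls suffice.\<close>
  define pat where "pat x = restrict (\<lambda>i. SOME c. c \<in> k i \<and> dist (x (q i)) c < e / 8) {..n}" for x :: "real \<Rightarrow>\<^sub>C 'a"
  have pat: "pat x i \<in> k i \<and> dist (x (q i)) (pat x i) < e / 8" if "x \<in> X" "i \<le> n" for x i
    using someI_ex[of "\<lambda>c. c \<in> k i \<and> dist (x (q i)) c < e / 8"] k(2)[OF that(2,1)] that by (auto simp: pat_def)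
  have "pat ` X \<subseteq> PiE {..n} k"
  proof
    fix g
    assume "g \<in> pat ` X"
    then obtain x where "x \<in> X" "g = pat x"
      by auto
    then show "g \<in> PiE {..n} k"
      using pat by (intro PiE_I) (auto simp: pat_def)
  qed
  then have "finite (pat ` X)"
    by (rule finite_subset) (use k(1) in \<open>auto intro: finite_PiE\<close>)
  then obtain K where K: "K \<subseteq> X" "finite K" "pat ` X = pat ` K"
    using finite_subset_image[of "pat ` X" pat X] by blast
  have "X \<subseteq> (\<Union>x\<in>K. ball x e)"
  proof
    fix x
    assume x: "x \<in> X"
    then obtain y where y: "y \<in> K" "pat x = pat y"
      using K(3) by (metis imageE imageI)
    then have yX: "y \<in> X"
      using K by auto
    have close: "dist (x t) (y t) \<le> e / 2" if t: "0 \<le> t" "t \<le> T" for t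
    proof -
      define i where "i = nat \<lfloor>t * real n / T\<rfloor>"
      have "q i \<le> t \<and> t - q i < d \<and> i \<le> n"
      proof (cases "T = 0")
        case True
        then show ?thesis
          using t d by (simp add: q_def i_def)
      next
        case False
        then have T0: "0 < T"
          using T by simp
        have f0: "0 \<le> t * real n / T"
          using t T0 by simp
        have i1: "real i \<le> t * real n / T" "t * real n / T < real i + 1"
          using f0 unfolding i_def by linarith+
        have "real i * T \<le> t * real n"
          using i1(1) T0 by (simp add: pos_le_divide_eq)
        then have 1: "q i \<le> t"
          using n0 by (simp add: q_def pos_divide_le_eq)
        have "t * real n < (real i + 1) * T"
          using i1(2) T0 by (simp add: pos_divide_less_eq)
        then have "t < (real i + 1) * T / real n"
          using n0 by (simp add: pos_less_divide_eq)
        then have "t - q i < T / real n"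
          by (simp add: q_def distrib_right add_divide_distrib)
        also have "T / real n < d"
          using n d n0 by (simp add: pos_divide_less_eq mult.commute)
        finally have 2: "t - q i < d" .
        have "t * real n / T \<le> real n"
          using t T0 by (simp add: pos_divide_le_eq mult_right_mono mult.commute)
        then have "real i \<le> real n"
          using i1(1) by linarith
        then show ?thesis
          using 1 2 by simp
      qed
      then have i: "q i \<le> t" "t - q i < d" "i \<le> n"
        by auto
      have "dist (x t) (x (q i)) \<le> e / 8" "dist (y t) (y (q i)) \<le> e / 8"
        using equi'[OF x _ i(1) t(2) i(2)] equi'[OF yX _ i(1) t(2) i(2)] q[OF i(3)] by auto
      moreover have "dist (x (q i)) (pat x i) < e / 8" "dist (y (q i)) (pat x i) < e / 8"
        using pat[OF x i(3)] pat[OF yX i(3)] y(2) by auto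
      moreover have "dist (x t) (y t) \<le> dist (x t) (x (q i)) + dist (x (q i)) (pat x i) + dist (y (q i)) (pat x i) + dist (y t) (y (q i))"
        using dist_triangle[of "x t" "y t" "x (q i)"] dist_triangle[of "x (q i)" "y t" "pat x i"] dist_triangle[of "pat x i" "y t" "y (q i)"]
        by (simp add: dist_commute)
      ultimately show ?thesis
        by linarith
    qed
    have "dist x y \<le> e / 2"
    proof (rule dist_bound)
      fix t
      have "dist (x (max 0 (min T t))) (y (max 0 (min T t))) \<le> e / 2"
        by (rule close) (use T in auto)
      then show "dist (x t) (y t) \<le> e / 2"
        using clamp[OF x, of t] clamp[OF yX, of t] by simp
    qed
    then have "x \<in> ball y e"
      using e by (simp add: dist_commute)
    then show "x \<in> (\<Union>x\<in>K. ball x e)"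
      using y by blast
  qed
  then show ?thesis
    using K by blast
qed

lemma mult_divide_mult_cancel: "Y * (x / (c * Y)) = x / c" if "Y \<noteq> 0" for x c Y :: real
  using that by simp

lemma set_integrable_lebesgue_bound:
  fixes f :: "real \<Rightarrow> 'a::{banach, second_countable_topology}" and \<kappa> :: "real \<Rightarrow> real"
  assumes "set_integrable lebesgue S \<kappa>" "(\<lambda>t. indicator S t *\<^sub>R f t) \<in> borel_measurable lebesgue"
    and le: "AE t in lebesgue. t \<in> S \<longrightarrow> norm (f t) \<le> \<kappa> t"
  shows "set_integrable lebesgue S f"
    and "norm (LINT t:S|lebesgue. f t) \<le> (LINT t:S|lebesgue. \<kappa> t)"
proof -
  show int: "set_integrable lebesgue S f"
  proof (rule set_integrable_bound[OF assms(1)])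
    show "AE t in lebesgue. t \<in> S \<longrightarrow> norm (f t) \<le> norm (\<kappa> t)"
      using le by eventually_elim (auto intro: order_trans[OF _ abs_ge_self])
  qed (use assms(2) in \<open>simp add: set_borel_measurable_def\<close>)
  have "norm (LINT t:S|lebesgue. f t) \<le> (LINT t:S|lebesgue. norm (f t))"
    by (rule set_integral_norm_bound[OF int])
  also have "\<dots> \<le> (LINT t:S|lebesgue. \<kappa> t)"
    by (rule set_integral_mono_AE[OF set_integrable_norm[OF int] assms(1)]) (use le in \<open>auto elim: eventually_mono\<close>)
  finally show "norm (LINT t:S|lebesgue. f t) \<le> (LINT t:S|lebesgue. \<kappa> t)" .
qed

lemma set_integral_le_superset:
  fixes \<kappa> :: "real \<Rightarrow> real"
  assumes "set_integrable lebesgue S \<kappa>" "S' \<subseteq> S" "S' \<in> sets lebesgue" and nn: "\<And>t. t \<in> S \<Longrightarrow> 0 \<le> \<kappa> t"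
  shows "(LINT t:S'|lebesgue. \<kappa> t) \<le> (LINT t:S|lebesgue. \<kappa> t)"
  unfolding set_lebesgue_integral_def
proof (rule integral_mono)
  show "integrable lebesgue (\<lambda>t. indicat_real S t *\<^sub>R \<kappa> t)"
    using assms(1) by (simp add: set_integrable_def)
  show "integrable lebesgue (\<lambda>t. indicat_real S' t *\<^sub>R \<kappa> t)"
    using set_integrable_subset[OF assms(1,3,2)] by (simp add: set_integrable_def)
  show "indicat_real S' t *\<^sub>R \<kappa> t \<le> indicat_real S t *\<^sub>R \<kappa> t" for t
    using nn assms(2) by (auto simp: indicator_def)
qed

text \<open>Uniform continuity of the indefinite integral. It fixes the length of the piece of a
  Duhamel integral that is cut off near the singular time.\<close>

lemma integrable_absolutely_continuous:
  fixes \<kappa> :: "real \<Rightarrow> real"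
  assumes \<kappa>: "set_integrable lebesgue {0..T} \<kappa>" and e: "0 < e"
  shows "\<exists>d>0. \<forall>s t. 0 \<le> s \<and> s \<le> t \<and> t \<le> T \<and> t - s < d \<longrightarrow> (LINT r:{s..t}|lebesgue. \<kappa> r) < e"
proof -
  have hk: "\<kappa> integrable_on {0..T}"
    using \<kappa> by (rule set_lebesgue_integral_eq_integral(1))
  have "uniformly_continuous_on {0..T} (\<lambda>t. integral {0..t} \<kappa>)"
    by (intro compact_uniformly_continuous indefinite_integral_continuous_1 hk compact_Icc)
  then obtain d where d: "0 < d" "\<And>s t. s \<in> {0..T} \<Longrightarrow> t \<in> {0..T} \<Longrightarrow> dist t s < d \<Longrightarrow> dist (integral {0..t} \<kappa>) (integral {0..s} \<kappa>) < e"
    unfolding uniformly_continuous_on_def using e by metis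
  have "(LINT r:{s..t}|lebesgue. \<kappa> r) < e" if st: "0 \<le> s" "s \<le> t" "t \<le> T" "t - s < d" for s t
  proof -
    have "set_integrable lebesgue {s..t} \<kappa>"
      by (rule set_integrable_subset[OF \<kappa>]) (use st in auto)
    then have "(LINT r:{s..t}|lebesgue. \<kappa> r) = integral {s..t} \<kappa>"
      by (rule set_lebesgue_integral_eq_integral(2))
    moreover have "integral {0..s} \<kappa> + integral {s..t} \<kappa> = integral {0..t} \<kappa>"
    proof (rule Henstock_Kurzweil_Integration.integral_combine[OF st(1,2)])
      show "\<kappa> integrable_on {0..t}"
        by (rule integrable_on_subinterval[OF hk]) (use st in auto)
    qed
    moreover have "dist (integral {0..t} \<kappa>) (integral {0..s} \<kappa>) < e"
      by (rule d(2)) (use st in \<open>auto simp: dist_real_def\<close>)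
    ultimately show ?thesis
      by (simp add: dist_real_def)
  qed
  then show ?thesis
    using d(1) by blast
qed

text \<open>Index of the last node not after \<open>t\<close>; on \<open>[0, T]\<close> the value
  \<open>n\<close> is attained at \<open>t = T\<close> only, so sums over cells run up to
  \<open>n\<close> inclusive.\<close>

definition grid_index :: "real \<Rightarrow> nat \<Rightarrow> real \<Rightarrow> nat"
  where "grid_index T n t = nat \<lfloor>t * real n / T\<rfloor>"

lemma grid_index:
  assumes T: "0 < T" and n: "0 < n" and t: "0 \<le> t" "t \<le> T"
  shows "grid_index T n t \<le> n" "real (grid_index T n t) * T / real n \<le> t" "t - real (grid_index T n t) * T / real n < T / real n"
proof -
  have "0 \<le> t * real n / T"
    using t T by simp
  then have i: "real (grid_index T n t) \<le> t * real n / T" "t * real n / T < real (grid_index T n t) + 1"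
    unfolding grid_index_def by linarith+
  have "t * real n / T \<le> real n"
    using t T by (simp add: pos_divide_le_eq mult_right_mono mult.commute)
  then have "real (grid_index T n t) \<le> real n"
    using i(1) by linarith
  then show "grid_index T n t \<le> n"
    by simp
  have "real (grid_index T n t) * T \<le> t * real n"
    using i(1) T by (simp add: pos_le_divide_eq)
  then show "real (grid_index T n t) * T / real n \<le> t"
    using n by (simp add: pos_divide_le_eq)
  have "t * real n < (real (grid_index T n t) + 1) * T"
    using i(2) T by (simp add: pos_divide_less_eq)
  then have "t < (real (grid_index T n t) + 1) * T / real n"
    using n by (simp add: pos_less_divide_eq)
  then show "t - real (grid_index T n t) * T / real n < T / real n"
    by (simp add: distrib_right add_divide_distrib)
qed

lemma grid_index_sets: "{t. grid_index T n t = i} \<in> sets borel"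
  unfolding grid_index_def by measurable

lemma grid_index_sets_lebesgue: "{t. grid_index T n t = i} \<in> sets lebesgue"
  using grid_index_sets[of T n i] sets_completionI_sets by fastforce

section \<open>Total boundedness and Duhamel integrals\<close>

definition totally_bounded_set :: "'a::metric_space set \<Rightarrow> bool"
  where "totally_bounded_set S \<longleftrightarrow> (\<forall>e>0. \<exists>k. finite k \<and> (\<forall>x\<in>S. \<exists>c\<in>k. dist x c < e))"

lemma compact_closure_imp_totally_bounded: "compact (closure S) \<Longrightarrow> totally_bounded_set S"
proof -
  assume "compact (closure S)"
  then have k: "\<forall>e>0. \<exists>k. finite k \<and> closure S \<subseteq> (\<Union>x\<in>k. ball x e)"
    by (simp add: compact_eq_totally_bounded)
  show ?thesis
    unfolding totally_bounded_set_def
  proof (intro allI impI)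
    fix e :: real
    assume "0 < e"
    then obtain k where "finite k" "closure S \<subseteq> (\<Union>x\<in>k. ball x e)"
      using k by blast
    then show "\<exists>k. finite k \<and> (\<forall>x\<in>S. \<exists>c\<in>k. dist x c < e)"
      using closure_subset[of S] by (intro exI[of _ k]) (fastforce simp: dist_commute)
  qed
qed

lemma totally_bounded_set_add:
  fixes S S' :: "'a::real_normed_vector set"
  assumes "totally_bounded_set S" "totally_bounded_set S'"
  shows "totally_bounded_set {x + y |x y. x \<in> S \<and> y \<in> S'}"
  unfolding totally_bounded_set_def
proof (intro allI impI)
  fix e :: real
  assume "0 < e"
  then have "0 < e / 2"
    by simp
  then obtain k k' where k: "finite k" "\<And>x. x \<in> S \<Longrightarrow> \<exists>c\<in>k. dist x c < e / 2"
    and k': "finite k'" "\<And>x. x \<in> S' \<Longrightarrow> \<exists>c\<in>k'. dist x c < e / 2"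
    using assms unfolding totally_bounded_set_def by metis
  show "\<exists>K. finite K \<and> (\<forall>z\<in>{x + y |x y. x \<in> S \<and> y \<in> S'}. \<exists>c\<in>K. dist z c < e)"
  proof (intro exI[of _ "(\<lambda>(c, c'). c + c') ` (k \<times> k')"] conjI ballI)
    show "finite ((\<lambda>(c, c'). c + c') ` (k \<times> k'))"
      using k k' by simp
    fix z
    assume "z \<in> {x + y |x y. x \<in> S \<and> y \<in> S'}"
    then obtain x y where xy: "z = x + y" "x \<in> S" "y \<in> S'"
      by blast
    obtain c c' where c: "c \<in> k" "dist x c < e / 2" "c' \<in> k'" "dist y c' < e / 2"
      using k(2)[OF xy(2)] k'(2)[OF xy(3)] by blast
    have "dist z (c + c') < e"
      using dist_triangle_add[of x y c c'] c by (simp add: xy(1))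
    then show "\<exists>c\<in>(\<lambda>(c, c'). c + c') ` (k \<times> k'). dist z c < e"
      using c by (intro bexI[of _ "c + c'"]) auto
  qed
qed

lemma totally_bounded_set_sum:
  fixes S :: "nat \<Rightarrow> 'a::real_normed_vector set"
  assumes "\<And>i. i < n \<Longrightarrow> totally_bounded_set (S i)"
  shows "totally_bounded_set {\<Sum>i<n. x i |x. \<forall>i<n. x i \<in> S i}"
  using assms
proof (induction n)
  case 0
  then show ?case
    by (auto simp: totally_bounded_set_def intro!: exI[of _ "{0}"])
next
  case (Suc n)
  have "totally_bounded_set {x + y |x y. x \<in> {\<Sum>i<n. x i |x. \<forall>i<n. x i \<in> S i} \<and> y \<in> S n}"
    by (intro totally_bounded_set_add Suc) (use Suc.prems in auto)
  moreover have "{\<Sum>i<Suc n. x i |x. \<forall>i<Suc n. x i \<in> S i} \<subseteq> {x + y |x y. x \<in> {\<Sum>i<n. x i |x. \<forall>i<n. x i \<in> S i} \<and> y \<in> S n}"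
    by (auto simp: less_Suc_eq)
  ultimately show ?case
    unfolding totally_bounded_set_def by (meson subset_iff)
qed

lemma totally_bounded_set_approx:
  fixes S :: "'a::metric_space set"
  assumes "\<And>e. 0 < e \<Longrightarrow> \<exists>S'. totally_bounded_set S' \<and> (\<forall>x\<in>S. \<exists>y\<in>S'. dist x y \<le> e)"
  shows "totally_bounded_set S"
  unfolding totally_bounded_set_def
proof (intro allI impI)
  fix e :: real
  assume "0 < e"
  then have e2: "0 < e / 2"
    by simp
  obtain S' where S': "totally_bounded_set S'" "\<And>x. x \<in> S \<Longrightarrow> \<exists>y\<in>S'. dist x y \<le> e / 2"
    using assms[OF e2] by blast
  obtain k where k: "finite k" "\<And>y. y \<in> S' \<Longrightarrow> \<exists>c\<in>k. dist y c < e / 2"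
    using S'(1) e2 unfolding totally_bounded_set_def by metis
  have "\<exists>c\<in>k. dist x c < e" if x: "x \<in> S" for x
  proof -
    obtain y where y: "y \<in> S'" "dist x y \<le> e / 2"
      using S'(2)[OF x] by blast
    obtain c where c: "c \<in> k" "dist y c < e / 2"
      using k(2)[OF y(1)] by blast
    have "dist x c < e"
      using dist_triangle[of x c y] y c by linarith
    then show ?thesis
      using c by blast
  qed
  then show "\<exists>k. finite k \<and> (\<forall>x\<in>S. \<exists>c\<in>k. dist x c < e)"
    using k(1) by blast
qed

text \<open>The interface between contour analysis and compactness: \<open>A\<close>,
  \<open>G\<close> and \<open>N\<close> no longer appear. \<open>L\<close> depends on the distance
  from time 0, where the Lipschitz constant may blow up.\<close>

locale compact_family =
  fixes R :: "real \<Rightarrow> 'w::{complex_banach, second_countable_topology} \<Rightarrow>\<^sub>L 'w" and M \<omega> T :: real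
    and L :: "real \<Rightarrow> real \<Rightarrow> real"
  assumes bound: "\<And>t. 0 \<le> t \<Longrightarrow> norm (R t) \<le> M * exp (\<omega> * t)" and \<omega>: "0 < \<omega>"
    and cont: "\<And>z. continuous_on {0..} (\<lambda>t. R t z)" and T: "0 < T"
    and Lip: "\<And>\<epsilon> T s t. 0 < \<epsilon> \<Longrightarrow> \<epsilon> \<le> s \<Longrightarrow> s \<le> t \<Longrightarrow> t \<le> T \<Longrightarrow> norm (R t - R s) \<le> L \<epsilon> T * (t - s)"
    and comp: "\<And>t r. 0 < t \<Longrightarrow> compact (closure (R t ` cball 0 r))"
begin

definition Rmax :: real
  where "Rmax = M * exp (\<omega> * T)"

lemma Rmax: "0 \<le> Rmax" "0 \<le> t \<Longrightarrow> t \<le> T \<Longrightarrow> norm (R t) \<le> Rmax" "0 \<le> t \<Longrightarrow> t \<le> T \<Longrightarrow> norm (R t x) \<le> Rmax * norm x"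
proof -
  have M: "0 \<le> M"
    by (rule M_nonneg[OF bound \<omega> cont])
  then show "0 \<le> Rmax"
    by (simp add: Rmax_def)
  show *: "norm (R t) \<le> Rmax" if "0 \<le> t" "t \<le> T" for t
  proof -
    have "M * exp (\<omega> * t) \<le> M * exp (\<omega> * T)"
      using M \<omega> that by (intro mult_left_mono) auto
    then show ?thesis
      using bound[OF that(1)] by (simp add: Rmax_def)
  qed
  show "norm (R t x) \<le> Rmax * norm x" if "0 \<le> t" "t \<le> T"
    by (rule order_trans[OF norm_blinfun mult_right_mono[OF *[OF that]]]) simp
qed

definition duhamel :: "(real \<Rightarrow> 'w) \<Rightarrow> real \<Rightarrow> 'w"
  where "duhamel h t = (LINT s:{0..t}|lebesgue. R (t - s) (h s))"

lemma measurable_duhamel_integrand: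
  assumes h: "set_integrable lebesgue {0..T} h" and S: "S \<subseteq> {0..t}" "S \<in> sets lebesgue" and t: "t \<le> T"
  shows "(\<lambda>s. indicator S s *\<^sub>R R (t - s) (h s)) \<in> borel_measurable lebesgue"
proof -
  have h': "(\<lambda>s. indicator {0..T} s *\<^sub>R h s) \<in> borel_measurable lebesgue"
    using h unfolding set_integrable_def by (rule borel_measurable_integrable)
  have m: "(\<lambda>s. R (max 0 (t - s)) (indicator {0..T} s *\<^sub>R h s)) \<in> borel_measurable lebesgue"
    by (rule measurable_family[OF bound \<omega> cont, of "\<lambda>s. t - s"]) (use h' in \<open>auto intro!: borel_imp_lebesgue_measurable\<close>)
  have "(\<lambda>s. indicator S s *\<^sub>R R (max 0 (t - s)) (indicator {0..T} s *\<^sub>R h s)) \<in> borel_measurable lebesgue"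
    by (intro borel_measurable_scaleR m borel_measurable_indicator S)
  moreover have "indicator S s *\<^sub>R R (max 0 (t - s)) (indicator {0..T} s *\<^sub>R h s) = indicator S s *\<^sub>R R (t - s) (h s)" for s
    using S(1) t by (auto simp: indicator_def subset_iff)
  ultimately show ?thesis
    by simp
qed

lemma duhamel_bound:
  assumes h: "set_integrable lebesgue {0..T} h" and S: "S \<subseteq> {0..t}" "S \<in> sets lebesgue" and t: "t \<le> T"
  shows "set_integrable lebesgue S (\<lambda>s. R (t - s) (h s))"
    and "norm (LINT s:S|lebesgue. R (t - s) (h s)) \<le> Rmax * (LINT s:S|lebesgue. norm (h s))"
proof -
  have "S \<subseteq> {0..T}"
    using S t by auto
  then have hS: "set_integrable lebesgue S h"
    using set_integrable_subset[OF h S(2)] by blast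
  have i: "set_integrable lebesgue S (\<lambda>s. Rmax * norm (h s))"
    by (intro set_integrable_mult_right set_integrable_norm hS)
  have le: "AE s in lebesgue. s \<in> S \<longrightarrow> norm (R (t - s) (h s)) \<le> Rmax * norm (h s)"
    using S t by (intro AE_I2 impI Rmax(3)) auto
  note * = set_integrable_lebesgue_bound[OF i measurable_duhamel_integrand[OF assms] le]
  show "set_integrable lebesgue S (\<lambda>s. R (t - s) (h s))"
    by (rule *(1))
  show "norm (LINT s:S|lebesgue. R (t - s) (h s)) \<le> Rmax * (LINT s:S|lebesgue. norm (h s))"
    using *(2) by (simp only: set_integral_mult_right)
qed

lemma L_nonneg: "0 < \<epsilon> \<Longrightarrow> \<epsilon> < T \<Longrightarrow> 0 \<le> L \<epsilon> T"
  using order_trans[OF norm_ge_zero Lip[of \<epsilon> \<epsilon> T T]] by (simp add: zero_le_mult_iff)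

lemma duhamel_split:
  assumes h: "set_integrable lebesgue {0..T} h" and q: "0 \<le> q" "q \<le> t" "t \<le> T"
  shows "duhamel h t = (LINT r:{0..<q}|lebesgue. R (t - r) (h r)) + (LINT r:{q..t}|lebesgue. R (t - r) (h r))"
proof -
  have "{0..t} = {0..<q} \<union> {q..t}"
    using q by auto
  then show ?thesis
    unfolding duhamel_def using q by (simp only:) (intro set_integral_Un duhamel_bound[OF h], auto)
qed

context
  fixes \<kappa> :: "real \<Rightarrow> real"
  assumes \<kappa>: "set_integrable lebesgue {0..T} \<kappa>" and \<kappa>0: "\<And>t. t \<in> {0..T} \<Longrightarrow> 0 \<le> \<kappa> t"
begin

definition dominated :: "(real \<Rightarrow> 'w) set"
  where "dominated = {h. set_integrable lebesgue {0..T} h \<and> (AE t in lebesgue. t \<in> {0..T} \<longrightarrow> norm (h t) \<le> \<kappa> t)}"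

lemma dominated_norm_integral:
  assumes h: "h \<in> dominated" and S: "S \<subseteq> {0..T}" "S \<in> sets lebesgue"
  shows "(LINT s:S|lebesgue. norm (h s)) \<le> (LINT s:S|lebesgue. \<kappa> s)"
proof (rule set_integral_mono_AE)
  have "set_integrable lebesgue {0..T} h"
    using h by (simp add: dominated_def)
  then show "set_integrable lebesgue S (\<lambda>s. norm (h s))"
    by (intro set_integrable_norm set_integrable_subset[OF _ S(2,1)])
  show "set_integrable lebesgue S \<kappa>"
    by (rule set_integrable_subset[OF \<kappa> S(2,1)])
  have "AE t in lebesgue. t \<in> {0..T} \<longrightarrow> norm (h t) \<le> \<kappa> t"
    using h by (simp add: dominated_def)
  then show "AE s\<in>S in lebesgue. norm (h s) \<le> \<kappa> s"
    by eventually_elim (use S in auto)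
qed

definition \<kappa>T :: real
  where "\<kappa>T = (LINT s:{0..T}|lebesgue. \<kappa> s)"

lemma \<kappa>T_nonneg: "0 \<le> \<kappa>T"
proof -
  have "(LINT s:{}|lebesgue. \<kappa> s) \<le> \<kappa>T"
    unfolding \<kappa>T_def by (rule set_integral_le_superset[OF \<kappa> _ _ \<kappa>0]) auto
  then show ?thesis
    by (simp add: set_lebesgue_integral_def)
qed

text \<open>Inputs up to \<open>s - \<epsilon>\<close> are weighted by operators at times at least
  \<epsilon>, where \<open>R\<close> is Lipschitz in norm; the resulting bound is uniform over
  dominated inputs. The contributions from the short interval before \<open>s\<close> and from the
  interval up to \<open>t\<close> are small by absolute continuity of the integral of \<kappa>. Four
  errors of \<open>e / 4\<close> add up.\<close>

lemma duhamel_equicontinuous: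
  assumes e: "0 < e"
  shows "\<exists>d>0. \<forall>h\<in>dominated. \<forall>s t. 0 \<le> s \<and> s \<le> t \<and> t \<le> T \<and> t - s < d \<longrightarrow> dist (duhamel h t) (duhamel h s) \<le> e"
proof -
  \<comment> \<open>Chosen so that \<open>Rmax * e' \<le> e / 4\<close>; the \<open>+ 1\<close>
    covers \<open>Rmax = 0\<close>.\<close>
  define e' where "e' = e / (4 * (Rmax + 1))"
  have e': "0 < e'" "Rmax * e' \<le> e / 4"
  proof -
    show "0 < e'"
      using e Rmax(1) by (simp add: e'_def add_nonneg_pos)
    have "Rmax * e' \<le> (Rmax + 1) * e'"
      using \<open>0 < e'\<close> by (intro mult_right_mono) auto
    also have "\<dots> = e / 4"
      unfolding e'_def by (rule mult_divide_mult_cancel) (use Rmax(1) in simp)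
    finally show "Rmax * e' \<le> e / 4" .
  qed
  obtain d1 where d1: "0 < d1" "\<And>s t. 0 \<le> s \<Longrightarrow> s \<le> t \<Longrightarrow> t \<le> T \<Longrightarrow> t - s < d1 \<Longrightarrow> (LINT r:{s..t}|lebesgue. \<kappa> r) < e'"
    using integrable_absolutely_continuous[OF \<kappa> e'(1)] by metis
  define \<epsilon> where "\<epsilon> = min (d1 / 2) (T / 2)"
  have \<epsilon>: "0 < \<epsilon>" "\<epsilon> < d1" "\<epsilon> < T"
    using d1(1) T by (auto simp: \<epsilon>_def min_def)
  define d where "d = min d1 (e / (4 * (L \<epsilon> T * \<kappa>T + 1)))"
  have LK: "0 \<le> L \<epsilon> T * \<kappa>T"
    using L_nonneg[OF \<epsilon>(1,3)] \<kappa>T_nonneg by simp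
  have d: "0 < d" "d \<le> d1"
    using d1(1) e LK by (auto simp: d_def)
  have dL: "\<delta> * (L \<epsilon> T * \<kappa>T) \<le> e / 4" if "0 \<le> \<delta>" "\<delta> < d" for \<delta>
  proof -
    have "\<delta> \<le> e / (4 * (L \<epsilon> T * \<kappa>T + 1))"
      using that by (simp add: d_def)
    then have "\<delta> * (4 * (L \<epsilon> T * \<kappa>T + 1)) \<le> e"
      using LK by (simp add: pos_le_divide_eq)
    moreover have "\<delta> * (4 * (L \<epsilon> T * \<kappa>T + 1)) = 4 * (\<delta> * (L \<epsilon> T * \<kappa>T)) + 4 * \<delta>"
      by (simp add: algebra_simps)
    ultimately show ?thesis
      using that(1) by linarith
  qed
  have "dist (duhamel h t) (duhamel h s) \<le> e" if hd: "h \<in> dominated" and st: "0 \<le> s" "s \<le> t" "t \<le> T" "t - s < d" for h s t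
  proof -
    have h: "set_integrable lebesgue {0..T} h"
      using hd by (simp add: dominated_def)
    \<comment> \<open>For \<open>0 \<le> r < q\<close> both \<open>s - r\<close> and
      \<open>t - r\<close> exceed \<epsilon>; if \<open>s \<le> \<epsilon>\<close> this part is
      empty.\<close>
    define q where "q = max 0 (s - \<epsilon>)"
    have q: "0 \<le> q" "q \<le> s" "s - q < d1" "q \<le> t"
      using st \<epsilon> by (auto simp: q_def max_def)
    have qs: "(LINT r:{q..s}|lebesgue. \<kappa> r) < e'"
      by (rule d1(2)) (use q st in auto)
    have st': "(LINT r:{s..t}|lebesgue. \<kappa> r) < e'"
      by (rule d1(2)) (use st d in auto)
    let ?A = "\<lambda>u. LINT r:{0..<q}|lebesgue. R (u - r) (h r)"
    have 1: "norm (LINT r:{q..s}|lebesgue. R (s - r) (h r)) \<le> e / 4"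
    proof -
      have "norm (LINT r:{q..s}|lebesgue. R (s - r) (h r)) \<le> Rmax * (LINT r:{q..s}|lebesgue. norm (h r))"
        by (rule duhamel_bound(2)[OF h]) (use q st in auto)
      also have "\<dots> \<le> Rmax * e'"
        using dominated_norm_integral[OF hd, of "{q..s}"] qs q st by (intro mult_left_mono Rmax(1)) auto
      finally show ?thesis
        using e'(2) by linarith
    qed
    have 2: "norm (LINT r:{q..<s}|lebesgue. R (t - r) (h r)) \<le> e / 4"
    proof -
      have "norm (LINT r:{q..<s}|lebesgue. R (t - r) (h r)) \<le> Rmax * (LINT r:{q..<s}|lebesgue. norm (h r))"
        by (rule duhamel_bound(2)[OF h]) (use q st in auto)
      also have "(LINT r:{q..<s}|lebesgue. norm (h r)) \<le> (LINT r:{q..s}|lebesgue. norm (h r))"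
        by (rule set_integral_le_superset[OF set_integrable_norm[OF set_integrable_subset[OF h]]]) (use q st in auto)
      also have "\<dots> \<le> e'"
        using dominated_norm_integral[OF hd, of "{q..s}"] qs q st by auto
      finally show ?thesis
        using e'(2) Rmax(1) by (simp add: mult_left_mono)
    qed
    have 3: "norm (LINT r:{s..t}|lebesgue. R (t - r) (h r)) \<le> e / 4"
    proof -
      have "norm (LINT r:{s..t}|lebesgue. R (t - r) (h r)) \<le> Rmax * (LINT r:{s..t}|lebesgue. norm (h r))"
        by (rule duhamel_bound(2)[OF h]) (use q st in auto)
      also have "\<dots> \<le> Rmax * e'"
        using dominated_norm_integral[OF hd, of "{s..t}"] st' q st by (intro mult_left_mono Rmax(1)) auto
      finally show ?thesis
        using e'(2) by linarith
    qed
    have 4: "norm (?A t - ?A s) \<le> e / 4"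
    proof -
      have i: "set_integrable lebesgue {0..<q} (\<lambda>r. R (t - r) (h r))" "set_integrable lebesgue {0..<q} (\<lambda>r. R (s - r) (h r))"
        by (rule duhamel_bound(1)[OF h]; use q st in auto)+
      have hq: "set_integrable lebesgue {0..<q} h"
        by (rule set_integrable_subset[OF h]) (use q st in auto)
      have le: "norm (R (t - r) (h r) - R (s - r) (h r)) \<le> L \<epsilon> T * (t - s) * norm (h r)" if r: "r \<in> {0..<q}" for r
      proof -
        have "norm (R (t - r) - R (s - r)) \<le> L \<epsilon> T * ((t - r) - (s - r))"
          by (rule Lip) (use r \<epsilon> st in \<open>auto simp: q_def max_def split: if_splits\<close>)
        then show ?thesis
          using norm_blinfun[of "R (t - r) - R (s - r)" "h r"] mult_right_mono[of _ _ "norm (h r)"]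
          by (simp add: blinfun.diff_left) (meson norm_ge_zero order_trans)
      qed
      have "?A t - ?A s = (LINT r:{0..<q}|lebesgue. R (t - r) (h r) - R (s - r) (h r))"
        by (rule set_integral_diff(2)[OF i, symmetric])
      then have "norm (?A t - ?A s) \<le> (LINT r:{0..<q}|lebesgue. norm (R (t - r) (h r) - R (s - r) (h r)))"
        using set_integral_norm_bound[OF set_integral_diff(1)[OF i]] by (simp only:)
      also have "\<dots> \<le> (LINT r:{0..<q}|lebesgue. L \<epsilon> T * (t - s) * norm (h r))"
        by (rule set_integral_mono[OF set_integrable_norm[OF set_integral_diff(1)[OF i]] set_integrable_mult_right[OF set_integrable_norm[OF hq]] le])
      also have "\<dots> = L \<epsilon> T * (t - s) * (LINT r:{0..<q}|lebesgue. norm (h r))"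
        by (rule set_integral_mult_right)
      also have "\<dots> \<le> L \<epsilon> T * (t - s) * \<kappa>T"
      proof (rule mult_left_mono)
        have "(LINT r:{0..<q}|lebesgue. norm (h r)) \<le> (LINT r:{0..<q}|lebesgue. \<kappa> r)"
          by (rule dominated_norm_integral[OF hd]) (use q st in auto)
        also have "\<dots> \<le> \<kappa>T"
          unfolding \<kappa>T_def by (rule set_integral_le_superset[OF \<kappa> _ _ \<kappa>0]) (use q st in auto)
        finally show "(LINT r:{0..<q}|lebesgue. norm (h r)) \<le> \<kappa>T" .
        show "0 \<le> L \<epsilon> T * (t - s)"
          using L_nonneg[OF \<epsilon>(1,3)] st by simp
      qed
      also have "\<dots> = (t - s) * (L \<epsilon> T * \<kappa>T)"
        by simp
      also have "\<dots> \<le> e / 4"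
        by (rule dL) (use st in auto)
      finally show ?thesis .
    qed
    have "{0..<s} = {0..<q} \<union> {q..<s}"
      using q by auto
    then have "(LINT r:{0..<s}|lebesgue. R (t - r) (h r)) = ?A t + (LINT r:{q..<s}|lebesgue. R (t - r) (h r))"
      using q st by (simp only:) (intro set_integral_Un duhamel_bound[OF h], auto)
    then have "duhamel h t - duhamel h s = (?A t - ?A s) + (LINT r:{q..<s}|lebesgue. R (t - r) (h r))
      + (LINT r:{s..t}|lebesgue. R (t - r) (h r)) - (LINT r:{q..s}|lebesgue. R (s - r) (h r))"
      using duhamel_split[OF h st(1,2,3)] duhamel_split[OF h q(1,2)] st by simp
    moreover have "norm (p + p' + p'' - p''') \<le> e" if "norm p \<le> e / 4" "norm p' \<le> e / 4" "norm p'' \<le> e / 4" "norm p''' \<le> e / 4" for p p' p'' p''' :: 'w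
      using norm_triangle_ineq4[of "p + p' + p''" p'''] norm_triangle_ineq[of "p + p'" p''] norm_triangle_ineq[of p p'] that by linarith
    ultimately show ?thesis
      using 1 2 3 4 by (simp only: dist_norm)
  qed
  then show ?thesis
    using d(1) by blast
qed

text \<open>A Riemann-type approximation: up to \<open>t - \<epsilon>\<close> the operator is frozen
  at the left node of each cell, which turns the integral into a finite sum of compact operators
  \<open>R (t - qi i)\<close> applied to vectors of norm at most \<open>\<kappa>T\<close>. The
  freezing error is uniform over dominated inputs by the Lipschitz bound, and the last piece of
  length \<epsilon> is small by absolute continuity.\<close>

lemma duhamel_pointwise_totally_bounded:
  assumes t: "0 \<le> t" "t \<le> T"
  shows "totally_bounded_set ((\<lambda>h. duhamel h t) ` dominated)"
proof (rule totally_bounded_set_approx)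
  fix e :: real
  assume e: "0 < e"
  define e' where "e' = e / (2 * (Rmax + 1))"
  have e': "0 < e'" "Rmax * e' \<le> e / 2"
  proof -
    show "0 < e'"
      using e Rmax(1) by (simp add: e'_def add_nonneg_pos)
    have "Rmax * e' \<le> (Rmax + 1) * e'"
      using \<open>0 < e'\<close> by (intro mult_right_mono) auto
    also have "\<dots> = e / 2"
      unfolding e'_def by (rule mult_divide_mult_cancel) (use Rmax(1) in simp)
    finally show "Rmax * e' \<le> e / 2" .
  qed
  obtain d1 where d1: "0 < d1" "\<And>s t. 0 \<le> s \<Longrightarrow> s \<le> t \<Longrightarrow> t \<le> T \<Longrightarrow> t - s < d1 \<Longrightarrow> (LINT r:{s..t}|lebesgue. \<kappa> r) < e'"
    using integrable_absolutely_continuous[OF \<kappa> e'(1)] by metis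
  define \<epsilon> where "\<epsilon> = min (d1 / 2) (T / 2)"
  have \<epsilon>: "0 < \<epsilon>" "\<epsilon> < d1" "\<epsilon> < T"
    using d1(1) T by (auto simp: \<epsilon>_def min_def)
  show "\<exists>S'. totally_bounded_set S' \<and> (\<forall>x\<in>(\<lambda>h. duhamel h t) ` dominated. \<exists>y\<in>S'. dist x y \<le> e)"
  proof (cases "t \<le> \<epsilon>")
    \<comment> \<open>The whole interval is short, so the single vector 0 approximates all
      integrals.\<close>
    case True
    have "norm (duhamel h t) \<le> e" if hd: "h \<in> dominated" for h
    proof -
      have h: "set_integrable lebesgue {0..T} h"
        using hd by (simp add: dominated_def)
      have "norm (duhamel h t) \<le> Rmax * (LINT r:{0..t}|lebesgue. norm (h r))"
        unfolding duhamel_def by (rule duhamel_bound(2)[OF h]) (use t in auto)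
      also have "(LINT r:{0..t}|lebesgue. norm (h r)) \<le> (LINT r:{0..t}|lebesgue. \<kappa> r)"
        by (rule dominated_norm_integral[OF hd]) (use t in auto)
      also have "\<dots> \<le> e'"
        using d1(2)[of 0 t] t True \<epsilon> by simp
      finally show ?thesis
        using e'(2) Rmax(1) e by (simp add: mult_left_mono)
    qed
    then show ?thesis
      by (intro exI[of _ "{0}"]) (auto simp: totally_bounded_set_def dist_norm intro!: exI[of _ "{0}"])
  next
    case False
    define q where "q = t - \<epsilon>"
    have q: "0 < q" "q < t" "q \<le> T"
      using False \<epsilon> t by (auto simp: q_def)
    have LK: "0 \<le> L \<epsilon> T * \<kappa>T"
      using L_nonneg[OF \<epsilon>(1,3)] \<kappa>T_nonneg by simp
    \<comment> \<open>This \<open>n\<close> makes the freezing error, cell length times Lipschitz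
      constant times \<open>\<kappa>T\<close>, at most \<open>e / 2\<close>.\<close>
    obtain n :: nat where n: "2 * q * (L \<epsilon> T * \<kappa>T) / e < real n"
      using reals_Archimedean2 by blast
    have n0: "0 < n"
    proof -
      have "0 \<le> 2 * q * (L \<epsilon> T * \<kappa>T) / e"
        using q LK e by simp
      then show ?thesis
        using n by (cases "n = 0") auto
    qed
    have nq: "L \<epsilon> T * (q / real n) * \<kappa>T \<le> e / 2"
    proof -
      have "2 * q * (L \<epsilon> T * \<kappa>T) < real n * e"
        using n e by (simp add: pos_divide_less_eq)
      then have "q * (L \<epsilon> T * \<kappa>T) / real n \<le> e / 2"
        using n0 by (simp add: pos_divide_le_eq mult.commute)
      then show ?thesis
        by (simp add: mult_ac)
    qed
    define qi where "qi i = real i * q / real n" for i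
    define I where "I i = {r \<in> {0..<q}. grid_index q n r = i}" for i
    have Im: "I i \<in> sets lebesgue" for i
    proof -
      have "I i = {0..<q} \<inter> {r. grid_index q n r = i}"
        by (auto simp: I_def)
      then show ?thesis
        using grid_index_sets_lebesgue by auto
    qed
    have Isub: "I i \<subseteq> {0..T}" for i
      using q by (auto simp: I_def)
    have gi: "grid_index q n r \<le> n" "qi (grid_index q n r) \<le> r" "r - qi (grid_index q n r) \<le> q / real n" if "r \<in> {0..<q}" for r
      using grid_index[OF q(1) n0, of r] that by (auto simp: qi_def)
    have gi_lt: "grid_index q n r < Suc n" if "r \<in> {0..<q}" for r
      using gi(1)[OF that] by simp
    let ?S' = "{\<Sum>i<Suc n. x i |x. \<forall>i<Suc n. x i \<in> (if qi i < q then R (t - qi i) ` cball 0 \<kappa>T else {0})}"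
    have "totally_bounded_set ?S'"
    proof (rule totally_bounded_set_sum)
      fix i
      show "totally_bounded_set (if qi i < q then R (t - qi i) ` cball 0 \<kappa>T else {0})"
        using compact_closure_imp_totally_bounded[OF comp[of "t - qi i"]] q
          compact_closure_imp_totally_bounded[of "{0::'w}"] by auto
    qed
    moreover have "\<exists>y\<in>?S'. dist x y \<le> e" if x: "x \<in> (\<lambda>h. duhamel h t) ` dominated" for x
    proof -
      obtain h where hd: "h \<in> dominated" and xh: "x = duhamel h t"
        using x by blast
      have h: "set_integrable lebesgue {0..T} h"
        using hd by (simp add: dominated_def)
      have hI: "set_integrable lebesgue (I i) h" for i
        by (rule set_integrable_subset[OF h Im Isub])
      have hq: "set_integrable lebesgue {0..<q} h"
        by (rule set_integrable_subset[OF h]) (use q in auto)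
      \<comment> \<open>The last node equals \<open>q\<close>, so its cell is empty and the default
        0 is the right value.\<close>
      define xi where "xi i = (if qi i < q then R (t - qi i) (LINT r:I i|lebesgue. h r) else 0)" for i
      have xiS: "xi i \<in> (if qi i < q then R (t - qi i) ` cball 0 \<kappa>T else {0})" for i
      proof -
        have "norm (LINT r:I i|lebesgue. h r) \<le> (LINT r:I i|lebesgue. norm (h r))"
          by (rule set_integral_norm_bound[OF hI])
        also have "\<dots> \<le> (LINT r:I i|lebesgue. \<kappa> r)"
          by (rule dominated_norm_integral[OF hd Isub Im])
        also have "\<dots> \<le> \<kappa>T"
          unfolding \<kappa>T_def by (rule set_integral_le_superset[OF \<kappa> Isub Im \<kappa>0])
        finally show ?thesis
          by (simp add: xi_def)
      qed
      define y where "y = (\<Sum>i<Suc n. xi i)"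
      have yS: "y \<in> ?S'"
        unfolding y_def using xiS by blast
      define v where "v r = R (t - qi (grid_index q n r)) (h r)" for r
      have v_sum: "indicator {0..<q} r *\<^sub>R v r = (\<Sum>i<Suc n. indicator (I i) r *\<^sub>R (R (t - qi i) (h r)))" for r
      proof (cases "r \<in> {0..<q}")
        case True
        have "(\<Sum>i<Suc n. indicator (I i) r *\<^sub>R (R (t - qi i) (h r))) = (\<Sum>i<Suc n. if i = grid_index q n r then R (t - qi i) (h r) else 0)"
          using True by (intro sum.cong) (auto simp: I_def indicator_def)
        also have "\<dots> = v r"
          using gi_lt[OF True] by (simp add: v_def del: sum.lessThan_Suc)
        finally show ?thesis
          using True by simp
      next
        case False
        then have "indicat_real (I i) r = 0" for i
          by (auto simp: I_def indicator_def)
        then show ?thesis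
          using False by simp
      qed
      have intRi: "integrable lebesgue (\<lambda>r. indicator (I i) r *\<^sub>R (R (t - qi i) (h r)))" 
        "(\<integral>r. indicator (I i) r *\<^sub>R (R (t - qi i) (h r)) \<partial>lebesgue) = R (t - qi i) (LINT r:I i|lebesgue. h r)" for i
        using integrable_bounded_linear[OF blinfun.bounded_linear_right hI[of i, unfolded set_integrable_def], of "R (t - qi i)"]
          integral_bounded_linear[OF blinfun.bounded_linear_right hI[of i, unfolded set_integrable_def], of "R (t - qi i)"]
        by (simp_all add: blinfun.scaleR_right set_lebesgue_integral_def)
      have vint: "set_integrable lebesgue {0..<q} v"
        unfolding set_integrable_def v_sum by (intro Bochner_Integration.integrable_sum intRi)
      have "(LINT r:{0..<q}|lebesgue. v r) = (\<Sum>i<Suc n. R (t - qi i) (LINT r:I i|lebesgue. h r))"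
        unfolding set_lebesgue_integral_def v_sum Bochner_Integration.integral_sum[OF intRi(1)] intRi(2) set_lebesgue_integral_def ..
      also have "\<dots> = y"
        unfolding y_def
      proof (rule sum.cong)
        fix i
        show "R (t - qi i) (LINT r:I i|lebesgue. h r) = xi i"
        proof (cases "qi i < q")
          case False
          have "I i = {}"
            using gi(2) False by (auto simp: I_def) (metis atLeastLessThan_iff linorder_not_le order_le_less_trans)
          then show ?thesis
            by (simp add: xi_def set_lebesgue_integral_def blinfun.zero_right)
        qed (simp add: xi_def)
      qed simp
      finally have yv: "(LINT r:{0..<q}|lebesgue. v r) = y" .
      have i: "set_integrable lebesgue {0..<q} (\<lambda>r. R (t - r) (h r))"
        by (rule duhamel_bound(1)[OF h]) (use q t in auto)
      have le: "norm (R (t - r) (h r) - v r) \<le> L \<epsilon> T * (q / real n) * norm (h r)" if r: "r \<in> {0..<q}" for r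
      proof -
        have qi0: "0 \<le> qi (grid_index q n r)"
          using q by (simp add: qi_def)
        have "norm (R (t - qi (grid_index q n r)) - R (t - r)) \<le> L \<epsilon> T * ((t - qi (grid_index q n r)) - (t - r))"
          by (rule Lip) (use r \<epsilon> t gi(2)[OF r] qi0 in \<open>auto simp: q_def\<close>)
        also have "\<dots> \<le> L \<epsilon> T * (q / real n)"
          using gi(3)[OF r] L_nonneg[OF \<epsilon>(1,3)] by (intro mult_left_mono) auto
        finally have "norm (R (t - r) - R (t - qi (grid_index q n r))) * norm (h r) \<le> L \<epsilon> T * (q / real n) * norm (h r)"
          by (intro mult_right_mono) (auto simp: norm_minus_commute)
        moreover have "norm (R (t - r) (h r) - v r) \<le> norm (R (t - r) - R (t - qi (grid_index q n r))) * norm (h r)"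
          using norm_blinfun[of "R (t - r) - R (t - qi (grid_index q n r))" "h r"] by (simp add: v_def blinfun.diff_left)
        ultimately show ?thesis
          by linarith
      qed
      have 1: "norm ((LINT r:{0..<q}|lebesgue. R (t - r) (h r)) - y) \<le> e / 2"
      proof -
        have "(LINT r:{0..<q}|lebesgue. R (t - r) (h r)) - y = (LINT r:{0..<q}|lebesgue. R (t - r) (h r) - v r)"
          unfolding yv[symmetric] by (rule set_integral_diff(2)[OF i vint, symmetric])
        then have "norm ((LINT r:{0..<q}|lebesgue. R (t - r) (h r)) - y) \<le> (LINT r:{0..<q}|lebesgue. norm (R (t - r) (h r) - v r))"
          using set_integral_norm_bound[OF set_integral_diff(1)[OF i vint]] by (simp only:)
        also have "\<dots> \<le> (LINT r:{0..<q}|lebesgue. L \<epsilon> T * (q / real n) * norm (h r))"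
          by (rule set_integral_mono[OF set_integrable_norm[OF set_integral_diff(1)[OF i vint]] set_integrable_mult_right[OF set_integrable_norm[OF hq]] le])
        also have "\<dots> = L \<epsilon> T * (q / real n) * (LINT r:{0..<q}|lebesgue. norm (h r))"
          by (rule set_integral_mult_right)
        also have "\<dots> \<le> L \<epsilon> T * (q / real n) * \<kappa>T"
        proof (rule mult_left_mono)
          have "(LINT r:{0..<q}|lebesgue. norm (h r)) \<le> (LINT r:{0..<q}|lebesgue. \<kappa> r)"
            by (rule dominated_norm_integral[OF hd]) (use q in auto)
          also have "\<dots> \<le> \<kappa>T"
            unfolding \<kappa>T_def by (rule set_integral_le_superset[OF \<kappa> _ _ \<kappa>0]) (use q in auto)
          finally show "(LINT r:{0..<q}|lebesgue. norm (h r)) \<le> \<kappa>T" .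
          show "0 \<le> L \<epsilon> T * (q / real n)"
            using L_nonneg[OF \<epsilon>(1,3)] q by simp
        qed
        also have "\<dots> \<le> e / 2"
          by (rule nq)
        finally show ?thesis .
      qed
      have 2: "norm (LINT r:{q..t}|lebesgue. R (t - r) (h r)) \<le> e / 2"
      proof -
        have "norm (LINT r:{q..t}|lebesgue. R (t - r) (h r)) \<le> Rmax * (LINT r:{q..t}|lebesgue. norm (h r))"
          by (rule duhamel_bound(2)[OF h]) (use q t in auto)
        also have "\<dots> \<le> Rmax * e'"
        proof (rule mult_left_mono[OF _ Rmax(1)])
          have "(LINT r:{q..t}|lebesgue. norm (h r)) \<le> (LINT r:{q..t}|lebesgue. \<kappa> r)"
            by (rule dominated_norm_integral[OF hd]) (use q t in auto)
          also have "\<dots> < e'"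
            by (rule d1(2)) (use q t \<epsilon> in \<open>auto simp: q_def\<close>)
          finally show "(LINT r:{q..t}|lebesgue. norm (h r)) \<le> e'"
            by simp
        qed
        finally show ?thesis
          using e'(2) by linarith
      qed
      have "duhamel h t - y = ((LINT r:{0..<q}|lebesgue. R (t - r) (h r)) - y) + (LINT r:{q..t}|lebesgue. R (t - r) (h r))"
        using duhamel_split[OF h, of q t] q t by simp
      then have "norm (duhamel h t - y) \<le> norm ((LINT r:{0..<q}|lebesgue. R (t - r) (h r)) - y) + norm (LINT r:{q..t}|lebesgue. R (t - r) (h r))"
        using norm_triangle_ineq by metis
      then have "dist x y \<le> e"
        using 1 2 by (simp add: dist_norm xh)
      then show ?thesis
        using yS by blast
    qed
    ultimately show ?thesis
      by blast
  qed
qed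

end

end

section \<open>Feedback controls\<close>

lemma simple_function_grid:
  fixes u :: "real \<Rightarrow> 'a"
  assumes T: "0 < T" and n: "0 < n"
  shows "simple_function (lebesgue_on {0..T}) (\<lambda>t. u (real (grid_index T n t) * T / real n))"
proof -
  have "simple_function (lebesgue_on {0..T}) (grid_index T n)"
    unfolding simple_function_def
  proof (intro conjI ballI)
    have "grid_index T n ` space (lebesgue_on {0..T}) \<subseteq> {..n}"
      using grid_index(1)[OF T n] by auto
    then show "finite (grid_index T n ` space (lebesgue_on {0..T}))"
      by (rule finite_subset) simp
    fix i
    have "grid_index T n -` {i} \<inter> space (lebesgue_on {0..T}) = {0..T} \<inter> {t. grid_index T n t = i}"
      by auto
    then show "grid_index T n -` {i} \<inter> space (lebesgue_on {0..T}) \<in> sets (lebesgue_on {0..T})"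
      using grid_index_sets_lebesgue[of T n i] by (auto simp: sets_restrict_space)
  qed
  then show ?thesis
    by (rule simple_function_compose1)
qed

lemma grid_index_tendsto:
  assumes T: "0 < T" and t: "0 \<le> t" "t \<le> T"
  shows "(\<lambda>n. real (grid_index T (Suc n) t) * T / real (Suc n)) \<longlonglongrightarrow> t"
proof -
  have "(\<lambda>n. t - T / real (Suc n)) \<longlonglongrightarrow> t - 0"
    by (intro tendsto_intros LIMSEQ_Suc[OF lim_const_over_n])
  then have *: "(\<lambda>n. t - T / real (Suc n)) \<longlonglongrightarrow> t"
    by simp
  show ?thesis
    by (rule tendsto_sandwich[OF _ _ * tendsto_const])
      (use grid_index(2,3)[OF T _ t, of "Suc _"] in \<open>auto intro!: always_eventually simp: less_imp_le algebra_simps\<close>)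
qed

text \<open>Sampling at left nodes gives simple functions without any separability of the codomain.
  The endpoint is a null set and may be left out, which suits the controls: their continuity rests
  on norm continuity of \<open>R\<close> at positive times and is shown before \<open>T\<close>
  only.\<close>

lemma continuous_on_strongly_measurable:
  fixes u :: "real \<Rightarrow> 'a::topological_space"
  assumes T: "0 < T" and u: "continuous_on {0..<T} u"
  shows "strongly_measurable (lebesgue_on {0..T}) u"
  unfolding strongly_measurable_def
proof (intro exI conjI allI)
  show "simple_function (lebesgue_on {0..T}) (\<lambda>t. u (real (grid_index T (Suc n) t) * T / real (Suc n)))" for n
    by (rule simple_function_grid[OF T]) simp
  have lim: "(\<lambda>n. u (real (grid_index T (Suc n) t) * T / real (Suc n))) \<longlonglongrightarrow> u t" if t: "t \<in> {0..<T}" for t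
  proof (rule continuous_on_tendsto_compose[OF u grid_index_tendsto[OF T]])
    show "\<forall>\<^sub>F n in sequentially. real (grid_index T (Suc n) t) * T / real (Suc n) \<in> {0..<T}"
    proof (intro always_eventually allI)
      fix n
      have "real (grid_index T (Suc n) t) * T / real (Suc n) \<le> t"
        by (rule grid_index(2)[OF T]) (use t in auto)
      moreover have "0 \<le> real (grid_index T (Suc n) t) * T / real (Suc n)"
        using T by simp
      ultimately show "real (grid_index T (Suc n) t) * T / real (Suc n) \<in> {0..<T}"
        using t by simp
    qed
  qed (use t in auto)
  have "AE t in lebesgue. t \<noteq> T"
    by (rule AE_I[of _ _ "{T}"]) auto
  then have "AE t in lebesgue. t \<in> {0..T} \<longrightarrow> (\<lambda>n. u (real (grid_index T (Suc n) t) * T / real (Suc n))) \<longlonglongrightarrow> u t"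
    by eventually_elim (use lim in auto)
  then show "AE t in lebesgue_on {0..T}. (\<lambda>n. u (real (grid_index T (Suc n) t) * T / real (Suc n))) \<longlonglongrightarrow> u t"
    by (subst AE_restrict_space_iff) auto
qed

lemma set_integrable_const_Icc: "set_integrable lebesgue {0..T::real} (\<lambda>_. C::real)"
  unfolding set_integrable_def by (rule integrable_scaleR_left) (auto intro!: integrable_real_indicator simp: emeasure_lborel_Icc_eq)

lemma bounded_continuous_set_integrable:
  fixes h :: "real \<Rightarrow> 'a::{banach, second_countable_topology}"
  assumes T: "0 < T" and h: "continuous_on {0..<T} h" and C: "\<And>t. t \<in> {0..T} \<Longrightarrow> norm (h t) \<le> C"
  shows "set_integrable lebesgue {0..T} h"
proof (rule set_integrable_lebesgue_bound(1))
  show "set_integrable lebesgue {0..T} (\<lambda>_. C)"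
    by (rule set_integrable_const_Icc)
  show "(\<lambda>t. indicat_real {0..T} t *\<^sub>R h t) \<in> borel_measurable lebesgue"
    by (rule strongly_measurable_imp_borel_measurable[OF _ continuous_on_strongly_measurable[OF T h]]) simp
  show "AE t in lebesgue. t \<in> {0..T} \<longrightarrow> norm (h t) \<le> C"
    using C by simp
qed

locale controlled_family = compact_family R M \<omega> T L
  for R :: "real \<Rightarrow> 'w::{complex_banach, second_countable_topology} \<Rightarrow>\<^sub>L 'w" and M \<omega> T :: real
    and L :: "real \<Rightarrow> real \<Rightarrow> real" +
  fixes B :: "'u::complex_hilbert \<Rightarrow>\<^sub>L 'w"
  assumes clin: "\<And>t. 0 \<le> t \<Longrightarrow> clinear_blinfun (R t)" and clinB: "clinear_blinfun B"
begin

text \<open>The control belonging to a fixed functional \<open>g\<close>. The feedback law is the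
  case where \<open>g\<close> is computed from the state.\<close>

definition ctrl :: "('w \<Rightarrow>\<^sub>L complex) \<Rightarrow> real \<Rightarrow> 'u"
  where "ctrl g t = hilbert_adjoint B (banach_adjoint (R (T - t)) g)"

lemma ctrl_adjoint: "g \<in> cdual \<Longrightarrow> t \<le> T \<Longrightarrow> g (R (T - t) (B u)) = cinner u (ctrl g t)"
  using hilbert_adjoint[OF clinB cdual_banach_adjoint[OF clin], of "T - t" g u]
  by (simp add: ctrl_def banach_adjoint_apply)

lemma ctrl_linear:
  assumes "g \<in> cdual" "g' \<in> cdual" "t \<le> T"
  shows "ctrl (g + g') t = ctrl g t + ctrl g' t" "ctrl (g - g') t = ctrl g t - ctrl g' t" "ctrl (r *\<^sub>R g) t = r *\<^sub>R ctrl g t"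
proof -
  have c: "banach_adjoint (R (T - t)) g \<in> cdual" "banach_adjoint (R (T - t)) g' \<in> cdual"
    using assms by (intro cdual_banach_adjoint clin; simp)+
  have "banach_adjoint S (g + g') = banach_adjoint S g + banach_adjoint S g'"
    "banach_adjoint S (g - g') = banach_adjoint S g - banach_adjoint S g'"
    "banach_adjoint S (r *\<^sub>R g) = r *\<^sub>R banach_adjoint S g" for S :: "'w \<Rightarrow>\<^sub>L 'w"
    by (rule blinfun_eqI; simp add: banach_adjoint_apply blinfun.add_left blinfun.diff_left blinfun.scaleR_left)+
  then show "ctrl (g + g') t = ctrl g t + ctrl g' t" "ctrl (g - g') t = ctrl g t - ctrl g' t" "ctrl (r *\<^sub>R g) t = r *\<^sub>R ctrl g t"
    using hilbert_adjoint_linear[OF clinB c] by (simp_all add: ctrl_def)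
qed

lemma norm_banach_adjoint_le: "norm (banach_adjoint S g) \<le> norm g * norm S"
  unfolding banach_adjoint_def by (rule norm_blinfun_compose)

lemma norm_ctrl_le:
  assumes "g \<in> cdual" "0 \<le> t" "t \<le> T"
  shows "norm (ctrl g t) \<le> norm g * (Rmax * norm B)"
proof -
  have "norm (ctrl g t) \<le> norm (banach_adjoint (R (T - t)) g) * norm B"
    unfolding ctrl_def using assms by (intro norm_hilbert_adjoint_le clinB cdual_banach_adjoint clin) auto
  also have "\<dots> \<le> (norm g * norm (R (T - t))) * norm B"
    by (intro mult_right_mono norm_banach_adjoint_le) simp
  also have "\<dots> \<le> (norm g * Rmax) * norm B"
    using assms by (intro mult_right_mono mult_left_mono Rmax(2)) auto
  finally show ?thesis
    by (simp add: mult.assoc)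
qed

text \<open>Strong continuity of \<open>R\<close> need not pass to adjoints, norm continuity does.
  As the latter is available at positive times, the endpoint \<open>T\<close> is excluded, and the
  Lipschitz constant depends on the distance to it.\<close>

lemma continuous_on_ctrl:
  assumes g: "g \<in> cdual"
  shows "continuous_on {0..<T} (ctrl g)"
proof -
  have le: "norm (ctrl g t - ctrl g s) \<le> norm g * norm B * norm (R (T - s) - R (T - t))" if "t \<le> T" "s \<le> T" for s t
  proof -
    have c: "banach_adjoint (R (T - t)) g \<in> cdual" "banach_adjoint (R (T - s)) g \<in> cdual"
      using that g by (intro cdual_banach_adjoint clin; simp)+
    have "ctrl g t - ctrl g s = hilbert_adjoint B (banach_adjoint (R (T - t)) g - banach_adjoint (R (T - s)) g)"
      unfolding ctrl_def by (rule hilbert_adjoint_linear(2)[OF clinB c, symmetric])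
    then have "norm (ctrl g t - ctrl g s) \<le> norm (banach_adjoint (R (T - t)) g - banach_adjoint (R (T - s)) g) * norm B"
      using norm_hilbert_adjoint_le[OF clinB cdual_closed_ops(3)[OF c]] by simp
    also have "banach_adjoint (R (T - t)) g - banach_adjoint (R (T - s)) g = banach_adjoint (R (T - t) - R (T - s)) g"
      by (rule blinfun_eqI) (simp add: banach_adjoint_apply blinfun.diff_left blinfun.diff_right)
    also have "norm (banach_adjoint (R (T - t) - R (T - s)) g) * norm B \<le> (norm g * norm (R (T - t) - R (T - s))) * norm B"
      by (intro mult_right_mono norm_banach_adjoint_le) simp
    finally show ?thesis
      by (simp add: mult_ac norm_minus_commute)
  qed
  have cont': "continuous_on {0..a} (ctrl g)" if a: "0 < a" "a < T" for a
  proof -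
    let ?K = "norm g * norm B * L (T - a) T"
    have "0 \<le> L (T - a) T"
      using a by (intro L_nonneg) auto
    then have K: "0 \<le> ?K"
      by simp
    have d: "dist (ctrl g t) (ctrl g s) \<le> ?K * dist t s" if st: "s \<le> t" "t \<in> {0..a}" "s \<in> {0..a}" for s t
    proof -
      have "norm (R (T - s) - R (T - t)) \<le> L (T - a) T * ((T - s) - (T - t))"
        by (rule Lip) (use a st in auto)
      then have "norm g * norm B * norm (R (T - s) - R (T - t)) \<le> norm g * norm B * (L (T - a) T * (t - s))"
        by (intro mult_left_mono) auto
      then show ?thesis
        using le[of t s] st a by (simp add: dist_norm dist_real_def mult_ac)
    qed
    have "?K-lipschitz_on {0..a} (ctrl g)"
    proof (rule lipschitz_onI[OF _ K])
      fix s t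
      assume "s \<in> {0..a}" "t \<in> {0..a}"
      then show "dist (ctrl g s) (ctrl g t) \<le> ?K * dist s t"
        using d[of s t] d[of t s] by (cases "s \<le> t") (auto simp: dist_commute)
    qed
    then show ?thesis
      by (rule lipschitz_on_continuous_on)
  qed
  show ?thesis
  proof (rule continuous_on_eq_continuous_within[THEN iffD2], intro ballI)
    fix t
    assume t: "t \<in> {0..<T}"
    define a where "a = (t + T) / 2"
    have a: "0 < a" "a < T" "t < a"
      using t T by (auto simp: a_def)
    have "continuous (at t within {0..a}) (ctrl g)"
      using cont'[OF a(1,2)] t a by (auto simp: continuous_on_eq_continuous_within)
    moreover have "at t within {0..<T} = at t within {0..a}"
      by (rule at_within_nhd[of _ "{..<a}"]) (use a in auto)
    ultimately show "continuous (at t within {0..<T}) (ctrl g)"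
      by simp
  qed
qed

lemma L2_function_ctrl:
  assumes g: "g \<in> cdual"
  shows "L2_function T (ctrl g)"
  unfolding L2_function_def
proof (intro conjI)
  show "strongly_measurable (lebesgue_on {0..T}) (ctrl g)"
    by (rule continuous_on_strongly_measurable[OF T continuous_on_ctrl[OF g]])
  have "set_integrable lebesgue {0..T} (\<lambda>t. (norm (ctrl g t))\<^sup>2)"
  proof (rule bounded_continuous_set_integrable[OF T])
    show "continuous_on {0..<T} (\<lambda>t. (norm (ctrl g t))\<^sup>2)"
      by (intro continuous_intros continuous_on_ctrl g)
    show "norm ((norm (ctrl g t))\<^sup>2) \<le> (norm g * (Rmax * norm B))\<^sup>2" if "t \<in> {0..T}" for t
      using norm_ctrl_le[OF g, of t] that by (simp add: power_mono)
  qed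
  then show "integrable (lebesgue_on {0..T}) (\<lambda>t. (norm (ctrl g t))\<^sup>2)"
    by (subst set_integral_lebesgue_on(2)) auto
qed

lemma norm_B_ctrl_le:
  assumes "g \<in> cdual" "0 \<le> t" "t \<le> T"
  shows "norm (B (ctrl g t)) \<le> norm B * (norm g * (Rmax * norm B))"
  using norm_blinfun[of B "ctrl g t"] mult_left_mono[OF norm_ctrl_le[OF assms], of "norm B"] by simp

lemma set_integrable_B_ctrl:
  assumes g: "g \<in> cdual"
  shows "set_integrable lebesgue {0..T} (\<lambda>t. B (ctrl g t))"
  by (rule bounded_continuous_set_integrable[OF T _ norm_B_ctrl_le[OF g]])
    (auto intro!: bounded_linear.continuous_on[OF blinfun.bounded_linear_right] continuous_on_ctrl g)

lemma control_gramian_eq: "control_gramian T R B g = duhamel (\<lambda>t. B (ctrl g t)) T"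
  unfolding control_gramian_def duhamel_def ctrl_def by (rule set_integral_lebesgue_on(1)) simp

lemma set_integrable_duhamel: "set_integrable lebesgue {0..T} h \<Longrightarrow> t \<le> T \<Longrightarrow> set_integrable lebesgue {0..t} (\<lambda>s. R (t - s) (h s))"
  by (rule duhamel_bound(1)) auto

lemma duhamel_cong: "(\<And>s. s \<in> {0..t} \<Longrightarrow> h s = h' s) \<Longrightarrow> duhamel h t = duhamel h' t"
  unfolding duhamel_def by (rule set_lebesgue_integral_cong) auto

lemma duhamel_add:
  assumes "set_integrable lebesgue {0..T} h" "set_integrable lebesgue {0..T} h'" "t \<le> T"
  shows "duhamel (\<lambda>s. h s + h' s) t = duhamel h t + duhamel h' t"
  unfolding duhamel_def blinfun.add_right by (rule set_integral_add(2)) (intro set_integrable_duhamel assms)+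

lemma duhamel_diff:
  assumes "set_integrable lebesgue {0..T} h" "set_integrable lebesgue {0..T} h'" "t \<le> T"
  shows "duhamel (\<lambda>s. h s - h' s) t = duhamel h t - duhamel h' t"
  unfolding duhamel_def blinfun.diff_right by (rule set_integral_diff(2)) (intro set_integrable_duhamel assms)+

lemma norm_duhamel_le:
  assumes "set_integrable lebesgue {0..T} h" "0 \<le> t" "t \<le> T"
  shows "norm (duhamel h t) \<le> Rmax * (LINT s:{0..T}|lebesgue. norm (h s))"
proof -
  have "norm (duhamel h t) \<le> Rmax * (LINT s:{0..t}|lebesgue. norm (h s))"
    unfolding duhamel_def by (rule duhamel_bound(2)) (use assms in auto)
  also have "\<dots> \<le> Rmax * (LINT s:{0..T}|lebesgue. norm (h s))"
    by (intro mult_left_mono Rmax set_integral_le_superset set_integrable_norm assms) (use assms in auto)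
  finally show ?thesis .
qed

text \<open>Moving the functional into the integral and using adjointness writes the Gramian as an
  integrated inner product of two controls; symmetry and positivity can be read off.\<close>

lemma gramian_form:
  assumes g: "g \<in> cdual" and g': "g' \<in> cdual"
  shows "set_integrable lebesgue {0..T} (\<lambda>t. Re (cinner (ctrl g t) (ctrl g' t)))"
    and "Re (g' (control_gramian T R B g)) = (LINT t:{0..T}|lebesgue. Re (cinner (ctrl g t) (ctrl g' t)))"
proof -
  note i = set_integrable_duhamel[OF set_integrable_B_ctrl[OF g] order_refl, unfolded set_integrable_def]
  interpret bl: bounded_linear "\<lambda>x. Re (g' x)"
    by (rule bounded_linear_compose[OF bounded_linear_Re blinfun.bounded_linear_right])
  have eq: "indicator {0..T} t *\<^sub>R Re (cinner (ctrl g t) (ctrl g' t)) = Re (g' (indicator {0..T} t *\<^sub>R R (T - t) (B (ctrl g t))))" for t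
    using ctrl_adjoint[OF g', of t "ctrl g t"] by (auto simp: indicator_def blinfun.zero_right)
  show "set_integrable lebesgue {0..T} (\<lambda>t. Re (cinner (ctrl g t) (ctrl g' t)))"
    unfolding set_integrable_def eq by (rule integrable_bounded_linear[OF bl.bounded_linear_axioms i])
  show "Re (g' (control_gramian T R B g)) = (LINT t:{0..T}|lebesgue. Re (cinner (ctrl g t) (ctrl g' t)))"
    unfolding control_gramian_eq duhamel_def set_lebesgue_integral_def eq
    by (rule integral_bounded_linear[OF bl.bounded_linear_axioms i, symmetric])
qed

section \<open>The Gramian as a positive symmetric operator\<close>

abbreviation gramian :: "('w \<Rightarrow>\<^sub>L complex) \<Rightarrow> 'w"
  where "gramian \<equiv> control_gramian T R B"

lemma gramian_add: "g \<in> cdual \<Longrightarrow> g' \<in> cdual \<Longrightarrow> gramian (g + g') = gramian g + gramian g'"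
proof -
  assume g: "g \<in> cdual" "g' \<in> cdual"
  have "duhamel (\<lambda>t. B (ctrl (g + g') t)) T = duhamel (\<lambda>t. B (ctrl g t) + B (ctrl g' t)) T"
    by (rule duhamel_cong) (simp add: ctrl_linear[OF g] blinfun.add_right)
  then show "gramian (g + g') = gramian g + gramian g'"
    by (simp add: control_gramian_eq duhamel_add set_integrable_B_ctrl g)
qed

lemma gramian_scaleR: "g \<in> cdual \<Longrightarrow> gramian (r *\<^sub>R g) = r *\<^sub>R gramian g"
proof -
  assume g: "g \<in> cdual"
  have "duhamel (\<lambda>t. B (ctrl (r *\<^sub>R g) t)) T = duhamel (\<lambda>t. r *\<^sub>R B (ctrl g t)) T"
    by (rule duhamel_cong) (simp add: ctrl_linear[OF g g] blinfun.scaleR_right)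
  also have "\<dots> = r *\<^sub>R duhamel (\<lambda>t. B (ctrl g t)) T"
    by (simp add: duhamel_def blinfun.scaleR_right)
  finally show "gramian (r *\<^sub>R g) = r *\<^sub>R gramian g"
    by (simp add: control_gramian_eq)
qed

lemma gramian_bounded: "g \<in> cdual \<Longrightarrow> norm (gramian g) \<le> (Rmax * (T * (norm B * (Rmax * norm B)))) * norm g"
proof -
  assume g: "g \<in> cdual"
  have i: "set_integrable lebesgue {0..T} (\<lambda>_. norm B * (norm g * (Rmax * norm B)))"
    by (rule set_integrable_const_Icc)
  have "(LINT s:{0..T}|lebesgue. norm (B (ctrl g s))) \<le> (LINT s:{0..T}|lebesgue. norm B * (norm g * (Rmax * norm B)))"
    by (rule set_integral_mono[OF set_integrable_norm[OF set_integrable_B_ctrl[OF g]] i norm_B_ctrl_le[OF g]]) auto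
  also have "\<dots> = T * (norm B * (norm g * (Rmax * norm B)))"
    using T by (simp add: set_lebesgue_integral_def)
  finally have "Rmax * (LINT s:{0..T}|lebesgue. norm (B (ctrl g s))) \<le> Rmax * (T * (norm B * (norm g * (Rmax * norm B))))"
    by (intro mult_left_mono Rmax(1))
  moreover have "norm (gramian g) \<le> Rmax * (LINT s:{0..T}|lebesgue. norm (B (ctrl g s)))"
    unfolding control_gramian_eq by (rule norm_duhamel_le[OF set_integrable_B_ctrl[OF g]]) (use T in auto)
  ultimately show "norm (gramian g) \<le> (Rmax * (T * (norm B * (Rmax * norm B)))) * norm g"
    by (simp add: mult_ac)
qed

lemma gramian_sym: "g \<in> cdual \<Longrightarrow> g' \<in> cdual \<Longrightarrow> Re (g (gramian g')) = Re (g' (gramian g))"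
  by (simp add: gramian_form Re_cinner_commute)

lemma gramian_pos: "g \<in> cdual \<Longrightarrow> 0 \<le> Re (g (gramian g))"
  by (auto simp: gramian_form set_lebesgue_integral_def cinner_self intro!: Bochner_Integration.integral_nonneg)

end

section \<open>The fixed point argument\<close>

instance bcontfun :: (metric_space, banach) banach ..

locale neutral_system = controlled_family R M \<omega> T L B
  for R :: "real \<Rightarrow> 'w::{complex_banach, second_countable_topology} \<Rightarrow>\<^sub>L 'w" and M \<omega> T :: real
    and L :: "real \<Rightarrow> real \<Rightarrow> real" and B :: "'u::complex_hilbert \<Rightarrow>\<^sub>L 'w" +
  fixes \<BB> :: "(real \<Rightarrow> 'w) set" and p :: "(real \<Rightarrow> 'w) \<Rightarrow> real"
    and f :: "real \<Rightarrow> (real \<Rightarrow> 'w) \<Rightarrow> 'w" and \<gamma> :: "real \<Rightarrow> real" and \<psi> f1' f2 :: "real \<Rightarrow> 'w"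
    and \<mu> :: real and \<zeta>1 :: 'w
  assumes uc: "uniformly_convex (cdual :: ('w \<Rightarrow>\<^sub>L complex) set)"
    and R0: "R 0 = id_blinfun"
    and phase: "phase_space \<BB> p"
    and f_cont: "AE t in lebesgue_on {0..T}. \<forall>\<phi>\<in>\<BB>. \<forall>\<epsilon>>0. \<exists>\<delta>>0. \<forall>\<xi>\<in>\<BB>.
           p (\<lambda>\<theta>. \<xi> \<theta> - \<phi> \<theta>) < \<delta> \<longrightarrow> norm (f t \<xi> - f t \<phi>) < \<epsilon>"
    and f_meas: "\<And>\<phi>. \<phi> \<in> \<BB> \<Longrightarrow> strongly_measurable (lebesgue_on {0..T}) (\<lambda>t. f t \<phi>)"
    and \<gamma>: "set_integrable lebesgue {0..T} \<gamma>" and \<gamma>0: "\<And>t. t \<in> {0..T} \<Longrightarrow> 0 \<le> \<gamma> t"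
    and f_le: "AE t in lebesgue_on {0..T}. \<forall>\<phi>\<in>\<BB>. norm (f t \<phi>) \<le> \<gamma> t"
    and \<psi>: "\<psi> \<in> \<BB>"
    and f1': "set_integrable lebesgue {0..T} f1'" and f2: "set_integrable lebesgue {0..T} f2"
    and \<mu>: "0 < \<mu>"
begin

text \<open>
  Fixed points are sought among bounded continuous functions on the whole line, so every function is
  first forced to pass through \<open>\<psi> 0\<close>.
\<close>

definition ext :: "(real \<Rightarrow> 'w) \<Rightarrow> real \<Rightarrow> 'w"
  where "ext x t = (if t \<le> 0 then \<psi> t else x t - x 0 + \<psi> 0)"

lemma seminormed: "seminormed_function_space \<BB> p"
  using phase by (simp add: phase_space_def)

lemma zero_seminorm: "p (\<lambda>\<theta>. 0) = 0"
proof -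
  have "p (\<lambda>\<theta>. 0 *C \<psi> \<theta>) = cmod 0 * p \<psi>"
    using seminormed \<psi> unfolding seminormed_function_space_def by blast
  then show ?thesis
    by (simp add: scaleC.zero_left)
qed

lemma history_ext_0: "history (ext x) 0 = \<psi>"
  using seminormed \<psi> by (auto simp: seminormed_function_space_def history_def ext_def fun_eq_iff)

lemma continuous_on_ext: "continuous_on UNIV x \<Longrightarrow> continuous_on {0..} (ext x)"
  by (rule continuous_on_eq[of _ "\<lambda>t. x t - x 0 + \<psi> 0"])
    (auto simp: ext_def intro!: continuous_intros continuous_on_subset[of UNIV x])

lemma history_ext: "continuous_on UNIV x \<Longrightarrow> 0 \<le> t \<Longrightarrow> history (ext x) t \<in> \<BB>"
proof -
  assume x: "continuous_on UNIV x" and t: "0 \<le> t"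
  have "continuous_on {0..<0 + (t + 1)} (ext x)"
    by (rule continuous_on_subset[OF continuous_on_ext[OF x]]) auto
  then show "history (ext x) t \<in> \<BB>"
    using phase t \<psi> unfolding phase_space_def
    by (elim conjE exE allE[of _ "0::real"] allE[of _ "t + 1"] allE[of _ "ext x"]) (auto simp: history_ext_0)
qed

lemma history_ext_tendsto:
  assumes x: "continuous_on UNIV x" and t: "0 \<le> t" and q: "q \<longlonglongrightarrow> t" "\<And>n::nat. 0 \<le> q n" "\<And>n. q n \<le> t"
  shows "(\<lambda>n. p (\<lambda>\<theta>. history (ext x) (q n) \<theta> - history (ext x) t \<theta>)) \<longlonglongrightarrow> 0"
proof -
  let ?P = "\<lambda>s. p (\<lambda>\<theta>. history (ext x) s \<theta> - history (ext x) t \<theta>)"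
  \<comment> \<open>The phase space axioms speak of half-open intervals; prolonging to
    \<open>t + 1\<close> makes \<open>t\<close> an admissible time.\<close>
  let ?S = "{0..<0 + (t + 1)}"
  have "continuous_on ?S (ext x)"
    by (rule continuous_on_subset[OF continuous_on_ext[OF x]]) auto
  then have "(?P \<longlongrightarrow> 0) (at t within ?S)"
    using phase t \<psi> unfolding phase_space_def
    by (elim conjE allE[of _ "0::real"] allE[of _ "t + 1"] allE[of _ "ext x"]) (auto simp: history_ext_0)
  then have "continuous (at t within ?S) ?P"
    by (simp add: continuous_within zero_seminorm)
  then have "(\<lambda>n. ?P (q n)) \<longlonglongrightarrow> ?P t"
    by (rule continuous_within_tendsto_compose) (use q t in \<open>auto intro!: always_eventually intro: le_less_trans[OF q(3)]\<close>)
  then show ?thesis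
    by (simp add: zero_seminorm)
qed

text \<open>The difference of two extensions vanishes on the whole past, so the phase space estimate
  keeps only the supremum term. The factor 2 comes from the correction by \<open>x 0\<close> in
  \<open>ext\<close>.\<close>

lemma history_ext_Lipschitz: "\<exists>K. \<forall>(x :: real \<Rightarrow>\<^sub>C 'w) (y :: real \<Rightarrow>\<^sub>C 'w). \<forall>t\<ge>0.
    p (\<lambda>\<theta>. history (ext (apply_bcontfun x)) t \<theta> - history (ext (apply_bcontfun y)) t \<theta>) \<le> K t * dist x y"
proof -
  from phase[unfolded phase_space_def, THEN conjunct2, THEN conjunct1]
  obtain K1 and \<Lambda> \<Upsilon> :: "real \<Rightarrow> real" where \<Lambda>: "\<forall>r\<ge>0. 1 \<le> \<Lambda> r"
    and le: "\<forall>\<sigma> \<tau> z. 0 < \<tau> \<and> continuous_on {\<sigma>..<\<sigma> + \<tau>} z \<and> history z \<sigma> \<in> \<BB> \<longrightarrow>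
        (\<forall>t\<in>{\<sigma>..<\<sigma> + \<tau>}. history z t \<in> \<BB> \<and> norm (z t) \<le> K1 * p (history z t) \<and>
          p (history z t) \<le> \<Lambda> (t - \<sigma>) * (SUP s\<in>{\<sigma>..t}. norm (z s)) + \<Upsilon> (t - \<sigma>) * p (history z \<sigma>))"
    by (elim exE conjE) (rule that)
  have "p (\<lambda>\<theta>. history (ext (apply_bcontfun x)) t \<theta> - history (ext (apply_bcontfun y)) t \<theta>) \<le> (2 * \<Lambda> t) * dist x y"
    if t: "0 \<le> t" for x y :: "real \<Rightarrow>\<^sub>C 'w" and t
  proof -
    define z where "z s = ext (apply_bcontfun x) s - ext (apply_bcontfun y) s" for s
    have hz: "history z s = (\<lambda>\<theta>. history (ext (apply_bcontfun x)) s \<theta> - history (ext (apply_bcontfun y)) s \<theta>)" for s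
      by (auto simp: history_def z_def)
    have h0: "history z 0 = (\<lambda>\<theta>. 0)"
      by (simp add: hz history_ext_0)
    have c: "continuous_on {0..<0 + (t + 1)} z"
      unfolding z_def
      by (intro continuous_on_diff continuous_on_subset[OF continuous_on_ext] continuous_on_apply_bcontfun) auto
    have zs: "norm (z s) \<le> 2 * dist x y" for s
    proof (cases "s \<le> 0")
      case False
      have "z s = (apply_bcontfun x s - apply_bcontfun y s) - (apply_bcontfun x 0 - apply_bcontfun y 0)"
        using False by (simp add: z_def ext_def)
      then have "norm (z s) \<le> dist (apply_bcontfun x s) (apply_bcontfun y s) + dist (apply_bcontfun x 0) (apply_bcontfun y 0)"
        using norm_triangle_ineq4[of "apply_bcontfun x s - apply_bcontfun y s" "apply_bcontfun x 0 - apply_bcontfun y 0"] by (simp add: dist_norm)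
      then show ?thesis
        using dist_bounded[of x s y] dist_bounded[of x 0 y] by linarith
    qed (simp add: z_def ext_def)
    have "(\<lambda>\<theta>. 0) \<in> \<BB>"
      using seminormed by (simp add: seminormed_function_space_def)
    then have "p (history z t) \<le> \<Lambda> (t - 0) * (SUP s\<in>{0..t}. norm (z s)) + \<Upsilon> (t - 0) * p (history z 0)"
      using t c by (intro le[rule_format, THEN conjunct2, THEN conjunct2, of "t + 1"]) (auto simp: h0)
    then have "p (history z t) \<le> \<Lambda> t * (SUP s\<in>{0..t}. norm (z s))"
      by (simp add: h0 zero_seminorm)
    also have "\<dots> \<le> \<Lambda> t * (2 * dist x y)"
      by (rule mult_left_mono[OF cSUP_least]) (use zs \<Lambda> t in \<open>auto intro: order_trans[OF zero_le_one]\<close>)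
    finally show ?thesis
      by (simp add: hz mult_ac)
  qed
  then show ?thesis
    by (intro exI[of _ "\<lambda>t. 2 * \<Lambda> t"] allI impI) auto
qed

section \<open>The nonlinearity along histories\<close>

definition forcing :: "(real \<Rightarrow> 'w) \<Rightarrow> real \<Rightarrow> 'w"
  where "forcing x t = f t (history (ext x) t)"

lemma f_cont': "AE t in lebesgue. t \<in> {0..T} \<longrightarrow> (\<forall>\<phi>\<in>\<BB>. \<forall>\<epsilon>>0. \<exists>\<delta>>0. \<forall>\<xi>\<in>\<BB>.
    p (\<lambda>\<theta>. \<xi> \<theta> - \<phi> \<theta>) < \<delta> \<longrightarrow> norm (f t \<xi> - f t \<phi>) < \<epsilon>)"
  using f_cont by (simp add: AE_restrict_space_iff)

lemma f_tendsto:
  assumes c: "\<forall>\<phi>\<in>\<BB>. \<forall>\<epsilon>>0. \<exists>\<delta>>0. \<forall>\<xi>\<in>\<BB>. p (\<lambda>\<theta>. \<xi> \<theta> - \<phi> \<theta>) < \<delta> \<longrightarrow> norm (f t \<xi> - f t \<phi>) < \<epsilon>"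
    and \<phi>: "\<phi> \<in> \<BB>" "\<And>n. \<xi> n \<in> \<BB>" and lim: "(\<lambda>n. p (\<lambda>\<theta>. \<xi> n \<theta> - \<phi> \<theta>)) \<longlonglongrightarrow> 0"
  shows "(\<lambda>n::nat. f t (\<xi> n)) \<longlonglongrightarrow> f t \<phi>"
proof (rule tendstoI)
  fix e :: real
  assume "0 < e"
  then obtain d where d: "0 < d" "\<And>\<xi>. \<xi> \<in> \<BB> \<Longrightarrow> p (\<lambda>\<theta>. \<xi> \<theta> - \<phi> \<theta>) < d \<Longrightarrow> norm (f t \<xi> - f t \<phi>) < e"
    using c \<phi>(1) by meson
  have "\<forall>\<^sub>F n in sequentially. p (\<lambda>\<theta>. \<xi> n \<theta> - \<phi> \<theta>) < d"
    by (rule order_tendstoD(2)[OF lim d(1)])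
  then show "\<forall>\<^sub>F n in sequentially. dist (f t (\<xi> n)) (f t \<phi>) < e"
    by eventually_elim (simp add: dist_norm d(2) \<phi>)
qed

text \<open>The usual Caratheodory argument: with the history frozen at grid nodes the composite is
  a finite sum of functions \<open>f t \<phi>\<close> of \<open>t\<close> cut to cells, and
  continuity of the history in time and of \<open>f t\<close> in the state carries measurability to
  the limit.\<close>

lemma measurable_forcing:
  assumes x: "continuous_on UNIV x"
  shows "(\<lambda>t. indicator {0..T} t *\<^sub>R forcing x t) \<in> borel_measurable lebesgue"
proof (rule borel_measurable_lebesgue_AE_limit)
  define q where "q n t = real (grid_index T (Suc n) t) * T / real (Suc n)" for n t
  define qi where "qi n i = real i * T / real (Suc n)" for n i
  define s where "s n t = indicat_real {0..T} t *\<^sub>R f t (history (ext x) (q n t))" for n t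
  have q: "0 \<le> q n t" "t \<in> {0..T} \<Longrightarrow> q n t \<le> t" for n t
    using T grid_index(2)[OF T, of "Suc n" t] by (auto simp: q_def)
  show "s n \<in> borel_measurable lebesgue" for n
  proof -
    \<comment> \<open>Nodes are numbered up to \<open>Suc n\<close>, the last one being attained at
      \<open>t = T\<close> only; hence \<open>Suc (Suc n)\<close> terms.\<close>
    have "s n t = (\<Sum>i<Suc (Suc n). indicator {t. grid_index T (Suc n) t = i} t *\<^sub>R (indicat_real {0..T} t *\<^sub>R f t (history (ext x) (qi n i))))" for t
    proof (cases "t \<in> {0..T}")
      case True
      then have "grid_index T (Suc n) t < Suc (Suc n)"
        using grid_index(1)[OF T, of "Suc n" t] by auto
      moreover have "(\<Sum>i<Suc (Suc n). indicator {t. grid_index T (Suc n) t = i} t *\<^sub>R (indicat_real {0..T} t *\<^sub>R f t (history (ext x) (qi n i))))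
        = (\<Sum>i<Suc (Suc n). if i = grid_index T (Suc n) t then f t (history (ext x) (qi n i)) else 0)"
        using True by (intro sum.cong) (auto simp: indicator_def)
      ultimately show ?thesis
        using True by (simp add: s_def q_def qi_def del: sum.lessThan_Suc)
    qed (simp add: s_def)
    moreover have "(\<lambda>t. indicat_real {0..T} t *\<^sub>R f t (history (ext x) (qi n i))) \<in> borel_measurable lebesgue" for i
      by (rule strongly_measurable_imp_borel_measurable[OF _ f_meas[OF history_ext[OF x]]]) (use T in \<open>auto simp: qi_def\<close>)
    then have "(\<lambda>t. \<Sum>i<Suc (Suc n). indicat_real {t. grid_index T (Suc n) t = i} t *\<^sub>R (indicat_real {0..T} t *\<^sub>R f t (history (ext x) (qi n i)))) \<in> borel_measurable lebesgue"
      by (intro borel_measurable_sum borel_measurable_scaleR[OF borel_measurable_indicator[OF grid_index_sets_lebesgue]])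
    ultimately show ?thesis
      by presburger
  qed
  show "AE t in lebesgue. (\<lambda>n. s n t) \<longlonglongrightarrow> indicator {0..T} t *\<^sub>R forcing x t"
    using f_cont'
  proof eventually_elim
    case (elim t)
    show ?case
    proof (cases "t \<in> {0..T}")
      case True
      have qt: "(\<lambda>n. q n t) \<longlonglongrightarrow> t"
        unfolding q_def by (rule grid_index_tendsto[OF T]) (use True in auto)
      have "(\<lambda>n. f t (history (ext x) (q n t))) \<longlonglongrightarrow> f t (history (ext x) t)"
        by (rule f_tendsto[OF mp[OF elim True] history_ext[OF x] history_ext[OF x] history_ext_tendsto[OF x _ qt]])
          (use True q in auto)
      then show ?thesis
        using True by (simp add: s_def forcing_def)
    qed (simp add: s_def)
  qed
qed

lemma norm_forcing_le:
  assumes x: "continuous_on UNIV x"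
  shows "AE t in lebesgue. t \<in> {0..T} \<longrightarrow> norm (forcing x t) \<le> \<gamma> t"
proof -
  have "AE t in lebesgue. t \<in> {0..T} \<longrightarrow> (\<forall>\<phi>\<in>\<BB>. norm (f t \<phi>) \<le> \<gamma> t)"
    using f_le by (simp add: AE_restrict_space_iff)
  then show ?thesis
    by eventually_elim (auto simp: forcing_def history_ext[OF x])
qed

lemma set_integrable_forcing: "continuous_on UNIV x \<Longrightarrow> set_integrable lebesgue {0..T} (forcing x)"
  by (rule set_integrable_lebesgue_bound(1)[OF \<gamma> measurable_forcing norm_forcing_le])

text \<open>Convergence in the mean is what the Duhamel bound asks for. Pointwise convergence comes
  from the Lipschitz dependence of histories, and \<open>2 * \<gamma>\<close> dominates.\<close>

lemma forcing_tendsto: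
  fixes x :: "nat \<Rightarrow> real \<Rightarrow>\<^sub>C 'w"
  assumes x: "x \<longlonglongrightarrow> y"
  shows "(\<lambda>n. LINT t:{0..T}|lebesgue. norm (forcing (apply_bcontfun (x n)) t - forcing (apply_bcontfun y) t)) \<longlonglongrightarrow> 0"
proof -
  obtain K where K: "\<And>x y t. 0 \<le> t \<Longrightarrow>
      p (\<lambda>\<theta>. history (ext (apply_bcontfun x)) t \<theta> - history (ext (apply_bcontfun y)) t \<theta>) \<le> K t * dist x y"
    using history_ext_Lipschitz by blast
  have p0: "0 \<le> p (\<lambda>\<theta>. history (ext (apply_bcontfun x)) t \<theta> - history (ext (apply_bcontfun y)) t \<theta>)" if "0 \<le> t" for x y t
  proof -
    have s: "\<And>c \<phi>. \<phi> \<in> \<BB> \<Longrightarrow> (\<lambda>\<theta>. c *C \<phi> \<theta>) \<in> \<BB>" "\<And>\<phi> \<xi>. \<phi> \<in> \<BB> \<Longrightarrow> \<xi> \<in> \<BB> \<Longrightarrow> (\<lambda>\<theta>. \<phi> \<theta> + \<xi> \<theta>) \<in> \<BB>" "\<And>\<phi>. \<phi> \<in> \<BB> \<Longrightarrow> 0 \<le> p \<phi>"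
      using seminormed by (auto simp: seminormed_function_space_def)
    have "(- 1) *C v = - v" for v :: 'w
      using scaleR_scaleC[of "- 1" v] by simp
    then have "(\<lambda>\<theta>. history (ext (apply_bcontfun x)) t \<theta> + (- 1) *C history (ext (apply_bcontfun y)) t \<theta>)
      = (\<lambda>\<theta>. history (ext (apply_bcontfun x)) t \<theta> - history (ext (apply_bcontfun y)) t \<theta>)"
      by (auto simp: fun_eq_iff)
    moreover have "(\<lambda>\<theta>. history (ext (apply_bcontfun x)) t \<theta> + (- 1) *C history (ext (apply_bcontfun y)) t \<theta>) \<in> \<BB>"
      by (intro s history_ext continuous_on_apply_bcontfun that)
    ultimately show ?thesis
      using s(3) by metis
  qed
  have c: "continuous_on UNIV (apply_bcontfun z)" for z :: "real \<Rightarrow>\<^sub>C 'w"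
    by (rule continuous_on_apply_bcontfun)
  have "(\<lambda>n. \<integral>t. indicat_real {0..T} t *\<^sub>R norm (forcing (apply_bcontfun (x n)) t - forcing (apply_bcontfun y) t) \<partial>lebesgue) \<longlonglongrightarrow> (\<integral>t. 0 \<partial>(lebesgue :: real measure))"
  proof (rule integral_dominated_convergence)
    show "integrable lebesgue (\<lambda>t. indicat_real {0..T} t *\<^sub>R (2 * \<gamma> t))"
      using set_integrable_mult_right[OF \<gamma>, of 2] by (simp add: set_integrable_def)
    show "(\<lambda>t. indicat_real {0..T} t *\<^sub>R norm (forcing (apply_bcontfun (x n)) t - forcing (apply_bcontfun y) t)) \<in> borel_measurable lebesgue" for n
      using set_integrable_norm[OF set_integral_diff(1)[OF set_integrable_forcing[OF c] set_integrable_forcing[OF c]], of "x n" y]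
      unfolding set_integrable_def by (rule borel_measurable_integrable)
    show "AE t in lebesgue. norm (indicat_real {0..T} t *\<^sub>R norm (forcing (apply_bcontfun (x n)) t - forcing (apply_bcontfun y) t)) \<le> indicat_real {0..T} t *\<^sub>R (2 * \<gamma> t)" for n
      using norm_forcing_le[OF c[of "x n"]] norm_forcing_le[OF c[of y]]
    proof eventually_elim
      case (elim t)
      show ?case
      proof (cases "t \<in> {0..T}")
        case True
        then show ?thesis
          using elim norm_triangle_ineq4[of "forcing (apply_bcontfun (x n)) t" "forcing (apply_bcontfun y) t"] by simp
      qed simp
    qed
    show "AE t in lebesgue. (\<lambda>n. indicat_real {0..T} t *\<^sub>R norm (forcing (apply_bcontfun (x n)) t - forcing (apply_bcontfun y) t)) \<longlonglongrightarrow> 0"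
      using f_cont'
    proof eventually_elim
      case (elim t)
      show ?case
      proof (cases "t \<in> {0..T}")
        case True
        then have t: "0 \<le> t"
          by simp
        have "(\<lambda>n. K t * dist (x n) y) \<longlonglongrightarrow> 0"
          using x by (intro tendsto_mult_right_zero) (simp add: tendsto_dist_iff[symmetric])
        then have "(\<lambda>n. p (\<lambda>\<theta>. history (ext (apply_bcontfun (x n))) t \<theta> - history (ext y) t \<theta>)) \<longlonglongrightarrow> 0"
          by (rule tendsto_sandwich[OF _ _ tendsto_const, rotated 2]) (use K[OF t] p0[OF t] in \<open>auto intro!: always_eventually\<close>)
        from f_tendsto[OF mp[OF elim True] history_ext[OF c t] history_ext[OF c t] this]
        have "(\<lambda>n. forcing (apply_bcontfun (x n)) t) \<longlonglongrightarrow> forcing (apply_bcontfun y) t"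
          by (simp add: forcing_def)
        then have "(\<lambda>n. norm (forcing (apply_bcontfun (x n)) t - forcing (apply_bcontfun y) t)) \<longlonglongrightarrow> 0"
          by (intro tendsto_norm_zero) (simp add: Lim_null[symmetric])
        then show ?thesis
          using True by simp
      qed simp
    qed
  qed simp
  then show ?thesis
    by (simp add: set_lebesgue_integral_def)
qed

definition source :: "real \<Rightarrow> 'w"
  where "source t = f1' t + f2 t"

lemma source: "set_integrable lebesgue {0..T} source"
  unfolding source_def[abs_def] by (rule set_integral_add(1)[OF f1' f2])

definition defect :: "(real \<Rightarrow> 'w) \<Rightarrow> 'w"
  where "defect x = \<zeta>1 - R T (\<psi> 0) - duhamel source T - duhamel (forcing x) T"

text \<open>Named as one map because the control sees only this composite, and the minimisation
  argument gives its continuity directly in the norm of the dual.\<close>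

definition covector :: "'w \<Rightarrow> ('w \<Rightarrow>\<^sub>L complex)"
  where "covector z = duality_map (gramian_resolvent \<mu> gramian z)"

definition total_input :: "(real \<Rightarrow> 'w) \<Rightarrow> real \<Rightarrow> 'w"
  where "total_input x t = B (ctrl (covector (defect x)) t) + forcing x t + source t"

lemma covector_cdual: "covector z \<in> cdual"
  unfolding covector_def by (rule duality_map_cdual[OF uc])

lemma norm_covector: "norm (covector z) \<le> norm z / \<mu>"
  unfolding covector_def
  by (rule norm_duality_map_gramian_resolvent[OF uc gramian_add gramian_scaleR gramian_bounded gramian_sym gramian_pos \<mu>])

lemma continuous_on_covector: "continuous_on UNIV covector"
  unfolding covector_def[abs_def]
  by (rule continuous_duality_map_gramian_resolvent[OF uc gramian_add gramian_scaleR gramian_bounded gramian_sym gramian_pos \<mu>])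

lemma feedback_control_ext: "feedback_control T R B f \<psi> f1' f2 \<mu> \<zeta>1 (ext x) = ctrl (covector (defect x))"
  unfolding feedback_control_def steering_defect_def ctrl_def covector_def defect_def duhamel_def source_def forcing_def
  by (simp add: fun_eq_iff set_integral_lebesgue_on(1))

text \<open>The constant is the chain of estimates for the control: the numerator bounds the defect
  because \<gamma> bounds every forcing, \<open>norm_covector\<close> divides by \<mu>, and
  \<open>norm_B_ctrl_le\<close> adds the outer factors.\<close>

definition dominant :: "real \<Rightarrow> real"
  where "dominant t = norm B * ((norm \<zeta>1 + norm (R T (\<psi> 0)) + norm (duhamel source T) + Rmax * (LINT s:{0..T}|lebesgue. \<gamma> s)) / \<mu> * (Rmax * norm B))
    + \<gamma> t + norm (source t)"

lemma dominant_nonneg_const: "0 \<le> norm B * ((norm \<zeta>1 + norm (R T (\<psi> 0)) + norm (duhamel source T) + Rmax * (LINT s:{0..T}|lebesgue. \<gamma> s)) / \<mu> * (Rmax * norm B))"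
proof -
  have "0 \<le> (LINT s:{0..T}|lebesgue. \<gamma> s)"
    unfolding set_lebesgue_integral_def by (rule Bochner_Integration.integral_nonneg) (use \<gamma>0 in \<open>auto simp: indicator_def\<close>)
  then show ?thesis
    using Rmax(1) \<mu> by simp
qed

lemma dominant: "set_integrable lebesgue {0..T} dominant" "t \<in> {0..T} \<Longrightarrow> 0 \<le> dominant t"
proof -
  show "set_integrable lebesgue {0..T} dominant"
    unfolding dominant_def[abs_def] by (intro set_integral_add(1) set_integrable_const_Icc \<gamma> set_integrable_norm source)
  show "t \<in> {0..T} \<Longrightarrow> 0 \<le> dominant t"
    unfolding dominant_def using dominant_nonneg_const \<gamma>0 by (simp only: add_nonneg_nonneg norm_ge_zero)
qed

lemma total_input_dominated:
  assumes x: "continuous_on UNIV x"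
  shows "set_integrable lebesgue {0..T} (total_input x)" "total_input x \<in> dominated dominant"
proof -
  show i: "set_integrable lebesgue {0..T} (total_input x)"
    unfolding total_input_def[abs_def]
    by (intro set_integral_add(1) set_integrable_B_ctrl covector_cdual set_integrable_forcing x source)
  have "norm (duhamel (forcing x) T) \<le> Rmax * (LINT s:{0..T}|lebesgue. norm (forcing x s))"
    by (rule norm_duhamel_le[OF set_integrable_forcing[OF x]]) (use T in auto)
  also have "\<dots> \<le> Rmax * (LINT s:{0..T}|lebesgue. \<gamma> s)"
    by (intro mult_left_mono Rmax(1) set_integral_mono_AE set_integrable_norm set_integrable_forcing x \<gamma> norm_forcing_le)
  finally have "norm (defect x) \<le> norm \<zeta>1 + norm (R T (\<psi> 0)) + norm (duhamel source T) + Rmax * (LINT s:{0..T}|lebesgue. \<gamma> s)"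
    using norm_triangle_ineq4[of "\<zeta>1 - R T (\<psi> 0) - duhamel source T" "duhamel (forcing x) T"]
      norm_triangle_ineq4[of "\<zeta>1 - R T (\<psi> 0)" "duhamel source T"] norm_triangle_ineq4[of \<zeta>1 "R T (\<psi> 0)"]
    unfolding defect_def by linarith
  then have c: "norm (covector (defect x)) \<le> (norm \<zeta>1 + norm (R T (\<psi> 0)) + norm (duhamel source T) + Rmax * (LINT s:{0..T}|lebesgue. \<gamma> s)) / \<mu>"
    using norm_covector[of "defect x"] \<mu> by (meson divide_right_mono less_imp_le order_trans)
  have b: "norm (B (ctrl (covector (defect x)) t)) \<le> norm B * ((norm \<zeta>1 + norm (R T (\<psi> 0)) + norm (duhamel source T) + Rmax * (LINT s:{0..T}|lebesgue. \<gamma> s)) / \<mu> * (Rmax * norm B))"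
    if "t \<in> {0..T}" for t
  proof -
    have "norm (B (ctrl (covector (defect x)) t)) \<le> norm B * (norm (covector (defect x)) * (Rmax * norm B))"
      by (rule norm_B_ctrl_le[OF covector_cdual]) (use that in auto)
    also have "\<dots> \<le> norm B * ((norm \<zeta>1 + norm (R T (\<psi> 0)) + norm (duhamel source T) + Rmax * (LINT s:{0..T}|lebesgue. \<gamma> s)) / \<mu> * (Rmax * norm B))"
      by (intro mult_left_mono mult_right_mono c) (use Rmax(1) in auto)
    finally show ?thesis .
  qed
  have "norm (total_input x t) \<le> dominant t" if t: "t \<in> {0..T}" and "norm (forcing x t) \<le> \<gamma> t" for t
    unfolding total_input_def dominant_def by (intro norm_triangle_le add_mono b that order_refl)
  then have "AE t in lebesgue. t \<in> {0..T} \<longrightarrow> norm (total_input x t) \<le> dominant t"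
    using norm_forcing_le[OF x] by (auto elim: eventually_mono)
  with i show "total_input x \<in> dominated dominant"
    by (subst dominated_def[OF dominant]) auto
qed

text \<open>Extending by constants turns continuous functions on \<open>[0, T]\<close> into bounded
  continuous functions on the line without changing the supremum norm, so that a Banach space given
  by a type serves as the domain of the fixed point map.\<close>

definition clamp :: "real \<Rightarrow> real"
  where "clamp t = max 0 (min T t)"

lemma clamp: "0 \<le> clamp t" "clamp t \<le> T" "clamp (clamp t) = clamp t" "0 \<le> t \<Longrightarrow> t \<le> T \<Longrightarrow> clamp t = t"
  using T by (auto simp: clamp_def)

lemma continuous_on_clamp: "continuous_on UNIV clamp"
  unfolding clamp_def[abs_def] by (intro continuous_intros)

lemma range_clamp: "range clamp \<subseteq> {0..T}"
  using clamp by auto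

section \<open>The solution map and its fixed point\<close>

definition next_iterate :: "(real \<Rightarrow> 'w) \<Rightarrow> real \<Rightarrow> 'w"
  where "next_iterate x t = R (clamp t) (\<psi> 0) + duhamel (total_input x) (clamp t)"

text \<open>Uniform in \<open>x\<close> because all inputs lie in one dominated set. The free term
  \<open>R t (\<psi> 0)\<close> does not depend on \<open>x\<close>, so strong continuity on a
  compact interval is enough for it.\<close>

lemma equicontinuous_iterates:
  assumes e: "0 < e"
  shows "\<exists>d>0. \<forall>x. continuous_on UNIV x \<longrightarrow> (\<forall>s t. 0 \<le> s \<and> s \<le> t \<and> t \<le> T \<and> t - s < d \<longrightarrow>
    dist (next_iterate x t) (next_iterate x s) \<le> e)"
proof -
  have "0 < e / 2"
    using e by simp
  have "\<exists>d>0. \<forall>h\<in>dominated dominant. \<forall>s t. 0 \<le> s \<and> s \<le> t \<and> t \<le> T \<and> t - s < d \<longrightarrow> dist (duhamel h t) (duhamel h s) \<le> e / 2"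
    by (rule duhamel_equicontinuous[OF dominant \<open>0 < e / 2\<close>])
  then obtain d1 where d1: "0 < d1" "\<And>h s t. h \<in> dominated dominant \<Longrightarrow> 0 \<le> s \<Longrightarrow> s \<le> t \<Longrightarrow> t \<le> T \<Longrightarrow> t - s < d1 \<Longrightarrow>
      dist (duhamel h t) (duhamel h s) \<le> e / 2"
    by metis
  have "uniformly_continuous_on {0..T} (\<lambda>t. R t (\<psi> 0))"
    by (intro compact_uniformly_continuous continuous_on_subset[OF cont]) auto
  then obtain d2 where d2: "0 < d2" "\<And>s t. s \<in> {0..T} \<Longrightarrow> t \<in> {0..T} \<Longrightarrow> dist t s < d2 \<Longrightarrow> dist (R t (\<psi> 0)) (R s (\<psi> 0)) < e / 2"
    unfolding uniformly_continuous_on_def using \<open>0 < e / 2\<close> by metis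
  have "dist (next_iterate x t) (next_iterate x s) \<le> e"
    if x: "continuous_on UNIV x" and st: "0 \<le> s" "s \<le> t" "t \<le> T" "t - s < min d1 d2" for x s t
  proof -
    have "dist (R t (\<psi> 0)) (R s (\<psi> 0)) < e / 2"
      by (rule d2(2)) (use st in \<open>auto simp: dist_real_def\<close>)
    moreover have "dist (duhamel (total_input x) t) (duhamel (total_input x) s) \<le> e / 2"
      by (rule d1(2)[OF total_input_dominated(2)[OF x]]) (use st in auto)
    ultimately have "dist (R t (\<psi> 0) + duhamel (total_input x) t) (R s (\<psi> 0) + duhamel (total_input x) s) \<le> e"
      using dist_triangle_add[of "R t (\<psi> 0)" "duhamel (total_input x) t" "R s (\<psi> 0)" "duhamel (total_input x) s"] by linarith
    then show ?thesis
      using st by (simp add: next_iterate_def clamp)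
  qed
  then show ?thesis
    using d1(1) d2(1) by (intro exI[of _ "min d1 d2"]) auto
qed

lemma continuous_on_next_iterate:
  assumes x: "continuous_on UNIV x"
  shows "continuous_on {0..T} (next_iterate x)"
  unfolding continuous_on_iff
proof (intro ballI allI impI)
  fix s e :: real
  assume s: "s \<in> {0..T}" and "0 < e"
  then have "0 < e / 2"
    by simp
  then obtain d where d: "0 < d" "\<And>s t. 0 \<le> s \<Longrightarrow> s \<le> t \<Longrightarrow> t \<le> T \<Longrightarrow> t - s < d \<Longrightarrow> dist (next_iterate x t) (next_iterate x s) \<le> e / 2"
    using equicontinuous_iterates[OF \<open>0 < e / 2\<close>] x by metis
  have "dist (next_iterate x t) (next_iterate x s) < e" if "t \<in> {0..T}" "dist t s < d" for t
  proof -
    have "dist (next_iterate x t) (next_iterate x s) \<le> e / 2"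
      using d(2)[of s t] d(2)[of t s] s that
      by (cases "s \<le> t") (auto simp: dist_real_def dist_commute)
    then show ?thesis
      using \<open>0 < e\<close> by linarith
  qed
  then show "\<exists>d>0. \<forall>t\<in>{0..T}. dist t s < d \<longrightarrow> dist (next_iterate x t) (next_iterate x s) < e"
    using d(1) by blast
qed

lemma next_iterate_clamp: "next_iterate x (clamp t) = next_iterate x t"
  by (simp add: next_iterate_def clamp(3))

lemma next_iterate_bcontfun:
  assumes x: "continuous_on UNIV x"
  shows "next_iterate x \<in> bcontfun"
unfolding bcontfun_def mem_Collect_eq
proof (rule conjI)
  have "continuous_on UNIV (\<lambda>t. next_iterate x (clamp t))"
    by (rule continuous_on_compose2[OF continuous_on_next_iterate[OF x] continuous_on_clamp range_clamp])
  then show "continuous_on UNIV (next_iterate x)"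
    by (simp add: next_iterate_clamp)
  have "bounded (next_iterate x ` {0..T})"
    by (intro compact_imp_bounded compact_continuous_image continuous_on_next_iterate x compact_Icc)
  moreover have "range (next_iterate x) \<subseteq> next_iterate x ` {0..T}"
  proof (rule image_subsetI)
    show "next_iterate x t \<in> next_iterate x ` {0..T}" for t
      by (rule image_eqI[of _ _ "clamp t"]) (simp_all add: next_iterate_clamp clamp)
  qed
  ultimately show "bounded (range (next_iterate x))"
    by (rule bounded_subset)
qed

definition solution_map :: "(real \<Rightarrow>\<^sub>C 'w) \<Rightarrow> (real \<Rightarrow>\<^sub>C 'w)"
  where "solution_map x = Bcontfun (next_iterate (apply_bcontfun x))"

lemma solution_map_apply: "apply_bcontfun (solution_map x) = next_iterate (apply_bcontfun x)"
  unfolding solution_map_def by (rule Bcontfun_inverse[OF next_iterate_bcontfun[OF continuous_on_apply_bcontfun]])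

text \<open>The nonlinearity converges in the mean, so the defect converges, hence the functional in
  the dual norm; the control depends linearly and boundedly on that functional. All resulting bounds
  are independent of \<open>t\<close>.\<close>

lemma continuous_on_solution_map: "continuous_on UNIV solution_map"
  unfolding continuous_on_sequentially o_def
proof (intro ballI allI impI)
  fix x :: "nat \<Rightarrow> real \<Rightarrow>\<^sub>C 'w" and y
  assume "(\<forall>n. x n \<in> UNIV) \<and> x \<longlonglongrightarrow> y"
  then have x: "x \<longlonglongrightarrow> y"
    by simp
  have c: "continuous_on UNIV (apply_bcontfun z)" for z :: "real \<Rightarrow>\<^sub>C 'w"
    by (rule continuous_on_apply_bcontfun)
  define F where "F n = (LINT t:{0..T}|lebesgue. norm (forcing (apply_bcontfun (x n)) t - forcing (apply_bcontfun y) t))" for n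
  have F: "F \<longlonglongrightarrow> 0"
    unfolding F_def[abs_def] by (rule forcing_tendsto[OF x])
  note idf = set_integral_diff(1)[OF set_integrable_forcing[OF c] set_integrable_forcing[OF c]]
  have "norm (defect (apply_bcontfun (x n)) - defect (apply_bcontfun y)) \<le> Rmax * F n" for n
  proof -
    have "defect (apply_bcontfun (x n)) - defect (apply_bcontfun y)
      = - duhamel (\<lambda>t. forcing (apply_bcontfun (x n)) t - forcing (apply_bcontfun y) t) T"
      by (simp add: defect_def duhamel_diff[OF set_integrable_forcing[OF c] set_integrable_forcing[OF c]])
    then show ?thesis
      using norm_duhamel_le[OF idf, of T "x n" y] T by (simp add: F_def)
  qed
  then have "(\<lambda>n. defect (apply_bcontfun (x n)) - defect (apply_bcontfun y)) \<longlonglongrightarrow> 0"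
    by (intro Lim_null_comparison[OF always_eventually tendsto_mult_right_zero[OF F]]) blast
  then have "(\<lambda>n. covector (defect (apply_bcontfun (x n)))) \<longlonglongrightarrow> covector (defect (apply_bcontfun y))"
    by (intro continuous_on_tendsto_compose[OF continuous_on_covector]) (auto simp: Lim_null[symmetric])
  then have "(\<lambda>n. norm (covector (defect (apply_bcontfun (x n))) - covector (defect (apply_bcontfun y)))) \<longlonglongrightarrow> 0"
    by (intro tendsto_norm_zero) (simp add: Lim_null[symmetric])
  moreover define C where "C n = norm (covector (defect (apply_bcontfun (x n))) - covector (defect (apply_bcontfun y)))" for n
  ultimately have C: "C \<longlonglongrightarrow> 0"
    by (simp add: C_def[abs_def])
  have le: "dist (solution_map (x n)) (solution_map y) \<le> Rmax * (T * (norm B * (C n * (Rmax * norm B))) + F n)" for n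
  proof (rule dist_bound)
    fix t
    let ?b = "\<lambda>s. B (ctrl (covector (defect (apply_bcontfun (x n))) - covector (defect (apply_bcontfun y))) s)"
    let ?d = "\<lambda>s. forcing (apply_bcontfun (x n)) s - forcing (apply_bcontfun y) s"
    have cd: "covector (defect (apply_bcontfun (x n))) - covector (defect (apply_bcontfun y)) \<in> cdual"
      by (intro cdual_closed_ops covector_cdual)
    note ib = set_integrable_B_ctrl[OF cd]
    have "apply_bcontfun (solution_map (x n)) t - apply_bcontfun (solution_map y) t
      = duhamel (total_input (apply_bcontfun (x n))) (clamp t) - duhamel (total_input (apply_bcontfun y)) (clamp t)"
      by (simp add: solution_map_apply next_iterate_def)
    also have "\<dots> = duhamel (\<lambda>s. total_input (apply_bcontfun (x n)) s - total_input (apply_bcontfun y) s) (clamp t)"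
      by (rule duhamel_diff[OF total_input_dominated(1)[OF c] total_input_dominated(1)[OF c] clamp(2), symmetric])
    also have "\<dots> = duhamel (\<lambda>s. ?b s + ?d s) (clamp t)"
    proof (rule duhamel_cong)
      fix s
      assume "s \<in> {0..clamp t}"
      then have "s \<le> T"
        using clamp(2)[of t] by simp
      then show "total_input (apply_bcontfun (x n)) s - total_input (apply_bcontfun y) s = ?b s + ?d s"
        by (simp add: total_input_def ctrl_linear(2)[OF covector_cdual covector_cdual] blinfun.diff_right)
    qed
    finally have "norm (apply_bcontfun (solution_map (x n)) t - apply_bcontfun (solution_map y) t)
      \<le> Rmax * (LINT s:{0..T}|lebesgue. norm (?b s + ?d s))"
      using norm_duhamel_le[OF set_integral_add(1)[OF ib idf] clamp(1,2)] by simp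
    also have "\<dots> \<le> Rmax * (LINT s:{0..T}|lebesgue. norm B * (C n * (Rmax * norm B)) + norm (?d s))"
    proof (intro mult_left_mono Rmax(1) set_integral_mono set_integrable_norm set_integral_add(1) ib idf set_integrable_const_Icc)
      fix s
      assume "s \<in> {0..T}"
      then have "norm (?b s) \<le> norm B * (C n * (Rmax * norm B))"
        using norm_B_ctrl_le[OF cd, of s] by (simp add: C_def)
      then show "norm (?b s + ?d s) \<le> norm B * (C n * (Rmax * norm B)) + norm (?d s)"
        by (intro norm_triangle_le add_right_mono)
    qed
    also have "(LINT s:{0..T}|lebesgue. norm B * (C n * (Rmax * norm B)) + norm (?d s))
      = (LINT s:{0..T}|lebesgue. norm B * (C n * (Rmax * norm B))) + F n"
      unfolding F_def by (intro set_integral_add(2) set_integrable_norm idf set_integrable_const_Icc)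
    also have "(LINT s:{0..T}|lebesgue. norm B * (C n * (Rmax * norm B))) = T * (norm B * (C n * (Rmax * norm B)))"
      using T by (simp add: set_lebesgue_integral_def)
    finally show "dist (apply_bcontfun (solution_map (x n)) t) (apply_bcontfun (solution_map y) t)
      \<le> Rmax * (T * (norm B * (C n * (Rmax * norm B))) + F n)"
      by (simp add: dist_norm)
  qed
  have "(\<lambda>n. Rmax * (T * (norm B * (C n * (Rmax * norm B))) + F n)) \<longlonglongrightarrow> Rmax * (T * (norm B * (0 * (Rmax * norm B))) + 0)"
    by (intro tendsto_intros C F)
  then have lim: "(\<lambda>n. Rmax * (T * (norm B * (C n * (Rmax * norm B))) + F n)) \<longlonglongrightarrow> 0"
    by simp
  have "(\<lambda>n. dist (solution_map (x n)) (solution_map y)) \<longlonglongrightarrow> 0"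
  proof (rule tendsto_sandwich[OF _ _ tendsto_const lim])
    show "\<forall>\<^sub>F n in sequentially. 0 \<le> dist (solution_map (x n)) (solution_map y)"
      by simp
    show "\<forall>\<^sub>F n in sequentially. dist (solution_map (x n)) (solution_map y) \<le> Rmax * (T * (norm B * (C n * (Rmax * norm B))) + F n)"
      using le by (intro always_eventually allI)
  qed
  then show "(\<lambda>n. solution_map (x n)) \<longlonglongrightarrow> solution_map y"
    by (simp add: tendsto_dist_iff[symmetric])
qed

lemma solution_map_totally_bounded:
  assumes e: "0 < e"
  shows "\<exists>k. finite k \<and> range solution_map \<subseteq> (\<Union>x\<in>k. ball x e)"
proof (rule Arzela_Ascoli_totally_bounded[of T])
  have c: "continuous_on UNIV (apply_bcontfun z)" for z :: "real \<Rightarrow>\<^sub>C 'w"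
    by (rule continuous_on_apply_bcontfun)
  show "apply_bcontfun x t = apply_bcontfun x (max 0 (min T t))" if "x \<in> range solution_map" for x t
    using that next_iterate_clamp by (auto simp: solution_map_apply simp flip: clamp_def)
  show "\<exists>d>0. \<forall>x\<in>range solution_map. \<forall>s t. 0 \<le> s \<and> s \<le> t \<and> t \<le> T \<and> t - s < d \<longrightarrow> dist (apply_bcontfun x t) (apply_bcontfun x s) \<le> e'"
    if e': "0 < e'" for e'
  proof -
    obtain d where d: "0 < d" "\<And>x s t. continuous_on UNIV x \<Longrightarrow> 0 \<le> s \<Longrightarrow> s \<le> t \<Longrightarrow> t \<le> T \<Longrightarrow> t - s < d \<Longrightarrow> dist (next_iterate x t) (next_iterate x s) \<le> e'"
      using equicontinuous_iterates[OF e'] by metis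
    then show ?thesis
      using c by (intro exI[of _ d]) (auto simp: solution_map_apply)
  qed
  show "\<exists>k. finite k \<and> (\<forall>x\<in>range solution_map. \<exists>c\<in>k. dist (apply_bcontfun x t) c < e')"
    if t: "0 \<le> t" "t \<le> T" and e': "0 < e'" for t e'
  proof -
    have "totally_bounded_set ((\<lambda>h. duhamel h t) ` dominated dominant)"
      by (rule duhamel_pointwise_totally_bounded[OF dominant t])
    then obtain k where k: "finite k" "\<And>h. h \<in> dominated dominant \<Longrightarrow> \<exists>c\<in>k. dist (duhamel h t) c < e'"
      using e' unfolding totally_bounded_set_def by (metis imageI)
    \<comment> \<open>Translation by the fixed vector \<open>R t (\<psi> 0)\<close> carries the net
      for the Duhamel values over to the iterates.\<close>
    have "\<exists>c\<in>(+) (R t (\<psi> 0)) ` k. dist (apply_bcontfun (solution_map x) t) c < e'" for x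
    proof -
      obtain c where "c \<in> k" "dist (duhamel (total_input (apply_bcontfun x)) t) c < e'"
        using k(2)[OF total_input_dominated(2)[OF continuous_on_apply_bcontfun]] by blast
      then show ?thesis
        using t by (intro bexI[of _ "R t (\<psi> 0) + c"]) (auto simp: solution_map_apply next_iterate_def clamp)
    qed
    then show ?thesis
      using k(1) by (intro exI[of _ "(+) (R t (\<psi> 0)) ` k"]) auto
  qed
qed (use T e in auto)

lemma exists_mild_solution: "\<exists>w. mild_solution T R B f \<psi> f1' f2 (feedback_control T R B f \<psi> f1' f2 \<mu> \<zeta>1 w) w"
proof -
  obtain X where X: "solution_map X = X"
    using Schauder_fixpoint[OF continuous_on_solution_map solution_map_totally_bounded] by blast
  define x where "x = apply_bcontfun X"
  have xc: "continuous_on UNIV x"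
    unfolding x_def by (rule continuous_on_apply_bcontfun)
  have eq: "x = next_iterate x"
    using solution_map_apply[of X] unfolding X x_def[symmetric] .
  have x: "x t = R t (\<psi> 0) + duhamel (total_input x) t" if "0 \<le> t" "t \<le> T" for t
    using fun_cong[OF eq, of t] that unfolding next_iterate_def by (simp add: clamp)
  \<comment> \<open>The integral extends over a single point. With \<open>R 0\<close> the identity
    the fixed point starts at \<open>\<psi> 0\<close>, so \<open>ext\<close> changes nothing for
    nonnegative times and the equation holds for the extended function itself.\<close>
  have "duhamel (total_input x) 0 = 0"
    unfolding duhamel_def set_lebesgue_integral_def
  proof (rule integral_eq_zero_AE)
    have "AE s in lebesgue. s \<noteq> (0::real)"
      by (rule AE_I[of _ _ "{0}"]) auto
    then show "AE s in lebesgue. indicat_real {0..0} s *\<^sub>R R (0 - s) (total_input x s) = 0"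
      by eventually_elim simp
  qed
  then have x0: "x 0 = \<psi> 0"
    using x[of 0] T by (simp add: R0)
  have ext: "ext x t = x t" if "0 \<le> t" for t
    using that x0 by (auto simp: ext_def)
  let ?u = "ctrl (covector (defect x))"
  have "mild_solution T R B f \<psi> f1' f2 ?u (ext x)"
    unfolding mild_solution_def
  proof (intro conjI ballI)
    show "L2_function T ?u"
      by (rule L2_function_ctrl[OF covector_cdual])
    show "history (ext x) 0 = \<psi>"
      by (rule history_ext_0)
    show "continuous_on {0..T} (ext x)"
      by (rule continuous_on_subset[OF continuous_on_ext[OF xc]]) auto
    fix t
    assume t: "t \<in> {0..T}"
    note ih = set_integral_add(1)[OF set_integrable_B_ctrl[OF covector_cdual] set_integrable_forcing[OF xc]]
    have S: "{0..t} \<in> sets lebesgue"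
      by simp
    show "integrable (lebesgue_on {0..t}) (\<lambda>s. R (t - s) (B (?u s) + f s (history (ext x) s)))"
      using set_integrable_duhamel[OF ih, of t "defect x"] t unfolding set_integral_lebesgue_on(2)[OF S] forcing_def by simp
    show "integrable (lebesgue_on {0..t}) (\<lambda>s. R (t - s) (f1' s + f2 s))"
      using set_integrable_duhamel[OF source, of t] t unfolding set_integral_lebesgue_on(2)[OF S] source_def by simp
    have "duhamel (total_input x) t = duhamel (\<lambda>s. B (?u s) + forcing x s) t + duhamel source t"
      unfolding total_input_def[abs_def] by (rule duhamel_add[OF ih source]) (use t in simp)
    then show "ext x t = R t (\<psi> 0) + (LINT s|lebesgue_on {0..t}. R (t - s) (B (?u s) + f s (history (ext x) s)))
        + (LINT s|lebesgue_on {0..t}. R (t - s) (f1' s + f2 s))"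
      unfolding set_integral_lebesgue_on(1)[OF S]
      using t x[of t] ext[of t] by (simp add: duhamel_def forcing_def source_def)
  qed
  then show ?thesis
    unfolding feedback_control_ext[of x, symmetric] by blast
qed

end

theorem theorem4p1:
  fixes T \<nu> \<alpha> :: real
    and D :: "'w::{complex_banach, second_countable_topology} set"
    and A :: "'w \<Rightarrow> 'w"
    and G :: "real \<Rightarrow> 'w \<Rightarrow>\<^sub>L 'w" and Gh :: "complex \<Rightarrow> 'w \<Rightarrow>\<^sub>L 'w"
    and DN :: "real \<Rightarrow> 'w set" and N :: "real \<Rightarrow> 'w \<Rightarrow> 'w" and Nh :: "complex \<Rightarrow> 'w \<Rightarrow> 'w"
    and R :: "real \<Rightarrow> 'w \<Rightarrow>\<^sub>L 'w"
    and B :: "'u::complex_hilbert \<Rightarrow>\<^sub>L 'w"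
    and \<BB> :: "(real \<Rightarrow> 'w) set" and p :: "(real \<Rightarrow> 'w) \<Rightarrow> real"
    and f :: "real \<Rightarrow> (real \<Rightarrow> 'w) \<Rightarrow> 'w" and \<gamma> :: "real \<Rightarrow> real"
    and \<psi> f1 f1' f2 :: "real \<Rightarrow> 'w"
    and \<mu> :: real and \<zeta>1 :: 'w
  assumes "0 < T"
    and "reflexive_space TYPE('w)"
    and "uniformly_convex (cdual :: ('w \<Rightarrow>\<^sub>L complex) set)"
    and "clinear_blinfun B"
    and "closed_operator D A"
    and "Cd1 \<nu> D A"
    and "Cd2 \<nu> \<alpha> D A G Gh"
    and "Cd3 \<nu> D A DN N Nh"
    and "Cd4 \<nu> \<alpha> D A Gh Nh"
    and "resolvent_operator D A G N R"
    and "phase_space \<BB> p"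
    and "\<exists>\<mu>0\<in>resolvent_set D A. compact_operator (resolvent D A \<mu>0)"
    and "AE t in lebesgue_on {0..T}. \<forall>\<phi>\<in>\<BB>. \<forall>\<epsilon>>0. \<exists>\<delta>>0. \<forall>\<xi>\<in>\<BB>.
           p (\<lambda>\<theta>. \<xi> \<theta> - \<phi> \<theta>) < \<delta> \<longrightarrow> norm (f t \<xi> - f t \<phi>) < \<epsilon>"
    and "\<forall>\<phi>\<in>\<BB>. strongly_measurable (lebesgue_on {0..T}) (\<lambda>t. f t \<phi>)"
    and "integrable (lebesgue_on {0..T}) \<gamma>" and "\<forall>t\<in>{0..T}. 0 \<le> \<gamma> t"
    and "AE t in lebesgue_on {0..T}. \<forall>\<phi>\<in>\<BB>. norm (f t \<phi>) \<le> \<gamma> t"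
    and "\<psi> \<in> \<BB>"
    and "AE t in lebesgue_on {0..T}. integrable (lebesgue_on {..0}) (\<lambda>s. G (t - s) (\<psi> s))"
    and "\<forall>t\<in>{0..T}. f1 t = - (LINT s|lebesgue_on {..0}. G (t - s) (\<psi> s))"
    and "has_W11_derivative T f1 f1'"
    and "AE t in lebesgue_on {0..T}. AE s in lebesgue_on {..0}. \<psi> s \<in> DN (t - s)"
    and "AE t in lebesgue_on {0..T}. integrable (lebesgue_on {..0}) (\<lambda>s. N (t - s) (\<psi> s))"
    and "\<forall>t\<in>{0..T}. f2 t = (LINT s|lebesgue_on {..0}. N (t - s) (\<psi> s))"
    and "integrable (lebesgue_on {0..T}) f2"
    and "0 < \<mu>"
  shows "\<exists>w. mild_solution T R B f \<psi> f1' f2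
           (feedback_control T R B f \<psi> f1' f2 \<mu> \<zeta>1 w) w"
proof -
  obtain M \<omega> where M: "0 < \<omega>" "\<And>t. 0 \<le> t \<Longrightarrow> norm (R t) \<le> M * exp (\<omega> * t)"
    using resolvent_bound[OF assms(5-8,10)] by metis
  \<comment> \<open>One function of the cut-off and the horizon serves all pairs of times, as the
    compactness argument requires.\<close>
  obtain L where L: "\<And>\<epsilon> T s t. 0 < \<epsilon> \<Longrightarrow> \<epsilon> \<le> s \<Longrightarrow> s \<le> t \<Longrightarrow> t \<le> T \<Longrightarrow> norm (R t - R s) \<le> L \<epsilon> T * (t - s)"
    using resolvent_operator_Lipschitz[OF assms(5-8,10)] by metis
  obtain \<mu>0 where \<mu>0: "\<mu>0 \<in> resolvent_set D A" "compact_operator (resolvent D A \<mu>0)"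
    using assms(12) by blast
  have S: "{0..T} \<in> sets lebesgue"
    by simp
  interpret neutral_system R M \<omega> T L B \<BB> p f \<gamma> \<psi> f1' f2 \<mu> \<zeta>1
  proof unfold_locales
    show "continuous_on {0..} (\<lambda>t. R t z)" "0 \<le> t \<Longrightarrow> clinear_blinfun (R t)" "R 0 = id_blinfun" for z t
      using assms(10) by (simp_all add: resolvent_operator_def)
    show "0 < t \<Longrightarrow> compact (closure (R t ` cball 0 r))" for t r
      by (rule resolvent_operator_compact[OF assms(5-8,10) \<mu>0])
    show "set_integrable lebesgue {0..T} \<gamma>" "set_integrable lebesgue {0..T} f1'" "set_integrable lebesgue {0..T} f2"
      using assms(15,21,25) by (simp_all add: set_integral_lebesgue_on(2)[OF S] has_W11_derivative_def)
  qed (use assms M L in blast)+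
  show ?thesis
    by (rule exists_mild_solution)
qed

end
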